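(* Let $f:\mathbb{P}^2(\mathbb{C})\to\mathbb{P}^2(\mathbb{C})$ be a holomorphic endomorphism of degree $d\geq 2$ which is generic in the following sense: $C_f\cap f^i(C_f)\cap f^j(C_f)=\emptyset$ for all integers $i,j\geq 1$ with $i\neq j$, where $C_f$ is the critical set of $f$. Let $\mu$ be the Green measure of $f$. Then for every (small) neighbourhood $U$ of the support of $\mu$, $$\limsup_{n\to\infty}\frac1n\log\max_{x\in\mathbb{P}^2(\mathbb{C})}\mathrm{Card}\big(f^{-n}(x)-U\big)\leq\log d .$$
   Context: A holomorphic endomorphism of $\mathbb{P}^2(\mathbb{C})$ has degree $d$ if it is given in homogeneous coordinates by three homogeneous polynomials of degree $d$ without common zero other than the origin. Green current and measure: let $\omega$ be the Fubini-Study form on $\mathbb{P}^2(\mathbb{C})$, normalized to have mass 1. The currents $d^{-n}(f^n)^*\omega$ converge to a positive closed $(1,1)$-current $T=\omega+dd^cG$ with $G$ continuous, the Green current of $f$. The Green measure is $\mu=T\wedge T$, which is well defined since $T$ has continuous potentials. $f^{-n}(x)$ is the (finite) set of preimages of $x$ by the $n$-th iterate $f^n$. Convention: $\log 0=-\infty$. *)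

theory Defs
  imports "HOL-Analysis.Analysis"
begin

section \<open>The complex projective plane\<close>

quotient_type cp2 = "complex ^ 3" / partial:
  "\<lambda>x y. x \<noteq> 0 \<and> (\<exists>c. c \<noteq> 0 \<and> y = c *s x)"
proof (rule part_equivpI)
  show "\<exists>x. (x :: complex ^ 3) \<noteq> 0 \<and> (\<exists>c. c \<noteq> 0 \<and> x = c *s x)"
    by (intro exI[of _ "axis 1 1"] conjI exI[of _ 1]) (auto simp: axis_eq_0_iff)
  show "symp (\<lambda>x y :: complex ^ 3. x \<noteq> 0 \<and> (\<exists>c. c \<noteq> 0 \<and> y = c *s x))"
  proof (rule sympI, elim conjE exE)
    fix x y :: "complex ^ 3" and c
    assume "x \<noteq> 0" "c \<noteq> 0" "y = c *s x"
    then show "y \<noteq> 0 \<and> (\<exists>c. c \<noteq> 0 \<and> x = c *s y)"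
      by (intro conjI exI[of _ "inverse c"]) auto
  qed
  show "transp (\<lambda>x y :: complex ^ 3. x \<noteq> 0 \<and> (\<exists>c. c \<noteq> 0 \<and> y = c *s x))"
    by (rule transpI) (metis mult_eq_0_iff vector_smult_assoc)
qed

definition proj :: "complex ^ 3 \<Rightarrow> cp2" where
  "proj = abs_cp2"

lemma proj_eq_iff:
  assumes "x \<noteq> 0" "y \<noteq> 0"
  shows "proj x = proj y \<longleftrightarrow> (\<exists>c. c \<noteq> 0 \<and> y = c *s x)"
proof -
  have refl: "z \<noteq> 0 \<Longrightarrow> z \<noteq> 0 \<and> (\<exists>c. c \<noteq> 0 \<and> z = c *s z)" for z :: "complex ^ 3"
    by (auto intro: exI[of _ 1])
  show ?thesis
    using Quotient3_rel[OF Quotient3_cp2, of x y] refl[of x] refl[of y] assms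
    by (auto simp: proj_def)
qed

lemma proj_surj: "\<exists>z. z \<noteq> 0 \<and> proj z = x"
  by (induction x rule: cp2.abs_induct) (auto simp: proj_def)

instantiation cp2 :: topological_space
begin

text \<open>The quotient topology.\<close>

definition open_cp2 :: "cp2 set \<Rightarrow> bool" where
  "open_cp2 V \<longleftrightarrow> open {z. z \<noteq> 0 \<and> proj z \<in> V}"

instance
proof
  have "{z :: complex ^ 3. z \<noteq> 0 \<and> proj z \<in> UNIV} = - {0}"
    by auto
  then show "open (UNIV :: cp2 set)"
    by (simp add: open_cp2_def open_Compl)
next
  fix S T :: "cp2 set"
  assume "open S" "open T"
  moreover have "{z. z \<noteq> 0 \<and> proj z \<in> S \<inter> T} =
      {z. z \<noteq> 0 \<and> proj z \<in> S} \<inter> {z. z \<noteq> 0 \<and> proj z \<in> T}"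
    by auto
  ultimately show "open (S \<inter> T)"
    unfolding open_cp2_def by (simp only: open_Int)
next
  fix K :: "cp2 set set"
  assume "\<forall>S\<in>K. open S"
  moreover have "{z. z \<noteq> 0 \<and> proj z \<in> \<Union>K} = (\<Union>S\<in>K. {z. z \<noteq> 0 \<and> proj z \<in> S})"
    by auto
  ultimately show "open (\<Union>K)"
    unfolding open_cp2_def by (simp only:) (intro open_UN, auto)
qed

end

definition affine_lift :: "3 \<Rightarrow> complex ^ 2 \<Rightarrow> complex ^ 3" where
  "affine_lift i w =
     (if i = 1 then vector [1, w $ 1, w $ 2]
      else if i = 2 then vector [w $ 1, 1, w $ 2]
      else vector [w $ 1, w $ 2, 1])"

definition chart :: "3 \<Rightarrow> complex ^ 2 \<Rightarrow> cp2" where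
  "chart i w = proj (affine_lift i w)"

text \<open>Affine coordinates; meaningful only on \<open>range (chart i)\<close>.\<close>

definition coords :: "3 \<Rightarrow> cp2 \<Rightarrow> complex ^ 2" where
  "coords i = inv (chart i)"

lemma inj_chart: "inj (chart i)"
proof (rule injI)
  fix w w' :: "complex ^ 2"
  assume eq: "chart i w = chart i w'"
  have nz: "affine_lift i u \<noteq> 0" for u
    using exhaust_3[of i] by (auto simp: affine_lift_def vec_eq_iff forall_3)
  obtain c where c: "affine_lift i w' = c *s affine_lift i w"
    using eq proj_eq_iff[OF nz nz] unfolding chart_def by blast
  show "w = w'"
    using c exhaust_3[of i] by (auto simp: affine_lift_def vec_eq_iff forall_3 forall_2)
qed

lemma coords_chart [simp]: "coords i (chart i w) = w"
  by (simp add: coords_def inj_chart)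

lemma charts_cover: "(\<Union>i. range (chart i)) = UNIV"
proof -
  have "\<exists>i w. x = chart i w" for x
  proof -
    obtain z where z: "z \<noteq> 0" "proj z = x"
      using proj_surj by blast
    obtain i where i: "z $ i \<noteq> 0"
      using z(1) by (auto simp: vec_eq_iff)
    define u where "u = inverse (z $ i) *s z"
    define w :: "complex ^ 2" where
      "w = (if i = 1 then vector [u $ 2, u $ 3]
            else if i = 2 then vector [u $ 1, u $ 3] else vector [u $ 1, u $ 2])"
    have u: "u = affine_lift i w"
      using i exhaust_3[of i]
      by (auto simp: u_def w_def affine_lift_def vec_eq_iff forall_3)
    have "u \<noteq> 0"
      using z(1) i by (auto simp: u_def)
    moreover have "\<exists>c. c \<noteq> 0 \<and> u = c *s z"
      using i by (intro exI[of _ "inverse (z $ i)"]) (auto simp: u_def)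
    ultimately have "proj z = proj u"
      using proj_eq_iff z(1) by blast
    then show ?thesis
      using z(2) u by (auto simp: chart_def)
  qed
  then show ?thesis
    by blast
qed

section \<open>Holomorphic endomorphisms\<close>

definition homogeneous_poly :: "nat \<Rightarrow> (complex ^ 3 \<Rightarrow> complex) \<Rightarrow> bool" where
  "homogeneous_poly d p \<longleftrightarrow>
     (\<exists>c. \<forall>z. p z = (\<Sum>\<alpha> | (\<Sum>i\<in>UNIV. \<alpha> i) = d. c \<alpha> * (\<Prod>i\<in>UNIV. (z $ i) ^ \<alpha> i)))"

definition endomorphism_of_degree :: "(cp2 \<Rightarrow> cp2) \<Rightarrow> nat \<Rightarrow> bool" where
  "endomorphism_of_degree f d \<longleftrightarrow>
     (\<exists>F :: complex ^ 3 \<Rightarrow> complex ^ 3.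
        (\<forall>i. homogeneous_poly d (\<lambda>z. F z $ i)) \<and>
        (\<forall>z. F z = 0 \<longrightarrow> z = 0) \<and>
        (\<forall>z. z \<noteq> 0 \<longrightarrow> f (proj z) = proj (F z)))"

definition local_rep :: "(cp2 \<Rightarrow> cp2) \<Rightarrow> 3 \<Rightarrow> 3 \<Rightarrow> complex ^ 2 \<Rightarrow> complex ^ 2" where
  "local_rep f i j w = coords j (f (chart i w))"

text \<open>The points where the differential of the map is not invertible.\<close>

definition critical_set :: "(cp2 \<Rightarrow> cp2) \<Rightarrow> cp2 set" where
  "critical_set f =
     {x. \<exists>i j w. x = chart i w \<and> f x \<in> range (chart j) \<and>
         \<not> bij (frechet_derivative (local_rep f i j) (at w))}"

section \<open>Currents in affine charts\<close>

primrec C_diff :: "nat \<Rightarrow> (complex ^ 2 \<Rightarrow> complex) \<Rightarrow> bool" where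
  "C_diff 0 h \<longleftrightarrow> continuous_on UNIV h"
| "C_diff (Suc k) h \<longleftrightarrow>
     h differentiable_on UNIV \<and> (\<forall>v. C_diff k (\<lambda>w. frechet_derivative h (at w) v))"

definition test_function :: "(complex ^ 2 \<Rightarrow> complex) \<Rightarrow> bool" where
  "test_function \<phi> \<longleftrightarrow> (\<forall>k. C_diff k \<phi>) \<and> compact (closure {w. \<phi> w \<noteq> 0})"

definition dz :: "2 \<Rightarrow> (complex ^ 2 \<Rightarrow> complex) \<Rightarrow> complex ^ 2 \<Rightarrow> complex" where
  "dz j h w = (frechet_derivative h (at w) (axis j 1)
                 - \<i> * frechet_derivative h (at w) (axis j \<i>)) / 2"

definition dzbar :: "2 \<Rightarrow> (complex ^ 2 \<Rightarrow> complex) \<Rightarrow> complex ^ 2 \<Rightarrow> complex" where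
  "dzbar j h w = (frechet_derivative h (at w) (axis j 1)
                    + \<i> * frechet_derivative h (at w) (axis j \<i>)) / 2"

text \<open>
  Throughout, a matrix \<open>a\<close> stands for the \<open>(1,1)\<close>-form
  \<open>(i/pi) (SUM j k. a $ j $ k dz_j \<and> dzbar_k)\<close> on an affine chart. With the normalization
  \<open>dd^c = (i/pi) ddbar\<close>, which gives the Fubini-Study form mass 1, the form \<open>dd^c u\<close> is then
  the matrix \<open>complex_hessian u\<close>.
\<close>

definition complex_hessian :: "(complex ^ 2 \<Rightarrow> complex) \<Rightarrow> complex ^ 2 \<Rightarrow> complex ^ 2 ^ 2" where
  "complex_hessian u w = (\<chi> j k. dz j (dzbar k u) w)"

text \<open>The restriction of \<open>log |z|\<close> to the affine lifts; the same function in all three charts.\<close>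

definition fs_potential :: "complex ^ 2 \<Rightarrow> real" where
  "fs_potential w = ln (1 + (norm w)\<^sup>2) / 2"

definition fubini_study :: "complex ^ 2 \<Rightarrow> complex ^ 2 ^ 2" where
  "fubini_study = complex_hessian (\<lambda>w. complex_of_real (fs_potential w))"

definition pullback :: "(complex ^ 2 \<Rightarrow> complex ^ 2) \<Rightarrow> (complex ^ 2 \<Rightarrow> complex ^ 2 ^ 2)
    \<Rightarrow> complex ^ 2 \<Rightarrow> complex ^ 2 ^ 2" where
  "pullback g a w = (\<chi> l m. \<Sum>j\<in>UNIV. \<Sum>k\<in>UNIV.
     a (g w) $ j $ k * dz l (\<lambda>v. g v $ j) w * cnj (dz m (\<lambda>v. g v $ k) w))"

text \<open>
  The form \<open>f^* \<omega>\<close> in chart \<open>i\<close>. Since \<open>fubini_study\<close> is compatible with the coordinate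
  changes, the choice of a target chart \<open>j\<close> around \<open>f (chart i w)\<close> is immaterial.
\<close>

definition pullback_fs :: "(cp2 \<Rightarrow> cp2) \<Rightarrow> 3 \<Rightarrow> complex ^ 2 \<Rightarrow> complex ^ 2 ^ 2" where
  "pullback_fs f i w =
     (let j = (SOME j. f (chart i w) \<in> range (chart j))
      in pullback (local_rep f i j) fubini_study w)"

type_synonym distribution = "(complex ^ 2 \<Rightarrow> complex) \<Rightarrow> complex"

text \<open>
  A \<open>(1,1)\<close>-current on the projective plane is given by its coefficient distributions
  in the three charts; \<open>T i j k\<close> is the coefficient \<open>(j, k)\<close> in chart \<open>i\<close>. Only the values on
  test functions matter.
\<close>

type_synonym current11 = "3 \<Rightarrow> 2 \<Rightarrow> 2 \<Rightarrow> distribution"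

definition green_current :: "(cp2 \<Rightarrow> cp2) \<Rightarrow> nat \<Rightarrow> current11 \<Rightarrow> bool" where
  "green_current f d T \<longleftrightarrow>
     (\<forall>i j k \<eta>. test_function \<eta> \<longrightarrow>
        (\<lambda>n. (1 / of_nat d ^ n) * (\<integral>w. pullback_fs (f ^^ n) i w $ j $ k * \<eta> w \<partial>lborel))
          \<longlonglongrightarrow> T i j k \<eta>)"

definition local_potential :: "(cp2 \<Rightarrow> real) \<Rightarrow> 3 \<Rightarrow> complex ^ 2 \<Rightarrow> complex" where
  "local_potential G i w = complex_of_real (fs_potential w + G (chart i w))"

text \<open>\<open>T = \<omega> + dd^c G\<close>, with \<open>dd^c\<close> in the sense of distributions.\<close>

definition has_potential :: "current11 \<Rightarrow> (cp2 \<Rightarrow> real) \<Rightarrow> bool" where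
  "has_potential T G \<longleftrightarrow>
     (\<forall>i j k \<eta>. test_function \<eta> \<longrightarrow>
        T i j k \<eta> = (\<integral>w. local_potential G i w * complex_hessian \<eta> w $ j $ k \<partial>lborel))"

text \<open>
  Value of a distribution of order zero (a complex Radon measure) on a continuous function
  \<open>\<psi>\<close> with compact support, by uniform approximation with supports in a fixed compact set.
  The coefficients of a positive current are of order zero.
\<close>

definition order_zero_ext :: "distribution \<Rightarrow> distribution" where
  "order_zero_ext S \<psi> =
     (THE L. \<forall>\<eta> K. compact K \<and> (\<forall>m. test_function (\<eta> m) \<and> (\<forall>w. w \<notin> K \<longrightarrow> \<eta> m w = 0)) \<and>
        uniform_limit UNIV \<eta> \<psi> sequentially \<longrightarrow> (\<lambda>m. S (\<eta> m)) \<longlonglongrightarrow> L)"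

text \<open>
  \<open>T \<and> T\<close> for \<open>T = \<omega> + dd^c G\<close> with \<open>G\<close> continuous: in each chart \<open>T = dd^c u\<close> with
  \<open>u = local_potential G i\<close>, and \<open>T \<and> T = dd^c (u T)\<close>, that is
  \<open><T \<and> T, \<phi>> = <T, u dd^c \<phi>>\<close> for test functions \<open>\<phi>\<close>. In the above normalization the product
  of the forms with matrices \<open>a\<close> and \<open>b\<close> is
  \<open>(4/pi^2) (a11 b22 + a22 b11 - a12 b21 - a21 b12)\<close> times Lebesgue measure.
\<close>

definition wedge_square :: "current11 \<Rightarrow> (cp2 \<Rightarrow> real) \<Rightarrow> 3 \<Rightarrow> distribution" where
  "wedge_square T G i \<phi> =
     (let S = (\<lambda>j k l m. order_zero_ext (T i j k)
                 (\<lambda>w. local_potential G i w * complex_hessian \<phi> w $ l $ m))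
      in 4 / of_real (pi\<^sup>2) * (S 1 1 2 2 + S 2 2 1 1 - S 1 2 2 1 - S 2 1 1 2))"

definition green_measure :: "(cp2 \<Rightarrow> cp2) \<Rightarrow> nat \<Rightarrow> cp2 measure \<Rightarrow> bool" where
  "green_measure f d \<mu> \<longleftrightarrow>
     sets \<mu> = sets borel \<and> finite_measure \<mu> \<and>
     (\<exists>T G. green_current f d T \<and> continuous_on UNIV G \<and> has_potential T G \<and>
        (\<forall>i \<phi>. test_function \<phi> \<longrightarrow>
           (LINT x : range (chart i) | \<mu>. \<phi> (coords i x)) = wedge_square T G i \<phi>))"

definition measure_support :: "'a :: topological_space measure \<Rightarrow> 'a set" where
  "measure_support \<mu> = {x. \<forall>V. open V \<and> x \<in> V \<longrightarrow> emeasure \<mu> V > 0}"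

section \<open>Logarithmic growth\<close>

definition log_card :: "nat \<Rightarrow> ereal" where
  "log_card m = (if m = 0 then - \<infinity> else ereal (ln (real m)))"

end

theory Submission
  imports Defs "HOL-Computational_Algebra.Fundamental_Theorem_Algebra"
begin

text \<open>
  Orbits that start outside \<open>U\<close> are counted by separation. Fix a point of a set whose \<open>n\<close>-step
  orbits are pairwise \<open>\<delta>\<close>-apart at some time, and let \<open>\<rho>\<close> be the sum over the times \<open>k < n\<close> of the
  squared tangents of the angles between its orbit and a variable one. Then \<open>dd^c \<rho>\<close> is dominated
  by \<open>SUM k < n. (f^k)^* \<omega>\<close> where \<open>\<rho>\<close> is small, and comparing \<open>(dd^c \<rho>)^2\<close> with the mass of
  \<open>(dd^c log \<rho>)^2\<close> at the point, as in Lelong's theorem, bounds the mass of \<open>{\<rho> < t}\<close> from below.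
  These sets are disjoint for the different points. Off the support of \<open>\<mu> = T \<and> T\<close> the mass of
  \<open>(f^k)^* \<omega> \<and> (f^l)^* \<omega>\<close> is \<open>O(d^max(k,l))\<close> only, because \<open>d^-k (f^k)^* \<omega>\<close> is
  \<open>O(d^-k)\<close>-close to \<open>T\<close> in potential and \<open>T \<and> T\<close> vanishes there. Hence there are at most
  \<open>O(n^2 d^n)\<close> such points.

  Two points of one fibre of \<open>f^n\<close> are apart at the last time at which they differ, unless
  they are then close to the critical set. By genericity an orbit comes close to the critical set
  at most twice during any \<open>N\<close> consecutive times, so that coding these visits costs a factor
  \<open>O(N^2)^(n/N)\<close> only, whose exponential growth rate tends to 0 as \<open>N\<close> grows.
\<close>

section \<open>Finiteness of the fibres\<close>

text \<open>Tangents are summed, rather than sines, because the tangent of the angle to a fixed line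
  is the norm of a holomorphic vector: near its centre, \<open>rho\<close> is a sum of squared
  moduli of holomorphic functions. This is what the Gram inequality behind the lower mass bound
  requires, and it makes that bound independent of \<open>n\<close> and of the orbit.

  The obstacle on the other side is that T has only a continuous potential, so that T \<and> T is no
  pointwise object. All the estimates are made on the smooth forms of the finite iterates, and the
  vanishing of T \<and> T enters only through the limit of their diagonal masses.

  The order of the choices matters. The block length \<open>N\<close> is fixed at the outset;
  compactness then gives one size of the critical region for all orbits, this determines the
  separation in the fibres, and this in turn the constant \<open>K\<close>. \<open>K\<close> may
  depend on \<open>N\<close> in any way, since it disappears in (1/n) log; only afterwards does
  \<open>N\<close> tend to infinity. A bound for the fibres of \<open>f\<close> that is uniform in
  the point supplies the labels of the code.\<close>

lemma homogeneous_system_nontrivial_solution: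
  fixes A :: "'a \<Rightarrow> 'b \<Rightarrow> complex"
  assumes "finite J" "finite I" "card J < card I"
  shows "\<exists>l. (\<exists>i\<in>I. l i \<noteq> 0) \<and> (\<forall>j\<in>J. (\<Sum>i\<in>I. l i * A i j) = 0)"
  using assms
proof (induction J arbitrary: I A rule: finite_induct)
  case empty
  then have "I \<noteq> {}"
    by auto
  then obtain i where "i \<in> I"
    by blast
  then show ?case
    by (intro exI[of _ "\<lambda>_. 1"]) auto
next
  case (insert j J)
  show ?case
  proof (cases "\<forall>i\<in>I. A i j = 0")
    case True
    obtain l where "\<exists>i\<in>I. l i \<noteq> 0" "\<forall>j\<in>J. (\<Sum>i\<in>I. l i * A i j) = 0"
      using insert.IH[of I A] insert.prems insert.hyps by auto
    then show ?thesis
      using True by (intro exI[of _ l]) auto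
  next
    case False
    then obtain p where p: "p \<in> I" "A p j \<noteq> 0"
      by blast
    \<comment> \<open>Gaussian elimination with pivot \<open>A p j\<close>: equation
      \<open>j\<close> determines \<open>l p\<close>, and \<open>B\<close> holds the coefficients of
      the other equations after \<open>l p\<close> has been substituted.\<close>
    define B where "B i k = A i k - A i j / A p j * A p k" for i k
    have "card J < card (I - {p})"
      using insert p by (simp add: card_Diff_singleton)
    then obtain l where l: "\<exists>i\<in>I-{p}. l i \<noteq> 0"
        "\<forall>k\<in>J. (\<Sum>i\<in>I-{p}. l i * B i k) = 0"
      using insert.IH[of "I - {p}" B] insert.prems by auto
    define s where "s = (\<Sum>i\<in>I-{p}. l i * A i j)"
    define l' where "l' i = (if i = p then - s / A p j else l i)" for i
    have split: "(\<Sum>i\<in>I. l' i * A i k) = - s / A p j * A p k + (\<Sum>i\<in>I-{p}. l i * A i k)" for k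
      using p insert.prems(1) by (subst sum.remove[of I p]) (auto simp: l'_def intro!: sum.cong)
    have "(\<Sum>i\<in>I. l' i * A i k) = 0" if "k \<in> insert j J" for k
    proof (cases "k = j")
      case True
      then show ?thesis
        using p split[of k] by (simp add: s_def)
    next
      case False
      have "(\<Sum>i\<in>I-{p}. l i * B i k) = (\<Sum>i\<in>I-{p}. l i * A i k) - s / A p j * A p k"
        by (simp add: B_def s_def algebra_simps sum_subtractf sum_distrib_left sum_distrib_right
            sum_divide_distrib)
      then show ?thesis
        using False that l split[of k] by simp
    qed
    moreover have "\<exists>i\<in>I. l' i \<noteq> 0"
      using l(1) by (auto simp: l'_def)
    ultimately show ?thesis
      by blast
  qed
qed

subsection \<open>Forms and graded ideals\<close>

definition exponents :: "nat \<Rightarrow> (3 \<Rightarrow> nat) set" where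
  "exponents k = {\<alpha>. (\<Sum>i\<in>UNIV. \<alpha> i) = k}"

definition monom_eval :: "(3 \<Rightarrow> nat) \<Rightarrow> complex ^ 3 \<Rightarrow> complex" where
  "monom_eval \<alpha> z = (\<Prod>i\<in>UNIV. (z $ i) ^ \<alpha> i)"

lemma finite_exponents: "finite (exponents k)"
proof (rule finite_subset)
  show "exponents k \<subseteq> Pi\<^sub>E UNIV (\<lambda>_. {..k})"
    by (auto simp: exponents_def PiE_def intro!: member_le_sum)
  show "finite (Pi\<^sub>E (UNIV :: 3 set) (\<lambda>_. {..k}))"
    by (intro finite_PiE) auto
qed

lemma monom_eval_add: "monom_eval (\<lambda>i. \<alpha> i + \<beta> i) z = monom_eval \<alpha> z * monom_eval \<beta> z"
  by (simp add: monom_eval_def power_add prod.distrib)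

lemma exponents_add: "\<alpha> \<in> exponents k \<Longrightarrow> \<beta> \<in> exponents l \<Longrightarrow> (\<lambda>i. \<alpha> i + \<beta> i) \<in> exponents (k + l)"
  by (simp add: exponents_def sum.distrib)

lemma homogeneous_poly_iff:
  "homogeneous_poly k p \<longleftrightarrow> (\<exists>c. \<forall>z. p z = (\<Sum>\<alpha>\<in>exponents k. c \<alpha> * monom_eval \<alpha> z))"
  by (simp add: homogeneous_poly_def exponents_def monom_eval_def)

text \<open>Products and sums of forms produce the same monomial several times; grouping the
  summands by their exponent restores the normal form.\<close>

lemma homogeneous_poly_sumI:
  assumes "finite X" "\<And>x. x \<in> X \<Longrightarrow> g x \<in> exponents k"
    and "\<And>z. p z = (\<Sum>x\<in>X. a x * monom_eval (g x) z)"
  shows "homogeneous_poly k p"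
  unfolding homogeneous_poly_iff
proof (intro exI allI)
  fix z
  have "(\<Sum>\<alpha>\<in>exponents k. (\<Sum>x | x \<in> X \<and> g x = \<alpha>. a x) * monom_eval \<alpha> z) =
      (\<Sum>\<alpha>\<in>exponents k. \<Sum>x | x \<in> X \<and> g x = \<alpha>. a x * monom_eval (g x) z)"
    by (auto simp: sum_distrib_right intro!: sum.cong)
  also have "\<dots> = (\<Sum>x\<in>X. a x * monom_eval (g x) z)"
    using assms finite_exponents by (intro sum.group) auto
  finally show "p z = (\<Sum>\<alpha>\<in>exponents k. (\<Sum>x | x \<in> X \<and> g x = \<alpha>. a x) * monom_eval \<alpha> z)"
    using assms(3) by simp
qed

lemma homogeneous_poly_mono: "\<alpha> \<in> exponents k \<Longrightarrow> homogeneous_poly k (monom_eval \<alpha>)"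
  by (rule homogeneous_poly_sumI[where X = "{()}" and g = "\<lambda>_. \<alpha>" and a = "\<lambda>_. 1"]) auto

lemma homogeneous_poly_zero: "homogeneous_poly k (\<lambda>z. 0)"
  by (rule homogeneous_poly_sumI[where X = "{}"]) auto

lemma homogeneous_poly_const: "homogeneous_poly 0 (\<lambda>z. c)"
  by (rule homogeneous_poly_sumI[where X = "{()}" and g = "\<lambda>_ _. 0" and a = "\<lambda>_. c"])
    (auto simp: exponents_def monom_eval_def)

lemma homogeneous_poly_coord: "homogeneous_poly 1 (\<lambda>z. z $ i)"
  by (rule homogeneous_poly_sumI[where X = "{()}" and g = "\<lambda>_ j. if j = i then 1 else 0" and a = "\<lambda>_. 1"])
    (auto simp: exponents_def monom_eval_def if_distrib power_0 cong: if_cong)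

lemma homogeneous_poly_add:
  "homogeneous_poly k p \<Longrightarrow> homogeneous_poly k q \<Longrightarrow> homogeneous_poly k (\<lambda>z. p z + q z)"
  unfolding homogeneous_poly_iff
  by (elim exE) (rule_tac x = "\<lambda>\<alpha>. c \<alpha> + ca \<alpha>" in exI, simp add: sum.distrib algebra_simps)

lemma homogeneous_poly_mult:
  assumes "homogeneous_poly k p" "homogeneous_poly l q"
  shows "homogeneous_poly (k + l) (\<lambda>z. p z * q z)"
proof -
  obtain c where c: "\<And>z. p z = (\<Sum>\<alpha>\<in>exponents k. c \<alpha> * monom_eval \<alpha> z)"
    using assms by (auto simp: homogeneous_poly_iff)
  obtain e where e: "\<And>z. q z = (\<Sum>\<alpha>\<in>exponents l. e \<alpha> * monom_eval \<alpha> z)"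
    using assms by (auto simp: homogeneous_poly_iff)
  show ?thesis
  proof (rule homogeneous_poly_sumI[where X = "exponents k \<times> exponents l"
        and g = "\<lambda>(\<alpha>, \<beta>) i. \<alpha> i + \<beta> i" and a = "\<lambda>(\<alpha>, \<beta>). c \<alpha> * e \<beta>"])
    show "p z * q z = (\<Sum>x\<in>exponents k \<times> exponents l. (case x of (\<alpha>, \<beta>) \<Rightarrow> c \<alpha> * e \<beta>) *
        monom_eval (case x of (\<alpha>, \<beta>) \<Rightarrow> \<lambda>i. \<alpha> i + \<beta> i) z)" for z
      unfolding c e sum_product sum.cartesian_product
      by (intro sum.cong) (auto simp: monom_eval_add)
  qed (auto simp: finite_exponents exponents_add)
qed

lemma homogeneous_poly_cmult: "homogeneous_poly k p \<Longrightarrow> homogeneous_poly k (\<lambda>z. c * p z)"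
  using homogeneous_poly_mult[OF homogeneous_poly_const[of c], of k p] by simp

lemma homogeneous_poly_sum:
  "(\<And>x. x \<in> X \<Longrightarrow> homogeneous_poly k (p x)) \<Longrightarrow> homogeneous_poly k (\<lambda>z. \<Sum>x\<in>X. p x z)"
  by (induction X rule: infinite_finite_induct)
    (auto intro: homogeneous_poly_zero homogeneous_poly_add)

lemma homogeneous_poly_power: "homogeneous_poly k p \<Longrightarrow> homogeneous_poly (n * k) (\<lambda>z. p z ^ n)"
  by (induction n) (auto intro: homogeneous_poly_const dest: homogeneous_poly_mult)

lemma homogeneous_poly_coord_power: "homogeneous_poly n (\<lambda>z. (z $ i) ^ n)"
  using homogeneous_poly_power[OF homogeneous_poly_coord, of n i] by simp

lemma homogeneous_poly_scale: "homogeneous_poly k p \<Longrightarrow> p (c *s z) = c ^ k * p z"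
  unfolding homogeneous_poly_iff monom_eval_def
  by (auto simp: power_mult_distrib prod.distrib sum_distrib_left exponents_def
      simp flip: power_sum intro!: sum.cong)

text \<open>The cofactors of a generator of degree \<open>d\<close> in degree \<open>k\<close>.
  Below degree \<open>d\<close> the cofactor has to vanish; natural subtraction alone would turn
  \<open>k - d\<close> into 0 there and admit constants.\<close>

definition shifted_poly :: "nat \<Rightarrow> nat \<Rightarrow> (complex ^ 3 \<Rightarrow> complex) \<Rightarrow> bool" where
  "shifted_poly d k h \<longleftrightarrow> (if d \<le> k then homogeneous_poly (k - d) h else h = (\<lambda>_. 0))"

lemma shifted_poly_zero: "shifted_poly d k (\<lambda>_. 0)"
  by (simp add: shifted_poly_def homogeneous_poly_zero)

lemma shifted_poly_add:
  "shifted_poly d k p \<Longrightarrow> shifted_poly d k q \<Longrightarrow> shifted_poly d k (\<lambda>z. p z + q z)"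
  by (auto simp: shifted_poly_def homogeneous_poly_add split: if_splits)

lemma shifted_poly_mult:
  assumes "homogeneous_poly l q" "shifted_poly d k p"
  shows "shifted_poly d (l + k) (\<lambda>z. q z * p z)"
proof (cases "d \<le> k")
  case True
  then show ?thesis
    using homogeneous_poly_mult[OF assms(1), of "k - d" p] assms(2)
    by (simp add: shifted_poly_def)
next
  case False
  then show ?thesis
    using assms by (simp add: shifted_poly_def homogeneous_poly_zero)
qed

definition graded_ideal :: "(nat \<Rightarrow> (complex ^ 3 \<Rightarrow> complex) set) \<Rightarrow> bool" where
  "graded_ideal J \<longleftrightarrow>
     (\<forall>k. (\<lambda>_. 0) \<in> J k) \<and>
     (\<forall>k p q. p \<in> J k \<longrightarrow> q \<in> J k \<longrightarrow> (\<lambda>z. p z + q z) \<in> J k) \<and>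
     (\<forall>k l p q. homogeneous_poly l q \<longrightarrow> p \<in> J k \<longrightarrow> (\<lambda>z. q z * p z) \<in> J (l + k))"

lemma
  assumes "graded_ideal J"
  shows graded_ideal_zero: "(\<lambda>_. 0) \<in> J k"
    and graded_ideal_add: "p \<in> J k \<Longrightarrow> q \<in> J k \<Longrightarrow> (\<lambda>z. p z + q z) \<in> J k"
    and graded_ideal_mult: "homogeneous_poly l q \<Longrightarrow> p \<in> J k \<Longrightarrow> (\<lambda>z. q z * p z) \<in> J (l + k)"
  using assms by (auto simp: graded_ideal_def)

lemma graded_ideal_sum:
  "graded_ideal J \<Longrightarrow> (\<And>x. x \<in> X \<Longrightarrow> p x \<in> J k) \<Longrightarrow> (\<lambda>z. \<Sum>x\<in>X. p x z) \<in> J k"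
  by (induction X rule: infinite_finite_induct) (auto intro: graded_ideal_zero graded_ideal_add)

definition generated_ideal :: "nat \<Rightarrow> (complex ^ 3 \<Rightarrow> complex ^ 3) \<Rightarrow> nat \<Rightarrow> (complex ^ 3 \<Rightarrow> complex) set" where
  "generated_ideal d F k = {\<lambda>z. \<Sum>j\<in>UNIV. h j z * F z $ j |h. \<forall>j. shifted_poly d k (h j)}"

text \<open>The ideal generated by \<open>J\<close> and one linear form \<open>A\<close>, whence the
  shift by 1. Adjoining \<open>z $ j - c * z $ i\<close> amounts to restricting to a hyperplane with
  slope \<open>c\<close>.\<close>

definition adjoin :: "(nat \<Rightarrow> (complex ^ 3 \<Rightarrow> complex) set) \<Rightarrow> (complex ^ 3 \<Rightarrow> complex)
    \<Rightarrow> nat \<Rightarrow> (complex ^ 3 \<Rightarrow> complex) set" where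
  "adjoin J A k = {\<lambda>z. p z + h z * A z |p h. p \<in> J k \<and> shifted_poly 1 k h}"

lemma graded_ideal_generated: "graded_ideal (generated_ideal d F)"
  unfolding graded_ideal_def
proof (intro conjI allI impI)
  show "(\<lambda>_. 0) \<in> generated_ideal d F k" for k
    unfolding generated_ideal_def by (force intro!: shifted_poly_zero)
next
  fix k p q assume "p \<in> generated_ideal d F k" "q \<in> generated_ideal d F k"
  then obtain g h where "p = (\<lambda>z. \<Sum>j\<in>UNIV. g j z * F z $ j)" "q = (\<lambda>z. \<Sum>j\<in>UNIV. h j z * F z $ j)"
    "\<forall>j. shifted_poly d k (g j)" "\<forall>j. shifted_poly d k (h j)"
    by (auto simp: generated_ideal_def)
  then show "(\<lambda>z. p z + q z) \<in> generated_ideal d F k"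
    unfolding generated_ideal_def
    by (intro CollectI exI[of _ "\<lambda>j z. g j z + h j z"])
      (auto intro!: shifted_poly_add simp: sum.distrib algebra_simps)
next
  fix k l p q assume q: "homogeneous_poly l q" and "p \<in> generated_ideal d F k"
  then obtain g where "p = (\<lambda>z. \<Sum>j\<in>UNIV. g j z * F z $ j)" "\<forall>j. shifted_poly d k (g j)"
    by (auto simp: generated_ideal_def)
  then show "(\<lambda>z. q z * p z) \<in> generated_ideal d F (l + k)"
    unfolding generated_ideal_def
    by (intro CollectI exI[of _ "\<lambda>j z. q z * g j z"])
      (auto intro: shifted_poly_mult[OF q] simp: sum_distrib_left mult.assoc)
qed

lemma graded_ideal_adjoin:
  assumes "graded_ideal J"
  shows "graded_ideal (adjoin J A)"
  unfolding graded_ideal_def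
proof (intro conjI allI impI)
  show "(\<lambda>_. 0) \<in> adjoin J A k" for k
    unfolding adjoin_def using graded_ideal_zero[OF assms, of k] by (force intro!: shifted_poly_zero)
next
  fix k p q assume "p \<in> adjoin J A k" "q \<in> adjoin J A k"
  then obtain a b g h where "p = (\<lambda>z. a z + g z * A z)" "q = (\<lambda>z. b z + h z * A z)"
    "a \<in> J k" "b \<in> J k" "shifted_poly 1 k g" "shifted_poly 1 k h"
    by (auto simp: adjoin_def)
  then show "(\<lambda>z. p z + q z) \<in> adjoin J A k"
    unfolding adjoin_def
    by (intro CollectI exI[of _ "\<lambda>z. a z + b z"] exI[of _ "\<lambda>z. g z + h z"])
      (auto intro!: shifted_poly_add graded_ideal_add assms simp: algebra_simps)
next
  fix k l p q assume q: "homogeneous_poly l q" and "p \<in> adjoin J A k"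
  then obtain a g where "p = (\<lambda>z. a z + g z * A z)" "a \<in> J k" "shifted_poly 1 k g"
    by (auto simp: adjoin_def)
  then show "(\<lambda>z. q z * p z) \<in> adjoin J A (l + k)"
    unfolding adjoin_def
    by (intro CollectI exI[of _ "\<lambda>z. q z * a z"] exI[of _ "\<lambda>z. q z * g z"])
      (auto intro: shifted_poly_mult[OF q] graded_ideal_mult[OF assms q] simp: distrib_left mult.assoc)
qed

lemma subset_adjoin: "J k \<subseteq> adjoin J A k"
proof
  fix p assume "p \<in> J k"
  then show "p \<in> adjoin J A k"
    unfolding adjoin_def by (intro CollectI exI[of _ p] exI[of _ "\<lambda>_. 0"]) (auto intro: shifted_poly_zero)
qed

lemma generator_in_adjoin: "graded_ideal J \<Longrightarrow> A \<in> adjoin J A 1"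
  unfolding adjoin_def
  by (intro CollectI exI[of _ "\<lambda>_. 0"] exI[of _ "\<lambda>_. 1"])
    (auto intro: graded_ideal_zero simp: shifted_poly_def homogeneous_poly_const)

text \<open>The coordinate is nilpotent in the quotient by the ideal. Its failure is the algebraic
  substitute for a common zero with nonzero coordinate \<open>i\<close>.\<close>

definition coord_nilpotent :: "3 \<Rightarrow> (nat \<Rightarrow> (complex ^ 3 \<Rightarrow> complex) set) \<Rightarrow> bool" where
  "coord_nilpotent i J \<longleftrightarrow> (\<exists>N. (\<lambda>z. (z $ i) ^ N) \<in> J N)"

text \<open>The binary form y^m r(x / y) in x = \<open>z $ j\<close> and y = \<open>z $ i\<close>.
  The degree \<open>m\<close> is free to exceed that of \<open>r\<close>, the surplus being a power
  of y.\<close>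

definition homogenization :: "3 \<Rightarrow> 3 \<Rightarrow> complex poly \<Rightarrow> nat \<Rightarrow> complex ^ 3 \<Rightarrow> complex" where
  "homogenization i j r m z = (\<Sum>k\<le>m. coeff r k * (z $ j) ^ k * (z $ i) ^ (m - k))"

lemma homogenization_linear_factor:
  assumes "degree r \<le> m"
  shows "homogenization i j ([:- e, 1:] * r) (Suc m) z = (z $ j - e * z $ i) * homogenization i j r m z"
proof -
  let ?x = "z $ j" and ?y = "z $ i"
  have c0: "coeff r (Suc m) = 0"
    using assms by (simp add: coeff_eq_0)
  have co: "coeff ([:- e, 1:] * r) k = (case k of 0 \<Rightarrow> 0 | Suc n \<Rightarrow> coeff r n) - e * coeff r k" for k
    by (simp add: coeff_pCons split: nat.split)
  have "homogenization i j ([:- e, 1:] * r) (Suc m) z =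
      (\<Sum>k\<le>Suc m. (case k of 0 \<Rightarrow> 0 | Suc n \<Rightarrow> coeff r n) * ?x ^ k * ?y ^ (Suc m - k)) -
      (\<Sum>k\<le>Suc m. e * coeff r k * ?x ^ k * ?y ^ (Suc m - k))"
    unfolding homogenization_def co by (simp only: left_diff_distrib sum_subtractf)
  also have "(\<Sum>k\<le>Suc m. (case k of 0 \<Rightarrow> 0 | Suc n \<Rightarrow> coeff r n) * ?x ^ k * ?y ^ (Suc m - k)) =
      ?x * homogenization i j r m z"
    unfolding homogenization_def by (subst sum.atMost_Suc_shift) (simp add: sum_distrib_left mult_ac)
  also have "(\<Sum>k\<le>Suc m. e * coeff r k * ?x ^ k * ?y ^ (Suc m - k)) =
      e * ?y * homogenization i j r m z"
    using c0 by (auto simp: homogenization_def sum_distrib_left Suc_diff_le intro!: sum.cong)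
  finally show ?thesis
    by (simp add: algebra_simps)
qed

lemma homogeneous_poly_homogenization: "homogeneous_poly m (homogenization i j r m)"
proof -
  have "homogeneous_poly m (\<lambda>z. coeff r k * (z $ j) ^ k * (z $ i) ^ (m - k))" if "k \<le> m" for k
    using homogeneous_poly_mult[OF homogeneous_poly_cmult[OF homogeneous_poly_coord_power[of k j], of "coeff r k"]
        homogeneous_poly_coord_power[of "m - k" i]] that by simp
  then show ?thesis
    unfolding homogenization_def by (intro homogeneous_poly_sum) auto
qed

text \<open>Over the complex numbers a binary form splits into linear forms
  \<open>z $ j - e * z $ i\<close>. Nilpotency modulo \<open>adjoin\<close> gives
  \<open>(z $ i) ^ N' = p + h * (z $ j - e * z $ i)\<close> with \<open>p\<close> in
  \<open>J\<close>; hence multiplication of the remaining form \<open>r'\<close> by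
  \<open>(z $ i) ^ N'\<close> stays in the ideal, one factor at a time is traded for a power of
  \<open>z $ i\<close>, and in the end only such a power is left.\<close>

lemma coord_nilpotent_if_homogenization:
  assumes J: "graded_ideal J"
    and nil: "\<And>c. coord_nilpotent i (adjoin J (\<lambda>z. z $ j - c * z $ i))"
    and "r \<noteq> 0" "degree r \<le> m" "(\<lambda>z. (z $ i) ^ N * homogenization i j r m z) \<in> J (N + m)"
  shows "coord_nilpotent i J"
  using assms(3-)
proof (induction m arbitrary: r N)
  case 0
  then obtain a where a: "r = [:a:]" "a \<noteq> 0"
    by (metis degree_eq_zeroE le_zero_eq pCons_0_0)
  have "(\<lambda>z. inverse a * ((z $ i) ^ N * homogenization i j r 0 z)) \<in> J (0 + (N + 0))"
    by (rule graded_ideal_mult[OF J homogeneous_poly_const 0(3)])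
  also have "(\<lambda>z. inverse a * ((z $ i) ^ N * homogenization i j r 0 z)) = (\<lambda>z. (z $ i) ^ N)"
    using a by (auto simp: homogenization_def)
  finally show ?case
    by (auto simp: coord_nilpotent_def)
next
  case (Suc m)
  show ?case
  proof (cases "degree r = 0")
    case True
    then obtain a where a: "r = [:a:]" "a \<noteq> 0"
      using Suc.prems(1) by (metis degree_eq_zeroE pCons_0_0)
    have hom: "homogenization i j r (Suc m) z = a * (z $ i) ^ Suc m" for z
      using a by (subst homogenization_def, subst sum.atMost_Suc_shift) simp
    have "(\<lambda>z. inverse a * ((z $ i) ^ N * homogenization i j r (Suc m) z)) \<in> J (0 + (N + Suc m))"
      by (rule graded_ideal_mult[OF J homogeneous_poly_const Suc(4)])
    also have "(\<lambda>z. inverse a * ((z $ i) ^ N * homogenization i j r (Suc m) z)) = (\<lambda>z. (z $ i) ^ (N + Suc m))"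
      using a unfolding hom by (auto simp: power_add)
    finally show ?thesis
      unfolding coord_nilpotent_def add_0 by blast
  next
    case False
    then obtain e where "poly r e = 0"
      using fundamental_theorem_of_algebra[of r] constant_degree[of r] by auto
    then obtain r' where r': "r = [:- e, 1:] * r'"
      using poly_eq_0_iff_dvd by (blast elim: dvdE)
    have "r' \<noteq> 0"
      using Suc.prems(1) r' by auto
    then have "degree r = Suc (degree r')"
      unfolding r' by (subst degree_mult_eq) auto
    then have deg: "degree r' \<le> m"
      using Suc.prems(2) by simp
    obtain N' p h where ph: "p \<in> J N'" "shifted_poly 1 N' h"
        "(\<lambda>z. (z $ i) ^ N') = (\<lambda>z. p z + h z * (z $ j - e * z $ i))"
      using nil[of e] by (auto simp: coord_nilpotent_def adjoin_def)
    show ?thesis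
    proof (cases "N' = 0")
      case True
      then have "h = (\<lambda>_. 0)"
        using ph(2) by (simp add: shifted_poly_def)
      then have "(\<lambda>z. (z $ i) ^ N') \<in> J N'"
        using ph by simp
      then show ?thesis
        by (auto simp: coord_nilpotent_def)
    next
      case False
      then have h: "homogeneous_poly (N' - 1) h"
        using ph(2) by (simp add: shifted_poly_def)
      have 1: "(\<lambda>z. (z $ i) ^ N * homogenization i j r' m z * p z) \<in> J (N + m + N')"
        by (intro graded_ideal_mult[OF J] homogeneous_poly_mult homogeneous_poly_coord_power
            homogeneous_poly_homogenization ph)
      have 2: "(\<lambda>z. h z * ((z $ i) ^ N * homogenization i j r (Suc m) z)) \<in> J (N' - 1 + (N + Suc m))"
        by (intro graded_ideal_mult[OF J] h Suc.prems)
      have "(\<lambda>z. (z $ i) ^ N * homogenization i j r' m z * p z + h z * ((z $ i) ^ N * homogenization i j r (Suc m) z))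
          \<in> J (N + N' + m)"
        using graded_ideal_add[OF J 1, of "\<lambda>z. h z * ((z $ i) ^ N * homogenization i j r (Suc m) z)"] 2 False
        by (simp add: add_ac)
      also have "(\<lambda>z. (z $ i) ^ N * homogenization i j r' m z * p z + h z * ((z $ i) ^ N * homogenization i j r (Suc m) z))
          = (\<lambda>z. (z $ i) ^ (N + N') * homogenization i j r' m z)"
      proof
        fix z
        have "(z $ i) ^ N' = p z + h z * (z $ j - e * z $ i)"
          using ph(3) by meson
        then show "(z $ i) ^ N * homogenization i j r' m z * p z + h z * ((z $ i) ^ N * homogenization i j r (Suc m) z)
          = (z $ i) ^ (N + N') * homogenization i j r' m z"
          using homogenization_linear_factor[OF deg, of i j e z, folded r']
          by (simp only: power_add) (simp add: ring_distribs mult_ac)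
      qed
      finally show ?thesis
        using Suc.IH[OF \<open>r' \<noteq> 0\<close> deg] by simp
    qed
  qed
qed

lemma homogenization_sum:
  "homogenization i j (\<Sum>x\<in>X. r x) m z = (\<Sum>x\<in>X. homogenization i j (r x) m z)"
  unfolding homogenization_def by (subst sum.swap) (simp add: coeff_sum sum_distrib_right)

lemma homogenization_smult: "homogenization i j (smult c r) m z = c * homogenization i j r m z"
  by (simp add: homogenization_def sum_distrib_left mult_ac)

lemma homogenization_prod:
  "finite X \<Longrightarrow> homogenization i j (\<Prod>e\<in>X. [:- e, 1:]) (card X) z = (\<Prod>e\<in>X. (z $ j - e * z $ i))"
proof (induction X rule: finite_induct)
  case (insert e X)
  then have "degree (\<Prod>e\<in>X. [:- e, 1:]) \<le> card X"
    using degree_prod_sum_le[of X "\<lambda>e. [:- e, 1:]"] by simp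
  then show ?case
    using insert homogenization_linear_factor[of "\<Prod>e\<in>X. [:- e, 1:]"] by simp
qed (simp add: homogenization_def)

text \<open>
  The uncountability of the field replaces the Nullstellensatz: if all the slopes \<open>c\<close> were bad,
  infinitely many would be bad with the same exponent, and a linear relation between the
  finitely generated cofactors would produce a binary form in the ideal.
\<close>

lemma exists_slope_not_coord_nilpotent:
  assumes J: "graded_ideal J" and "\<not> coord_nilpotent i J"
  shows "\<exists>c. \<not> coord_nilpotent i (adjoin J (\<lambda>z. z $ j - c * z $ i))"
proof (rule ccontr)
  assume "\<not> ?thesis"
  then have nil: "\<And>c. coord_nilpotent i (adjoin J (\<lambda>z. z $ j - c * z $ i))"
    by blast
  define C where "C N = {c. (\<lambda>z. (z $ i) ^ N) \<in> adjoin J (\<lambda>z. z $ j - c * z $ i) N}" for N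
  have "(\<Union>N. C N) = UNIV"
    using nil by (auto simp: C_def coord_nilpotent_def)
  moreover have "uncountable (UNIV :: complex set)"
    by (rule uncountable_UNIV_complex)
  ultimately have "\<exists>N. infinite (C N)"
    using countable_UN[of "UNIV :: nat set" C] countable_finite by auto
  then obtain N where N: "infinite (C N)"
    by blast
  have "N \<noteq> 0"
  proof
    assume "N = 0"
    obtain c where "c \<in> C N"
      using N by (metis finite.emptyI ex_in_conv)
    then obtain p h where "p \<in> J N" "shifted_poly 1 N h"
        "(\<lambda>z. (z $ i) ^ N) = (\<lambda>z. p z + h z * (z $ j - c * z $ i))"
      by (auto simp: adjoin_def C_def)
    then have "(\<lambda>z. (z $ i) ^ N) \<in> J N"
      using \<open>N = 0\<close> by (simp add: shifted_poly_def)
    then show False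
      using assms(2) by (auto simp: coord_nilpotent_def)
  qed
  obtain X where X: "X \<subseteq> C N" "finite X" "card X = Suc (card (exponents (N - 1)))"
    using N infinite_arbitrarily_large by blast
  have "\<exists>p h. p \<in> J N \<and> homogeneous_poly (N - 1) h \<and>
      (\<forall>z. (z $ i) ^ N = p z + h z * (z $ j - c * z $ i))" if c: "c \<in> X" for c
  proof -
    obtain p h where "p \<in> J N" "shifted_poly 1 N h"
        "(\<lambda>z. (z $ i) ^ N) = (\<lambda>z. p z + h z * (z $ j - c * z $ i))"
      using c X(1) by (auto simp: adjoin_def C_def)
    then show ?thesis
      using \<open>N \<noteq> 0\<close> by (auto simp: shifted_poly_def fun_eq_iff)
  qed
  then obtain p h where ph: "\<And>c. c \<in> X \<Longrightarrow> p c \<in> J N" "\<And>c. c \<in> X \<Longrightarrow> homogeneous_poly (N - 1) (h c)"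
      "\<And>c z. c \<in> X \<Longrightarrow> (z $ i) ^ N = p c z + h c z * (z $ j - c * z $ i)"
    by metis
  then have "\<exists>a. \<forall>c\<in>X. \<forall>z. h c z = (\<Sum>\<alpha>\<in>exponents (N - 1). a c \<alpha> * monom_eval \<alpha> z)"
    unfolding homogeneous_poly_iff by (intro bchoice) auto
  then obtain a where a: "\<And>c z. c \<in> X \<Longrightarrow> h c z = (\<Sum>\<alpha>\<in>exponents (N - 1). a c \<alpha> * monom_eval \<alpha> z)"
    by blast
  obtain l where l: "\<exists>c\<in>X. l c \<noteq> 0" "\<forall>\<alpha>\<in>exponents (N - 1). (\<Sum>c\<in>X. l c * a c \<alpha>) = 0"
    using homogeneous_system_nontrivial_solution[OF finite_exponents X(2), of "N - 1" a] X(3) by auto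
  have lh: "(\<Sum>c\<in>X. l c * h c z) = 0" for z
  proof -
    have "(\<Sum>c\<in>X. l c * h c z) = (\<Sum>\<alpha>\<in>exponents (N - 1). (\<Sum>c\<in>X. l c * a c \<alpha>) * monom_eval \<alpha> z)"
      unfolding sum_distrib_right by (subst sum.swap) (auto simp: a sum_distrib_left mult_ac intro!: sum.cong)
    then show ?thesis
      using l(2) by simp
  qed
  define m where "m = card (exponents (N - 1))"
  \<comment> \<open>Multiply the relation for \<open>c\<close> by \<open>l c\<close> and by the
    linear forms of the other slopes. All the cofactors \<open>h c\<close> then carry the product
    over the whole of \<open>X\<close>, and their sum cancels by \<open>lh\<close>. At
    \<open>c0\<close> only the summand of \<open>c0\<close> itself survives, so \<open>r\<close> is
    not zero.\<close>
  define r where "r = (\<Sum>c\<in>X. smult (l c) (\<Prod>e\<in>X-{c}. [:- e, 1:]))"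
  have card: "card (X - {c}) = m" if "c \<in> X" for c
    using that X by (simp add: m_def card_Diff_singleton)
  obtain c0 where c0: "c0 \<in> X" "l c0 \<noteq> 0"
    using l(1) by blast
  have "poly r c0 = (\<Sum>c\<in>X. l c * (\<Prod>e\<in>X-{c}. (c0 - e)))"
    by (simp add: r_def poly_sum poly_prod)
  also have "\<dots> = l c0 * (\<Prod>e\<in>X-{c0}. (c0 - e)) + (\<Sum>c\<in>X-{c0}. l c * (\<Prod>e\<in>X-{c}. (c0 - e)))"
    using c0 X by (simp add: sum.remove)
  also have "(\<Sum>c\<in>X-{c0}. l c * (\<Prod>e\<in>X-{c}. (c0 - e))) = 0"
    using c0 X(2) by (intro sum.neutral) (auto intro!: prod_zero)
  finally have "poly r c0 \<noteq> 0"
    using c0 X(2) by (auto simp: prod_zero_iff)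
  then have "r \<noteq> 0"
    by auto
  have "degree (\<Prod>e\<in>X-{c}. [:- e, 1:]) \<le> m" if "c \<in> X" for c
    using degree_prod_sum_le[of "X - {c}" "\<lambda>e. [:- e, 1:]"] X card[OF that] by simp
  then have deg: "degree r \<le> m"
    unfolding r_def by (intro degree_sum_le) (auto intro: order_trans[OF degree_smult_le] simp: X)
  have hp: "homogenization i j (\<Prod>e\<in>X-{c}. [:- e, 1:]) m z = (\<Prod>e\<in>X-{c}. (z $ j - e * z $ i))"
    if "c \<in> X" for c z
    using homogenization_prod[of "X - {c}" i j z] X(2) card[OF that] by simp
  have hr: "homogenization i j r m z = (\<Sum>c\<in>X. l c * (\<Prod>e\<in>X-{c}. (z $ j - e * z $ i)))" for z
    unfolding r_def homogenization_sum homogenization_smult by (simp add: hp)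
  have id: "(z $ i) ^ N * homogenization i j r m z =
      (\<Sum>c\<in>X. (l c * homogenization i j (\<Prod>e\<in>X-{c}. [:- e, 1:]) m z) * p c z)" for z
  proof -
    let ?P = "\<lambda>c. \<Prod>e\<in>X-{c}. (z $ j - e * z $ i)"
    have "(z $ i) ^ N * homogenization i j r m z = (\<Sum>c\<in>X. l c * ?P c * (z $ i) ^ N)"
      unfolding hr by (simp add: sum_distrib_left mult_ac)
    also have "\<dots> = (\<Sum>c\<in>X. l c * ?P c * p c z + l c * h c z * (\<Prod>e\<in>X. (z $ j - e * z $ i)))"
    proof (intro sum.cong refl)
      fix c assume c: "c \<in> X"
      have "(\<Prod>e\<in>X. (z $ j - e * z $ i)) = (z $ j - c * z $ i) * ?P c"
        using c X(2) by (rule prod.remove[rotated])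
      then show "l c * ?P c * (z $ i) ^ N = l c * ?P c * p c z + l c * h c z * (\<Prod>e\<in>X. (z $ j - e * z $ i))"
        by (simp only: ph(3)[OF c]) (simp add: ring_distribs mult_ac)
    qed
    also have "\<dots> = (\<Sum>c\<in>X. l c * ?P c * p c z)"
      unfolding sum.distrib sum_distrib_right[symmetric] lh by simp
    also have "\<dots> = (\<Sum>c\<in>X. (l c * homogenization i j (\<Prod>e\<in>X-{c}. [:- e, 1:]) m z) * p c z)"
      by (simp add: hp)
    finally show ?thesis .
  qed
  have "(\<lambda>z. \<Sum>c\<in>X. (l c * homogenization i j (\<Prod>e\<in>X-{c}. [:- e, 1:]) m z) * p c z) \<in> J (m + N)"
    by (intro graded_ideal_sum[OF J] graded_ideal_mult[OF J] homogeneous_poly_cmult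
        homogeneous_poly_homogenization ph)
  then have "(\<lambda>z. (z $ i) ^ N * homogenization i j r m z) \<in> J (N + m)"
    unfolding id by (simp add: add.commute)
  from coord_nilpotent_if_homogenization[OF J nil \<open>r \<noteq> 0\<close> deg this] assms(2) show False
    by simp
qed

section \<open>Forms modulo a graded ideal, and a projective Nullstellensatz\<close>

lemma prod_UNIV_3: "prod f (UNIV :: 3 set) = f 1 * f 2 * f 3"
  unfolding UNIV_3 by (simp add: mult_ac)

definition congruent_mod :: "(nat \<Rightarrow> (complex ^ 3 \<Rightarrow> complex) set) \<Rightarrow> nat
    \<Rightarrow> (complex ^ 3 \<Rightarrow> complex) \<Rightarrow> (complex ^ 3 \<Rightarrow> complex) \<Rightarrow> bool" where
  "congruent_mod J k p q \<longleftrightarrow>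
     homogeneous_poly k p \<and> homogeneous_poly k q \<and> (\<lambda>z. p z - q z) \<in> J k"

lemma congruent_mod_mult:
  assumes J: "graded_ideal J" and "congruent_mod J k p q" "congruent_mod J l p' q'"
  shows "congruent_mod J (k + l) (\<lambda>z. p z * p' z) (\<lambda>z. q z * q' z)"
proof -
  have "(\<lambda>z. p z * (p' z - q' z)) \<in> J (k + l)" "(\<lambda>z. q' z * (p z - q z)) \<in> J (l + k)"
    using assms by (auto simp: congruent_mod_def intro: graded_ideal_mult[OF J])
  then have "(\<lambda>z. p z * (p' z - q' z) + q' z * (p z - q z)) \<in> J (k + l)"
    by (intro graded_ideal_add[OF J]) (simp_all add: add.commute)
  also have "(\<lambda>z. p z * (p' z - q' z) + q' z * (p z - q z)) = (\<lambda>z. p z * p' z - q z * q' z)"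
    by (simp add: algebra_simps)
  finally show ?thesis
    using assms by (simp add: congruent_mod_def homogeneous_poly_mult)
qed

lemma congruent_mod_power:
  assumes J: "graded_ideal J" and "congruent_mod J 1 p q"
  shows "congruent_mod J n (\<lambda>z. p z ^ n) (\<lambda>z. q z ^ n)"
proof (induction n)
  case 0
  then show ?case
    using graded_ideal_zero[OF J, of 0] by (simp add: congruent_mod_def homogeneous_poly_const)
next
  case (Suc n)
  then show ?case
    using congruent_mod_mult[OF J assms(2) Suc] by simp
qed

text \<open>If every coordinate is congruent to a multiple of \<open>z $ i0\<close>, substitution in
  each monomial reduces a form to its value at \<open>c\<close> times a power of
  \<open>z $ i0\<close>.\<close>

lemma congruent_mod_homogeneous:
  assumes J: "graded_ideal J" and x: "\<And>i. congruent_mod J 1 (\<lambda>z. z $ i) (\<lambda>z. c $ i * z $ i0)"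
    and p: "homogeneous_poly k p"
  shows "(\<lambda>z. p z - p c * (z $ i0) ^ k) \<in> J k"
proof -
  obtain a where a: "\<And>z. p z = (\<Sum>\<alpha>\<in>exponents k. a \<alpha> * monom_eval \<alpha> z)"
    using p by (auto simp: homogeneous_poly_iff)
  have mono: "congruent_mod J k (monom_eval \<alpha>) (\<lambda>z. monom_eval \<alpha> c * (z $ i0) ^ k)" if "\<alpha> \<in> exponents k" for \<alpha>
  proof -
    have "congruent_mod J (\<alpha> 1 + \<alpha> 2 + \<alpha> 3)
      (\<lambda>z. (z $ 1) ^ \<alpha> 1 * (z $ 2) ^ \<alpha> 2 * (z $ 3) ^ \<alpha> 3)
      (\<lambda>z. (c $ 1 * z $ i0) ^ \<alpha> 1 * (c $ 2 * z $ i0) ^ \<alpha> 2 * (c $ 3 * z $ i0) ^ \<alpha> 3)"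
      by (intro congruent_mod_mult congruent_mod_power J x)
    moreover have "\<alpha> 1 + \<alpha> 2 + \<alpha> 3 = k"
      using that by (simp add: exponents_def sum_3)
    moreover have "(\<lambda>z. (z $ 1) ^ \<alpha> 1 * (z $ 2) ^ \<alpha> 2 * (z $ 3) ^ \<alpha> 3) = monom_eval \<alpha>"
      unfolding monom_eval_def prod_UNIV_3 by (rule refl)
    moreover have "(c $ 1 * z $ i0) ^ \<alpha> 1 * (c $ 2 * z $ i0) ^ \<alpha> 2 * (c $ 3 * z $ i0) ^ \<alpha> 3 =
        monom_eval \<alpha> c * (z $ i0) ^ k" for z :: "complex ^ 3"
      unfolding \<open>\<alpha> 1 + \<alpha> 2 + \<alpha> 3 = k\<close>[symmetric]
      unfolding monom_eval_def prod_UNIV_3 by (simp add: power_mult_distrib power_add mult_ac)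
    ultimately show ?thesis
      by simp
  qed
  have "(\<lambda>z. \<Sum>\<alpha>\<in>exponents k. a \<alpha> * (monom_eval \<alpha> z - monom_eval \<alpha> c * (z $ i0) ^ k)) \<in> J k"
  proof (intro graded_ideal_sum[OF J])
    fix \<alpha> assume "\<alpha> \<in> exponents k"
    then show "(\<lambda>z. a \<alpha> * (monom_eval \<alpha> z - monom_eval \<alpha> c * (z $ i0) ^ k)) \<in> J k"
      using graded_ideal_mult[OF J homogeneous_poly_const[of "a \<alpha>"]] mono
      by (fastforce simp: congruent_mod_def)
  qed
  then show ?thesis
    by (simp add: a right_diff_distrib sum_subtractf sum_distrib_right mult.assoc)
qed

text \<open>Otherwise slopes \<open>c1\<close> and \<open>c2\<close> for the two other coordinates
  can be adjoined in turn, with \<open>z $ i0\<close> remaining non-nilpotent. Modulo the larger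
  ideal the component \<open>i\<close> of \<open>F\<close> becomes \<open>F c $ i\<close> times the
  power \<open>d\<close> of \<open>z $ i0\<close>; it lies in the ideal while the power does not, so
  \<open>F c = 0\<close> although \<open>c $ i0 = 1\<close>.\<close>

lemma coord_nilpotent_generated:
  fixes F :: "complex ^ 3 \<Rightarrow> complex ^ 3"
  assumes F: "\<And>i. homogeneous_poly d (\<lambda>z. F z $ i)" and nz: "\<And>z. F z = 0 \<Longrightarrow> z = 0"
  shows "coord_nilpotent i0 (generated_ideal d F)"
proof (rule ccontr)
  assume not0: "\<not> ?thesis"
  obtain i1 i2 where i12: "i1 \<noteq> i0" "i2 \<noteq> i0" "i1 \<noteq> i2" "\<And>i :: 3. i = i0 \<or> i = i1 \<or> i = i2"
  proof -
    have "\<exists>i1 i2. i1 \<noteq> i0 \<and> i2 \<noteq> i0 \<and> i1 \<noteq> i2 \<and> (\<forall>i :: 3. i = i0 \<or> i = i1 \<or> i = i2)"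
      using exhaust_3[of i0]
    proof (elim disjE)
      assume "i0 = 1"
      then show ?thesis
        using exhaust_3 by (intro exI[of _ 2] exI[of _ 3]) auto
    next
      assume "i0 = 2"
      then show ?thesis
        using exhaust_3 by (intro exI[of _ 1] exI[of _ 3]) auto
    next
      assume "i0 = 3"
      then show ?thesis
        using exhaust_3 by (intro exI[of _ 1] exI[of _ 2]) auto
    qed
    then show ?thesis
      using that by blast
  qed
  let ?J0 = "generated_ideal d F"
  note J0 = graded_ideal_generated[of d F]
  obtain c1 where c1: "\<not> coord_nilpotent i0 (adjoin ?J0 (\<lambda>z. z $ i1 - c1 * z $ i0))"
    using exists_slope_not_coord_nilpotent[OF J0 not0] by blast
  define J1 where "J1 = adjoin ?J0 (\<lambda>z. z $ i1 - c1 * z $ i0)"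
  have J1: "graded_ideal J1"
    unfolding J1_def by (intro graded_ideal_adjoin J0)
  obtain c2 where c2: "\<not> coord_nilpotent i0 (adjoin J1 (\<lambda>z. z $ i2 - c2 * z $ i0))"
    using exists_slope_not_coord_nilpotent[OF J1] c1 unfolding J1_def by blast
  define J where "J = adjoin J1 (\<lambda>z. z $ i2 - c2 * z $ i0)"
  have J: "graded_ideal J"
    unfolding J_def by (intro graded_ideal_adjoin J1)
  define c :: "complex ^ 3" where "c = (\<chi> i. if i = i0 then 1 else if i = i1 then c1 else c2)"
  have "(\<lambda>z. z $ i - c $ i * z $ i0) \<in> J 1" for i
  proof -
    consider "i = i0" | "i = i1" | "i = i2"
      using i12(4) by blast
    then show ?thesis
    proof cases
      case 1
      then show ?thesis
        using graded_ideal_zero[OF J] by (simp add: c_def)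
    next
      case 2
      have "(\<lambda>z. z $ i1 - c1 * z $ i0) \<in> J1 1"
        unfolding J1_def by (rule generator_in_adjoin[OF J0])
      then show ?thesis
        using 2 i12 subset_adjoin[of J1] by (auto simp: c_def J_def)
    next
      case 3
      then show ?thesis
        using i12 generator_in_adjoin[OF J1] by (simp add: c_def J_def)
    qed
  qed
  then have cong: "congruent_mod J 1 (\<lambda>z. z $ i) (\<lambda>z. c $ i * z $ i0)" for i
    unfolding congruent_mod_def
    by (intro conjI homogeneous_poly_coord homogeneous_poly_cmult) auto
  have "F c $ i = 0" for i
  proof (rule ccontr)
    assume nz: "F c $ i \<noteq> 0"
    have "(\<lambda>z. F z $ i) \<in> ?J0 d"
      unfolding generated_ideal_def
      by (intro CollectI exI[of _ "\<lambda>j z. if j = i then 1 else 0"])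
        (auto simp: shifted_poly_def homogeneous_poly_const if_distrib[of "\<lambda>x. x * _"] cong: if_cong)
    then have "(\<lambda>z. F z $ i) \<in> J d"
      unfolding J_def J1_def using subset_adjoin by blast
    moreover have "(\<lambda>z. F z $ i - F c $ i * (z $ i0) ^ d) \<in> J d"
      by (rule congruent_mod_homogeneous[OF J cong F])
    ultimately have "(\<lambda>z. F z $ i + (-1) * (F z $ i - F c $ i * (z $ i0) ^ d)) \<in> J d"
      using graded_ideal_mult[OF J homogeneous_poly_const[of "-1"], of "\<lambda>z. F z $ i - F c $ i * (z $ i0) ^ d" d]
      by (intro graded_ideal_add[OF J]) simp_all
    also have "(\<lambda>z. F z $ i + (-1) * (F z $ i - F c $ i * (z $ i0) ^ d)) = (\<lambda>z. F c $ i * (z $ i0) ^ d)"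
      by simp
    finally have "(\<lambda>z. F c $ i * (z $ i0) ^ d) \<in> J d" .
    then have "(\<lambda>z. inverse (F c $ i) * (F c $ i * (z $ i0) ^ d)) \<in> J (0 + d)"
      by (rule graded_ideal_mult[OF J homogeneous_poly_const])
    moreover have "(\<lambda>z. inverse (F c $ i) * (F c $ i * (z $ i0) ^ d)) = (\<lambda>z. (z $ i0) ^ d)"
      using nz by auto
    ultimately show False
      using c2 by (auto simp: coord_nilpotent_def J_def)
  qed
  then have "F c = 0"
    by (simp add: vec_eq_iff)
  then have "c = 0"
    by (rule assms(2))
  moreover have "c $ i0 = 1"
    by (simp add: c_def)
  ultimately show False
    by simp
qed

text \<open>Pigeonhole: a monomial whose degree exceeds the sum of the \<open>N i\<close> is
  divisible by some \<open>(z $ i) ^ N i\<close>, which lies in the ideal.\<close>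

lemma homogeneous_poly_in_generated_ideal:
  fixes F :: "complex ^ 3 \<Rightarrow> complex ^ 3"
  assumes F: "\<And>i. homogeneous_poly d (\<lambda>z. F z $ i)" and nz: "\<And>z. F z = 0 \<Longrightarrow> z = 0"
  shows "\<exists>D. \<forall>k\<ge>D. \<forall>p. homogeneous_poly k p \<longrightarrow> p \<in> generated_ideal d F k"
proof -
  let ?J = "generated_ideal d F"
  note J = graded_ideal_generated[of d F]
  obtain N where N: "\<And>i. (\<lambda>z. (z $ i) ^ N i) \<in> ?J (N i)"
    using coord_nilpotent_generated[OF assms] unfolding coord_nilpotent_def by metis
  show ?thesis
  proof (intro exI allI impI)
    fix k p assume k: "(\<Sum>i\<in>UNIV. N i) + 1 \<le> k" and "homogeneous_poly k p"
    then obtain a where a: "\<And>z. p z = (\<Sum>\<alpha>\<in>exponents k. a \<alpha> * monom_eval \<alpha> z)"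
      by (auto simp: homogeneous_poly_iff)
    have "monom_eval \<alpha> \<in> ?J k" if \<alpha>: "\<alpha> \<in> exponents k" for \<alpha>
    proof -
      have "\<exists>i. N i \<le> \<alpha> i"
      proof (rule ccontr)
        assume "\<not> ?thesis"
        then have "(\<Sum>i\<in>UNIV. \<alpha> i) \<le> (\<Sum>i\<in>UNIV. N i)"
          by (intro sum_mono) (auto simp: not_le intro: less_imp_le)
        then show False
          using \<alpha> k by (simp add: exponents_def)
      qed
      then obtain i where i: "N i \<le> \<alpha> i"
        by blast
      define \<beta> where "\<beta> j = (if j = i then \<alpha> i - N i else \<alpha> j)" for j
      have "(\<Sum>j\<in>UNIV. \<beta> j) = \<alpha> i - N i + (\<Sum>j\<in>UNIV-{i}. \<alpha> j)"
        by (subst sum.remove[of _ i]) (auto simp: \<beta>_def intro!: sum.cong)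
      also have "\<dots> = k - N i"
        using \<alpha> i sum.remove[of UNIV i \<alpha>] by (simp add: exponents_def)
      finally have \<beta>: "\<beta> \<in> exponents (k - N i)"
        by (simp add: exponents_def)
      have "N i \<le> k"
        using i \<alpha> member_le_sum[of i UNIV \<alpha>] by (simp add: exponents_def)
      have "monom_eval \<alpha> z = monom_eval \<beta> z * (z $ i) ^ N i" for z
        unfolding monom_eval_def
        by (subst (1 2) prod.remove[of _ i]) (auto simp: \<beta>_def i simp flip: power_add intro!: prod.cong)
      moreover have "(\<lambda>z. monom_eval \<beta> z * (z $ i) ^ N i) \<in> ?J (k - N i + N i)"
        by (rule graded_ideal_mult[OF J homogeneous_poly_mono[OF \<beta>] N])
      ultimately have "monom_eval \<alpha> \<in> ?J (k - N i + N i)"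
        by presburger
      then show ?thesis
        using \<open>N i \<le> k\<close> by simp
    qed
    then have "(\<lambda>z. \<Sum>\<alpha>\<in>exponents k. a \<alpha> * monom_eval \<alpha> z) \<in> ?J k"
      using graded_ideal_mult[OF J homogeneous_poly_const, of _ k] by (intro graded_ideal_sum[OF J]) auto
    then show "p \<in> ?J k"
      unfolding a[symmetric] .
  qed
qed

text \<open>On a level set the components of \<open>F\<close> are the constants
  \<open>w $ j\<close>, so a form of degree at least \<open>D\<close>, written with cofactors of
  degree \<open>k - d\<close>, reduces to lower degree. Restricted to the level set, all polynomials
  thus lie in the span of the monomials of degree below \<open>D\<close>. With more points than such
  monomials, the point evaluations would satisfy a linear relation, which a product of coordinate
  differences that vanishes at all the points but one refutes. The bound does not involve
  \<open>w\<close>.\<close>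

lemma card_level_set_le:
  fixes F :: "complex ^ 3 \<Rightarrow> complex ^ 3"
  assumes F: "\<And>i. homogeneous_poly d (\<lambda>z. F z $ i)" and nz: "\<And>z. F z = 0 \<Longrightarrow> z = 0" and "d > 0"
  shows "\<exists>M. \<forall>w. finite {z. F z = w} \<and> card {z. F z = w} \<le> M"
proof -
  obtain D where D: "\<And>k p. k \<ge> D \<Longrightarrow> homogeneous_poly k p \<Longrightarrow> p \<in> generated_ideal d F k"
    using homogeneous_poly_in_generated_ideal[OF F nz] by blast
  define E where "E = (\<Union>k<D. exponents k)"
  have E: "finite E"
    by (auto simp: E_def finite_exponents)
  define red where "red w p \<longleftrightarrow> (\<exists>b. \<forall>z. F z = w \<longrightarrow> p z = (\<Sum>\<alpha>\<in>E. b \<alpha> * monom_eval \<alpha> z))" for w p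
  have red_cmult: "red w (\<lambda>z. c * p z)" if p: "red w p" for w c p
  proof -
    obtain b where "\<forall>z. F z = w \<longrightarrow> p z = (\<Sum>\<alpha>\<in>E. b \<alpha> * monom_eval \<alpha> z)"
      using p by (auto simp: red_def)
    then show ?thesis
      unfolding red_def by (intro exI[of _ "\<lambda>\<alpha>. c * b \<alpha>"]) (simp add: sum_distrib_left mult_ac)
  qed
  have red_sum: "red w (\<lambda>z. \<Sum>x\<in>X. p x z)" if p: "\<And>x. x \<in> X \<Longrightarrow> red w (p x)" for X :: "'x set" and w p
  proof -
    have "\<exists>b. \<forall>x\<in>X. \<forall>z. F z = w \<longrightarrow> p x z = (\<Sum>\<alpha>\<in>E. b x \<alpha> * monom_eval \<alpha> z)"
      by (rule bchoice) (use p in \<open>simp add: red_def\<close>)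
    then obtain b where "\<forall>x\<in>X. \<forall>z. F z = w \<longrightarrow> p x z = (\<Sum>\<alpha>\<in>E. b x \<alpha> * monom_eval \<alpha> z)"
      by blast
    then have "(\<Sum>x\<in>X. p x z) = (\<Sum>\<alpha>\<in>E. (\<Sum>x\<in>X. b x \<alpha>) * monom_eval \<alpha> z)" if "F z = w" for z
      unfolding sum_distrib_right using that by (subst sum.swap) simp
    then show ?thesis
      unfolding red_def by (intro exI[of _ "\<lambda>\<alpha>. \<Sum>x\<in>X. b x \<alpha>"]) simp
  qed
  have red_hom: "red w p" if "homogeneous_poly k p" for w k p
    using that
  proof (induction k arbitrary: p rule: less_induct)
    case (less k)
    show ?case
    proof (cases "k < D")
      case True
      obtain a where a: "\<And>z. p z = (\<Sum>\<alpha>\<in>exponents k. a \<alpha> * monom_eval \<alpha> z)"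
        using less.prems by (auto simp: homogeneous_poly_iff)
      have "p z = (\<Sum>\<alpha>\<in>E. (if \<alpha> \<in> exponents k then a \<alpha> else 0) * monom_eval \<alpha> z)" for z
        unfolding a using True E by (intro sum.mono_neutral_cong_left) (auto simp: E_def)
      then show ?thesis
        unfolding red_def
        by (intro exI[of _ "\<lambda>\<alpha>. if \<alpha> \<in> exponents k then a \<alpha> else 0"]) simp
    next
      case False
      then obtain h where h: "p = (\<lambda>z. \<Sum>j\<in>UNIV. h j z * F z $ j)" "\<And>j. shifted_poly d k (h j)"
        using D[OF _ less.prems] by (auto simp: generated_ideal_def)
      have "red w (h j)" for j
      proof (cases "d \<le> k")
        case True
        then show ?thesis
          using less.IH[of "k - d" "h j"] h(2)[of j] \<open>d > 0\<close> by (simp add: shifted_poly_def)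
      next
        case False
        then have "h j = (\<lambda>_. 0)"
          using h(2)[of j] by (simp add: shifted_poly_def)
        then show ?thesis
          unfolding red_def by (intro exI[of _ "\<lambda>_. 0"]) simp
      qed
      then have "red w (\<lambda>z. \<Sum>j\<in>UNIV. w $ j * h j z)"
        by (intro red_sum red_cmult)
      then show ?thesis
        unfolding red_def h(1) by (auto simp: mult.commute)
    qed
  qed
  have red_shift: "red w (\<lambda>z. (z $ i - e) * p z)" if p: "red w p" for w i e p
  proof -
    obtain b where b: "\<And>z. F z = w \<Longrightarrow> p z = (\<Sum>\<alpha>\<in>E. b \<alpha> * monom_eval \<alpha> z)"
      using p by (auto simp: red_def)
    have "red w (\<lambda>z. \<Sum>\<alpha>\<in>E. b \<alpha> * (z $ i * monom_eval \<alpha> z + (- e) * monom_eval \<alpha> z))"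
    proof (intro red_sum red_cmult)
      fix \<alpha> assume "\<alpha> \<in> E"
      then obtain k where "\<alpha> \<in> exponents k"
        by (auto simp: E_def)
      then have "red w (\<lambda>z. z $ i * monom_eval \<alpha> z)" "red w (monom_eval \<alpha>)"
        by (auto intro!: red_hom homogeneous_poly_mult[OF homogeneous_poly_coord] homogeneous_poly_mono)
      then have "red w (\<lambda>z. \<Sum>x\<in>{True,False}. if x then z $ i * monom_eval \<alpha> z else (-e) * monom_eval \<alpha> z)"
        using red_cmult[of w "monom_eval \<alpha>" "- e"] by (intro red_sum) (case_tac x, simp_all)
      then show "red w (\<lambda>z. z $ i * monom_eval \<alpha> z + (- e) * monom_eval \<alpha> z)"
        by simp
    qed
    moreover have "(\<Sum>\<alpha>\<in>E. b \<alpha> * (z $ i * monom_eval \<alpha> z + (- e) * monom_eval \<alpha> z)) = (z $ i - e) * p z"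
      if "F z = w" for z
      unfolding b[OF that] by (simp add: sum_distrib_left algebra_simps)
    ultimately show ?thesis
      unfolding red_def by simp
  qed
  have red_prod: "red w (\<lambda>z. \<Prod>y\<in>Y. (z $ i y - e y))" if "finite Y" for w i e and Y :: "(complex ^ 3) set"
    using that
  proof (induction Y rule: finite_induct)
    case empty
    show ?case
      using red_hom[OF homogeneous_poly_const[of 1]] by simp
  next
    case (insert y Y)
    then show ?case
      using red_shift[of w "\<lambda>z. \<Prod>y\<in>Y. (z $ i y - e y)" "i y" "e y"] by simp
  qed
  have bound: "card Y \<le> card E" if Y: "finite Y" "Y \<subseteq> {z. F z = w}" for Y w
  proof (rule ccontr)
    assume "\<not> card Y \<le> card E"
    then obtain l where l: "\<exists>y\<in>Y. l y \<noteq> 0" "\<forall>\<alpha>\<in>E. (\<Sum>y\<in>Y. l y * monom_eval \<alpha> y) = 0"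
      using homogeneous_system_nontrivial_solution[OF E Y(1), of "\<lambda>y \<alpha>. monom_eval \<alpha> y"] by auto
    have zero: "(\<Sum>y\<in>Y. l y * p y) = 0" if p: "red w p" for p
    proof -
      obtain b where b: "\<And>z. F z = w \<Longrightarrow> p z = (\<Sum>\<alpha>\<in>E. b \<alpha> * monom_eval \<alpha> z)"
        using p by (auto simp: red_def)
      have "(\<Sum>y\<in>Y. l y * p y) = (\<Sum>y\<in>Y. \<Sum>\<alpha>\<in>E. b \<alpha> * (l y * monom_eval \<alpha> y))"
        using Y(2) by (intro sum.cong refl) (auto simp: b sum_distrib_left mult_ac)
      also have "\<dots> = (\<Sum>\<alpha>\<in>E. b \<alpha> * (\<Sum>y\<in>Y. l y * monom_eval \<alpha> y))"
        by (subst sum.swap) (simp add: sum_distrib_left)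
      finally show ?thesis
        using l(2) by simp
    qed
    obtain y0 where y0: "y0 \<in> Y" "l y0 \<noteq> 0"
      using l(1) by blast
    have "\<forall>y\<in>Y-{y0}. \<exists>i. y0 $ i \<noteq> y $ i"
      by (auto simp: vec_eq_iff)
    then obtain i where i: "\<forall>y\<in>Y-{y0}. y0 $ i y \<noteq> y $ i y"
      using bchoice[of "Y - {y0}" "\<lambda>y i. y0 $ i \<noteq> y $ i"] by blast
    define p where "p z = (\<Prod>y\<in>Y-{y0}. (z $ i y - y $ i y))" for z :: "complex ^ 3"
    have "red w p"
      unfolding p_def using Y(1) by (intro red_prod) auto
    then have "(\<Sum>y\<in>Y. l y * p y) = 0"
      by (rule zero)
    moreover have "(\<Sum>y\<in>Y. l y * p y) = l y0 * p y0 + (\<Sum>y\<in>Y-{y0}. l y * p y)"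
      using Y(1) y0(1) by (rule sum.remove)
    moreover have "(\<Sum>y\<in>Y-{y0}. l y * p y) = 0"
      using Y(1) by (intro sum.neutral) (auto simp: p_def intro!: prod_zero)
    moreover have "p y0 \<noteq> 0"
      using i Y(1) by (auto simp: p_def prod_zero_iff)
    ultimately show False
      using y0(2) by simp
  qed
  show ?thesis
  proof (intro exI allI conjI)
    fix w
    show "finite {z. F z = w}"
    proof (rule ccontr)
      assume "infinite {z. F z = w}"
      then obtain Y where "Y \<subseteq> {z. F z = w}" "finite Y" "card Y = Suc (card E)"
        using infinite_arbitrarily_large by blast
      then show False
        using bound[of Y w] by simp
    qed
    then show "card {z. F z = w} \<le> card E"
      using bound[of "{z. F z = w}" w] by simp
  qed
qed

text \<open>By homogeneity a lift can be rescaled by a \<open>d\<close>-th root, so every point of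
  the fibre has a lift on one and the same level set of \<open>F\<close>.\<close>

lemma card_fibre_le:
  fixes F :: "complex ^ 3 \<Rightarrow> complex ^ 3"
  assumes F: "\<And>i. homogeneous_poly d (\<lambda>z. F z $ i)" and nz: "\<And>z. F z = 0 \<Longrightarrow> z = 0" and "d > 0"
    and f: "\<And>z. z \<noteq> 0 \<Longrightarrow> f (proj z) = proj (F z)"
  shows "\<exists>M. \<forall>x. finite (f -` {x}) \<and> card (f -` {x}) \<le> M"
proof -
  obtain M where M: "\<And>w. finite {z. F z = w}" "\<And>w. card {z. F z = w} \<le> M"
    using card_level_set_le[OF F nz \<open>d > 0\<close>] by blast
  have scale: "F (c *s z) = c ^ d *s F z" for c z
    using homogeneous_poly_scale[OF F] by (simp add: vec_eq_iff)
  have "finite (f -` {x}) \<and> card (f -` {x}) \<le> M" for x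
  proof -
    obtain w where w: "w \<noteq> 0" "proj w = x"
      using proj_surj by blast
    have sub: "f -` {x} \<subseteq> proj ` {z. F z = w}"
    proof
      fix y assume "y \<in> f -` {x}"
      then have y: "f y = x"
        by simp
      obtain z where z: "z \<noteq> 0" "proj z = y"
        using proj_surj by blast
      have "F z \<noteq> 0" "proj (F z) = proj w"
        using z nz f y w by auto
      then obtain c where c: "c \<noteq> 0" "w = c *s F z"
        using proj_eq_iff w(1) by blast
      obtain r where r: "r ^ d = c"
        using exists_complex_root[of d c] \<open>d > 0\<close> by auto
      then have "r \<noteq> 0"
        using c(1) \<open>d > 0\<close> by (auto simp: power_0_left)
      have "F (r *s z) = w"
        by (simp add: scale r c(2))
      moreover have "proj (r *s z) = y"
        using z \<open>r \<noteq> 0\<close> by (metis proj_eq_iff vector_mul_eq_0)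
      ultimately show "y \<in> proj ` {z. F z = w}"
        by blast
    qed
    show ?thesis
      using finite_surj[OF M(1) sub] card_image_le[OF M(1)[of w], of proj] M(2)[of w]
        card_mono[OF finite_imageI[OF M(1)] sub] by (meson le_trans)
  qed
  then show ?thesis
    by blast
qed

section \<open>Smooth functions of two complex variables\<close>

lemma C_diff_SucI:
  assumes "\<And>w. (h has_derivative h' w) (at w)" "\<And>v. C_diff k (\<lambda>w. h' w v)"
  shows "C_diff (Suc k) h"
proof -
  have "frechet_derivative h (at w) = h' w" for w
    using assms(1) frechet_derivative_at by metis
  then show ?thesis
    using assms by (auto simp: differentiable_on_def differentiable_def)
qed

lemma C_diff_SucD:
  assumes "C_diff (Suc k) h"
  shows "(h has_derivative frechet_derivative h (at w)) (at w)"
    "C_diff k (\<lambda>w. frechet_derivative h (at w) v)"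
  using assms by (auto simp: differentiable_on_def frechet_derivative_works)

declare C_diff.simps(2) [simp del]

lemma C_diff_decrease: "C_diff (Suc k) h \<Longrightarrow> C_diff k h"
proof (induction k arbitrary: h)
  case 0
  then show ?case
    using C_diff_SucD(1)[OF 0] by (auto intro!: has_derivative_continuous continuous_at_imp_continuous_on)
next
  case (Suc k)
  then show ?case
    using C_diff_SucD[OF Suc.prems] by (intro C_diff_SucI[of h]) auto
qed

lemma C_diff_const: "C_diff k (\<lambda>w. c)"
  by (induction k arbitrary: c) (auto intro: C_diff_SucI[where h' = "\<lambda>_ _. 0"])

lemma C_diff_linear:
  assumes "bounded_linear L"
  shows "C_diff k L"
proof (cases k)
  case 0
  then show ?thesis
    using assms linear_continuous_on by auto
next
  case (Suc n)
  show ?thesis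
    unfolding Suc
    by (intro C_diff_SucI[where h' = "\<lambda>_. L"] bounded_linear_imp_has_derivative assms C_diff_const)
qed

lemma C_diff_add: "C_diff k g \<Longrightarrow> C_diff k h \<Longrightarrow> C_diff k (\<lambda>w. g w + h w)"
proof (induction k arbitrary: g h)
  case (Suc k)
  show ?case
    using C_diff_SucD[OF Suc.prems(1)] C_diff_SucD[OF Suc.prems(2)] Suc.IH
    by (intro C_diff_SucI) (auto intro: has_derivative_add)
qed (auto intro: continuous_intros)

lemma C_diff_mult: "C_diff k g \<Longrightarrow> C_diff k h \<Longrightarrow> C_diff k (\<lambda>w. g w * h w)"
proof (induction k arbitrary: g h)
  case (Suc k)
  show ?case
    using C_diff_SucD[OF Suc.prems(1)] C_diff_SucD[OF Suc.prems(2)]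
      Suc.IH C_diff_decrease[OF Suc.prems(1)] C_diff_decrease[OF Suc.prems(2)]
    by (intro C_diff_SucI[where h' = "\<lambda>w v. g w * frechet_derivative h (at w) v + frechet_derivative g (at w) v * h w"])
      (auto intro: has_derivative_mult C_diff_add)
qed (auto intro: continuous_intros)

lemma C_diff_compose_linear:
  assumes "bounded_linear L"
  shows "C_diff k h \<Longrightarrow> C_diff k (\<lambda>w. L (h w))"
proof (induction k arbitrary: h)
  case 0
  then show ?case
    using linear_continuous_on[OF assms, of UNIV] continuous_on_compose2 by force
next
  case (Suc k)
  show ?case
    using C_diff_SucD[OF Suc.prems] Suc.IH
    by (intro C_diff_SucI) (auto intro: bounded_linear.has_derivative[OF assms])
qed

lemma C_diff_inverse:
  "C_diff k h \<Longrightarrow> (\<And>w. h w \<noteq> 0) \<Longrightarrow> C_diff k (\<lambda>w. inverse (h w))"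
proof (induction k arbitrary: h)
  case (Suc k)
  note IH = Suc.IH[OF C_diff_decrease[OF Suc.prems(1)] Suc.prems(2)]
  show ?case
  proof (rule C_diff_SucI)
    show "((\<lambda>w. inverse (h w)) has_derivative
        (\<lambda>v. - (inverse (h w) * frechet_derivative h (at w) v * inverse (h w)))) (at w)" for w
      by (rule Deriv.has_derivative_inverse[OF Suc.prems(2) C_diff_SucD(1)[OF Suc.prems(1)]])
    show "C_diff k (\<lambda>w. - (inverse (h w) * frechet_derivative h (at w) v * inverse (h w)))" for v
      by (intro C_diff_compose_linear[OF bounded_linear_minus[OF bounded_linear_ident]] C_diff_mult IH
          C_diff_SucD(2)[OF Suc.prems(1)])
  qed
qed (auto intro: continuous_intros)

text \<open>\<open>D\<close> lists the successive derivatives of one function. The induction runs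
  over all the entries \<open>m\<close> at once, because differentiating a composition with
  \<open>D m\<close> produces one with \<open>D (Suc m)\<close>.\<close>

lemma C_diff_compose_real:
  fixes D :: "nat \<Rightarrow> real \<Rightarrow> real"
  assumes D: "\<And>k x. x \<in> X \<Longrightarrow> (D k has_real_derivative D (Suc k) x) (at x)"
    and X: "\<And>w. Re (h w) \<in> X"
  shows "C_diff k h \<Longrightarrow> C_diff k (\<lambda>w. complex_of_real (D m (Re (h w))))"
proof (induction k arbitrary: m)
  case 0
  have "continuous_on UNIV (\<lambda>w. D m (Re (h w)))"
  proof (rule continuous_on_compose2[where g = "D m" and f = "\<lambda>w. Re (h w)" and t = "X"])
    show "continuous_on X (D m)"
      using D by (auto intro!: continuous_at_imp_continuous_on DERIV_isCont)
  qed (use 0 X in \<open>auto intro!: continuous_intros\<close>)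
  then show ?case
    by (auto intro: continuous_intros)
next
  case (Suc k)
  show ?case
  proof (rule C_diff_SucI)
    show "((\<lambda>w. complex_of_real (D m (Re (h w)))) has_derivative
       (\<lambda>v. complex_of_real (D (Suc m) (Re (h w))) * complex_of_real (Re (frechet_derivative h (at w) v)))) (at w)" for w
    proof -
      have "((\<lambda>w. Re (h w)) has_derivative (\<lambda>v. Re (frechet_derivative h (at w) v))) (at w)"
        using C_diff_SucD(1)[OF Suc.prems] by (rule has_derivative_Re)
      then have "((\<lambda>w. D m (Re (h w))) has_derivative
          (\<lambda>v. D (Suc m) (Re (h w)) * Re (frechet_derivative h (at w) v))) (at w)"
        using D[OF X[of w], of m] by (rule has_derivative_compose[of "\<lambda>w. Re (h w)", OF _ has_field_derivative_imp_has_derivative])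
      from has_derivative_of_real[OF this, where ?'a = complex] show ?thesis
        by simp
    qed
    have "bounded_linear (\<lambda>z. complex_of_real (Re z))"
      by (intro bounded_linear_compose[OF bounded_linear_of_real bounded_linear_Re])
    from C_diff_compose_linear[OF this C_diff_SucD(2)[OF Suc.prems]]
    show "C_diff k (\<lambda>w. complex_of_real (D (Suc m) (Re (h w))) * complex_of_real (Re (frechet_derivative h (at w) v)))" for v
      using Suc.IH[OF C_diff_decrease[OF Suc.prems]] by (intro C_diff_mult) auto
  qed
qed

definition smooth :: "(complex ^ 2 \<Rightarrow> complex) \<Rightarrow> bool" where
  "smooth h \<longleftrightarrow> (\<forall>k. C_diff k h)"

named_theorems smooth_intros

lemma smooth_const [smooth_intros]: "smooth (\<lambda>w. c)"
  by (simp add: smooth_def C_diff_const)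

lemma smooth_add [smooth_intros]: "smooth g \<Longrightarrow> smooth h \<Longrightarrow> smooth (\<lambda>w. g w + h w)"
  by (simp add: smooth_def C_diff_add)

lemma smooth_mult [smooth_intros]: "smooth g \<Longrightarrow> smooth h \<Longrightarrow> smooth (\<lambda>w. g w * h w)"
  by (simp add: smooth_def C_diff_mult)

lemma smooth_compose_linear: "bounded_linear L \<Longrightarrow> smooth h \<Longrightarrow> smooth (\<lambda>w. L (h w))"
  by (simp add: smooth_def C_diff_compose_linear)

lemma smooth_minus [smooth_intros]: "smooth h \<Longrightarrow> smooth (\<lambda>w. - h w)"
  by (rule smooth_compose_linear[OF bounded_linear_minus[OF bounded_linear_ident]])

lemma smooth_diff [smooth_intros]: "smooth g \<Longrightarrow> smooth h \<Longrightarrow> smooth (\<lambda>w. g w - h w)"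
  using smooth_add[of g "\<lambda>w. - h w"] smooth_minus by simp

lemma smooth_cnj [smooth_intros]: "smooth h \<Longrightarrow> smooth (\<lambda>w. cnj (h w))"
  by (rule smooth_compose_linear[OF bounded_linear_cnj])

lemma smooth_sum [smooth_intros]: "(\<And>x. x \<in> X \<Longrightarrow> smooth (h x)) \<Longrightarrow> smooth (\<lambda>w. \<Sum>x\<in>X. h x w)"
  by (induction X rule: infinite_finite_induct) (auto intro: smooth_intros)

lemma smooth_inverse: "smooth h \<Longrightarrow> (\<And>w. h w \<noteq> 0) \<Longrightarrow> smooth (\<lambda>w. inverse (h w))"
  by (simp add: smooth_def C_diff_inverse)

lemma smooth_divide: "smooth g \<Longrightarrow> smooth h \<Longrightarrow> (\<And>w. h w \<noteq> 0) \<Longrightarrow> smooth (\<lambda>w. g w / h w)"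
  unfolding divide_inverse by (intro smooth_mult smooth_inverse)

lemma smooth_coord [smooth_intros]: "smooth (\<lambda>w. w $ i)"
  by (simp add: smooth_def C_diff_linear bounded_linear_vec_nth)

lemma smooth_ln:
  assumes "smooth (\<lambda>w. complex_of_real (h w))" "\<And>w. h w > 0"
  shows "smooth (\<lambda>w. complex_of_real (ln (h w)))"
proof -
  define D :: "nat \<Rightarrow> real \<Rightarrow> real" where
    "D k x = (case k of 0 \<Rightarrow> ln x | Suc n \<Rightarrow> (-1) ^ n * fact n * inverse x ^ Suc n)" for k x
  have "(D k has_real_derivative D (Suc k) x) (at x)" if "x \<in> {0<..}" for k x
  proof (cases k)
    case 0
    then show ?thesis
      using that by (auto simp: D_def[abs_def] inverse_eq_divide intro!: derivative_eq_intros)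
  next
    case (Suc n)
    then show ?thesis
      using that
      by (auto simp: D_def[abs_def] power2_eq_square intro!: derivative_eq_intros) (cases n; simp add: field_simps)
  qed
  then have "C_diff k (\<lambda>w. complex_of_real (D 0 (Re (complex_of_real (h w)))))" for k
    using assms by (intro C_diff_compose_real[where X = "{0<..}"]) (auto simp: smooth_def)
  then show ?thesis
    by (simp add: smooth_def D_def)
qed

lemma smooth_imp_differentiable:
  "smooth h \<Longrightarrow> (h has_derivative frechet_derivative h (at w)) (at w)"
  using C_diff_SucD(1) by (auto simp: smooth_def)

lemma smooth_derivative: "smooth h \<Longrightarrow> smooth (\<lambda>w. frechet_derivative h (at w) v)"
  using C_diff_SucD(2) by (auto simp: smooth_def)

lemma smooth_imp_continuous: "smooth h \<Longrightarrow> continuous_on UNIV h"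
  unfolding smooth_def by (metis C_diff.simps(1))

lemma smooth_dz [smooth_intros]: "smooth h \<Longrightarrow> smooth (dz j h)"
  unfolding dz_def[abs_def] divide_inverse by (intro smooth_intros smooth_derivative)

lemma smooth_dzbar [smooth_intros]: "smooth h \<Longrightarrow> smooth (dzbar j h)"
  unfolding dzbar_def[abs_def] divide_inverse by (intro smooth_intros smooth_derivative)

lemma smooth_hessian [smooth_intros]: "smooth h \<Longrightarrow> smooth (\<lambda>w. complex_hessian h w $ j $ k)"
  unfolding complex_hessian_def by (simp add: smooth_intros)

subsection \<open>Wirtinger derivatives\<close>

lemma dz_eq: "(h has_derivative h') (at w) \<Longrightarrow> dz j h w = (h' (axis j 1) - \<i> * h' (axis j \<i>)) / 2"
  unfolding dz_def using frechet_derivative_at by metis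

lemma dzbar_eq: "(h has_derivative h') (at w) \<Longrightarrow> dzbar j h w = (h' (axis j 1) + \<i> * h' (axis j \<i>)) / 2"
  unfolding dzbar_def using frechet_derivative_at by metis

lemma dz_add: "g differentiable (at w) \<Longrightarrow> h differentiable (at w) \<Longrightarrow> dz j (\<lambda>w. g w + h w) w = dz j g w + dz j h w"
  unfolding frechet_derivative_works
  by (subst dz_eq[OF has_derivative_add]) (auto simp: dz_def field_simps)

lemma dzbar_add: "g differentiable (at w) \<Longrightarrow> h differentiable (at w) \<Longrightarrow> dzbar j (\<lambda>w. g w + h w) w = dzbar j g w + dzbar j h w"
  unfolding frechet_derivative_works
  by (subst dzbar_eq[OF has_derivative_add]) (auto simp: dzbar_def field_simps)

lemma dz_mult: "g differentiable (at w) \<Longrightarrow> h differentiable (at w) \<Longrightarrow>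
    dz j (\<lambda>w. g w * h w) w = dz j g w * h w + g w * dz j h w"
  unfolding frechet_derivative_works
  by (subst dz_eq[OF has_derivative_mult]) (auto simp: dz_def field_simps)

lemma dzbar_mult: "g differentiable (at w) \<Longrightarrow> h differentiable (at w) \<Longrightarrow>
    dzbar j (\<lambda>w. g w * h w) w = dzbar j g w * h w + g w * dzbar j h w"
  unfolding frechet_derivative_works
  by (subst dzbar_eq[OF has_derivative_mult]) (auto simp: dzbar_def field_simps)

lemma dz_const [simp]: "dz j (\<lambda>w. c) w = 0"
  by (subst dz_eq[OF has_derivative_const]) auto

lemma dzbar_const [simp]: "dzbar j (\<lambda>w. c) w = 0"
  by (subst dzbar_eq[OF has_derivative_const]) auto

lemma dz_cnj: "h differentiable (at w) \<Longrightarrow> dz j (\<lambda>w. cnj (h w)) w = cnj (dzbar j h w)"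
  unfolding frechet_derivative_works
  by (subst dz_eq[OF bounded_linear.has_derivative[OF bounded_linear_cnj]]) (auto simp: dzbar_def)

lemma dzbar_cnj: "h differentiable (at w) \<Longrightarrow> dzbar j (\<lambda>w. cnj (h w)) w = cnj (dz j h w)"
  unfolding frechet_derivative_works
  by (subst dzbar_eq[OF bounded_linear.has_derivative[OF bounded_linear_cnj]]) (auto simp: dz_def)

lemma dz_sum: "(\<And>x. x \<in> X \<Longrightarrow> h x differentiable (at w)) \<Longrightarrow> dz j (\<lambda>w. \<Sum>x\<in>X. h x w) w = (\<Sum>x\<in>X. dz j (h x) w)"
  by (induction X rule: infinite_finite_induct) (auto simp: dz_add differentiable_sum)

lemma dzbar_sum: "(\<And>x. x \<in> X \<Longrightarrow> h x differentiable (at w)) \<Longrightarrow> dzbar j (\<lambda>w. \<Sum>x\<in>X. h x w) w = (\<Sum>x\<in>X. dzbar j (h x) w)"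
  by (induction X rule: infinite_finite_induct) (auto simp: dzbar_add differentiable_sum)

text \<open>\<open>frechet_derivative\<close> chooses one of the derivatives. Functions that agree
  near \<open>w\<close> have the same derivatives there, so the choices coincide, differentiable or
  not.\<close>

lemma dz_cong:
  assumes "open S" "w \<in> S" "\<And>x. x \<in> S \<Longrightarrow> g x = h x"
  shows "dz j g w = dz j h w" "dzbar j g w = dzbar j h w"
proof -
  have "(g has_derivative D) (at w) \<longleftrightarrow> (h has_derivative D) (at w)" for D
    using assms has_derivative_transform_within_open[of g D w UNIV S h]
      has_derivative_transform_within_open[of h D w UNIV S g] by auto
  then have "frechet_derivative g (at w) = frechet_derivative h (at w)"
    by (simp add: frechet_derivative_def)
  then show "dz j g w = dz j h w" "dzbar j g w = dzbar j h w"
    by (simp_all add: dz_def dzbar_def)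
qed

lemma hessian_cong:
  assumes "open S" "w \<in> S" "\<And>x. x \<in> S \<Longrightarrow> g x = h x"
  shows "complex_hessian g w = complex_hessian h w"
proof -
  have "dzbar k g x = dzbar k h x" if "x \<in> S" for x k
    using dz_cong(2)[OF assms(1) that assms(3)] by simp
  then have "dz j (dzbar k g) w = dz j (dzbar k h) w" for j k
    by (intro dz_cong(1)[OF assms(1,2)]) auto
  then show ?thesis
    by (simp add: complex_hessian_def)
qed

lemma dz_of_real_compose:
  assumes "(\<phi> has_real_derivative \<phi>') (at (h w))" "(\<lambda>w. complex_of_real (h w)) differentiable (at w)"
  shows "dz j (\<lambda>w. complex_of_real (\<phi> (h w))) w = of_real \<phi>' * dz j (\<lambda>w. complex_of_real (h w)) w"
    "dzbar j (\<lambda>w. complex_of_real (\<phi> (h w))) w = of_real \<phi>' * dzbar j (\<lambda>w. complex_of_real (h w)) w"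
    "(\<lambda>w. complex_of_real (\<phi> (h w))) differentiable (at w)"
proof -
  obtain D where D: "((\<lambda>w. complex_of_real (h w)) has_derivative D) (at w)"
    using assms(2) by (auto simp: differentiable_def)
  from has_derivative_Re[OF this] have h: "(h has_derivative (\<lambda>v. Re (D v))) (at w)"
    by simp
  from has_derivative_of_real[OF this, where ?'a = complex]
  have D': "((\<lambda>w. complex_of_real (h w)) has_derivative (\<lambda>v. complex_of_real (Re (D v)))) (at w)" .
  have "((\<lambda>w. \<phi> (h w)) has_derivative (\<lambda>v. \<phi>' * Re (D v))) (at w)"
    using has_derivative_compose[OF h has_field_derivative_imp_has_derivative[OF assms(1)]] .
  from has_derivative_of_real[OF this, where ?'a = complex]
  have C: "((\<lambda>w. complex_of_real (\<phi> (h w))) has_derivative (\<lambda>v. of_real \<phi>' * of_real (Re (D v)))) (at w)"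
    by simp
  show "dz j (\<lambda>w. complex_of_real (\<phi> (h w))) w = of_real \<phi>' * dz j (\<lambda>w. complex_of_real (h w)) w"
    unfolding dz_eq[OF C] dz_eq[OF D'] by (simp add: algebra_simps)
  show "dzbar j (\<lambda>w. complex_of_real (\<phi> (h w))) w = of_real \<phi>' * dzbar j (\<lambda>w. complex_of_real (h w)) w"
    unfolding dzbar_eq[OF C] dzbar_eq[OF D'] by (simp add: algebra_simps)
  show "(\<lambda>w. complex_of_real (\<phi> (h w))) differentiable (at w)"
    using C by (auto simp: differentiable_def)
qed

lemma smooth_differentiable: "smooth h \<Longrightarrow> h differentiable (at w)"
  using smooth_imp_differentiable by (auto simp: differentiable_def)

subsection \<open>Symmetry of second derivatives\<close>

text \<open>The mean value theorem twice: in direction \<open>u\<close> for the difference in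
  direction \<open>v\<close>, and then in direction \<open>v\<close> for the derivative along
  \<open>u\<close>.\<close>

lemma mixed_difference_quotient:
  fixes f :: "'a :: real_normed_vector \<Rightarrow> real"
  assumes f: "\<And>x. (f has_derivative f' x) (at x)"
    and fu: "\<And>x. ((\<lambda>x. f' x u) has_derivative A x) (at x)"
    and "t > 0"
  shows "\<exists>a b. 0 < a \<and> a < t \<and> 0 < b \<and> b < t \<and>
    f (x + t *\<^sub>R u + t *\<^sub>R v) - f (x + t *\<^sub>R u) - f (x + t *\<^sub>R v) + f x = t * t * A (x + a *\<^sub>R u + b *\<^sub>R v) v"
proof -
  have line: "((\<lambda>s. g (y + s *\<^sub>R e)) has_real_derivative g' (y + s *\<^sub>R e) e) (at s)"
    if "\<And>x. (g has_derivative g' x) (at x)" for g :: "'a \<Rightarrow> real" and g' y e s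
  proof -
    have "((\<lambda>s. g (y + s *\<^sub>R e)) has_derivative (\<lambda>r. g' (y + s *\<^sub>R e) (r *\<^sub>R e))) (at s)"
      by (rule has_derivative_compose[OF _ that]) (auto intro!: derivative_eq_intros)
    moreover have "g' (y + s *\<^sub>R e) (r *\<^sub>R e) = g' (y + s *\<^sub>R e) e * r" for r
      using linear_scale[OF has_derivative_linear[OF that]] by simp
    ultimately show ?thesis
      by (simp add: has_field_derivative_def)
  qed
  have "\<exists>a>0. a < t \<and> (f (x + t *\<^sub>R v + t *\<^sub>R u) - f (x + t *\<^sub>R u)) - (f (x + t *\<^sub>R v + 0 *\<^sub>R u) - f (x + 0 *\<^sub>R u))
      = (t - 0) * (f' (x + t *\<^sub>R v + a *\<^sub>R u) u - f' (x + a *\<^sub>R u) u)"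
    by (rule MVT2[OF \<open>t > 0\<close>, where f = "\<lambda>s. f (x + t *\<^sub>R v + s *\<^sub>R u) - f (x + s *\<^sub>R u)",
          simplified conj_assoc]) (intro DERIV_diff line f)
  then obtain a where a: "0 < a" "a < t"
    "f (x + t *\<^sub>R v + t *\<^sub>R u) - f (x + t *\<^sub>R u) - (f (x + t *\<^sub>R v) - f x) = t * (f' (x + t *\<^sub>R v + a *\<^sub>R u) u - f' (x + a *\<^sub>R u) u)"
    by auto
  have "\<exists>b>0. b < t \<and> f' (x + a *\<^sub>R u + t *\<^sub>R v) u - f' (x + a *\<^sub>R u + 0 *\<^sub>R v) u = (t - 0) * A (x + a *\<^sub>R u + b *\<^sub>R v) v"
    by (rule MVT2[OF \<open>t > 0\<close>, where f = "\<lambda>s. f' (x + a *\<^sub>R u + s *\<^sub>R v) u", simplified conj_assoc])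
      (intro line[where g = "\<lambda>x. f' x u"] fu)
  then obtain b where b: "0 < b" "b < t"
    "f' (x + a *\<^sub>R u + t *\<^sub>R v) u - f' (x + a *\<^sub>R u) u = t * A (x + a *\<^sub>R u + b *\<^sub>R v) v"
    by auto
  show ?thesis
    using a b by (intro exI[of _ a] exI[of _ b]) (simp add: add_ac)
qed

text \<open>The second difference is symmetric in \<open>u\<close> and \<open>v\<close>. Evaluated
  in either order it is \<open>t * t\<close> times a second derivative at a nearby point, and
  continuity compares these values with those at \<open>x\<close>.\<close>

lemma symmetric_second_derivative_real:
  fixes f :: "'a :: real_normed_vector \<Rightarrow> real"
  assumes f: "\<And>x. (f has_derivative f' x) (at x)"
    and fu: "\<And>x. ((\<lambda>x. f' x u) has_derivative A x) (at x)"
    and fv: "\<And>x. ((\<lambda>x. f' x v) has_derivative B x) (at x)"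
    and cont: "isCont (\<lambda>x. A x v) x" "isCont (\<lambda>x. B x u) x"
  shows "A x v = B x u"
proof (rule ccontr)
  assume ne: "A x v \<noteq> B x u"
  define e where "e = \<bar>A x v - B x u\<bar> / 2"
  have "e > 0"
    using ne by (simp add: e_def)
  then obtain r1 r2 where r: "r1 > 0" "r2 > 0"
    "\<And>y. dist y x < r1 \<Longrightarrow> dist (A y v) (A x v) < e" "\<And>y. dist y x < r2 \<Longrightarrow> dist (B y u) (B x u) < e"
    using cont unfolding continuous_at_eps_delta by metis
  define t where "t = min r1 r2 / (2 * (norm u + norm v + 1))"
  have "norm u + norm v + 1 > 0"
    by (simp add: add_nonneg_pos)
  then have "t > 0"
    using r by (simp add: t_def)
  have close: "dist (x + a *\<^sub>R u + b *\<^sub>R v) x < min r1 r2" if "0 < a" "a < t" "0 < b" "b < t" for a b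
  proof -
    have "norm (a *\<^sub>R u + b *\<^sub>R v) \<le> a * norm u + b * norm v"
      using norm_triangle_ineq[of "a *\<^sub>R u" "b *\<^sub>R v"] that by simp
    also have "\<dots> \<le> t * norm u + t * norm v"
      using that by (intro add_mono mult_right_mono) auto
    also have "\<dots> < t * (2 * (norm u + norm v + 1))"
      using \<open>t > 0\<close> by (simp add: algebra_simps add_nonneg_pos add_pos_nonneg)
    also have "\<dots> = min r1 r2"
      using \<open>norm u + norm v + 1 > 0\<close> by (simp add: t_def)
    finally show ?thesis
      by (simp add: dist_norm add.assoc)
  qed
  obtain a b where ab: "0 < a" "a < t" "0 < b" "b < t"
    "f (x + t *\<^sub>R u + t *\<^sub>R v) - f (x + t *\<^sub>R u) - f (x + t *\<^sub>R v) + f x = t * t * A (x + a *\<^sub>R u + b *\<^sub>R v) v"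
    using mixed_difference_quotient[OF f fu \<open>t > 0\<close>] by blast
  obtain a' b' where ab': "0 < a'" "a' < t" "0 < b'" "b' < t"
    "f (x + t *\<^sub>R v + t *\<^sub>R u) - f (x + t *\<^sub>R v) - f (x + t *\<^sub>R u) + f x = t * t * B (x + a' *\<^sub>R v + b' *\<^sub>R u) u"
    using mixed_difference_quotient[OF f fv \<open>t > 0\<close>] by blast
  have "t * t * A (x + a *\<^sub>R u + b *\<^sub>R v) v = t * t * B (x + a' *\<^sub>R v + b' *\<^sub>R u) u"
    using ab(5) ab'(5) unfolding add.assoc add.commute[of "t *\<^sub>R v" "t *\<^sub>R u"] by linarith
  then have "A (x + a *\<^sub>R u + b *\<^sub>R v) v = B (x + b' *\<^sub>R u + a' *\<^sub>R v) u"
    using \<open>t > 0\<close> unfolding add.assoc add.commute[of "b' *\<^sub>R u"] by simp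
  then show False
    using r(3)[of "x + a *\<^sub>R u + b *\<^sub>R v"] r(4)[of "x + b' *\<^sub>R u + a' *\<^sub>R v"]
      close[OF ab(1-4)] close[OF ab'(3,4) ab'(1,2)]
    unfolding dist_real_def e_def by argo
qed

lemma symmetric_second_derivative:
  assumes "smooth h"
  shows "frechet_derivative (\<lambda>w. frechet_derivative h (at w) u) (at w) v =
    frechet_derivative (\<lambda>w. frechet_derivative h (at w) v) (at w) u"
proof -
  let ?D = "\<lambda>u w. frechet_derivative h (at w) u"
  have d: "(h has_derivative frechet_derivative h (at w)) (at w)" for w
    by (rule smooth_imp_differentiable[OF assms])
  have dd: "(?D u has_derivative frechet_derivative (?D u) (at w)) (at w)" for u w
    by (rule smooth_imp_differentiable[OF smooth_derivative[OF assms]])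
  have cont: "isCont (\<lambda>w. frechet_derivative (?D u) (at w) v) w" for u v w
    using smooth_imp_continuous[OF smooth_derivative[OF smooth_derivative[OF assms]], of u v]
    by (simp add: continuous_on_eq_continuous_at)
  have 1: "Re (frechet_derivative (?D u) (at w) v) = Re (frechet_derivative (?D v) (at w) u)"
    by (rule symmetric_second_derivative_real[where f = "\<lambda>w. Re (h w)" and f' = "\<lambda>w v. Re (?D v w)"
          and A = "\<lambda>w v. Re (frechet_derivative (?D u) (at w) v)" and B = "\<lambda>w u. Re (frechet_derivative (?D v) (at w) u)"])
      (intro has_derivative_Re d dd continuous_Re cont)+
  have 2: "Im (frechet_derivative (?D u) (at w) v) = Im (frechet_derivative (?D v) (at w) u)"
    by (rule symmetric_second_derivative_real[where f = "\<lambda>w. Im (h w)" and f' = "\<lambda>w v. Im (?D v w)"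
          and A = "\<lambda>w v. Im (frechet_derivative (?D u) (at w) v)" and B = "\<lambda>w u. Im (frechet_derivative (?D v) (at w) u)"])
      (intro has_derivative_Im d dd continuous_Im cont)+
  show ?thesis
    using 1 2 by (simp add: complex_eq_iff)
qed

lemma
  assumes "smooth h"
  shows frechet_derivative_dz: "frechet_derivative (dz j h) (at w) v =
      dz j (\<lambda>w. frechet_derivative h (at w) v) w"
    and frechet_derivative_dzbar: "frechet_derivative (dzbar j h) (at w) v =
      dzbar j (\<lambda>w. frechet_derivative h (at w) v) w"
proof -
  let ?D = "\<lambda>u w. frechet_derivative h (at w) u"
  have dd: "(?D u has_derivative frechet_derivative (?D u) (at w)) (at w)" for u
    by (rule smooth_imp_differentiable[OF smooth_derivative[OF assms]])
  have "(dz j h has_derivative (\<lambda>v. (frechet_derivative (?D (axis j 1)) (at w) v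
      - \<i> * frechet_derivative (?D (axis j \<i>)) (at w) v) / 2)) (at w)"
    unfolding dz_def[abs_def]
    by (intro bounded_linear.has_derivative[OF bounded_linear_divide] has_derivative_diff has_derivative_mult_right dd)
  from frechet_derivative_at[OF this, symmetric]
  show "frechet_derivative (dz j h) (at w) v = dz j (\<lambda>w. frechet_derivative h (at w) v) w"
    by (simp add: dz_def symmetric_second_derivative[OF assms, of v])
  have "(dzbar j h has_derivative (\<lambda>v. (frechet_derivative (?D (axis j 1)) (at w) v
      + \<i> * frechet_derivative (?D (axis j \<i>)) (at w) v) / 2)) (at w)"
    unfolding dzbar_def[abs_def]
    by (intro bounded_linear.has_derivative[OF bounded_linear_divide] has_derivative_add has_derivative_mult_right dd)
  from frechet_derivative_at[OF this, symmetric]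
  show "frechet_derivative (dzbar j h) (at w) v = dzbar j (\<lambda>w. frechet_derivative h (at w) v) w"
    by (simp add: dzbar_def symmetric_second_derivative[OF assms, of v])
qed

lemma dzbar_divide_const: "h differentiable (at w) \<Longrightarrow> dzbar j (\<lambda>w. h w / c) w = dzbar j h w / c"
  using dzbar_mult[of h w "\<lambda>_. inverse c" j] by (simp add: divide_inverse)

lemma dz_commute: "smooth h \<Longrightarrow> dz j (dz k h) w = dz k (dz j h) w"
  and dz_dzbar_commute: "smooth h \<Longrightarrow> dz j (dzbar k h) w = dzbar k (dz j h) w"
  and dzbar_commute: "smooth h \<Longrightarrow> dzbar j (dzbar k h) w = dzbar k (dzbar j h) w"
proof -
  assume h: "smooth h"
  let ?D = "\<lambda>u w. frechet_derivative h (at w) u"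
  have 1: "dz j (dz k h) w = (dz k (?D (axis j 1)) w - \<i> * dz k (?D (axis j \<i>)) w) / 2" for j k
    by (subst dz_def) (simp add: frechet_derivative_dz[OF h])
  have 2: "dz j (dzbar k h) w = (dzbar k (?D (axis j 1)) w - \<i> * dzbar k (?D (axis j \<i>)) w) / 2" for j k
    by (subst dz_def) (simp add: frechet_derivative_dzbar[OF h])
  have 3: "dzbar j (dzbar k h) w = (dzbar k (?D (axis j 1)) w + \<i> * dzbar k (?D (axis j \<i>)) w) / 2" for j k
    by (subst dzbar_def) (simp add: frechet_derivative_dzbar[OF h])
  have 4: "dzbar j (dz k h) w = (dz k (?D (axis j 1)) w + \<i> * dz k (?D (axis j \<i>)) w) / 2" for j k
    by (subst dzbar_def) (simp add: frechet_derivative_dz[OF h])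
  note ss = symmetric_second_derivative[OF h, of "axis j _" w "axis k _"]
  show "dz j (dz k h) w = dz k (dz j h) w"
    unfolding 1 by (simp add: dz_def ss field_simps)
  show "dz j (dzbar k h) w = dzbar k (dz j h) w"
    unfolding 2 4 by (simp add: dz_def dzbar_def ss field_simps)
  show "dzbar j (dzbar k h) w = dzbar k (dzbar j h) w"
    unfolding 3 by (simp add: dzbar_def ss field_simps)
qed

section \<open>Integration by parts\<close>

lemma integrable_compact_support:
  fixes h :: "complex ^ 2 \<Rightarrow> 'b :: {banach, second_countable_topology}"
  assumes "continuous_on UNIV h" "compact K" "\<And>w. w \<notin> K \<Longrightarrow> h w = 0"
  shows "integrable lborel h"
proof -
  have "integrable lborel (\<lambda>w. indicator K w *\<^sub>R h w)"
    using assms by (intro borel_integrable_compact) (auto intro: continuous_on_subset)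
  also have "(\<lambda>w. indicator K w *\<^sub>R h w) = h"
    using assms(3) by (auto simp: indicator_def)
  finally show ?thesis .
qed

lemma integral_translation:
  fixes h :: "complex ^ 2 \<Rightarrow> complex"
  assumes "h \<in> borel_measurable borel"
  shows "(\<integral>w. h (w + v) \<partial>lborel) = (\<integral>w. h w \<partial>lborel)"
proof -
  have "(\<integral>w. h w \<partial>lborel) = (\<integral>w. h w \<partial>(distr lborel borel ((+) v)))"
    by (simp add: lborel_distr_plus)
  also have "\<dots> = (\<integral>w. h (v + w) \<partial>lborel)"
    using assms by (intro integral_distr) auto
  finally show ?thesis
    by (simp add: add.commute)
qed

text \<open>Translation invariance of Lebesgue measure annihilates the integrals of the difference
  quotients. These are bounded by the mean value inequality and vanish outside the compact set
  \<open>K'\<close> swept out by \<open>K\<close> along the segment, so dominated convergence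
  applies.\<close>

lemma integral_directional_derivative_zero:
  fixes h :: "complex ^ 2 \<Rightarrow> complex"
  assumes h: "\<And>w. (h has_derivative h' w) (at w)"
    and cont: "continuous_on UNIV (\<lambda>w. h' w v)"
    and K: "compact K" "\<And>w. w \<notin> K \<Longrightarrow> h w = 0"
  shows "(\<integral>w. h' w v \<partial>lborel) = 0"
proof -
  define s :: "nat \<Rightarrow> real" where "s n = inverse (real (Suc n))" for n
  have s: "0 < s n" "s n \<le> 1" for n
    by (auto simp: s_def field_simps)
  have "s \<longlonglongrightarrow> 0"
    unfolding s_def by (rule LIMSEQ_inverse_real_of_nat)
  define q where "q n w = (h (w + s n *\<^sub>R v) - h w) / of_real (s n)" for n w
  have conth: "continuous_on UNIV h"
    using h by (auto intro!: continuous_at_imp_continuous_on has_derivative_continuous)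
  have line: "((\<lambda>t. h (w + t *\<^sub>R v)) has_derivative (\<lambda>r. r *\<^sub>R h' (w + t *\<^sub>R v) v)) (at t)" for w t
  proof -
    have "((\<lambda>t. h (w + t *\<^sub>R v)) has_derivative (\<lambda>r. h' (w + t *\<^sub>R v) (r *\<^sub>R v))) (at t)"
      by (rule has_derivative_compose[OF _ h]) (auto intro!: derivative_eq_intros)
    then show ?thesis
      using linear_scale[OF has_derivative_linear[OF h]] by simp
  qed
  have zero': "h' w v = 0" if "w \<notin> K" for w
  proof -
    have "open (- K)" "w \<in> - K"
      using K that compact_imp_closed by auto
    then have "(h has_derivative (\<lambda>_. 0)) (at w)"
      using K(2) by (intro has_derivative_transform_within_open[OF has_derivative_const[of 0]]) auto
    then show ?thesis
      using has_derivative_unique[OF h] by metis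
  qed
  have "compact ((\<lambda>w. h' w v) ` K)"
    using K(1) cont by (intro compact_continuous_image) (auto intro: continuous_on_subset)
  then obtain M where M: "\<And>w. w \<in> K \<Longrightarrow> norm (h' w v) \<le> M" "M > 0"
    using compact_imp_bounded bounded_pos by (metis (mono_tags, lifting) imageI)
  then have bound: "norm (h' w v) \<le> M" for w
    using zero'[of w] by (cases "w \<in> K") auto
  have q_bound: "norm (q n w) \<le> M" for n w
  proof -
    have "norm (h (w + s n *\<^sub>R v) - h (w + 0 *\<^sub>R v)) \<le> M * norm (s n - 0)"
    proof (rule differentiable_bound[where S = UNIV and f = "\<lambda>t. h (w + t *\<^sub>R v)"])
      fix t
      show "((\<lambda>t. h (w + t *\<^sub>R v)) has_derivative (\<lambda>r. r *\<^sub>R h' (w + t *\<^sub>R v) v)) (at t within UNIV)"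
        using line by simp
      show "onorm (\<lambda>r. r *\<^sub>R h' (w + t *\<^sub>R v) v) \<le> M"
        using mult_left_mono[OF bound abs_ge_zero] by (intro onorm_le) (simp add: mult.commute)
    qed auto
    then show ?thesis
      using s[of n] by (simp add: q_def norm_divide field_simps)
  qed
  define K' where "K' = (\<lambda>(w, t). w - t *\<^sub>R v) ` (K \<times> {0..1})"
  have "compact K'"
    unfolding K'_def using K(1)
    by (intro compact_continuous_image compact_Times) (auto simp: case_prod_unfold intro!: continuous_intros)
  have q_zero: "q n w = 0" if "w \<notin> K'" for n w
  proof -
    have "w \<notin> K"
    proof
      assume "w \<in> K"
      then have "w \<in> K'"
        unfolding K'_def by (intro image_eqI[of _ _ "(w, 0)"]) auto
      then show False
        using that by simp
    qed
    moreover have "w + s n *\<^sub>R v \<notin> K"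
    proof
      assume "w + s n *\<^sub>R v \<in> K"
      then have "w \<in> K'"
        unfolding K'_def using s[of n] by (intro image_eqI[of _ _ "(w + s n *\<^sub>R v, s n)"]) auto
      then show False
        using that by simp
    qed
    ultimately show ?thesis
      using K(2) by (simp add: q_def)
  qed
  have int_h: "integrable lborel h"
    by (rule integrable_compact_support[OF conth K])
  have meas: "h \<in> borel_measurable borel"
    using conth by (rule borel_measurable_continuous_onI)
  have int_h': "integrable lborel (\<lambda>w. h (w + c))" for c
    using conth K
    by (intro integrable_compact_support[where K = "(\<lambda>w. w - c) ` K"])
      (force intro!: compact_continuous_image continuous_intros continuous_on_compose2[OF conth])+
  have int_q: "(\<integral>w. q n w \<partial>lborel) = 0" for n
    unfolding q_def using int_h int_h' integral_translation[OF meas] by simp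
  have lim: "(\<lambda>n. q n w) \<longlonglongrightarrow> h' w v" for w
  proof -
    have "(\<lambda>k. norm (h (w + (0 + k) *\<^sub>R v) - h (w + 0 *\<^sub>R v) - k *\<^sub>R h' (w + 0 *\<^sub>R v) v) / norm k) \<midarrow>0\<rightarrow> 0"
      using line[of w 0] unfolding has_derivative_at by blast
    moreover have "filterlim s (at 0) sequentially"
      using \<open>s \<longlonglongrightarrow> 0\<close> s(1) by (auto simp: filterlim_at less_imp_neq[symmetric])
    ultimately have "(\<lambda>n. norm (h (w + (0 + s n) *\<^sub>R v) - h (w + 0 *\<^sub>R v) - s n *\<^sub>R h' (w + 0 *\<^sub>R v) v) / norm (s n)) \<longlonglongrightarrow> 0"
      by (rule filterlim_compose)
    moreover have "norm (h (w + (0 + s n) *\<^sub>R v) - h (w + 0 *\<^sub>R v) - s n *\<^sub>R h' (w + 0 *\<^sub>R v) v) / norm (s n) = norm (q n w - h' w v)" for n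
    proof -
      have "q n w - h' w v = (h (w + s n *\<^sub>R v) - h w - s n *\<^sub>R h' w v) / of_real (s n)"
        using s(1)[of n] by (simp add: q_def field_simps scaleR_conv_of_real)
      then show ?thesis
        using s(1)[of n] by (simp add: norm_divide)
    qed
    ultimately have "(\<lambda>n. norm (q n w - h' w v)) \<longlonglongrightarrow> 0"
      by simp
    then show ?thesis
      by (rule LIM_zero_cancel[OF tendsto_norm_zero_cancel])
  qed
  have "(\<lambda>n. \<integral>w. q n w \<partial>lborel) \<longlonglongrightarrow> (\<integral>w. h' w v \<partial>lborel)"
  proof (rule integral_dominated_convergence[where w = "\<lambda>w. indicator K' w *\<^sub>R M"])
    show "(\<lambda>w. h' w v) \<in> borel_measurable lborel"
      using borel_measurable_continuous_onI[OF cont] by simp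
    show "q n \<in> borel_measurable lborel" for n
      using int_h int_h' unfolding q_def by (intro borel_measurable_integrable) auto
    show "integrable lborel (\<lambda>w. indicator K' w *\<^sub>R M)"
      using \<open>compact K'\<close> by (intro borel_integrable_compact) auto
    show "AE w in lborel. (\<lambda>n. q n w) \<longlonglongrightarrow> h' w v"
      using lim by simp
    show "AE w in lborel. norm (q n w) \<le> indicator K' w *\<^sub>R M" for n
      using q_bound q_zero by (auto simp: indicator_def)
  qed
  then show ?thesis
    unfolding int_q by (simp add: LIMSEQ_const_iff)
qed

lemma
  assumes h: "C_diff (Suc 0) h" and K: "compact K" "\<And>w. w \<notin> K \<Longrightarrow> h w = 0"
  shows integral_dz_zero: "(\<integral>w. dz j h w \<partial>lborel) = 0"
    and integral_dzbar_zero: "(\<integral>w. dzbar j h w \<partial>lborel) = 0"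
proof -
  have cont: "continuous_on UNIV (\<lambda>w. frechet_derivative h (at w) v)" for v
    using C_diff_SucD(2)[OF h] by simp
  have 0: "(\<integral>w. frechet_derivative h (at w) v \<partial>lborel) = 0" for v
    by (rule integral_directional_derivative_zero[OF C_diff_SucD(1)[OF h] cont K])
  have "frechet_derivative h (at w) v = 0" if "w \<notin> K" for w v
  proof -
    have "open (- K)" "w \<in> - K"
      using K that compact_imp_closed by auto
    then have "(h has_derivative (\<lambda>_. 0)) (at w)"
      using K(2) by (intro has_derivative_transform_within_open[OF has_derivative_const[of 0]]) auto
    then show ?thesis
      using frechet_derivative_at by metis
  qed
  then have int: "integrable lborel (\<lambda>w. frechet_derivative h (at w) v)" for v
    using cont K(1) by (intro integrable_compact_support)
  show "(\<integral>w. dz j h w \<partial>lborel) = 0" "(\<integral>w. dzbar j h w \<partial>lborel) = 0"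
    unfolding dz_def dzbar_def using int 0 by simp_all
qed

lemma test_function_iff:
  "test_function \<phi> \<longleftrightarrow> smooth \<phi> \<and> (\<exists>K. compact K \<and> (\<forall>w. w \<notin> K \<longrightarrow> \<phi> w = 0))"
proof
  assume "test_function \<phi>"
  then have "smooth \<phi>" "compact (closure {w. \<phi> w \<noteq> 0})"
    by (auto simp only: test_function_def smooth_def)
  moreover have "\<forall>w. w \<notin> closure {w. \<phi> w \<noteq> 0} \<longrightarrow> \<phi> w = 0"
    using closure_subset[of "{w. \<phi> w \<noteq> 0}"] by auto
  ultimately show "smooth \<phi> \<and> (\<exists>K. compact K \<and> (\<forall>w. w \<notin> K \<longrightarrow> \<phi> w = 0))"
    by blast
next
  assume "smooth \<phi> \<and> (\<exists>K. compact K \<and> (\<forall>w. w \<notin> K \<longrightarrow> \<phi> w = 0))"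
  then obtain K where K: "smooth \<phi>" "compact K" "\<And>w. w \<notin> K \<Longrightarrow> \<phi> w = 0"
    by blast
  then have "bounded {w. \<phi> w \<noteq> 0}"
    by (intro bounded_subset[OF compact_imp_bounded[OF K(2)]]) auto
  then show "test_function \<phi>"
    using K by (auto simp: test_function_def smooth_def compact_closure)
qed

lemma test_function_mult: "test_function \<phi> \<Longrightarrow> smooth h \<Longrightarrow> test_function (\<lambda>w. h w * \<phi> w)"
  unfolding test_function_iff by (auto intro: smooth_mult)

lemma frechet_derivative_outside:
  assumes "compact K" "\<And>w. w \<notin> K \<Longrightarrow> h w = 0" "w \<notin> K"
  shows "dz j h w = 0" "dzbar j h w = 0" "complex_hessian h w $ j $ k = 0"
proof -
  have S: "open (- K)" "w \<in> - K" "\<And>x. x \<in> - K \<Longrightarrow> h x = 0"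
    using assms compact_imp_closed by auto
  show "dz j h w = 0" "dzbar j h w = 0"
    using dz_cong[OF S] by simp_all
  show "complex_hessian h w $ j $ k = 0"
  proof -
    have "dzbar k (\<lambda>_. 0) = (\<lambda>_. 0)"
      by (rule ext) simp
    moreover have "complex_hessian h w = complex_hessian (\<lambda>_. 0) w"
      by (rule hessian_cong[OF S])
    ultimately show ?thesis
      by (simp add: complex_hessian_def)
  qed
qed

lemma
  assumes "test_function \<phi>"
  shows test_function_dz: "test_function (dz j \<phi>)"
    and test_function_dzbar: "test_function (dzbar j \<phi>)"
    and test_function_hessian: "test_function (\<lambda>w. complex_hessian \<phi> w $ j $ k)"
proof -
  obtain K where K: "compact K" "\<And>w. w \<notin> K \<Longrightarrow> \<phi> w = 0" "smooth \<phi>"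
    using assms by (auto simp: test_function_iff)
  note out = frechet_derivative_outside[OF K(1,2)]
  show "test_function (dz j \<phi>)"
    unfolding test_function_iff by (intro conjI exI[of _ K] allI impI smooth_dz K(1,3) out(1))
  show "test_function (dzbar j \<phi>)"
    unfolding test_function_iff by (intro conjI exI[of _ K] allI impI smooth_dzbar K(1,3) out(2))
  show "test_function (\<lambda>w. complex_hessian \<phi> w $ j $ k)"
    unfolding test_function_iff by (intro conjI exI[of _ K] allI impI smooth_hessian K(1,3) out(3))
qed

lemma integrable_continuous_test:
  assumes "continuous_on UNIV u" "test_function \<phi>"
  shows "integrable lborel (\<lambda>w. u w * \<phi> w)" "integrable lborel (\<lambda>w. \<phi> w * u w)"
proof -
  obtain K where K: "compact K" "\<And>w. w \<notin> K \<Longrightarrow> \<phi> w = 0" "smooth \<phi>"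
    using assms(2) by (auto simp: test_function_iff)
  show "integrable lborel (\<lambda>w. u w * \<phi> w)" "integrable lborel (\<lambda>w. \<phi> w * u w)"
    using assms(1) K
      smooth_imp_continuous[OF K(3)]
    by (auto intro!: integrable_compact_support[where K = K] continuous_on_mult)
qed

lemma
  assumes "smooth g" "test_function \<phi>"
  shows integral_by_parts_dz: "(\<integral>w. dz j g w * \<phi> w \<partial>lborel) = - (\<integral>w. g w * dz j \<phi> w \<partial>lborel)"
    and integral_by_parts_dzbar: "(\<integral>w. dzbar j g w * \<phi> w \<partial>lborel) = - (\<integral>w. g w * dzbar j \<phi> w \<partial>lborel)"
proof -
  obtain K where K: "compact K" "\<And>w. w \<notin> K \<Longrightarrow> \<phi> w = 0" "smooth \<phi>"
    using assms(2) by (auto simp: test_function_iff)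
  have C: "C_diff (Suc 0) (\<lambda>w. g w * \<phi> w)"
    using smooth_mult[OF assms(1) K(3)] by (simp add: smooth_def)
  have 0: "g w * \<phi> w = 0" if "w \<notin> K" for w
    using K that by simp
  have 1: "(\<integral>w. dz j g w * \<phi> w + g w * dz j \<phi> w \<partial>lborel) = 0"
    using integral_dz_zero[OF C K(1) 0, of j] assms(1) K(3) by (simp add: dz_mult smooth_differentiable)
  have 2: "(\<integral>w. dzbar j g w * \<phi> w + g w * dzbar j \<phi> w \<partial>lborel) = 0"
    using integral_dzbar_zero[OF C K(1) 0, of j] assms(1) K(3) by (simp add: dzbar_mult smooth_differentiable)
  have int: "integrable lborel (\<lambda>w. dz j g w * \<phi> w)" "integrable lborel (\<lambda>w. g w * dz j \<phi> w)"
    "integrable lborel (\<lambda>w. dzbar j g w * \<phi> w)" "integrable lborel (\<lambda>w. g w * dzbar j \<phi> w)"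
    using integrable_continuous_test(1)[OF smooth_imp_continuous[OF smooth_dz[OF assms(1)]] assms(2)]
      integrable_continuous_test(1)[OF smooth_imp_continuous[OF smooth_dzbar[OF assms(1)]] assms(2)]
      integrable_continuous_test(1)[OF smooth_imp_continuous[OF assms(1)] test_function_dz[OF assms(2)]]
      integrable_continuous_test(1)[OF smooth_imp_continuous[OF assms(1)] test_function_dzbar[OF assms(2)]]
    by blast+
  show "(\<integral>w. dz j g w * \<phi> w \<partial>lborel) = - (\<integral>w. g w * dz j \<phi> w \<partial>lborel)"
    using 1 int by (simp add: add_eq_0_iff2)
  show "(\<integral>w. dzbar j g w * \<phi> w \<partial>lborel) = - (\<integral>w. g w * dzbar j \<phi> w \<partial>lborel)"
    using 2 int by (simp add: add_eq_0_iff2)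
qed

lemma hessian_nth: "complex_hessian u w $ j $ k = dz j (dzbar k u) w"
  by (simp add: complex_hessian_def)

lemma integral_by_parts_hessian:
  assumes "smooth u" "test_function \<phi>"
  shows "(\<integral>w. complex_hessian u w $ j $ k * \<phi> w \<partial>lborel) = (\<integral>w. u w * complex_hessian \<phi> w $ j $ k \<partial>lborel)"
proof -
  have \<phi>: "smooth \<phi>"
    using assms(2) by (simp add: test_function_iff)
  show ?thesis
    unfolding hessian_nth dz_dzbar_commute[OF \<phi>]
    using integral_by_parts_dz[OF smooth_dzbar[OF assms(1)] assms(2)]
      integral_by_parts_dzbar[OF assms(1) test_function_dz[OF assms(2)]] by simp
qed

text \<open>The polarization of twice the determinant. Up to a constant it is the density of the
  wedge product of the two (1,1)-forms.\<close>

definition mixed_disc :: "complex ^ 2 ^ 2 \<Rightarrow> complex ^ 2 ^ 2 \<Rightarrow> complex" where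
  "mixed_disc a b = a $ 1 $ 1 * b $ 2 $ 2 + a $ 2 $ 2 * b $ 1 $ 1 - a $ 1 $ 2 * b $ 2 $ 1 - a $ 2 $ 1 * b $ 1 $ 2"

lemma mixed_disc_commute: "mixed_disc a b = mixed_disc b a"
  by (simp add: mixed_disc_def algebra_simps)

lemma hessian_mult:
  assumes "smooth a" "smooth b"
  shows "complex_hessian (\<lambda>w. a w * b w) w $ j $ k =
    complex_hessian a w $ j $ k * b w + dzbar k a w * dz j b w + dz j a w * dzbar k b w
      + a w * complex_hessian b w $ j $ k"
proof -
  have "dzbar k (\<lambda>w. a w * b w) = (\<lambda>w. dzbar k a w * b w + a w * dzbar k b w)"
    using assms by (auto simp: dzbar_mult smooth_differentiable)
  then show ?thesis
    using assms by (simp add: hessian_nth dz_add dz_mult smooth_differentiable smooth_intros)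
qed

text \<open>
  This is \<open>dd^c (a dd^c v) = dd^c a \<and> dd^c v\<close>: the form \<open>dd^c v\<close> is closed.
\<close>

lemma mixed_disc_hessian:
  assumes "smooth a" "smooth v"
  shows "complex_hessian (\<lambda>w. a w * complex_hessian v w $ 2 $ 2) w $ 1 $ 1
      + complex_hessian (\<lambda>w. a w * complex_hessian v w $ 1 $ 1) w $ 2 $ 2
      - complex_hessian (\<lambda>w. a w * complex_hessian v w $ 2 $ 1) w $ 1 $ 2
      - complex_hessian (\<lambda>w. a w * complex_hessian v w $ 1 $ 2) w $ 2 $ 1
    = mixed_disc (complex_hessian a w) (complex_hessian v w)"
proof -
  have H: "(\<lambda>w. complex_hessian v w $ l $ m) = dz l (dzbar m v)" for l m
    by (simp add: fun_eq_iff hessian_nth)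
  have sm: "smooth (\<lambda>w. complex_hessian v w $ l $ m)" for l m
    by (rule smooth_hessian[OF assms(2)])
  have 1: "dz j (\<lambda>w. complex_hessian v w $ l $ m) w = dz l (\<lambda>w. complex_hessian v w $ j $ m) w" for j l m w
    unfolding H by (rule dz_commute) (intro smooth_intros assms)
  have H': "(\<lambda>w. complex_hessian v w $ l $ m) = dzbar m (dz l v)" for l m
    by (simp add: fun_eq_iff hessian_nth dz_dzbar_commute[OF assms(2)])
  have 2: "dzbar k (\<lambda>w. complex_hessian v w $ l $ m) w = dzbar m (\<lambda>w. complex_hessian v w $ l $ k) w" for k l m w
    unfolding H' by (rule dzbar_commute) (intro smooth_intros assms)
  have 3: "complex_hessian (\<lambda>w. complex_hessian v w $ l $ m) w $ j $ k =
      complex_hessian (\<lambda>w. complex_hessian v w $ l $ k) w $ j $ m" for j k l m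
  proof -
    have "dzbar k (\<lambda>w. complex_hessian v w $ l $ m) = dzbar m (\<lambda>w. complex_hessian v w $ l $ k)"
      using 2 by (rule ext)
    then show ?thesis
      by (simp only: hessian_nth[of "\<lambda>w. complex_hessian v w $ l $ m"] hessian_nth[of "\<lambda>w. complex_hessian v w $ l $ k"])
  qed
  have e: "dz 1 (\<lambda>w. complex_hessian v w $ 2 $ 2) w = dz 2 (\<lambda>w. complex_hessian v w $ 1 $ 2) w"
    "dz 2 (\<lambda>w. complex_hessian v w $ 1 $ 1) w = dz 1 (\<lambda>w. complex_hessian v w $ 2 $ 1) w"
    "dzbar 1 (\<lambda>w. complex_hessian v w $ 2 $ 2) w = dzbar 2 (\<lambda>w. complex_hessian v w $ 2 $ 1) w"
    "dzbar 2 (\<lambda>w. complex_hessian v w $ 1 $ 1) w = dzbar 1 (\<lambda>w. complex_hessian v w $ 1 $ 2) w"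
    "complex_hessian (\<lambda>w. complex_hessian v w $ 2 $ 2) w $ 1 $ 1 = complex_hessian (\<lambda>w. complex_hessian v w $ 2 $ 1) w $ 1 $ 2"
    "complex_hessian (\<lambda>w. complex_hessian v w $ 1 $ 1) w $ 2 $ 2 = complex_hessian (\<lambda>w. complex_hessian v w $ 1 $ 2) w $ 2 $ 1"
    by (fact 1 2 3)+
  show ?thesis
    unfolding hessian_mult[OF assms(1) sm] mixed_disc_def e by (simp add: algebra_simps)
qed

text \<open>Each entry of the Hessian of \<open>u\<close> is integrated by parts against
  \<open>\<phi>\<close> times an entry of the Hessian of \<open>v\<close>;
  \<open>mixed_disc_hessian\<close> disposes of the derivatives that fall on the latter.\<close>

lemma mixed_disc_by_parts:
  assumes u: "smooth u" and v: "smooth v" and \<phi>: "test_function \<phi>"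
  shows "(\<integral>w. \<phi> w * mixed_disc (complex_hessian u w) (complex_hessian v w) \<partial>lborel) =
    (\<integral>w. u w * mixed_disc (complex_hessian \<phi> w) (complex_hessian v w) \<partial>lborel)"
proof -
  have t: "test_function (\<lambda>w. \<phi> w * complex_hessian v w $ l $ m)" for l m
    using test_function_mult[OF \<phi> smooth_hessian[OF v]] by (simp add: mult.commute)
  have \<phi>s: "smooth \<phi>"
    using \<phi> by (simp add: test_function_iff)
  have i: "integrable lborel (\<lambda>w. complex_hessian u w $ j $ k * (\<phi> w * complex_hessian v w $ l $ m))" for j k l m
    by (intro integrable_continuous_test smooth_imp_continuous smooth_hessian u t)
  have i': "integrable lborel (\<lambda>w. u w * complex_hessian (\<lambda>w. \<phi> w * complex_hessian v w $ l $ m) w $ j $ k)" for j k l m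
    by (intro integrable_continuous_test smooth_imp_continuous u test_function_hessian t)
  have "(\<integral>w. \<phi> w * mixed_disc (complex_hessian u w) (complex_hessian v w) \<partial>lborel) =
    (\<integral>w. complex_hessian u w $ 1 $ 1 * (\<phi> w * complex_hessian v w $ 2 $ 2)
      + complex_hessian u w $ 2 $ 2 * (\<phi> w * complex_hessian v w $ 1 $ 1)
      - complex_hessian u w $ 1 $ 2 * (\<phi> w * complex_hessian v w $ 2 $ 1)
      - complex_hessian u w $ 2 $ 1 * (\<phi> w * complex_hessian v w $ 1 $ 2) \<partial>lborel)"
    by (simp add: mixed_disc_def algebra_simps)
  also have "\<dots> = (\<integral>w. u w * complex_hessian (\<lambda>w. \<phi> w * complex_hessian v w $ 2 $ 2) w $ 1 $ 1
      + u w * complex_hessian (\<lambda>w. \<phi> w * complex_hessian v w $ 1 $ 1) w $ 2 $ 2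
      - u w * complex_hessian (\<lambda>w. \<phi> w * complex_hessian v w $ 2 $ 1) w $ 1 $ 2
      - u w * complex_hessian (\<lambda>w. \<phi> w * complex_hessian v w $ 1 $ 2) w $ 2 $ 1 \<partial>lborel)"
    by (simp add: i i' integral_by_parts_hessian[OF u t])
  also have "\<dots> = (\<integral>w. u w * mixed_disc (complex_hessian \<phi> w) (complex_hessian v w) \<partial>lborel)"
    unfolding mixed_disc_hessian[OF \<phi>s v, symmetric] by (simp add: algebra_simps)
  finally show ?thesis .
qed

section \<open>Polynomial maps and the Levi form of their norm\<close>

inductive poly_fun :: "(complex ^ 'n \<Rightarrow> complex) \<Rightarrow> bool" where
  poly_fun_const: "poly_fun (\<lambda>_. c)"
| poly_fun_coord: "poly_fun (\<lambda>w. w $ i)"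
| poly_fun_add: "poly_fun p \<Longrightarrow> poly_fun q \<Longrightarrow> poly_fun (\<lambda>w. p w + q w)"
| poly_fun_mult: "poly_fun p \<Longrightarrow> poly_fun q \<Longrightarrow> poly_fun (\<lambda>w. p w * q w)"

lemma poly_fun_sum: "(\<And>x. x \<in> X \<Longrightarrow> poly_fun (p x)) \<Longrightarrow> poly_fun (\<lambda>w. \<Sum>x\<in>X. p x w)"
  by (induction X rule: infinite_finite_induct) (auto intro: poly_fun.intros)

lemma poly_fun_prod: "(\<And>x. x \<in> X \<Longrightarrow> poly_fun (p x)) \<Longrightarrow> poly_fun (\<lambda>w. \<Prod>x\<in>X. p x w)"
  by (induction X rule: infinite_finite_induct) (auto intro: poly_fun.intros)

lemma poly_fun_power: "poly_fun p \<Longrightarrow> poly_fun (\<lambda>w. p w ^ n)"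
  by (induction n) (auto intro: poly_fun.intros)

lemma poly_fun_diff: "poly_fun p \<Longrightarrow> poly_fun q \<Longrightarrow> poly_fun (\<lambda>w. p w - q w)"
  using poly_fun_add[of p "\<lambda>w. (-1) * q w"] poly_fun_mult[OF poly_fun_const[of "-1"], of q] by simp

lemma poly_fun_compose:
  assumes "poly_fun p" "\<And>i. poly_fun (\<lambda>w. G w $ i)"
  shows "poly_fun (\<lambda>w. p (G w))"
  using assms(1) by induction (auto intro: poly_fun.intros assms(2))

lemma homogeneous_imp_poly_fun: "homogeneous_poly d p \<Longrightarrow> poly_fun p"
proof -
  assume "homogeneous_poly d p"
  then obtain c where "p = (\<lambda>z. \<Sum>\<alpha>\<in>exponents d. c \<alpha> * monom_eval \<alpha> z)"
    unfolding homogeneous_poly_iff by blast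
  then show ?thesis
    unfolding monom_eval_def
    by (auto intro!: poly_fun_sum poly_fun_mult poly_fun_const poly_fun_prod poly_fun_power poly_fun_coord)
qed

lemma poly_fun_has_derivative:
  fixes p :: "complex ^ 'n \<Rightarrow> complex"
  assumes "poly_fun p"
  shows "\<exists>p'. (\<forall>k. poly_fun (p' k)) \<and> (\<forall>w. (p has_derivative (\<lambda>v. \<Sum>k\<in>UNIV. p' k w * v $ k)) (at w))"
  using assms
proof induction
  case (poly_fun_const c)
  then show ?case
    by (intro exI[of _ "\<lambda>_ _. 0"]) (auto intro: poly_fun.intros)
next
  case (poly_fun_coord i)
  have "(\<Sum>k\<in>UNIV. (if k = i then 1 else 0) * v $ k) = v $ i" for v :: "complex ^ 'n"
    by (simp add: if_distrib[of "\<lambda>x. x * _"] cong: if_cong)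
  then show ?case
    by (intro exI[of _ "\<lambda>k _. if k = i then 1 else 0"])
      (auto intro: poly_fun.intros bounded_linear_imp_has_derivative bounded_linear_vec_nth)
next
  case (poly_fun_add p q)
  then obtain p' q' where "\<And>k. poly_fun (p' k)" "\<And>k. poly_fun (q' k)"
    "\<And>w. (p has_derivative (\<lambda>v. \<Sum>k\<in>UNIV. p' k w * v $ k)) (at w)"
    "\<And>w. (q has_derivative (\<lambda>v. \<Sum>k\<in>UNIV. q' k w * v $ k)) (at w)"
    by blast
  then show ?case
    by (intro exI[of _ "\<lambda>k w. p' k w + q' k w"])
      (auto intro: poly_fun.intros dest: has_derivative_add simp: distrib_right sum.distrib)
next
  case (poly_fun_mult p q)
  then obtain p' q' where pq: "\<And>k. poly_fun (p' k)" "\<And>k. poly_fun (q' k)"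
    "\<And>w. (p has_derivative (\<lambda>v. \<Sum>k\<in>UNIV. p' k w * v $ k)) (at w)"
    "\<And>w. (q has_derivative (\<lambda>v. \<Sum>k\<in>UNIV. q' k w * v $ k)) (at w)"
    by blast
  have "((\<lambda>w. p w * q w) has_derivative (\<lambda>v. \<Sum>k\<in>UNIV. (p w * q' k w + p' k w * q w) * v $ k)) (at w)" for w
    by (rule has_derivative_eq_rhs[OF has_derivative_mult[OF pq(3,4)]])
      (simp add: fun_eq_iff sum_distrib_left sum_distrib_right distrib_right distrib_left sum.distrib mult_ac)
  then show ?case
    by (intro exI[of _ "\<lambda>k w. p w * q' k w + p' k w * q w"] conjI allI poly_fun.poly_fun_add
        poly_fun.poly_fun_mult pq(1,2) poly_fun_mult.hyps)
qed

lemma poly_fun_continuous: "poly_fun p \<Longrightarrow> continuous_on S p"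
  by (meson poly_fun_has_derivative continuous_at_imp_continuous_on has_derivative_continuous)

lemma poly_fun_smooth: "poly_fun p \<Longrightarrow> smooth p"
  by (induction rule: poly_fun.induct) (auto intro: smooth_intros)

lemma
  fixes p :: "complex ^ 2 \<Rightarrow> complex"
  assumes "poly_fun p"
  shows poly_fun_dz: "poly_fun (dz j p)"
    and poly_fun_dzbar: "dzbar j p w = 0"
    and poly_fun_derivative: "(p has_derivative (\<lambda>v. \<Sum>k\<in>UNIV. dz k p w * v $ k)) (at w)"
proof -
  obtain p' where p': "\<And>k. poly_fun (p' k)" "\<And>w. (p has_derivative (\<lambda>v. \<Sum>k\<in>UNIV. p' k w * v $ k)) (at w)"
    using poly_fun_has_derivative[OF assms] by blast
  have ax: "(\<Sum>k\<in>UNIV. p' k w * axis j c $ k) = p' j w * c" for j c w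
    by (simp add: axis_def if_distrib[of "\<lambda>x. _ * x"] cong: if_cong)
  have dz: "dz j p w = p' j w" for j w
    unfolding dz_eq[OF p'(2)] ax by (simp add: complex_eq_iff)
  then show "poly_fun (dz j p)"
    using p'(1)[of j] by presburger
  show "dzbar j p w = 0"
    unfolding dzbar_eq[OF p'(2)] ax by (simp add: complex_eq_iff)
  show "(p has_derivative (\<lambda>v. \<Sum>k\<in>UNIV. dz k p w * v $ k)) (at w)"
    unfolding dz by (rule p'(2))
qed

lemma poly_fun_differentiable: "poly_fun (p :: complex ^ 2 \<Rightarrow> complex) \<Longrightarrow> p differentiable (at w)"
  by (intro smooth_differentiable poly_fun_smooth)

section \<open>The Hermitian product and the Levi form of log |p|\<close>

definition cinner :: "complex ^ 'n \<Rightarrow> complex ^ 'n \<Rightarrow> complex" where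
  "cinner a b = (\<Sum>s\<in>UNIV. a $ s * cnj (b $ s))"

lemma cinner_add_left: "cinner (a + b) c = cinner a c + cinner b c"
  and cinner_add_right: "cinner c (a + b) = cinner c a + cinner c b"
  and cinner_scale_left: "cinner (x *s a) c = x * cinner a c"
  and cinner_scale_right: "cinner c (x *s a) = cnj x * cinner c a"
  by (simp_all add: cinner_def algebra_simps sum.distrib sum_distrib_left)

lemma cinner_diff_left: "cinner (a - b) c = cinner a c - cinner b c"
  and cinner_diff_right: "cinner c (a - b) = cinner c a - cinner c b"
  by (simp_all add: cinner_def algebra_simps sum_subtractf)

lemma cinner_sum_left: "cinner (\<Sum>x\<in>X. a x) c = (\<Sum>x\<in>X. cinner (a x) c)"
  and cinner_sum_right: "cinner c (\<Sum>x\<in>X. a x) = (\<Sum>x\<in>X. cinner c (a x))"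
  by (induction X rule: infinite_finite_induct) (simp_all add: cinner_add_left cinner_add_right, simp_all add: cinner_def)

lemma cnj_cinner: "cnj (cinner a b) = cinner b a"
  by (simp add: cinner_def mult.commute)

lemma cinner_self: "cinner a a = of_real ((norm a)\<^sup>2)"
  by (simp add: cinner_def norm_vec_def L2_set_def sum_nonneg complex_norm_square[symmetric])

lemma cinner_Cauchy_Schwarz: "cmod (cinner a b) \<le> norm a * norm b"
proof -
  have "cmod (cinner a b) \<le> (\<Sum>s\<in>UNIV. \<bar>cmod (a $ s)\<bar> * \<bar>cmod (b $ s)\<bar>)"
    unfolding cinner_def by (rule order_trans[OF norm_sum]) (simp add: norm_mult)
  also have "\<dots> \<le> norm a * norm b"
    unfolding norm_vec_def by (rule L2_set_mult_ineq)
  finally show ?thesis .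
qed

lemma norm_scale_vec: "norm (c *s x) = cmod c * norm (x :: complex ^ 'n)"
proof -
  have "cinner (c *s x) (c *s x) = of_real ((cmod c)\<^sup>2) * cinner x x"
    by (simp add: cinner_scale_left cinner_scale_right complex_norm_square mult_ac flip: of_real_power)
  then have "(norm (c *s x))\<^sup>2 = (cmod c * norm x)\<^sup>2"
    unfolding cinner_self by (simp add: power_mult_distrib flip: of_real_mult of_real_power)
  then show ?thesis
    by simp
qed

text \<open>The Levi form of log |z| at \<open>p\<close>, applied to \<open>a\<close> and
  \<open>b\<close>; the factor 1/2 comes from log |z| = (1/2) log |z|^2. It is the lift of the
  Fubini-Study metric to the punctured vector space.\<close>

definition levi :: "complex ^ 'n \<Rightarrow> complex ^ 'n \<Rightarrow> complex ^ 'n \<Rightarrow> complex" where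
  "levi p a b = (cinner a b / cinner p p - cinner a p * cinner p b / (cinner p p)\<^sup>2) / 2"

lemma levi_sesquilinear:
  "levi p (\<Sum>j\<in>A. x j *s a j) (\<Sum>k\<in>B. y k *s b k) = (\<Sum>j\<in>A. \<Sum>k\<in>B. levi p (a j) (b k) * x j * cnj (y k))"
proof -
  have "cinner (\<Sum>j\<in>A. x j *s a j) (\<Sum>k\<in>B. y k *s b k) = (\<Sum>j\<in>A. \<Sum>k\<in>B. x j * cnj (y k) * cinner (a j) (b k))"
    by (simp only: cinner_sum_left cinner_scale_left)
      (simp add: cinner_sum_right cinner_scale_right sum_distrib_left mult_ac)
  moreover have "cinner (\<Sum>j\<in>A. x j *s a j) p * cinner p (\<Sum>k\<in>B. y k *s b k) =
      (\<Sum>j\<in>A. \<Sum>k\<in>B. x j * cinner (a j) p * (cnj (y k) * cinner p (b k)))"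
    unfolding cinner_sum_left cinner_sum_right cinner_scale_left cinner_scale_right sum_product ..
  ultimately show ?thesis
    unfolding levi_def by (simp only: sum_divide_distrib sum_subtractf[symmetric])
      (simp add: diff_divide_distrib algebra_simps)
qed

text \<open>Multiples of \<open>p\<close> are tangent to the fibre of the projection and are
  invisible to the metric of the quotient. Together with \<open>levi_scale\<close> this gives
  independence of the lift.\<close>

lemma levi_add_multiple:
  assumes "p \<noteq> 0"
  shows "levi p (a + x *s p) (b + y *s p) = levi p a b"
proof -
  have "cinner p p \<noteq> 0"
    using assms by (simp add: cinner_self)
  then show ?thesis
    by (simp add: levi_def cinner_add_left cinner_add_right cinner_scale_left cinner_scale_right
        field_simps power2_eq_square)
qed

lemma levi_scale:
  assumes "h \<noteq> 0"
  shows "levi (h *s p) (h *s a) (h *s b) = levi p a b"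
  using assms by (simp add: levi_def cinner_scale_left cinner_scale_right power2_eq_square)

lemma levi_nonneg: "Im (levi p a a) = 0" "Re (levi p a a) \<ge> 0"
proof -
  have "cinner a p * cinner p a = of_real ((cmod (cinner a p))\<^sup>2)"
    using complex_norm_square[of "cinner a p"] by (simp add: cnj_cinner)
  then have *: "levi p a a = of_real (((norm a)\<^sup>2 / (norm p)\<^sup>2 - (cmod (cinner a p))\<^sup>2 / ((norm p)\<^sup>2)\<^sup>2) / 2)"
    by (simp add: levi_def cinner_self)
  then show "Im (levi p a a) = 0"
    by (simp only: Im_complex_of_real)
  have "(cmod (cinner a p))\<^sup>2 \<le> (norm a)\<^sup>2 * (norm p)\<^sup>2"
    using power_mono[OF cinner_Cauchy_Schwarz[of a p], of 2] by (simp add: power_mult_distrib)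
  then have "(cmod (cinner a p))\<^sup>2 / ((norm p)\<^sup>2)\<^sup>2 \<le> (norm a)\<^sup>2 / (norm p)\<^sup>2"
    by (cases "p = 0") (simp_all add: field_simps power2_eq_square)
  then show "Re (levi p a a) \<ge> 0"
    unfolding * by simp
qed

definition dvec :: "2 \<Rightarrow> (complex ^ 2 \<Rightarrow> complex ^ 'n) \<Rightarrow> complex ^ 2 \<Rightarrow> complex ^ 'n" where
  "dvec j P w = (\<chi> s. dz j (\<lambda>w. P w $ s) w)"

lemma
  assumes "\<And>s. poly_fun (\<lambda>w. P w $ s)" "\<And>s. poly_fun (\<lambda>w. Q w $ s)"
  shows smooth_cinner: "smooth (\<lambda>w. cinner (P w) (Q w))"
    and dz_cinner: "dz j (\<lambda>w. cinner (P w) (Q w)) w = cinner (dvec j P w) (Q w)"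
    and dzbar_cinner: "dzbar j (\<lambda>w. cinner (P w) (Q w)) w = cinner (P w) (dvec j Q w)"
proof -
  note sm = assms[THEN poly_fun_smooth]
  show "smooth (\<lambda>w. cinner (P w) (Q w))"
    unfolding cinner_def by (intro smooth_intros sm)
  have diff: "(\<lambda>w. P w $ s * cnj (Q w $ s)) differentiable (at w)" for s
    by (intro smooth_differentiable smooth_intros sm)
  have d: "dzbar j (\<lambda>w. P w $ s) w = 0" "dzbar j (\<lambda>w. Q w $ s) w = 0" for s
    by (intro poly_fun_dzbar assms)+
  have df: "(\<lambda>w. P w $ s) differentiable (at w)" "(\<lambda>w. Q w $ s) differentiable (at w)"
    "(\<lambda>w. cnj (Q w $ s)) differentiable (at w)" for s
    by (intro smooth_differentiable smooth_intros sm)+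
  show "dz j (\<lambda>w. cinner (P w) (Q w)) w = cinner (dvec j P w) (Q w)"
    unfolding cinner_def by (simp add: dz_sum[OF diff] dz_mult df dz_cnj d dvec_def)
  show "dzbar j (\<lambda>w. cinner (P w) (Q w)) w = cinner (P w) (dvec j Q w)"
    unfolding cinner_def by (simp add: dzbar_sum[OF diff] dzbar_mult df dzbar_cnj d dvec_def)
qed

definition log_norm :: "(complex ^ 2 \<Rightarrow> complex ^ 'n) \<Rightarrow> complex ^ 2 \<Rightarrow> complex" where
  "log_norm P w = complex_of_real (ln (norm (P w)))"

lemma
  fixes P :: "complex ^ 2 \<Rightarrow> complex ^ 'n"
  assumes P: "\<And>s. poly_fun (\<lambda>w. P w $ s)" and nz: "\<And>w. P w \<noteq> 0"
  shows smooth_log_norm: "smooth (log_norm P)"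
    and hessian_log_norm: "complex_hessian (log_norm P) w $ j $ k = levi (P w) (dvec j P w) (dvec k P w)"
proof -
  define N where "N w = (norm (P w))\<^sup>2" for w
  have N: "complex_of_real (N w) = cinner (P w) (P w)" for w
    by (simp add: N_def cinner_self)
  have Npos: "N w > 0" for w
    using nz by (simp add: N_def)
  have smN: "smooth (\<lambda>w. complex_of_real (N w))"
    unfolding N by (rule smooth_cinner[OF P P])
  have L: "log_norm P w = complex_of_real (ln (N w)) * (1 / 2)" for w
    using nz by (simp add: log_norm_def N_def ln_realpow)
  show "smooth (log_norm P)"
    unfolding L[abs_def] by (intro smooth_intros smooth_ln smN Npos)
  have sml: "smooth (\<lambda>w. complex_of_real (ln (N w)))"
    by (intro smooth_ln smN Npos)
  have "dzbar k (log_norm P) w = cinner (P w) (dvec k P w) * complex_of_real (1 / (2 * N w))" for w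
  proof -
    have "(ln has_real_derivative 1 / N w) (at (N w))"
      using Npos[of w] by (auto intro!: derivative_eq_intros)
    from dz_of_real_compose(2)[OF this smooth_differentiable[OF smN]]
    have "dzbar k (\<lambda>w. complex_of_real (ln (N w))) w = of_real (1 / N w) * cinner (P w) (dvec k P w)"
      by (simp add: N dzbar_cinner[OF P P])
    then show ?thesis
      unfolding L[abs_def] by (simp add: dzbar_divide_const smooth_differentiable[OF sml])
  qed
  then have d: "dzbar k (log_norm P) = (\<lambda>w. cinner (P w) (dvec k P w) * complex_of_real (1 / (2 * N w)))"
    by (rule ext)
  have dP: "poly_fun (\<lambda>w. dvec k P w $ s)" for s
    using poly_fun_dz[OF P] by (simp add: dvec_def)
  have "((\<lambda>x. 1 / (2 * x)) has_real_derivative - 1 / (2 * (N w)\<^sup>2)) (at (N w))"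
    using Npos[of w] by (auto intro!: derivative_eq_intros simp: power2_eq_square field_simps)
  note inv = dz_of_real_compose[OF this smooth_differentiable[OF smN]]
  have "complex_hessian (log_norm P) w $ j $ k =
      cinner (dvec j P w) (dvec k P w) * complex_of_real (1 / (2 * N w))
      + cinner (P w) (dvec k P w) * (complex_of_real (- 1 / (2 * (N w)\<^sup>2)) * cinner (dvec j P w) (P w))"
    unfolding hessian_nth d
      dz_mult[OF smooth_differentiable[OF smooth_cinner[OF P dP]] inv(3)] dz_cinner[OF P dP] inv(1)
    unfolding N dz_cinner[OF P P] ..
  also have "\<dots> = levi (P w) (dvec j P w) (dvec k P w)"
    using Npos[of w] by (simp add: levi_def flip: N)
  finally show "complex_hessian (log_norm P) w $ j $ k = levi (P w) (dvec j P w) (dvec k P w)" .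
qed

subsection \<open>Positive semidefinite matrices\<close>

definition qform :: "complex ^ 2 ^ 2 \<Rightarrow> complex ^ 2 \<Rightarrow> complex" where
  "qform M v = (\<Sum>j\<in>UNIV. \<Sum>k\<in>UNIV. M $ j $ k * v $ j * cnj (v $ k))"

definition psd :: "complex ^ 2 ^ 2 \<Rightarrow> bool" where
  "psd M \<longleftrightarrow> (\<forall>v. Im (qform M v) = 0 \<and> Re (qform M v) \<ge> 0)"

lemma qform_levi:
  "qform (\<chi> j k. levi p (a j) (a k)) v = levi p (\<Sum>j\<in>UNIV. v $ j *s a j) (\<Sum>j\<in>UNIV. v $ j *s a j)"
  unfolding levi_sesquilinear qform_def by simp

lemma psd_levi: "psd (\<chi> j k. levi p (a j) (a k))"
  unfolding psd_def qform_levi using levi_nonneg by blast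

lemma psd_hessian_log_norm:
  fixes P :: "complex ^ 2 \<Rightarrow> complex ^ 'n"
  assumes P: "\<And>s. poly_fun (\<lambda>w. P w $ s)" and nz: "\<And>w. P w \<noteq> 0"
  shows "psd (complex_hessian (log_norm P) w)"
proof -
  have "complex_hessian (log_norm P) w = (\<chi> j k. levi (P w) (dvec j P w) (dvec k P w))"
    using hessian_log_norm[OF assms] by (simp add: vec_eq_iff)
  then show ?thesis
    using psd_levi by metis
qed

text \<open>The vectors (1, 1) and (1, i) reveal the Hermitian symmetry. The bound on the
  off-diagonal entry comes from the vector (b, -c), or, if b = 0, from (1, -t c) with t so large
  that the form would turn negative.\<close>

lemma psd_entries:
  assumes "psd M"
  obtains a b c where "M $ 1 $ 1 = complex_of_real a" "M $ 2 $ 2 = complex_of_real b"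
    "M $ 1 $ 2 = c" "M $ 2 $ 1 = cnj c" "a \<ge> 0" "b \<ge> 0" "(cmod c)\<^sup>2 \<le> a * b"
proof -
  have q: "qform M (vector [x, y]) = M $ 1 $ 1 * x * cnj x + M $ 1 $ 2 * x * cnj y
      + M $ 2 $ 1 * y * cnj x + M $ 2 $ 2 * y * cnj y" for x y
    by (simp add: qform_def sum_2)
  have psd: "Im (qform M v) = 0" "Re (qform M v) \<ge> 0" for v
    using assms by (auto simp: psd_def)
  define a b c where "a = Re (M $ 1 $ 1)" "b = Re (M $ 2 $ 2)" "c = M $ 1 $ 2"
  have 11: "M $ 1 $ 1 = of_real a" "a \<ge> 0"
    using psd[of "vector [1, 0]"] unfolding q a_b_c_def by (auto simp: complex_eq_iff)
  have 22: "M $ 2 $ 2 = of_real b" "b \<ge> 0"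
    using psd[of "vector [0, 1]"] unfolding q a_b_c_def by (auto simp: complex_eq_iff)
  have "Im (M $ 1 $ 2 + M $ 2 $ 1) = 0"
    using psd(1)[of "vector [1, 1]"] unfolding q 11 22 by simp
  moreover have "Re (M $ 2 $ 1) = Re (M $ 1 $ 2)"
    using psd(1)[of "vector [1, \<i>]"] unfolding q 11 22 by simp
  ultimately have 21: "M $ 2 $ 1 = cnj c"
    by (simp add: a_b_c_def complex_eq_iff)
  have nn: "a * (cmod x)\<^sup>2 + 2 * Re (c * x * cnj y) + b * (cmod y)\<^sup>2 \<ge> 0" for x y
  proof -
    have "qform M (vector [x, y]) = of_real a * (x * cnj x) + c * x * cnj y + cnj (c * x * cnj y) + of_real b * (y * cnj y)"
      unfolding q 11 22 21 by (simp add: a_b_c_def mult_ac)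
    also have "\<dots> = of_real (a * (cmod x)\<^sup>2 + 2 * Re (c * x * cnj y) + b * (cmod y)\<^sup>2)"
      using complex_add_cnj[of "c * x * cnj y"]
      unfolding complex_norm_square[symmetric] by (simp add: algebra_simps)
    finally show ?thesis
      using psd(2)[of "vector [x, y]"] by simp
  qed
  have "(cmod c)\<^sup>2 \<le> a * b"
  proof (cases "b = 0")
    case True
    show ?thesis
    proof (rule ccontr)
      assume "\<not> ?thesis"
      then have c: "(cmod c)\<^sup>2 > 0"
        using True by simp
      define t where "t = (a + 1) / (cmod c)\<^sup>2"
      have "Re (c * 1 * cnj (- of_real t * c)) = - (t * (cmod c)\<^sup>2)"
        by (simp add: cmod_power2) (simp add: algebra_simps power2_eq_square)
      then show False
        using nn[of 1 "- of_real t * c"] c 11(2) True unfolding t_def by simp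
    qed
  next
    case False
    then have "b > 0"
      using 22 by simp
    have "Re (c * of_real b * cnj (- c)) = - (b * (cmod c)\<^sup>2)"
      by (simp add: cmod_power2) (simp add: algebra_simps power2_eq_square)
    then have "b * (a * b - (cmod c)\<^sup>2) \<ge> 0"
      using nn[of "of_real b" "- c"] \<open>b > 0\<close> by (simp add: algebra_simps power2_eq_square)
    then show ?thesis
      using \<open>b > 0\<close> by (simp add: zero_le_mult_iff)
  qed
  then show ?thesis
    using that 11 22 21 a_b_c_def(3) by blast
qed

text \<open>The off-diagonal contribution is at most twice the square root of (a b) (a' b') = (a b')
  (b a'), hence at most a b' + b a' by the inequality of the means.\<close>

lemma mixed_disc_psd:
  assumes "psd M" "psd N"
  shows "Im (mixed_disc M N) = 0" "Re (mixed_disc M N) \<ge> 0"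
proof -
  obtain a b c where M: "M $ 1 $ 1 = complex_of_real a" "M $ 2 $ 2 = complex_of_real b"
    "M $ 1 $ 2 = c" "M $ 2 $ 1 = cnj c" "a \<ge> 0" "b \<ge> 0" "(cmod c)\<^sup>2 \<le> a * b"
    using psd_entries[OF assms(1)] .
  obtain a' b' c' where N: "N $ 1 $ 1 = complex_of_real a'" "N $ 2 $ 2 = complex_of_real b'"
    "N $ 1 $ 2 = c'" "N $ 2 $ 1 = cnj c'" "a' \<ge> 0" "b' \<ge> 0" "(cmod c')\<^sup>2 \<le> a' * b'"
    using psd_entries[OF assms(2)] .
  have eq: "mixed_disc M N = of_real (a * b' + b * a' - 2 * Re (c * cnj c'))"
    by (simp add: mixed_disc_def M N complex_eq_iff)
  show "Im (mixed_disc M N) = 0"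
    unfolding eq by simp
  have "(cmod c * cmod c')\<^sup>2 \<le> (a * b) * (a' * b')"
    unfolding power_mult_distrib using M(5-7) N(5-7) by (intro mult_mono) auto
  also have "\<dots> = (a * b') * (b * a')"
    by (simp add: mult_ac)
  also have "4 * \<dots> \<le> (a * b' + b * a')\<^sup>2"
    using sum_squares_bound[of "a * b'" "b * a'"] by (simp add: power2_sum mult_ac)
  finally have "(2 * (cmod c * cmod c'))\<^sup>2 \<le> (a * b' + b * a')\<^sup>2"
    by (simp add: power_mult_distrib)
  then have "2 * (cmod c * cmod c') \<le> a * b' + b * a'"
    using M(5,6) N(5,6) power2_le_imp_le[of "2 * (cmod c * cmod c')" "a * b' + b * a'"] by simp
  moreover have "Re (c * cnj c') \<le> cmod c * cmod c'"
    using complex_Re_le_cmod[of "c * cnj c'"] by (simp add: norm_mult)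
  ultimately show "Re (mixed_disc M N) \<ge> 0"
    unfolding eq by simp
qed

lemma qform_add: "qform (M + N) v = qform M v + qform N v"
  by (simp add: qform_def algebra_simps sum.distrib)

lemma psd_add: "psd M \<Longrightarrow> psd N \<Longrightarrow> psd (M + N)"
  by (simp add: psd_def qform_add)

lemma psd_entry_bound:
  assumes "psd M"
  shows "cmod (M $ j $ k) \<le> Re (M $ 1 $ 1 + M $ 2 $ 2)" "Im (M $ 1 $ 1 + M $ 2 $ 2) = 0"
proof -
  obtain a b c where M: "M $ 1 $ 1 = complex_of_real a" "M $ 2 $ 2 = complex_of_real b"
    "M $ 1 $ 2 = c" "M $ 2 $ 1 = cnj c" "a \<ge> 0" "b \<ge> 0" "(cmod c)\<^sup>2 \<le> a * b"
    using psd_entries[OF assms] .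
  have "a * b \<le> (a + b)\<^sup>2"
    using M(5,6) by (simp add: power2_sum)
  then have "cmod c \<le> a + b"
    using M(5-7) power2_le_imp_le[of "cmod c" "a + b"] by linarith
  then show "cmod (M $ j $ k) \<le> Re (M $ 1 $ 1 + M $ 2 $ 2)" "Im (M $ 1 $ 1 + M $ 2 $ 2) = 0"
    using M exhaust_2[of j] exhaust_2[of k] by auto
qed

subsection \<open>The pull-back of the Fubini-Study form\<close>

text \<open>The homogeneous coordinate that carries the affine coordinate \<open>k\<close> of chart
  \<open>j\<close>.\<close>

definition affine_index :: "3 \<Rightarrow> 2 \<Rightarrow> 3" where
  "affine_index j k = (if k = 1 then (if j = 1 then 2 else 1) else (if j = 3 then 2 else 3))"

lemma affine_lift_index: "affine_lift j u $ affine_index j k = u $ k" "affine_lift j u $ j = 1"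
  using exhaust_3[of j] exhaust_2[of k] by (auto simp: affine_lift_def affine_index_def)

lemma affine_index_cases: "s = j \<or> s = affine_index j 1 \<or> s = affine_index j 2"
  using exhaust_3[of j] exhaust_3[of s] by (auto simp: affine_index_def)

lemma affine_index_neq: "affine_index j k \<noteq> j"
  using exhaust_3[of j] exhaust_2[of k] by (auto simp: affine_index_def)

lemma affine_lift_nonzero: "affine_lift j u \<noteq> 0"
  using affine_lift_index(2)[of j u] by (metis zero_index zero_neq_one)

lemma affine_lift_eqI:
  assumes "v $ j = 1"
  shows "affine_lift j (\<chi> k. v $ affine_index j k) = v"
proof -
  have "affine_lift j (\<chi> k. v $ affine_index j k) $ s = v $ s" for s
    using affine_index_cases[of s j] assms by (elim disjE) (simp_all add: affine_lift_index)
  then show ?thesis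
    by (simp add: vec_eq_iff)
qed

lemma poly_fun_affine_lift: "poly_fun (\<lambda>w. affine_lift j w $ s)"
  using exhaust_3[of j] exhaust_3[of s]
  by (auto simp: affine_lift_def intro: poly_fun.intros)

lemma norm_affine_lift: "(norm (affine_lift j w))\<^sup>2 = 1 + (norm w)\<^sup>2"
proof -
  have "complex_of_real ((norm (affine_lift j w))\<^sup>2) = of_real (1 + (norm w)\<^sup>2)"
    unfolding of_real_add of_real_1 cinner_self[symmetric]
    using exhaust_3[of j] by (auto simp: affine_lift_def cinner_def sum_2 sum_3)
  then show ?thesis
    by (simp only: of_real_eq_iff)
qed

lemma fs_potential_eq: "complex_of_real (fs_potential w) = log_norm (affine_lift j) w"
  using affine_lift_nonzero[of j w]
  by (simp add: fs_potential_def log_norm_def flip: norm_affine_lift[of j]) (simp add: ln_realpow)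

lemma dvec_affine_lift: "dvec k (affine_lift j) u = axis (affine_index j k) 1"
proof -
  have "dz k (\<lambda>w. affine_lift j w $ s) u = (if s = affine_index j k then 1 else 0)" for s
  proof -
    have co: "dz k (\<lambda>w. w $ m) u = (if m = k then 1 else 0)" for m
      by (subst dz_eq[OF bounded_linear_imp_has_derivative[OF bounded_linear_vec_nth]])
        (auto simp: axis_def)
    consider "s = j" | m where "s = affine_index j m"
      using affine_index_cases[of s j] by blast
    then show ?thesis
    proof cases
      case 1
      then show ?thesis
        using affine_index_neq[of j k] by (auto simp: affine_lift_index)
    next
      case 2
      have "affine_index j m = affine_index j k \<longleftrightarrow> m = k"
        using exhaust_3[of j] exhaust_2[of k] exhaust_2[of m] by (auto simp: affine_index_def)
      then show ?thesis
        using 2 by (simp add: affine_lift_index co)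
    qed
  qed
  then show ?thesis
    by (simp add: dvec_def axis_def vec_eq_iff)
qed

lemma
  fixes P :: "complex ^ 2 \<Rightarrow> complex ^ 3"
  assumes gP: "g (chart i x) = proj (P x)" and nz: "P x \<noteq> 0" "P x $ j \<noteq> 0"
  shows local_rep_eq: "local_rep g i j x $ k = P x $ affine_index j k / P x $ j"
      "affine_lift j (local_rep g i j x) = (1 / P x $ j) *s P x"
    and image_in_chart: "g (chart i x) \<in> range (chart j)"
proof -
  let ?v = "(1 / P x $ j) *s P x"
  have v: "affine_lift j (\<chi> k. ?v $ affine_index j k) = ?v"
    by (rule affine_lift_eqI) (simp add: nz)
  then have "?v \<noteq> 0"
    using affine_lift_nonzero by metis
  then have "proj (P x) = proj ?v"
    using proj_eq_iff[OF nz(1) \<open>?v \<noteq> 0\<close>] nz(2) by (auto intro: exI[of _ "1 / P x $ j"])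
  then have c: "proj (P x) = chart j (\<chi> k. ?v $ affine_index j k)"
    by (simp only: chart_def v)
  then show "g (chart i x) \<in> range (chart j)"
    by (simp add: gP)
  have "local_rep g i j x = coords j (chart j (\<chi> k. ?v $ affine_index j k))"
    using c by (simp only: local_rep_def gP)
  then have R: "local_rep g i j x = (\<chi> k. ?v $ affine_index j k)"
    by simp
  show "local_rep g i j x $ k = P x $ affine_index j k / P x $ j"
    unfolding R by simp
  show "affine_lift j (local_rep g i j x) = ?v"
    unfolding R by (rule v)
qed

text \<open>The affine lift of the local representative is the polynomial lift \<open>P\<close>
  times a scalar function. Its derivatives are therefore those of \<open>P\<close>, scaled by
  \<open>h\<close>, up to multiples of the point \<open>p'\<close>, and both modifications leave
  \<open>levi\<close> unchanged. This also removes the target chart chosen in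
  \<open>pullback_fs\<close>.\<close>

lemma pullback_fs_eq:
  fixes G :: "complex ^ 3 \<Rightarrow> complex ^ 3"
  assumes G: "\<And>s. poly_fun (\<lambda>z. G z $ s)" and nz: "\<And>z. z \<noteq> 0 \<Longrightarrow> G z \<noteq> 0"
    and g: "\<And>z. z \<noteq> 0 \<Longrightarrow> g (proj z) = proj (G z)"
  shows "pullback_fs g i w = complex_hessian (log_norm (\<lambda>w. G (affine_lift i w))) w"
proof -
  define P where "P w = G (affine_lift i w)" for w
  have P: "poly_fun (\<lambda>w. P w $ s)" for s
    unfolding P_def by (rule poly_fun_compose[OF G poly_fun_affine_lift])
  have Pnz: "P w \<noteq> 0" for w
    unfolding P_def by (intro nz affine_lift_nonzero)
  define j where "j = (SOME j. g (chart i w) \<in> range (chart j))"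
  have gP: "g (chart i x) = proj (P x)" for x
    unfolding chart_def P_def by (rule g[OF affine_lift_nonzero])
  have "\<exists>j. g (chart i w) \<in> range (chart j)"
    using charts_cover by blast
  then have "g (chart i w) \<in> range (chart j)"
    unfolding j_def by (rule someI_ex)
  then obtain u where "proj (P w) = proj (affine_lift j u)"
    by (auto simp: gP) (metis chart_def)
  then obtain c where c: "c \<noteq> 0" "affine_lift j u = c *s P w"
    using proj_eq_iff[OF Pnz affine_lift_nonzero] by blast
  then have Pj: "P w $ j \<noteq> 0"
    using affine_lift_index(2)[of j u] by auto
  define S where "S = {x. P x $ j \<noteq> 0}"
  have "open S"
    unfolding S_def by (rule open_Collect_neq[OF poly_fun_continuous[OF P] continuous_on_const])
  have "w \<in> S"
    using Pj by (simp add: S_def)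
  have rep: "local_rep g i j x $ k = P x $ affine_index j k / P x $ j"
    and lift: "affine_lift j (local_rep g i j x) = (1 / P x $ j) *s P x" if "x \<in> S" for x k
    using local_rep_eq[of g i x P j, OF gP Pnz] that by (auto simp: S_def)
  define h where "h = 1 / P w $ j"
  define p' where "p' = affine_lift j (local_rep g i j w)"
  have p': "p' = h *s P w" "h \<noteq> 0"
    using lift[OF \<open>w \<in> S\<close>] Pj by (auto simp: p'_def h_def)
  have p'_nz: "p' \<noteq> 0"
    unfolding p'_def by (rule affine_lift_nonzero)
  have dR: "dz l (\<lambda>v. local_rep g i j v $ k) w =
      h * dvec l P w $ affine_index j k - h * dvec l P w $ j * p' $ affine_index j k" for l k
  proof -
    have "dz l (\<lambda>v. local_rep g i j v $ k) w = dz l (\<lambda>x. P x $ affine_index j k / P x $ j) w"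
      by (rule dz_cong(1)[OF \<open>open S\<close> \<open>w \<in> S\<close> rep])
    also have "\<dots> = (dz l (\<lambda>x. P x $ affine_index j k) w * P w $ j - P w $ affine_index j k * dz l (\<lambda>x. P x $ j) w)
        / (P w $ j * P w $ j)"
    proof -
      have "((\<lambda>x. P x $ affine_index j k / P x $ j) has_derivative
        (\<lambda>v. ((\<Sum>m\<in>UNIV. dz m (\<lambda>x. P x $ affine_index j k) w * v $ m) * P w $ j
          - P w $ affine_index j k * (\<Sum>m\<in>UNIV. dz m (\<lambda>x. P x $ j) w * v $ m)) / (P w $ j * P w $ j))) (at w)"
        by (rule has_derivative_divide'[OF poly_fun_derivative[OF P] poly_fun_derivative[OF P] Pj])
      note dz_eq[OF this, of l]
      moreover have "(\<Sum>m\<in>UNIV. a m * axis l x $ m) = a l * x" for a :: "2 \<Rightarrow> complex" and x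
        by (simp add: axis_def if_distrib[of "\<lambda>x. _ * x"] cong: if_cong)
      moreover have "(a * x * p - q * (b * x)) / D = x * ((a * p - q * b) / D)" for a x p q b D :: complex
        by (simp add: algebra_simps diff_divide_distrib)
      ultimately show ?thesis
        by (simp only:) (simp add: diff_divide_distrib algebra_simps)
    qed
    also have "\<dots> = h * dvec l P w $ affine_index j k - h * dvec l P w $ j * p' $ affine_index j k"
      using Pj by (simp add: h_def p'(1) dvec_def field_simps)
    finally show ?thesis .
  qed
  define E :: "2 \<Rightarrow> complex ^ 3" where "E k = axis (affine_index j k) 1" for k
  have dlift: "dvec k (affine_lift j) u = E k" for k u
    unfolding E_def by (rule dvec_affine_lift)
  have fs: "fubini_study u $ m $ k = levi (affine_lift j u) (E m) (E k)" for u m k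
  proof -
    have "(\<lambda>w. complex_of_real (fs_potential w)) = log_norm (affine_lift j)"
      by (rule ext) (rule fs_potential_eq)
    then show ?thesis
      unfolding fubini_study_def
      using hessian_log_norm[OF poly_fun_affine_lift affine_lift_nonzero, of j u m k] by (simp add: dlift)
  qed
  have a': "(\<Sum>k\<in>UNIV. dz l (\<lambda>v. local_rep g i j v $ k) w *s E k) = h *s dvec l P w + (- h * dvec l P w $ j) *s p'" for l
  proof -
    have "p' $ j = 1"
      unfolding p'_def by (rule affine_lift_index)
    then have "(\<Sum>k\<in>UNIV. (h * dvec l P w $ affine_index j k - h * dvec l P w $ j * p' $ affine_index j k) * E k $ s)
        = h * dvec l P w $ s - h * dvec l P w $ j * p' $ s" for s
      using exhaust_3[of s] exhaust_3[of j] by (auto simp: sum_2 E_def axis_def affine_index_def)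
    then show ?thesis
      unfolding dR by (simp only: vec_eq_iff) (simp only: sum_component vector_smult_component vector_add_component, simp)
  qed
  have "pullback_fs g i w $ l $ m = complex_hessian (log_norm P) w $ l $ m" for l m
  proof -
    have "pullback_fs g i w $ l $ m = (\<Sum>k\<in>UNIV. \<Sum>k'\<in>UNIV. levi p' (E k) (E k')
        * dz l (\<lambda>v. local_rep g i j v $ k) w * cnj (dz m (\<lambda>v. local_rep g i j v $ k') w))"
      unfolding pullback_fs_def Let_def j_def[symmetric] pullback_def by (simp add: fs p'_def)
    also have "\<dots> = levi p' (h *s dvec l P w + (- h * dvec l P w $ j) *s p') (h *s dvec m P w + (- h * dvec m P w $ j) *s p')"
      unfolding a'[symmetric] levi_sesquilinear by simp
    also have "\<dots> = levi (P w) (dvec l P w) (dvec m P w)"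
      unfolding levi_add_multiple[OF p'_nz] unfolding p'(1) levi_scale[OF p'(2)] ..
    finally show ?thesis
      using hessian_log_norm[OF P Pnz] by simp
  qed
  then show ?thesis
    by (simp add: vec_eq_iff P_def[abs_def])
qed

section \<open>Cut-off functions\<close>

definition flat :: "real poly \<Rightarrow> real \<Rightarrow> real" where
  "flat p x = (if x > 0 then poly p (1 / x) * exp (- (1 / x)) else 0)"

lemma poly_exp_tendsto_0: "((\<lambda>y. poly p y * exp (- y)) \<longlongrightarrow> 0) (at_top :: real filter)"
proof -
  have "((\<lambda>y. \<Sum>i\<le>degree p. coeff p i * (y ^ i / exp y)) \<longlongrightarrow> (\<Sum>i\<le>degree p. coeff p i * 0)) (at_top :: real filter)"
    by (intro tendsto_sum tendsto_mult tendsto_const tendsto_power_div_exp_0)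
  moreover have "(\<Sum>i\<le>degree p. coeff p i * (y ^ i / exp y)) = poly p y * exp (- y)" for y
    by (simp add: poly_altdef exp_minus sum_distrib_right divide_inverse mult.assoc)
  ultimately show ?thesis
    by simp
qed

text \<open>With y = 1/x the derivative of p(y) e^(-y) is y^2 (p - p')(y) e^(-y), which again has
  the form \<open>flat\<close>. So one computation, with the exponential beating every polynomial at
  0, yields all the derivatives.\<close>

lemma flat_has_derivative:
  "(flat p has_real_derivative flat (monom 1 2 * (p - pderiv p)) x) (at x)"
proof -
  consider "x > 0" | "x < 0" | "x = 0"
    by linarith
  then show ?thesis
  proof cases
    case 1
    have "((\<lambda>x. poly p (1 / x) * exp (- (1 / x))) has_real_derivative
        flat (monom 1 2 * (p - pderiv p)) x) (at x)"
      using 1 by (auto simp: flat_def poly_monom intro!: derivative_eq_intros DERIV_chain2[OF poly_DERIV])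
        (simp add: field_simps power2_eq_square)
    then show ?thesis
      by (rule has_field_derivative_transform_within_open[where S = "{0<..}"]) (auto simp: 1 flat_def)
  next
    case 2
    then show ?thesis
      by (intro has_field_derivative_transform_within_open[OF DERIV_const[of 0], where S = "{..<0}", THEN DERIV_cong])
        (auto simp: flat_def)
  next
    case 3
    have "((\<lambda>h. flat p h / h) \<longlongrightarrow> 0) (at 0)"
    proof (rule filterlim_split_at)
      show "((\<lambda>h. flat p h / h) \<longlongrightarrow> 0) (at_left 0)"
        by (rule tendsto_eventually) (auto simp: flat_def eventually_at_left_field intro: exI[of _ "-1"])
      have "((\<lambda>h. poly (pCons 0 p) (inverse h) * exp (- (inverse h))) \<longlongrightarrow> 0) (at_right (0 :: real))"
        by (rule filterlim_compose[OF poly_exp_tendsto_0 filterlim_inverse_at_top_right])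
      moreover have "eventually (\<lambda>h. poly (pCons 0 p) (inverse h) * exp (- (inverse h)) = flat p h / h) (at_right (0 :: real))"
        by (rule eventually_mono[OF eventually_at_right_less]) (auto simp: flat_def field_simps)
      ultimately show "((\<lambda>h. flat p h / h) \<longlongrightarrow> 0) (at_right 0)"
        by (rule Lim_transform_eventually)
    qed
    then show ?thesis
      using 3 by (simp add: DERIV_def flat_def)
  qed
qed

lemma smooth_flat:
  assumes "smooth (\<lambda>w. complex_of_real (h w))"
  shows "smooth (\<lambda>w. complex_of_real (flat p (h w)))"
proof -
  define D where "D k = flat (((\<lambda>p. monom 1 2 * (p - pderiv p)) ^^ k) p)" for k
  have "(D k has_real_derivative D (Suc k) x) (at x)" for k x
    unfolding D_def using flat_has_derivative by simp
  then have "C_diff k (\<lambda>w. complex_of_real (D 0 (Re (complex_of_real (h w)))))" for k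
    using assms by (intro C_diff_compose_real[where X = UNIV and D = D]) (auto simp: smooth_def)
  then show ?thesis
    by (simp add: smooth_def D_def)
qed

text \<open>Equal to \<open>1\<close> for \<open>x \<le> s\<close> and to \<open>0\<close> for \<open>x \<ge> t\<close>, if \<open>s < t\<close>.\<close>

definition smooth_step :: "real \<Rightarrow> real \<Rightarrow> real \<Rightarrow> real" where
  "smooth_step s t x = flat 1 (t - x) / (flat 1 (t - x) + flat 1 (x - s))"

lemma flat_1_nonneg: "flat 1 x \<ge> 0"
  by (simp add: flat_def)

lemma smooth_step_denominator: "s < t \<Longrightarrow> flat 1 (t - x) + flat 1 (x - s) > 0"
  by (cases "x < t") (auto simp: flat_def intro: add_pos_nonneg)

lemma
  assumes "s < t"
  shows smooth_step_nonneg: "smooth_step s t x \<ge> 0"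
    and smooth_step_le_1: "smooth_step s t x \<le> 1"
    and smooth_step_eq_1: "x \<le> s \<Longrightarrow> smooth_step s t x = 1"
    and smooth_step_eq_0: "t \<le> x \<Longrightarrow> smooth_step s t x = 0"
  using smooth_step_denominator[OF assms, of x] flat_1_nonneg[of "t - x"] flat_1_nonneg[of "x - s"] assms
  by (auto simp: smooth_step_def field_simps) (auto simp: flat_def)

lemma smooth_smooth_step:
  assumes "s < t" "smooth (\<lambda>w. complex_of_real (h w))"
  shows "smooth (\<lambda>w. complex_of_real (smooth_step s t (h w)))"
proof -
  have 1: "smooth (\<lambda>w. complex_of_real (flat 1 (t - h w)))" "smooth (\<lambda>w. complex_of_real (flat 1 (h w - s)))"
    using assms(2) by (auto intro!: smooth_flat smooth_intros)
  have "smooth (\<lambda>w. complex_of_real (flat 1 (t - h w)) / (complex_of_real (flat 1 (t - h w)) + complex_of_real (flat 1 (h w - s))))"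
    using smooth_step_denominator[OF assms(1)] by (intro smooth_divide smooth_intros 1)
      (simp flip: of_real_add add: less_imp_neq[symmetric])
  then show ?thesis
    by (simp add: smooth_step_def)
qed

lemma smooth_norm_square: "smooth (\<lambda>w. complex_of_real ((norm (w - a))\<^sup>2))"
proof -
  have "complex_of_real ((norm x)\<^sup>2) = (\<Sum>i\<in>UNIV. x $ i * cnj (x $ i))" for x :: "complex ^ 2"
    by (simp add: norm_vec_def L2_set_def sum_nonneg complex_norm_square[symmetric])
  then show ?thesis
    by (simp only: vector_minus_component) (intro smooth_intros)
qed

lemma exists_bump:
  fixes a :: "complex ^ 2"
  assumes "0 < r" "r < R"
  obtains \<theta> :: "complex ^ 2 \<Rightarrow> real" where
    "test_function (\<lambda>w. complex_of_real (\<theta> w))" "\<And>w. \<theta> w \<ge> 0"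
    "\<And>w. w \<in> cball a r \<Longrightarrow> \<theta> w = 1" "\<And>w. w \<notin> ball a R \<Longrightarrow> \<theta> w = 0"
proof
  have rR: "r\<^sup>2 < R\<^sup>2"
    using assms by (simp add: power_strict_mono)
  let ?\<theta> = "\<lambda>w. smooth_step (r\<^sup>2) (R\<^sup>2) ((norm (w - a))\<^sup>2)"
  show 0: "?\<theta> w = 0" if "w \<notin> ball a R" for w
    using that assms by (intro smooth_step_eq_0 rR) (auto simp: dist_norm norm_minus_commute intro: power_mono)
  show "?\<theta> w = 1" if "w \<in> cball a r" for w
    using that assms by (intro smooth_step_eq_1 rR) (auto simp: dist_norm norm_minus_commute intro: power_mono)
  show "?\<theta> w \<ge> 0" for w
    by (rule smooth_step_nonneg[OF rR])
  have "?\<theta> w = 0" if "w \<notin> cball a R" for w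
    using that 0 ball_subset_cball by blast
  then show "test_function (\<lambda>w. complex_of_real (?\<theta> w))"
    unfolding test_function_iff
    by (intro conjI smooth_smooth_step smooth_norm_square rR exI[of _ "cball a R"]) auto
qed

section \<open>Monge-Ampere masses away from the support\<close>

lemma real_polynomial_smooth:
  "real_polynomial_function (p :: complex ^ 2 \<Rightarrow> real) \<Longrightarrow> smooth (\<lambda>w. complex_of_real (p w))"
proof (induction rule: real_polynomial_function.induct)
  case (linear f)
  have "bounded_linear (\<lambda>w. complex_of_real (f w))"
    using linear by (intro bounded_linear_compose[OF bounded_linear_of_real])
  then show ?case
    by (simp add: smooth_def C_diff_linear)
qed (auto intro: smooth_intros)

text \<open>Polynomials, dense by Stone-Weierstrass, are the smooth approximants. Closeness on
  \<open>K\<close> suffices, as they will be multiplied by test functions that vanish outside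
  \<open>K\<close>.\<close>

lemma of_real_smooth_approximation:
  fixes g :: "complex ^ 2 \<Rightarrow> real"
  assumes "compact K" "continuous_on UNIV g" "e > 0"
  obtains p where "smooth p" "\<And>w. w \<in> K \<Longrightarrow> cmod (p w - complex_of_real (g w)) < e"
proof -
  obtain p where p: "real_polynomial_function p" "\<And>w. w \<in> K \<Longrightarrow> \<bar>g w - p w\<bar> < e"
    using Stone_Weierstrass_real_polynomial_function[OF assms(1) continuous_on_subset[OF assms(2)] assms(3)] by blast
  show thesis
  proof
    show "smooth (\<lambda>w. complex_of_real (p w))"
      by (rule real_polynomial_smooth[OF p(1)])
    show "cmod (complex_of_real (p w) - complex_of_real (g w)) < e" if "w \<in> K" for w
      using p(2)[OF that] by (simp flip: of_real_diff)
  qed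
qed

text \<open>Models the normalized potentials d^-n log |F^n|: smooth plurisubharmonic functions,
  uniformly Cauchy with rate \<open>e\<close>. The limit is deliberately not named; the potential
  prescribed for T is compared with the sequence only through the distributional equation.\<close>

locale psh_sequence =
  fixes u :: "nat \<Rightarrow> complex ^ 2 \<Rightarrow> complex" and e :: "nat \<Rightarrow> real"
  assumes smooth_u: "smooth (u n)"
    and psd_u: "psd (complex_hessian (u n) w)"
    and cauchy_u: "n \<le> m \<Longrightarrow> cmod (u m w - u n w) \<le> e n"
    and e_tendsto: "e \<longlonglongrightarrow> 0"
begin

definition A :: "nat \<Rightarrow> 2 \<Rightarrow> 2 \<Rightarrow> (complex ^ 2 \<Rightarrow> complex) \<Rightarrow> complex" where
  "A n j k \<eta> = (\<integral>w. complex_hessian (u n) w $ j $ k * \<eta> w \<partial>lborel)"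

text \<open>Up to a universal factor, the mass of dd^c u_i \<and> dd^c u_j against
  \<open>\<phi>\<close>, whereas \<open>A\<close> gives the coefficients of the current dd^c
  u_n.\<close>

definition MA :: "(complex ^ 2 \<Rightarrow> complex) \<Rightarrow> nat \<Rightarrow> nat \<Rightarrow> complex" where
  "MA \<phi> i j = (\<integral>w. \<phi> w * mixed_disc (complex_hessian (u i) w) (complex_hessian (u j) w) \<partial>lborel)"

lemma e_nonneg: "e n \<ge> 0"
  using cauchy_u[of n n] norm_ge_zero order_trans by blast

lemma continuous_hessian: "continuous_on UNIV (\<lambda>w. complex_hessian (u n) w $ j $ k)"
  by (intro smooth_imp_continuous smooth_hessian smooth_u)

lemma integrable_hessian_mult:
  assumes "continuous_on UNIV \<eta>" "compact K" "\<And>w. w \<notin> K \<Longrightarrow> \<eta> w = 0"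
  shows "integrable lborel (\<lambda>w. complex_hessian (u n) w $ j $ k * \<eta> w)"
  using assms by (intro integrable_compact_support[where K = K] continuous_on_mult continuous_hessian) auto

text \<open>
  The mixed mass \<open>\<integral> h dd^c u \<and> dd^c \<phi>\<close> in terms of the coefficients of \<open>dd^c u\<close>.
\<close>

definition mixed_sum :: "(2 \<Rightarrow> 2 \<Rightarrow> 2 \<Rightarrow> 2 \<Rightarrow> complex) \<Rightarrow> complex" where
  "mixed_sum S = S 1 1 2 2 + S 2 2 1 1 - S 1 2 2 1 - S 2 1 1 2"

definition is_mass_bound :: "(complex ^ 2) set \<Rightarrow> real \<Rightarrow> bool" where
  "is_mass_bound K C \<longleftrightarrow> C \<ge> 0 \<and> (\<forall>n j k \<eta> s. continuous_on UNIV \<eta> \<longrightarrow> (\<forall>w. w \<notin> K \<longrightarrow> \<eta> w = 0) \<longrightarrow>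
     (\<forall>w. cmod (\<eta> w) \<le> s) \<longrightarrow> cmod (A n j k \<eta>) \<le> C * s)"

definition is_mixed_bound :: "(complex ^ 2 \<Rightarrow> complex) \<Rightarrow> real \<Rightarrow> bool" where
  "is_mixed_bound \<phi> C \<longleftrightarrow> C \<ge> 0 \<and> (\<forall>n h h' s. continuous_on UNIV h \<longrightarrow> continuous_on UNIV h' \<longrightarrow>
     (\<forall>w. cmod (h w - h' w) \<le> s) \<longrightarrow>
     cmod (mixed_sum (\<lambda>j k l m. A n j k (\<lambda>w. h w * complex_hessian \<phi> w $ l $ m))
      - mixed_sum (\<lambda>j k l m. A n j k (\<lambda>w. h' w * complex_hessian \<phi> w $ l $ m))) \<le> C * s)"

text \<open>
  Chern--Levine--Nirenberg: positivity reduces all the coefficients to the trace, whose mass is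
  controlled by the sup norm of the potential.
\<close>

lemma mass_bound:
  assumes "compact K"
  shows "\<exists>C. is_mass_bound K C"
proof -
  obtain r where r: "r > 0" "K \<subseteq> cball 0 r"
    using bounded_subset_ballD[OF compact_imp_bounded[OF assms], of 0] ball_subset_cball by blast
  obtain \<theta> where \<theta>: "test_function (\<lambda>w. complex_of_real (\<theta> w))" "\<And>w. \<theta> w \<ge> 0"
      "\<And>w. w \<in> cball 0 r \<Longrightarrow> \<theta> w = 1" "\<And>w. w \<notin> ball 0 (r + 1) \<Longrightarrow> \<theta> w = 0"
    using exists_bump[of r "r + 1" 0] r(1) by auto
  define \<Delta> where "\<Delta> w = complex_hessian (\<lambda>w. complex_of_real (\<theta> w)) w $ 1 $ 1
    + complex_hessian (\<lambda>w. complex_of_real (\<theta> w)) w $ 2 $ 2" for w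
  have t: "test_function (\<lambda>w. complex_hessian (\<lambda>w. complex_of_real (\<theta> w)) w $ j $ j)" for j
    by (rule test_function_hessian[OF \<theta>(1)])
  then obtain K1 K2 where K12: "compact K1" "compact K2"
    "\<And>w. w \<notin> K1 \<Longrightarrow> complex_hessian (\<lambda>w. complex_of_real (\<theta> w)) w $ 1 $ 1 = 0"
    "\<And>w. w \<notin> K2 \<Longrightarrow> complex_hessian (\<lambda>w. complex_of_real (\<theta> w)) w $ 2 $ 2 = 0"
    unfolding test_function_iff by metis
  have \<Delta>: "smooth \<Delta>" "compact (K1 \<union> K2)" "\<And>w. w \<notin> K1 \<union> K2 \<Longrightarrow> \<Delta> w = 0"
    using t K12 by (auto simp: \<Delta>_def[abs_def] test_function_iff intro!: smooth_add)
  have \<Delta>c: "continuous_on UNIV \<Delta>"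
    by (rule smooth_imp_continuous[OF \<Delta>(1)])
  have cu: "continuous_on UNIV (u n)" for n
    by (rule smooth_imp_continuous[OF smooth_u])
  have intB: "integrable lborel (\<lambda>w. (cmod (u 0 w) + e 0) * cmod (\<Delta> w))"
    using \<Delta> by (intro integrable_compact_support[where K = "K1 \<union> K2"] continuous_intros cu \<Delta>c) auto
  \<comment> \<open>After integration by parts the trace mass is the integral of
    \<open>u n * \<Delta>\<close>; since \<open>u n\<close> is within \<open>e 0\<close> of
    \<open>u 0\<close>, this integral bounds it for all \<open>n\<close> at once.\<close>
  define C where "C = (\<integral>w. (cmod (u 0 w) + e 0) * cmod (\<Delta> w) \<partial>lborel)"
  have "C \<ge> 0"
    unfolding C_def using e_nonneg by (intro integral_nonneg_AE) auto
  have tr: "(\<integral>w. Re (complex_hessian (u n) w $ 1 $ 1 + complex_hessian (u n) w $ 2 $ 2) * \<theta> w \<partial>lborel) \<le> C"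
    and int_tr: "integrable lborel (\<lambda>w. Re (complex_hessian (u n) w $ 1 $ 1 + complex_hessian (u n) w $ 2 $ 2) * \<theta> w)" for n
  proof -
    have i: "integrable lborel (\<lambda>w. complex_hessian (u n) w $ j $ j * complex_of_real (\<theta> w))" for j
      by (intro integrable_continuous_test \<theta> continuous_hessian)
    have i': "integrable lborel (\<lambda>w. u n w * complex_hessian (\<lambda>w. complex_of_real (\<theta> w)) w $ j $ j)" for j
      by (intro integrable_continuous_test t cu)
    have eq: "complex_of_real (Re (complex_hessian (u n) w $ 1 $ 1 + complex_hessian (u n) w $ 2 $ 2) * \<theta> w)
      = complex_hessian (u n) w $ 1 $ 1 * complex_of_real (\<theta> w) + complex_hessian (u n) w $ 2 $ 2 * complex_of_real (\<theta> w)" for w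
      unfolding distrib_right[symmetric] using psd_entry_bound(2)[OF psd_u, of n w]
      by (simp add: complex_eq_iff)
    have "integrable lborel (\<lambda>w. complex_of_real (Re (complex_hessian (u n) w $ 1 $ 1 + complex_hessian (u n) w $ 2 $ 2) * \<theta> w))"
      unfolding eq by (intro Bochner_Integration.integrable_add i)
    then show int: "integrable lborel (\<lambda>w. Re (complex_hessian (u n) w $ 1 $ 1 + complex_hessian (u n) w $ 2 $ 2) * \<theta> w)"
      using integrable_Re by fastforce
    have "complex_of_real (\<integral>w. Re (complex_hessian (u n) w $ 1 $ 1 + complex_hessian (u n) w $ 2 $ 2) * \<theta> w \<partial>lborel)
      = (\<integral>w. complex_hessian (u n) w $ 1 $ 1 * complex_of_real (\<theta> w) + complex_hessian (u n) w $ 2 $ 2 * complex_of_real (\<theta> w) \<partial>lborel)"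
      unfolding eq[symmetric] by (rule integral_complex_of_real[symmetric])
    also have "\<dots> = (\<integral>w. u n w * \<Delta> w \<partial>lborel)"
      using i i' by (simp add: integral_by_parts_hessian[OF smooth_u \<theta>(1)] \<Delta>_def distrib_left)
    finally have eqI: "complex_of_real (\<integral>w. Re (complex_hessian (u n) w $ 1 $ 1 + complex_hessian (u n) w $ 2 $ 2) * \<theta> w \<partial>lborel) = (\<integral>w. u n w * \<Delta> w \<partial>lborel)" .
    have "(\<integral>w. Re (complex_hessian (u n) w $ 1 $ 1 + complex_hessian (u n) w $ 2 $ 2) * \<theta> w \<partial>lborel)
        \<le> cmod (\<integral>w. u n w * \<Delta> w \<partial>lborel)"
      unfolding eqI[symmetric] by simp
    also have "\<dots> \<le> C"
      unfolding C_def
    proof (rule Bochner_Integration.integral_norm_bound_integral)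
      show "integrable lborel (\<lambda>w. u n w * \<Delta> w)"
        using \<Delta> by (intro integrable_compact_support[where K = "K1 \<union> K2"] continuous_intros cu \<Delta>c) auto
      show "cmod (u n w * \<Delta> w) \<le> (cmod (u 0 w) + e 0) * cmod (\<Delta> w)" for w
      proof -
        have "cmod (u n w) \<le> cmod (u 0 w) + e 0"
          using cauchy_u[of 0 n w] norm_triangle_sub[of "u n w" "u 0 w"] by simp
        then show ?thesis
          by (simp add: norm_mult mult_right_mono)
      qed
    qed (rule intB)
    finally show "(\<integral>w. Re (complex_hessian (u n) w $ 1 $ 1 + complex_hessian (u n) w $ 2 $ 2) * \<theta> w \<partial>lborel) \<le> C" .
  qed
  show ?thesis
    unfolding is_mass_bound_def
  proof (intro exI conjI allI impI)
    show "C \<ge> 0"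
      by fact
    fix n j k and \<eta> :: "complex ^ 2 \<Rightarrow> complex" and s
    assume "continuous_on UNIV \<eta>" "\<forall>w. w \<notin> K \<longrightarrow> \<eta> w = 0" "\<forall>w. cmod (\<eta> w) \<le> s"
    then have \<eta>: "continuous_on UNIV \<eta>" "\<And>w. w \<notin> K \<Longrightarrow> \<eta> w = 0" "\<And>w. cmod (\<eta> w) \<le> s"
      by auto
    have "s \<ge> 0"
      using \<eta>(3)[of 0] norm_ge_zero order_trans by blast
    have "cmod (A n j k \<eta>) \<le> (\<integral>w. s * (Re (complex_hessian (u n) w $ 1 $ 1 + complex_hessian (u n) w $ 2 $ 2) * \<theta> w) \<partial>lborel)"
      unfolding A_def
    proof (rule Bochner_Integration.integral_norm_bound_integral)
      show "integrable lborel (\<lambda>w. complex_hessian (u n) w $ j $ k * \<eta> w)"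
        by (rule integrable_hessian_mult[OF \<eta>(1) assms \<eta>(2)])
      show "integrable lborel (\<lambda>w. s * (Re (complex_hessian (u n) w $ 1 $ 1 + complex_hessian (u n) w $ 2 $ 2) * \<theta> w))"
        by (intro integrable_mult_right int_tr)
      show "cmod (complex_hessian (u n) w $ j $ k * \<eta> w)
        \<le> s * (Re (complex_hessian (u n) w $ 1 $ 1 + complex_hessian (u n) w $ 2 $ 2) * \<theta> w)" for w
      proof (cases "w \<in> K")
        case True
        then have "\<theta> w = 1"
          using r \<theta>(3) by blast
        then show ?thesis
          using mult_mono[OF psd_entry_bound(1)[OF psd_u, of n w j k] \<eta>(3)[of w]]
            order_trans[OF norm_ge_zero psd_entry_bound(1)[OF psd_u, of n w j k]]
          by (simp add: norm_mult mult.commute)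
      next
        case False
        then show ?thesis
          using \<eta>(2) \<open>s \<ge> 0\<close> \<theta>(2)[of w] order_trans[OF norm_ge_zero psd_entry_bound(1)[OF psd_u, of n w j k]]
          by simp
      qed
    qed
    also have "\<dots> \<le> s * C"
      using tr[of n] \<open>s \<ge> 0\<close> by (simp add: mult_left_mono)
    finally show "cmod (A n j k \<eta>) \<le> C * s"
      by (simp add: mult.commute)
  qed
qed

section \<open>Stability of the mixed masses under uniform perturbation of a potential\<close>

lemma A_diff:
  assumes "compact K" "continuous_on UNIV \<eta>" "\<And>w. w \<notin> K \<Longrightarrow> \<eta> w = 0"
    "continuous_on UNIV \<zeta>" "\<And>w. w \<notin> K \<Longrightarrow> \<zeta> w = 0"
  shows "A n j k \<eta> - A n j k \<zeta> = A n j k (\<lambda>w. \<eta> w - \<zeta> w)"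
  unfolding A_def using assms by (simp add: right_diff_distrib integrable_hessian_mult)

lemma mixed_sum_A:
  assumes "test_function \<phi>" "continuous_on UNIV h"
  shows "(\<integral>w. h w * mixed_disc (complex_hessian (u n) w) (complex_hessian \<phi> w) \<partial>lborel) =
    mixed_sum (\<lambda>j k l m. A n j k (\<lambda>w. h w * complex_hessian \<phi> w $ l $ m))"
proof -
  have "integrable lborel (\<lambda>w. complex_hessian (u n) w $ j $ k * (h w * complex_hessian \<phi> w $ l $ m))" for j k l m
    using integrable_continuous_test(1)[OF continuous_on_mult[OF continuous_hessian[of n j k] assms(2)]
        test_function_hessian[OF assms(1), of l m]] by (simp add: mult.assoc)
  then show ?thesis
    unfolding mixed_sum_def A_def mixed_disc_def
    by (simp flip: Bochner_Integration.integral_add Bochner_Integration.integral_diff) (simp add: algebra_simps)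
qed

text \<open>On the right only \<open>u j\<close> is differentiated. Hence \<open>u i\<close> may be
  exchanged for any uniformly close function, at a cost that \<open>is_mixed_bound\<close> controls
  independently of \<open>j\<close>.\<close>

lemma MA_eq:
  assumes "test_function \<phi>"
  shows "MA \<phi> i j = mixed_sum (\<lambda>a b l m. A j a b (\<lambda>w. u i w * complex_hessian \<phi> w $ l $ m))"
  unfolding MA_def mixed_disc_by_parts[OF smooth_u smooth_u assms]
  using mixed_sum_A[OF assms smooth_imp_continuous[OF smooth_u], of i j] by (simp add: mixed_disc_commute)

lemma MA_commute: "MA \<phi> i j = MA \<phi> j i"
  by (simp add: MA_def mixed_disc_commute)

lemma test_function_bounded:
  assumes "test_function \<phi>"
  obtains s where "s \<ge> 0" "\<And>w. cmod (\<phi> w) \<le> s"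
proof -
  obtain K where K: "compact K" "\<And>w. w \<notin> K \<Longrightarrow> \<phi> w = 0" "smooth \<phi>"
    using assms by (auto simp: test_function_iff)
  have "compact (\<phi> ` K)"
    using K by (intro compact_continuous_image continuous_on_subset[OF smooth_imp_continuous]) auto
  then obtain s where s: "s > 0" "\<And>x. x \<in> \<phi> ` K \<Longrightarrow> cmod x \<le> s"
    using compact_imp_bounded bounded_pos by metis
  have "cmod (\<phi> w) \<le> s" for w
    using s K(2)[of w] by (cases "w \<in> K") auto
  then show thesis
    using that s(1) less_imp_le by blast
qed

lemma hessian_bound:
  assumes "test_function \<phi>"
  obtains K s where "compact K" "s \<ge> 0" "\<And>w l m. cmod (complex_hessian \<phi> w $ l $ m) \<le> s"
    "\<And>w l m. w \<notin> K \<Longrightarrow> complex_hessian \<phi> w $ l $ m = 0"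
proof -
  obtain K where K: "compact K" "\<And>w. w \<notin> K \<Longrightarrow> \<phi> w = 0"
    using assms by (auto simp: test_function_iff)
  have "\<exists>s\<ge>0. \<forall>w. cmod (complex_hessian \<phi> w $ l $ m) \<le> s" for l m
    using test_function_bounded[OF test_function_hessian[OF assms, of l m]] by metis
  then obtain s where s: "\<And>l m. s l m \<ge> 0" "\<And>l m w. cmod (complex_hessian \<phi> w $ l $ m) \<le> s l m"
    by metis
  have "s l m \<le> (\<Sum>l\<in>UNIV. \<Sum>m\<in>UNIV. s l m)" for l m
    using member_le_sum[of m UNIV "s l"] member_le_sum[of l UNIV "\<lambda>l. \<Sum>m\<in>UNIV. s l m"] s(1)
    by (meson UNIV_I finite_code order_trans sum_nonneg)
  then have "cmod (complex_hessian \<phi> w $ l $ m) \<le> (\<Sum>l\<in>UNIV. \<Sum>m\<in>UNIV. s l m)" for l m w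
    using s(2) order_trans by blast
  moreover have "(\<Sum>l\<in>UNIV. \<Sum>m\<in>UNIV. s l m) \<ge> 0"
    using s(1) by (intro sum_nonneg) auto
  moreover have "complex_hessian \<phi> w $ l $ m = 0" if "w \<notin> K" for w l m
    using frechet_derivative_outside(3)[of K \<phi> w l m] K that by simp
  ultimately show thesis
    using that[OF K(1)] by simp
qed

lemma norm_mixed_sum_le:
  assumes "\<And>j k l m. cmod (S j k l m) \<le> b"
  shows "cmod (mixed_sum S) \<le> 4 * b"
proof -
  have "cmod (mixed_sum S) \<le> cmod (S 1 1 2 2) + cmod (S 2 2 1 1) + cmod (S 1 2 2 1) + cmod (S 2 1 1 2)"
    unfolding mixed_sum_def by (intro order_trans[OF norm_triangle_ineq4] add_mono norm_triangle_ineq order_refl)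
  then show ?thesis
    using assms[of 1 1 2 2] assms[of 2 2 1 1] assms[of 1 2 2 1] assms[of 2 1 1 2] by simp
qed

lemma mixed_sum_diff: "mixed_sum S - mixed_sum S' = mixed_sum (\<lambda>j k l m. S j k l m - S' j k l m)"
  by (simp add: mixed_sum_def)

lemma tendsto_mixed_sum:
  "(\<And>j k l m. ((\<lambda>n. S n j k l m) \<longlongrightarrow> L j k l m) F) \<Longrightarrow> ((\<lambda>n. mixed_sum (S n)) \<longlongrightarrow> mixed_sum L) F"
  unfolding mixed_sum_def by (intro tendsto_intros)

lemma mixed_sum_A_bound:
  assumes "test_function \<phi>"
  shows "\<exists>C. is_mixed_bound \<phi> C"
proof -
  obtain K b where K: "compact K" "b \<ge> 0" "\<And>w l m. cmod (complex_hessian \<phi> w $ l $ m) \<le> b"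
    "\<And>w l m. w \<notin> K \<Longrightarrow> complex_hessian \<phi> w $ l $ m = 0"
    using hessian_bound[OF assms] by metis
  obtain C where "is_mass_bound K C"
    using mass_bound[OF K(1)] ..
    note C = this[unfolded is_mass_bound_def, THEN conjunct1] this[unfolded is_mass_bound_def, THEN conjunct2, rule_format]
  have c: "continuous_on UNIV (\<lambda>w. complex_hessian \<phi> w $ l $ m)" for l m
    using test_function_hessian[OF assms] by (auto simp: test_function_iff intro: smooth_imp_continuous)
  show ?thesis
    unfolding is_mixed_bound_def
  proof (intro exI[of _ "4 * (C * b)"] conjI allI impI)
    fix n and h h' :: "complex ^ 2 \<Rightarrow> complex" and s
    assume "continuous_on UNIV h" "continuous_on UNIV h'" "\<forall>w. cmod (h w - h' w) \<le> s"
    then have h: "continuous_on UNIV h" "continuous_on UNIV h'" "\<And>w. cmod (h w - h' w) \<le> s"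
      by auto
    have "s \<ge> 0"
      using h(3)[of 0] norm_ge_zero order_trans by blast
    have "cmod (A n j k (\<lambda>w. h w * complex_hessian \<phi> w $ l $ m) - A n j k (\<lambda>w. h' w * complex_hessian \<phi> w $ l $ m))
        \<le> C * (s * b)" for j k l m
    proof -
      have "A n j k (\<lambda>w. h w * complex_hessian \<phi> w $ l $ m) - A n j k (\<lambda>w. h' w * complex_hessian \<phi> w $ l $ m)
        = A n j k (\<lambda>w. h w * complex_hessian \<phi> w $ l $ m - h' w * complex_hessian \<phi> w $ l $ m)"
        using K(4) by (intro A_diff[OF K(1)] continuous_on_mult h c) auto
      also have "cmod \<dots> \<le> C * (s * b)"
      proof (rule C(2))
        show "cmod (h w * complex_hessian \<phi> w $ l $ m - h' w * complex_hessian \<phi> w $ l $ m) \<le> s * b" for w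
          using mult_mono[OF h(3)[of w] K(3)[of w l m]] \<open>s \<ge> 0\<close>
          by (simp add: norm_mult flip: left_diff_distrib)
      qed (use K(4) in \<open>auto intro!: continuous_intros h c\<close>)
      finally show ?thesis .
    qed
    then show "cmod (mixed_sum (\<lambda>j k l m. A n j k (\<lambda>w. h w * complex_hessian \<phi> w $ l $ m))
      - mixed_sum (\<lambda>j k l m. A n j k (\<lambda>w. h' w * complex_hessian \<phi> w $ l $ m))) \<le> 4 * (C * b) * s"
      unfolding mixed_sum_diff by (intro order_trans[OF norm_mixed_sum_le]) (auto simp: mult_ac)
  qed (use C K in auto)
qed

text \<open>Pass from (i, j) to (q, j) and then to (q, q), exchanging one potential at a time; the
  two exchanges cost \<open>C * e i\<close> and \<open>C * e j\<close>. The remaining diagonal mass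
  tends to 0 with growing \<open>q\<close>.\<close>

lemma MA_bound:
  assumes "test_function \<phi>" "(\<lambda>n. MA \<phi> n n) \<longlonglongrightarrow> 0"
  obtains C where "C \<ge> 0" "\<And>i j. cmod (MA \<phi> i j) \<le> C * (e i + e j)"
proof -
  obtain C where "is_mixed_bound \<phi> C"
    using mixed_sum_A_bound[OF assms(1)] ..
    note C = this[unfolded is_mixed_bound_def, THEN conjunct1] this[unfolded is_mixed_bound_def, THEN conjunct2, rule_format]
  have step: "cmod (MA \<phi> q i - MA \<phi> j i) \<le> C * e j" if "j \<le> q" for i j q
    unfolding MA_eq[OF assms(1)] using cauchy_u[OF that]
    by (intro C(2) smooth_imp_continuous smooth_u)
  show thesis
  proof (rule that[OF C(1)])
    fix i j
    have "cmod (MA \<phi> i j) \<le> C * (e i + e j) + cmod (MA \<phi> q q)" if "i \<le> q" "j \<le> q" for q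
    proof -
      have "cmod (MA \<phi> i j) \<le> cmod (MA \<phi> q q) + cmod (MA \<phi> q q - MA \<phi> j q) + cmod (MA \<phi> q j - MA \<phi> i j)"
        using norm_triangle_sub[of "MA \<phi> i j" "MA \<phi> q j"] norm_triangle_sub[of "MA \<phi> j q" "MA \<phi> q q"]
        by (simp add: MA_commute[of \<phi> q j] norm_minus_commute)
      then show ?thesis
        using step[OF that(2), of q] step[OF that(1), of j] by (simp add: algebra_simps)
    qed
    then have "eventually (\<lambda>q. cmod (MA \<phi> i j) \<le> C * (e i + e j) + cmod (MA \<phi> q q)) sequentially"
      by (auto simp: eventually_sequentially intro!: exI[of _ "max i j"])
    moreover have "(\<lambda>q. C * (e i + e j) + cmod (MA \<phi> q q)) \<longlonglongrightarrow> C * (e i + e j) + 0"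
      using assms(2) by (intro tendsto_add tendsto_const tendsto_norm_zero)
    ultimately show "cmod (MA \<phi> i j) \<le> C * (e i + e j)"
      using tendsto_lowerbound[of _ "C * (e i + e j) + 0" sequentially] by fastforce
  qed
qed

text \<open>The description by \<open>THE\<close> has to be shown meaningful. The products \<eta> of
  polynomials and \<psi> form one admissible sequence, which settles uniqueness. For any other
  admissible sequence the mass bound on the union of the two supports, uniform in \<open>n\<close>,
  forces the same limit \<open>L\<close>.\<close>

lemma order_zero_ext_tendsto:
  fixes g :: "complex ^ 2 \<Rightarrow> real"
  assumes T: "\<And>\<eta>. test_function \<eta> \<Longrightarrow> (\<lambda>n. A n j k \<eta>) \<longlonglongrightarrow> T \<eta>"
    and g: "continuous_on UNIV g" and \<psi>: "test_function \<psi>"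
  shows "(\<lambda>n. A n j k (\<lambda>w. complex_of_real (g w) * \<psi> w)) \<longlonglongrightarrow> order_zero_ext T (\<lambda>w. complex_of_real (g w) * \<psi> w)"
proof -
  obtain K where K: "compact K" "\<And>w. w \<notin> K \<Longrightarrow> \<psi> w = 0" "smooth \<psi>"
    using \<psi> by (auto simp: test_function_iff)
  obtain s where s: "s \<ge> 0" "\<And>w. cmod (\<psi> w) \<le> s"
    using test_function_bounded[OF \<psi>] by metis
  define G where "G w = complex_of_real (g w) * \<psi> w" for w
  have G: "continuous_on UNIV G" "\<And>w. w \<notin> K \<Longrightarrow> G w = 0"
    unfolding G_def using g K smooth_imp_continuous[OF K(3)] by (auto intro!: continuous_intros)
  have "\<exists>p. smooth p \<and> (\<forall>w\<in>K. cmod (p w - complex_of_real (g w)) < 1 / real (Suc m))" for m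
    using of_real_smooth_approximation[OF K(1) g, of "1 / real (Suc m)"] by (metis of_nat_0_less_iff zero_less_Suc zero_less_divide_1_iff)
  then obtain p where p: "\<And>m. smooth (p m)" "\<And>m w. w \<in> K \<Longrightarrow> cmod (p m w - complex_of_real (g w)) < 1 / real (Suc m)"
    by metis
  define \<eta> where "\<eta> m w = p m w * \<psi> w" for m w
  have \<eta>: "test_function (\<eta> m)" for m
    unfolding \<eta>_def by (rule test_function_mult[OF \<psi> p(1)])
  have \<eta>0: "\<eta> m w = 0" if "w \<notin> K" for m w
    using that K(2) by (simp add: \<eta>_def)
  have \<eta>G: "cmod (\<eta> m w - G w) \<le> s / real (Suc m)" for m w
  proof (cases "w \<in> K")
    case True
    have "cmod (\<eta> m w - G w) = cmod (p m w - complex_of_real (g w)) * cmod (\<psi> w)"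
      by (simp add: \<eta>_def G_def norm_mult flip: left_diff_distrib)
    also have "\<dots> \<le> 1 / real (Suc m) * s"
      using less_imp_le[OF p(2)[OF True, of m]] s by (intro mult_mono) auto
    finally show ?thesis
      by simp
  next
    case False
    then show ?thesis
      using \<eta>0 G(2) s(1) by simp
  qed
  have lim0: "(\<lambda>m. s / real (Suc m)) \<longlonglongrightarrow> 0"
    using tendsto_mult[OF tendsto_const[of s] LIMSEQ_inverse_real_of_nat] by (simp add: divide_inverse)
  have cont: "continuous_on UNIV \<zeta>" if "test_function \<zeta>" for \<zeta>
    using that by (auto simp: test_function_iff intro: smooth_imp_continuous)
  have unif: "uniform_limit UNIV \<eta> G sequentially"
    unfolding uniform_limit_iff
  proof (intro allI impI)
    fix \<epsilon> :: real assume "\<epsilon> > 0"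
    then have "eventually (\<lambda>m. s / real (Suc m) < \<epsilon>) sequentially"
      using order_tendstoD(2)[OF lim0] by simp
    then show "eventually (\<lambda>m. \<forall>w\<in>UNIV. dist (\<eta> m w) (G w) < \<epsilon>) sequentially"
      using \<eta>G by (auto simp: dist_norm elim!: eventually_mono intro: le_less_trans)
  qed
  have "convergent (\<lambda>n. A n j k G)"
  proof -
    obtain C where "is_mass_bound K C"
      using mass_bound[OF K(1)] ..
      note C = this[unfolded is_mass_bound_def, THEN conjunct1] this[unfolded is_mass_bound_def, THEN conjunct2, rule_format]
    have diff: "cmod (A n j k (\<eta> m) - A n j k G) \<le> C * (s / real (Suc m))" for n m
    proof -
      have "A n j k (\<eta> m) - A n j k G = A n j k (\<lambda>w. \<eta> m w - G w)"
        using \<eta>0 G(2) by (intro A_diff[OF K(1)] cont[OF \<eta>] G(1)) auto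
      also have "cmod \<dots> \<le> C * (s / real (Suc m))"
        using \<eta>G \<eta>0 G(2) by (intro C(2) continuous_on_diff cont[OF \<eta>] G(1)) auto
      finally show ?thesis .
    qed
    have "Cauchy (\<lambda>n. A n j k G)"
    proof (rule CauchyI)
      fix \<epsilon> :: real assume "\<epsilon> > 0"
      have "(\<lambda>m. C * (s / real (Suc m))) \<longlonglongrightarrow> C * 0"
        by (intro tendsto_mult tendsto_const lim0)
      then obtain m where m: "C * (s / real (Suc m)) < \<epsilon> / 3"
        using order_tendstoD(2)[of _ "C * 0" sequentially "\<epsilon> / 3"] \<open>\<epsilon> > 0\<close>
        by (metis (mono_tags, lifting) divide_pos_pos eventually_sequentially mult_zero_right order_refl zero_less_numeral)
      have "Cauchy (\<lambda>n. A n j k (\<eta> m))"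
        using T[OF \<eta>] by (rule LIMSEQ_imp_Cauchy)
      then obtain M where M: "\<And>n n'. n \<ge> M \<Longrightarrow> n' \<ge> M \<Longrightarrow> cmod (A n j k (\<eta> m) - A n' j k (\<eta> m)) < \<epsilon> / 3"
        using CauchyD[of _ "\<epsilon> / 3"] \<open>\<epsilon> > 0\<close> by (metis divide_pos_pos zero_less_numeral)
      show "\<exists>M. \<forall>n\<ge>M. \<forall>n'\<ge>M. cmod (A n j k G - A n' j k G) < \<epsilon>"
      proof (intro exI allI impI)
        fix n n' assume "n \<ge> M" "n' \<ge> M"
        have tri: "cmod (a - b) \<le> cmod (a' - b') + cmod (b' - b) + cmod (a' - a)" for a b a' b' :: complex
          using norm_triangle_ineq4[of "(a' - b') + (b' - b)" "a' - a"] norm_triangle_ineq[of "a' - b'" "b' - b"]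
          by (simp add: algebra_simps)
        have "cmod (A n j k G - A n' j k G) \<le> cmod (A n j k (\<eta> m) - A n' j k (\<eta> m))
            + cmod (A n' j k (\<eta> m) - A n' j k G) + cmod (A n j k (\<eta> m) - A n j k G)"
          by (rule tri)
        also have "\<dots> < \<epsilon> / 3 + \<epsilon> / 3 + \<epsilon> / 3"
          by (intro add_strict_mono M[OF \<open>n \<ge> M\<close> \<open>n' \<ge> M\<close>] le_less_trans[OF diff m])
        also have "\<dots> = \<epsilon>"
          by simp
        finally show "cmod (A n j k G - A n' j k G) < \<epsilon>" .
      qed
    qed
    then show ?thesis
      by (rule Cauchy_convergent)
  qed
  then obtain L where L: "(\<lambda>n. A n j k G) \<longlonglongrightarrow> L"
    by (auto simp: convergent_def)
  have "order_zero_ext T G = L"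
    unfolding order_zero_ext_def
  proof (rule the_equality)
    show "\<forall>\<eta> K. compact K \<and> (\<forall>m. test_function (\<eta> m) \<and> (\<forall>w. w \<notin> K \<longrightarrow> \<eta> m w = 0)) \<and>
        uniform_limit UNIV \<eta> G sequentially \<longrightarrow> (\<lambda>m. T (\<eta> m)) \<longlonglongrightarrow> L"
    proof (intro allI impI, elim conjE)
      fix \<zeta> :: "nat \<Rightarrow> complex ^ 2 \<Rightarrow> complex" and K'
      assume K': "compact K'" and \<zeta>: "\<forall>m. test_function (\<zeta> m) \<and> (\<forall>w. w \<notin> K' \<longrightarrow> \<zeta> m w = 0)"
        and ul: "uniform_limit UNIV \<zeta> G sequentially"
      obtain C where "is_mass_bound (K \<union> K') C"
        using mass_bound[OF compact_Un[OF K(1) K']] ..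
        note C = this[unfolded is_mass_bound_def, THEN conjunct1] this[unfolded is_mass_bound_def, THEN conjunct2, rule_format]
      show "(\<lambda>m. T (\<zeta> m)) \<longlonglongrightarrow> L"
      proof (rule LIMSEQ_I)
        fix \<epsilon> :: real assume "\<epsilon> > 0"
        define \<delta> where "\<delta> = \<epsilon> / (2 * (C + 1))"
        have "\<delta> > 0"
          using \<open>\<epsilon> > 0\<close> C(1) by (simp add: \<delta>_def)
        obtain M where M: "\<And>m w. m \<ge> M \<Longrightarrow> cmod (\<zeta> m w - G w) < \<delta>"
          using uniform_limitD[OF ul \<open>\<delta> > 0\<close>] by (auto simp: eventually_sequentially dist_norm)
        have "cmod (T (\<zeta> m) - L) < \<epsilon>" if "m \<ge> M" for m
        proof -
          have \<zeta>m: "test_function (\<zeta> m)" "\<And>w. w \<notin> K' \<Longrightarrow> \<zeta> m w = 0"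
            using \<zeta> by auto
          have "cmod (A n j k (\<zeta> m) - A n j k G) \<le> C * \<delta>" for n
          proof -
            have "A n j k (\<zeta> m) - A n j k G = A n j k (\<lambda>w. \<zeta> m w - G w)"
              using \<zeta>m(2) G(2) by (intro A_diff[OF compact_Un[OF K(1) K']] cont[OF \<zeta>m(1)] G(1)) auto
            also have "cmod \<dots> \<le> C * \<delta>"
              using less_imp_le[OF M[OF that]] \<zeta>m(2) G(2) by (intro C(2) continuous_on_diff cont[OF \<zeta>m(1)] G(1)) auto
            finally show ?thesis .
          qed
          moreover have "(\<lambda>n. cmod (A n j k (\<zeta> m) - A n j k G)) \<longlonglongrightarrow> cmod (T (\<zeta> m) - L)"
            by (intro tendsto_norm tendsto_diff T \<zeta>m L)
          ultimately have "cmod (T (\<zeta> m) - L) \<le> C * \<delta>"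
            by (intro LIMSEQ_le_const2) auto
          also have "\<dots> \<le> (C + 1) * \<delta>"
            using \<open>\<delta> > 0\<close> by (simp add: algebra_simps)
          also have "\<dots> = \<epsilon> / 2"
            using C(1) by (simp add: \<delta>_def field_simps)
          also have "\<dots> < \<epsilon>"
            using \<open>\<epsilon> > 0\<close> by simp
          finally show ?thesis .
        qed
        then show "\<exists>M. \<forall>m\<ge>M. cmod (T (\<zeta> m) - L) < \<epsilon>"
          by blast
      qed
    qed
    then have *: "(\<lambda>m. T (\<eta> m)) \<longlonglongrightarrow> L"
      using K(1) \<eta> \<eta>0 unif by blast
    fix L'
    assume "\<forall>\<eta> K. compact K \<and> (\<forall>m. test_function (\<eta> m) \<and> (\<forall>w. w \<notin> K \<longrightarrow> \<eta> m w = 0)) \<and>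
        uniform_limit UNIV \<eta> G sequentially \<longrightarrow> (\<lambda>m. T (\<eta> m)) \<longlonglongrightarrow> L'"
    then have "(\<lambda>m. T (\<eta> m)) \<longlonglongrightarrow> L'"
      using K(1) \<eta> \<eta>0 unif by blast
    then show "L' = L"
      using * by (rule LIMSEQ_unique)
  qed
  then show ?thesis
    using L by (simp add: G_def[abs_def])
qed

text \<open>
  Testing the equation \<open>T = dd^c g\<close> on \<open>u\<^sub>n dd^c \<phi>\<close> replaces the given potential \<open>g\<close> by the
  approximations \<open>u\<^sub>n\<close>, so that \<open>g\<close> need not be compared with their limit.
\<close>

lemma MA_diagonal_tendsto:
  fixes g :: "complex ^ 2 \<Rightarrow> real"
  assumes T: "\<And>j k \<eta>. test_function \<eta> \<Longrightarrow> (\<lambda>n. A n j k \<eta>) \<longlonglongrightarrow> T j k \<eta>"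
    and g: "continuous_on UNIV g"
    and Tg: "\<And>j k \<eta>. test_function \<eta> \<Longrightarrow>
      T j k \<eta> = (\<integral>w. complex_of_real (g w) * complex_hessian \<eta> w $ j $ k \<partial>lborel)"
    and \<phi>: "test_function \<phi>"
  shows "(\<lambda>n. MA \<phi> n n) \<longlonglongrightarrow>
    mixed_sum (\<lambda>j k l m. order_zero_ext (T j k) (\<lambda>w. complex_of_real (g w) * complex_hessian \<phi> w $ l $ m))"
    (is "_ \<longlonglongrightarrow> ?S")
proof -
  let ?H = "\<lambda>w l m. complex_hessian \<phi> w $ l $ m"
  have t: "test_function (\<lambda>w. ?H w l m)" for l m
    by (rule test_function_hessian[OF \<phi>])
  have tu: "test_function (\<lambda>w. u n w * ?H w l m)" for n l m
    by (rule test_function_mult[OF t smooth_u])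
  have \<phi>s: "smooth \<phi>"
    using \<phi> by (simp add: test_function_iff)
  define R where "R n = mixed_sum (\<lambda>j k l m. T j k (\<lambda>w. u n w * ?H w l m))" for n
  have "mixed_sum (\<lambda>j k l m. A n j k (\<lambda>w. complex_of_real (g w) * ?H w l m)) = R n" for n
  proof -
    have i: "integrable lborel (\<lambda>w. complex_of_real (g w) * complex_hessian (\<lambda>w. u n w * ?H w l m) w $ j $ k)" for j k l m
      by (intro integrable_continuous_test test_function_hessian tu continuous_intros g)
    have "mixed_sum (\<lambda>j k l m. A n j k (\<lambda>w. complex_of_real (g w) * ?H w l m)) =
      (\<integral>w. complex_of_real (g w) * mixed_disc (complex_hessian (u n) w) (complex_hessian \<phi> w) \<partial>lborel)"
      by (rule mixed_sum_A[OF \<phi>, symmetric]) (intro continuous_intros g)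
    also have "\<dots> = R n"
      unfolding mixed_disc_hessian[OF smooth_u \<phi>s, symmetric] R_def mixed_sum_def Tg[OF tu]
      using i by (simp add: distrib_left right_diff_distrib)
    finally show ?thesis .
  qed
  then have R: "R \<longlonglongrightarrow> ?S"
    using tendsto_mixed_sum[of "\<lambda>n j k l m. A n j k (\<lambda>w. complex_of_real (g w) * ?H w l m)", OF order_zero_ext_tendsto[OF T g t]]
    by simp
  obtain C where "is_mixed_bound \<phi> C"
    using mixed_sum_A_bound[OF \<phi>] ..
    note C = this[unfolded is_mixed_bound_def, THEN conjunct1] this[unfolded is_mixed_bound_def, THEN conjunct2, rule_format]
  show ?thesis
  proof (rule LIMSEQ_I)
    fix \<epsilon> :: real assume "\<epsilon> > 0"
    have "(\<lambda>n. C * e n) \<longlonglongrightarrow> C * 0"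
      by (intro tendsto_mult tendsto_const e_tendsto)
    then have "eventually (\<lambda>n. C * e n < \<epsilon> / 3) sequentially"
      using \<open>\<epsilon> > 0\<close> by (intro order_tendstoD(2)) auto
    moreover have "eventually (\<lambda>n. dist (R n) ?S < \<epsilon> / 3) sequentially"
      using tendstoD[OF R, of "\<epsilon> / 3"] \<open>\<epsilon> > 0\<close> by simp
    ultimately have "eventually (\<lambda>n. C * e n < \<epsilon> / 3 \<and> dist (R n) ?S < \<epsilon> / 3) sequentially"
      by (rule eventually_conj)
    then obtain n where n: "C * e n < \<epsilon> / 3" "cmod (R n - ?S) < \<epsilon> / 3"
      by (auto simp: eventually_sequentially dist_norm)
    \<comment> \<open>The index \<open>n\<close> of the undifferentiated potential is frozen from
      here on; only the index \<open>q\<close> of the differentiated one grows. Replacing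
      \<open>u q\<close> by \<open>u n\<close> costs \<open>C * e n\<close>, which is already
      small.\<close>
    define B where "B q = mixed_sum (\<lambda>j k l m. A q j k (\<lambda>w. u n w * ?H w l m))" for q
    have "B \<longlonglongrightarrow> R n"
      unfolding B_def R_def by (intro tendsto_mixed_sum T tu)
    then obtain M where M: "\<And>q. q \<ge> M \<Longrightarrow> cmod (B q - R n) < \<epsilon> / 3"
      using LIMSEQ_D[of B "R n" "\<epsilon> / 3"] \<open>\<epsilon> > 0\<close> by (metis divide_pos_pos zero_less_numeral)
    have "cmod (MA \<phi> q q - ?S) < \<epsilon>" if "q \<ge> max M n" for q
    proof -
      have "cmod (MA \<phi> q q - B q) \<le> C * e n"
        unfolding MA_eq[OF \<phi>] B_def using cauchy_u[of n q] that
        by (intro C(2) smooth_imp_continuous smooth_u) auto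
      moreover have "cmod (x - z) \<le> cmod (x - y) + cmod (y - y') + cmod (y' - z)" for x y y' z :: complex
        using norm_triangle_ineq[of "(x - y) + (y - y')" "y' - z"] norm_triangle_ineq[of "x - y" "y - y'"] by simp
      then have "cmod (MA \<phi> q q - ?S) \<le> cmod (MA \<phi> q q - B q) + cmod (B q - R n) + cmod (R n - ?S)" .
      ultimately show ?thesis
        using M[of q] n that by simp
    qed
    then show "\<exists>M. \<forall>q\<ge>M. cmod (MA \<phi> q q - ?S) < \<epsilon>"
      by blast
  qed
qed

end

section \<open>The Green current of an endomorphism\<close>

lemma qform_scale: "qform (\<chi> j k. c * M $ j $ k) v = c * qform M v"
  by (simp add: qform_def sum_distrib_left mult_ac)

lemma hessian_cmult:
  assumes "smooth h"
  shows "complex_hessian (\<lambda>w. c * h w) w $ j $ k = c * complex_hessian h w $ j $ k"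
proof -
  have "dzbar k (\<lambda>w. c * h w) = (\<lambda>w. c * dzbar k h w)"
    using assms by (auto simp: dzbar_mult smooth_differentiable)
  then show ?thesis
    using assms by (simp add: hessian_nth dz_mult smooth_differentiable smooth_dzbar)
qed

lemma continuous_on_vecI:
  fixes h :: "'a :: topological_space \<Rightarrow> complex ^ 'n"
  shows "(\<And>i. continuous_on S (\<lambda>x. h x $ i)) \<Longrightarrow> continuous_on S h"
  using continuous_on_vec_lambda[of S "\<lambda>i x. h x $ i"] by (simp add: vec_lambda_eta)

lemma continuous_on_chart: "continuous_on UNIV (chart i)"
proof (rule continuous_on_open_vimage[THEN iffD2, OF open_UNIV, rule_format])
  fix V :: "cp2 set" assume "open V"
  then have "open {z. z \<noteq> 0 \<and> proj z \<in> V}"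
    by (simp add: open_cp2_def)
  moreover have "continuous_on UNIV (affine_lift i)"
    by (intro continuous_on_vecI poly_fun_continuous poly_fun_affine_lift)
  ultimately have "open (affine_lift i -` {z. z \<noteq> 0 \<and> proj z \<in> V})"
    by (rule open_vimage)
  moreover have "chart i -` V = affine_lift i -` {z. z \<noteq> 0 \<and> proj z \<in> V}"
    using affine_lift_nonzero by (auto simp: chart_def)
  ultimately show "open (chart i -` V \<inter> UNIV)"
    by simp
qed

locale lifted_endomorphism =
  fixes f :: "cp2 \<Rightarrow> cp2" and d :: nat and F :: "complex ^ 3 \<Rightarrow> complex ^ 3"
  assumes d_ge_2: "d \<ge> 2"
    and homogeneous_F: "homogeneous_poly d (\<lambda>z. F z $ i)"
    and F_eq_0: "F z = 0 \<Longrightarrow> z = 0"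
    and f_proj: "z \<noteq> 0 \<Longrightarrow> f (proj z) = proj (F z)"
begin

lemma d_pos: "d > 0" "real d > 0" "real d \<ge> 2"
  using d_ge_2 by auto

lemma F_scale: "F (c *s z) = c ^ d *s F z"
  using homogeneous_poly_scale[OF homogeneous_F] by (simp add: vec_eq_iff)

lemma iter_nonzero: "z \<noteq> 0 \<Longrightarrow> (F ^^ n) z \<noteq> 0"
  by (induction n) (auto dest: F_eq_0)

lemma iter_proj: "z \<noteq> 0 \<Longrightarrow> (f ^^ n) (proj z) = proj ((F ^^ n) z)"
  by (induction n) (auto simp: f_proj iter_nonzero)

lemma poly_fun_iter: "poly_fun (\<lambda>z. (F ^^ n) z $ s)"
proof (induction n arbitrary: s)
  case (Suc n)
  then show ?case
    using poly_fun_compose[OF homogeneous_imp_poly_fun[OF homogeneous_F], of "F ^^ n" s] by simp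
qed (auto intro: poly_fun.intros)

lemma continuous_on_F: "continuous_on S F"
  by (intro continuous_on_vecI poly_fun_continuous homogeneous_imp_poly_fun[OF homogeneous_F])

text \<open>The extrema on the unit sphere, spread by homogeneity; the minimum is positive because
  \<open>F\<close> vanishes only at the origin.\<close>

lemma norm_F_bounds:
  obtains c C where "c > 0" "C > 0" "\<And>z. c * norm z ^ d \<le> norm (F z)" "\<And>z. norm (F z) \<le> C * norm z ^ d"
proof -
  let ?S = "sphere 0 1 :: (complex ^ 3) set"
  have cont: "continuous_on ?S (\<lambda>z. norm (F z))"
    by (intro continuous_on_norm continuous_on_F)
  have ne: "?S \<noteq> {}"
    using norm_sgn[of "axis 1 1 :: complex ^ 3"] by (auto simp: axis_eq_0_iff)
  obtain a where a: "a \<in> ?S" "\<And>z. z \<in> ?S \<Longrightarrow> norm (F a) \<le> norm (F z)"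
    using continuous_attains_inf[OF compact_sphere ne cont] by blast
  obtain b where b: "b \<in> ?S" "\<And>z. z \<in> ?S \<Longrightarrow> norm (F z) \<le> norm (F b)"
    using continuous_attains_sup[OF compact_sphere ne cont] by blast
  have *: "norm (F z) = norm z ^ d * norm (F (complex_of_real (1 / norm z) *s z))"
    and in_S: "complex_of_real (1 / norm z) *s z \<in> ?S" if "z \<noteq> 0" for z
  proof -
    show "complex_of_real (1 / norm z) *s z \<in> ?S"
      using that by (simp add: norm_scale_vec norm_divide)
    show "norm (F z) = norm z ^ d * norm (F (complex_of_real (1 / norm z) *s z))"
      unfolding F_scale norm_scale_vec using that by (simp add: norm_power norm_divide power_divide)
  qed
  show thesis
  proof (rule that[of "norm (F a)" "norm (F b)"])
    have "a \<noteq> 0" "b \<noteq> 0"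
      using a b by auto
    then show "norm (F a) > 0" "norm (F b) > 0"
      using F_eq_0 by auto
    fix z
    show "norm (F a) * norm z ^ d \<le> norm (F z)"
    proof (cases "z = 0")
      case True
      then show ?thesis
        using d_pos by (simp add: power_0_left)
    next
      case False
      then show ?thesis
        using a(2)[OF in_S[OF False]] by (subst *[OF False]) (simp add: mult.commute mult_left_mono)
    qed
    show "norm (F z) \<le> norm (F b) * norm z ^ d"
    proof (cases "z = 0")
      case True
      then have "F z = 0"
        using F_scale[of 0 z] d_pos by (simp add: power_0_left)
      then show ?thesis
        by simp
    next
      case False
      then show ?thesis
        using b(2)[OF in_S[OF False]] by (subst *[OF False]) (simp add: mult.commute mult_left_mono)
    qed
  qed
qed

lemma log_norm_F_bound:
  obtains C where "C \<ge> 0" "\<And>z. z \<noteq> 0 \<Longrightarrow> \<bar>ln (norm (F z)) - real d * ln (norm z)\<bar> \<le> C"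
proof -
  obtain c C where c: "c > 0" "C > 0" "\<And>z. c * norm z ^ d \<le> norm (F z)" "\<And>z. norm (F z) \<le> C * norm z ^ d"
    using norm_F_bounds by blast
  show thesis
  proof (rule that[of "\<bar>ln c\<bar> + \<bar>ln C\<bar>"])
    fix z :: "complex ^ 3" assume z: "z \<noteq> 0"
    then have "F z \<noteq> 0"
      using F_eq_0 by blast
    have "ln (c * norm z ^ d) \<le> ln (norm (F z))" "ln (norm (F z)) \<le> ln (C * norm z ^ d)"
      using c z \<open>F z \<noteq> 0\<close> by (simp_all add: ln_mono)
    moreover have "ln (c * norm z ^ d) = ln c + real d * ln (norm z)" "ln (C * norm z ^ d) = ln C + real d * ln (norm z)"
      using c z by (simp_all add: ln_mult_pos ln_realpow)
    ultimately show "\<bar>ln (norm (F z)) - real d * ln (norm z)\<bar> \<le> \<bar>ln c\<bar> + \<bar>ln C\<bar>"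
      by linarith
  qed simp
qed

definition lift_iter :: "3 \<Rightarrow> nat \<Rightarrow> complex ^ 2 \<Rightarrow> complex ^ 3" where
  "lift_iter i n w = (F ^^ n) (affine_lift i w)"

lemma lift_iter_nonzero: "lift_iter i n w \<noteq> 0"
  unfolding lift_iter_def by (intro iter_nonzero affine_lift_nonzero)

lemma poly_fun_lift_iter: "poly_fun (\<lambda>w. lift_iter i n w $ s)"
  unfolding lift_iter_def by (rule poly_fun_compose[OF poly_fun_iter poly_fun_affine_lift])

lemma proj_lift_iter: "proj (lift_iter i n w) = (f ^^ n) (chart i w)"
  unfolding lift_iter_def chart_def by (rule iter_proj[symmetric]) (rule affine_lift_nonzero)

definition potential :: "3 \<Rightarrow> nat \<Rightarrow> complex ^ 2 \<Rightarrow> complex" where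
  "potential i n w = complex_of_real (1 / real d ^ n) * log_norm (lift_iter i n) w"

lemma pullback_fs_iter: "pullback_fs (f ^^ n) i w = complex_hessian (log_norm (lift_iter i n)) w"
  using pullback_fs_eq[of "F ^^ n" "f ^^ n", OF poly_fun_iter iter_nonzero iter_proj]
  by (simp add: lift_iter_def[abs_def])

lemma smooth_log_norm_lift: "smooth (log_norm (lift_iter i n))"
  by (rule smooth_log_norm[OF poly_fun_lift_iter lift_iter_nonzero])

lemma hessian_potential:
  "complex_hessian (potential i n) w $ j $ k = complex_of_real (1 / real d ^ n) * complex_hessian (log_norm (lift_iter i n)) w $ j $ k"
  unfolding potential_def[abs_def] by (rule hessian_cmult[OF smooth_log_norm_lift])

lemma potential_step:
  obtains C where "C \<ge> 0" "\<And>i n w. cmod (potential i (Suc n) w - potential i n w) \<le> C / real d ^ Suc n"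
proof -
  obtain C where C: "C \<ge> 0" "\<And>z. z \<noteq> 0 \<Longrightarrow> \<bar>ln (norm (F z)) - real d * ln (norm z)\<bar> \<le> C"
    using log_norm_F_bound by blast
  show thesis
  proof (rule that[OF C(1)])
    fix i n w
    have "potential i (Suc n) w - potential i n w =
        complex_of_real ((ln (norm (F (lift_iter i n w))) - real d * ln (norm (lift_iter i n w))) / real d ^ Suc n)"
      using d_pos by (simp add: potential_def log_norm_def lift_iter_def field_simps)
    then have "cmod (potential i (Suc n) w - potential i n w) =
        \<bar>ln (norm (F (lift_iter i n w))) - real d * ln (norm (lift_iter i n w))\<bar> / real d ^ Suc n"
      using d_pos by (simp only: norm_of_real) simp
    also have "\<dots> \<le> C / real d ^ Suc n"
      using C(2)[OF lift_iter_nonzero] d_pos by (intro divide_right_mono) auto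
    finally show "cmod (potential i (Suc n) w - potential i n w) \<le> C / real d ^ Suc n" .
  qed
qed

lemma psh_sequence_potential:
  obtains C where "C \<ge> 0" "\<And>i. psh_sequence (potential i) (\<lambda>n. C / real d ^ n)"
proof -
  obtain C where C: "C \<ge> 0" "\<And>i n w. cmod (potential i (Suc n) w - potential i n w) \<le> C / real d ^ Suc n"
    using potential_step by blast
  \<comment> \<open>The subtracted term lets the induction close: as \<open>d\<close> is at least 2,
    the next increment C / d^(m+1) is at most C / d^m - C / d^(m+1).\<close>
  have tel: "cmod (potential i (n + k) w - potential i n w) \<le> C / real d ^ n - C / real d ^ (n + k)" for i n k w
  proof (induction k)
    case (Suc k)
    have "2 * (C / real d ^ Suc (n + k)) \<le> C / real d ^ (n + k)"
      using C(1) d_pos by (simp add: field_simps mult_left_mono)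
    then show ?case
      using Suc C(2)[of i "n + k" w]
        norm_triangle_ineq[of "potential i (Suc (n + k)) w - potential i (n + k) w" "potential i (n + k) w - potential i n w"]
      by simp
  qed simp
  show thesis
  proof (rule that[OF C(1)])
    fix i
    show "psh_sequence (potential i) (\<lambda>n. C / real d ^ n)"
    proof
      show "smooth (potential i n)" for n
        unfolding potential_def[abs_def] by (intro smooth_intros smooth_log_norm_lift)
      show "psd (complex_hessian (potential i n) w)" for n w
      proof -
        have "complex_hessian (potential i n) w = (\<chi> j k. complex_of_real (1 / real d ^ n) * complex_hessian (log_norm (lift_iter i n)) w $ j $ k)"
          by (simp add: vec_eq_iff hessian_potential)
        then show ?thesis
          using psd_hessian_log_norm[OF poly_fun_lift_iter lift_iter_nonzero, of i n w] d_pos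
          by (simp only: psd_def qform_scale) (simp add: mult_nonneg_nonneg)
      qed
      show "cmod (potential i m w - potential i n w) \<le> C / real d ^ n" if "n \<le> m" for m n w
      proof -
        have "C / real d ^ m \<ge> 0"
          using C(1) d_pos by simp
        then show ?thesis
          using tel[of i n "m - n" w] that by simp
      qed
      have "(\<lambda>n. C * inverse (real d) ^ n) \<longlonglongrightarrow> C * 0"
        using d_pos by (intro tendsto_mult tendsto_const LIMSEQ_power_zero) (simp add: field_simps)
      then show "(\<lambda>n. C / real d ^ n) \<longlonglongrightarrow> 0"
        by (simp add: divide_inverse power_inverse)
    qed
  qed
qed

text \<open>The bump is supported in a chart neighbourhood of \<mu>-measure 0. By the defining
  equation of the Green measure the wedge square vanishes on it, so the diagonal masses tend to 0
  and \<open>MA_bound\<close> applies with \<open>e n = C0 / d^n\<close>. Undoing the normalization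
  by d^m d^n exchanges the two summands and leaves d^m + d^n instead of the expected
  d^(m+n).\<close>

lemma local_mass_bound:
  assumes \<mu>: "green_measure f d \<mu>" and x: "chart i a \<notin> measure_support \<mu>"
  obtains r C where "r > 0" "C \<ge> 0"
    "\<exists>\<theta>. test_function (\<lambda>w. complex_of_real (\<theta> w)) \<and> (\<forall>w. \<theta> w \<ge> 0) \<and> (\<forall>w\<in>cball a r. \<theta> w = 1) \<and>
      (\<forall>m n. cmod (\<integral>w. complex_of_real (\<theta> w) * mixed_disc (complex_hessian (log_norm (lift_iter i m)) w)
          (complex_hessian (log_norm (lift_iter i n)) w) \<partial>lborel) \<le> C * (real d ^ m + real d ^ n))"
proof -
  obtain V where V: "open V" "chart i a \<in> V" "emeasure \<mu> V = 0"
    using x by (auto simp: measure_support_def)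
  have "open (chart i -` V)"
    by (rule open_vimage[OF V(1) continuous_on_chart])
  then obtain R where R: "R > 0" "ball a R \<subseteq> chart i -` V"
    using V(2) by (auto elim: openE)
  obtain \<theta> where \<theta>: "test_function (\<lambda>w. complex_of_real (\<theta> w))" "\<And>w. \<theta> w \<ge> 0"
      "\<And>w. w \<in> cball a (R / 2) \<Longrightarrow> \<theta> w = 1" "\<And>w. w \<notin> ball a R \<Longrightarrow> \<theta> w = 0"
    using exists_bump[of "R / 2" R a] R(1) by auto
  define \<phi> where "\<phi> w = complex_of_real (\<theta> w)" for w
  have \<phi>: "test_function \<phi>"
    unfolding \<phi>_def by (rule \<theta>(1))
  obtain T G where T: "green_current f d T" "continuous_on UNIV G" "has_potential T G"
    and W: "\<And>i \<phi>. test_function \<phi> \<Longrightarrow> (LINT x : range (chart i) | \<mu>. \<phi> (coords i x)) = wedge_square T G i \<phi>"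
    and sets: "sets \<mu> = sets borel"
    using \<mu> by (auto simp: green_measure_def)
  have "AE x in \<mu>. x \<notin> V"
    using V(1,3) sets by (intro AE_not_in) (auto simp: null_sets_def)
  then have "AE x in \<mu>. indicator (range (chart i)) x *\<^sub>R \<phi> (coords i x) = 0"
  proof eventually_elim
    case (elim x)
    have "\<theta> w = 0" if "x = chart i w" for w
      using elim that R(2) by (intro \<theta>(4)) auto
    then show ?case
      by (auto simp: indicator_def \<phi>_def)
  qed
  then have "(LINT x : range (chart i) | \<mu>. \<phi> (coords i x)) = 0"
    unfolding set_lebesgue_integral_def by (rule integral_eq_zero_AE)
  then have W0: "wedge_square T G i \<phi> = 0"
    using W[OF \<phi>] by simp
  obtain C0 where C0: "C0 \<ge> 0" "\<And>i. psh_sequence (potential i) (\<lambda>n. C0 / real d ^ n)"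
    using psh_sequence_potential by blast
  interpret psh_sequence "potential i" "\<lambda>n. C0 / real d ^ n"
    by (rule C0(2))
  define g where "g w = fs_potential w + G (chart i w)" for w
  have "continuous_on UNIV fs_potential"
    unfolding fs_potential_def[abs_def]
    by (intro continuous_intros) (auto simp: add_pos_nonneg less_imp_neq[symmetric])
  then have g: "continuous_on UNIV g"
    unfolding g_def using continuous_on_compose2[OF T(2) continuous_on_chart[of i]]
    by (intro continuous_on_add) auto
  have A: "A n j k \<eta> = (1 / of_nat d ^ n) * (\<integral>w. pullback_fs (f ^^ n) i w $ j $ k * \<eta> w \<partial>lborel)" for n j k \<eta>
    unfolding A_def hessian_potential pullback_fs_iter by (simp add: mult.assoc)
  have lim: "(\<lambda>n. A n j k \<eta>) \<longlonglongrightarrow> T i j k \<eta>" if "test_function \<eta>" for j k \<eta>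
    using T(1) that unfolding green_current_def A by blast
  have pot: "T i j k \<eta> = (\<integral>w. complex_of_real (g w) * complex_hessian \<eta> w $ j $ k \<partial>lborel)"
    if "test_function \<eta>" for j k \<eta>
    using T(3) that by (simp add: has_potential_def local_potential_def g_def)
  have "wedge_square T G i \<phi> = 4 / of_real (pi\<^sup>2) *
      mixed_sum (\<lambda>j k l m. order_zero_ext (T i j k) (\<lambda>w. complex_of_real (g w) * complex_hessian \<phi> w $ l $ m))"
    by (simp add: wedge_square_def mixed_sum_def local_potential_def g_def)
  then have "mixed_sum (\<lambda>j k l m. order_zero_ext (T i j k) (\<lambda>w. complex_of_real (g w) * complex_hessian \<phi> w $ l $ m)) = 0"
    using W0 by simp
  then have "(\<lambda>n. MA \<phi> n n) \<longlonglongrightarrow> 0"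
    using MA_diagonal_tendsto[OF lim g pot \<phi>] by simp
  then obtain C where C: "C \<ge> 0" "\<And>i j. cmod (MA \<phi> i j) \<le> C * (C0 / real d ^ i + C0 / real d ^ j)"
    using MA_bound[OF \<phi>] by blast
  show thesis
  proof (rule that[of "R / 2" "C * C0"])
    have "cmod (\<integral>w. \<phi> w * mixed_disc (complex_hessian (log_norm (lift_iter i m)) w)
          (complex_hessian (log_norm (lift_iter i n)) w) \<partial>lborel) \<le> C * C0 * (real d ^ m + real d ^ n)" for m n
    proof -
      let ?I = "\<integral>w. \<phi> w * mixed_disc (complex_hessian (log_norm (lift_iter i m)) w)
          (complex_hessian (log_norm (lift_iter i n)) w) \<partial>lborel"
      have "MA \<phi> m n = (\<integral>w. complex_of_real (1 / (real d ^ m * real d ^ n)) * (\<phi> w * mixed_disc (complex_hessian (log_norm (lift_iter i m)) w)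
          (complex_hessian (log_norm (lift_iter i n)) w)) \<partial>lborel)"
        unfolding MA_def mixed_disc_def hessian_potential using d_pos
        by (intro Bochner_Integration.integral_cong refl) (simp add: field_simps)
      then have "MA \<phi> m n = complex_of_real (1 / (real d ^ m * real d ^ n)) * ?I"
        by simp
      then have "cmod (MA \<phi> m n) = cmod ?I / (real d ^ m * real d ^ n)"
        by (simp add: norm_mult norm_divide norm_power)
      then have "cmod ?I / (real d ^ m * real d ^ n) \<le> C * (C0 / real d ^ m + C0 / real d ^ n)"
        using C(2)[of m n] by simp
      then show ?thesis
        using d_pos by (simp add: field_simps)
    qed
    then show "\<exists>\<theta>. test_function (\<lambda>w. complex_of_real (\<theta> w)) \<and> (\<forall>w. \<theta> w \<ge> 0) \<and> (\<forall>w\<in>cball a (R / 2). \<theta> w = 1) \<and>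
      (\<forall>m n. cmod (\<integral>w. complex_of_real (\<theta> w) * mixed_disc (complex_hessian (log_norm (lift_iter i m)) w)
          (complex_hessian (log_norm (lift_iter i n)) w) \<partial>lborel) \<le> C * C0 * (real d ^ m + real d ^ n))"
      using \<theta> unfolding \<phi>_def by (intro exI[of _ \<theta>]) auto
  qed (use R C C0 in auto)
qed

end

section \<open>A lower bound for Monge-Ampere masses\<close>

subsection \<open>Volumes in the complex plane\<close>

lemma lborel_complex2:
  "lborel = distr (lborel \<Otimes>\<^sub>M lborel) borel (\<lambda>(x, y). vector [x, y] :: complex ^ 2)"
proof (rule lborel_eqI)
  let ?v = "\<lambda>(x, y). vector [x, y] :: complex ^ 2"
  have "continuous_on UNIV ?v"
  proof -
    have "?v = (\<lambda>p. \<chi> i. if i = 1 then fst p else snd p)"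
      by (auto simp: fun_eq_iff vec_eq_iff forall_2)
    moreover have "continuous_on UNIV (\<lambda>p. if i = 1 then fst p else snd p :: complex)" for i :: 2
      by (cases "i = 1") (auto intro: continuous_intros)
    ultimately show ?thesis
      by (simp add: continuous_on_vec_lambda)
  qed
  then have meas: "?v \<in> borel_measurable (lborel \<Otimes>\<^sub>M lborel)"
    by (simp add: lborel_prod borel_measurable_continuous_onI)
  fix l u :: "complex ^ 2"
  assume lu: "\<And>b. b \<in> Basis \<Longrightarrow> l \<bullet> b \<le> u \<bullet> b"
  have B: "(Basis :: (complex ^ 2) set) = {axis 1 1, axis 1 \<i>, axis 2 1, axis 2 \<i>}"
    by (auto simp: Basis_vec_def Basis_complex_def UNIV_2)
  have ip: "x \<bullet> axis j 1 = Re (x $ j)" "x \<bullet> axis j \<i> = Im (x $ j)" for x :: "complex ^ 2" and j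
    by (simp_all add: inner_axis inner_complex_def)
  have box: "?v -` box l u = box (l $ 1) (u $ 1) \<times> box (l $ 2) (u $ 2)"
    by (auto simp: box_def B ip Basis_complex_def inner_complex_def)
  have le: "Re (l $ j) \<le> Re (u $ j)" "Im (l $ j) \<le> Im (u $ j)" for j
    using lu[of "axis j 1"] lu[of "axis j \<i>"] exhaust_2[of j] by (auto simp: B ip)
  have c: "emeasure lborel (box (l $ j) (u $ j)) = ennreal ((Re (u $ j) - Re (l $ j)) * (Im (u $ j) - Im (l $ j)))" for j
    using le by (subst emeasure_lborel_box)
      (auto simp: Basis_complex_def inner_complex_def prod.insert_if complex_eq_iff)
  have "emeasure (distr (lborel \<Otimes>\<^sub>M lborel) borel ?v) (box l u) = emeasure (lborel \<Otimes>\<^sub>M lborel) (?v -` box l u)"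
    using meas by (subst emeasure_distr) (auto simp: space_pair_measure)
  also have "\<dots> = emeasure lborel (box (l $ 1) (u $ 1)) * emeasure lborel (box (l $ 2) (u $ 2))"
    unfolding box by (rule lborel.emeasure_pair_measure_Times) auto
  also have "\<dots> = ennreal (\<Prod>b\<in>Basis. (u - l) \<bullet> b)"
    unfolding c using le
    by (simp add: B ip prod.insert_if axis_eq_axis ennreal_mult'[symmetric] inner_diff_left mult.assoc)
  finally show "emeasure (distr (lborel \<Otimes>\<^sub>M lborel) borel ?v) (box l u) = ennreal (\<Prod>b\<in>Basis. (u - l) \<bullet> b)" .
qed simp

text \<open>Fubini: in each slice with fixed second coordinate the shear is a translation.\<close>

lemma emeasure_sheared_box:
  fixes c :: complex
  assumes "S1 \<in> sets borel" "S2 \<in> sets borel"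
  shows "emeasure lborel {v :: complex ^ 2. v $ 1 + c * v $ 2 \<in> S1 \<and> v $ 2 \<in> S2} = emeasure lborel S1 * emeasure lborel S2"
proof -
  let ?E = "{v :: complex ^ 2. v $ 1 + c * v $ 2 \<in> S1 \<and> v $ 2 \<in> S2}"
  let ?v = "\<lambda>(x, y). vector [x, y] :: complex ^ 2"
  have cont: "continuous_on UNIV (\<lambda>v :: complex ^ 2. v $ j)" for j
    by (intro continuous_intros)
  have cont1: "continuous_on UNIV (\<lambda>v :: complex ^ 2. v $ 1 + c * v $ 2)"
    by (intro continuous_intros)
  have E: "?E \<in> sets borel"
  proof -
    have "?E = (\<lambda>v. v $ 1 + c * v $ 2) -` S1 \<inter> (\<lambda>v. v $ 2) -` S2"
      by auto
    moreover have "(\<lambda>v :: complex ^ 2. v $ 1 + c * v $ 2) -` S1 \<in> sets borel" "(\<lambda>v :: complex ^ 2. v $ 2) -` S2 \<in> sets borel"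
      using measurable_sets[OF borel_measurable_continuous_onI[OF cont1] assms(1)]
        measurable_sets[OF borel_measurable_continuous_onI[OF cont[of 2]] assms(2)] by simp_all
    ultimately show ?thesis
      by simp
  qed
  have meas: "?v \<in> borel_measurable (lborel \<Otimes>\<^sub>M lborel)"
  proof -
    have "?v = (\<lambda>p. \<chi> i. if i = 1 then fst p else snd p)"
      by (auto simp: fun_eq_iff vec_eq_iff forall_2)
    moreover have "continuous_on UNIV (\<lambda>p. if i = 1 then fst p else snd p :: complex)" for i :: 2
      by (cases "i = 1") (auto intro: continuous_intros)
    ultimately have "continuous_on UNIV ?v"
      by (simp add: continuous_on_vec_lambda)
    then show ?thesis
      by (simp add: lborel_prod borel_measurable_continuous_onI)
  qed
  let ?P = "{p. fst p + c * snd p \<in> S1 \<and> snd p \<in> S2}"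
  have vE: "?v -` ?E = ?P"
    by (auto simp: case_prod_beta)
  have P: "?P \<in> sets (lborel \<Otimes>\<^sub>M lborel)"
    using measurable_sets[OF meas, of ?E] E vE by (simp add: space_pair_measure)
  have "emeasure lborel ?E = emeasure (lborel \<Otimes>\<^sub>M lborel) ?P"
    by (subst lborel_complex2, subst emeasure_distr[OF meas E], subst vE) (simp add: space_pair_measure)
  also have "\<dots> = (\<integral>\<^sup>+ y. emeasure lborel ((\<lambda>x. (x, y)) -` ?P) \<partial>lborel)"
    by (rule lborel_pair.emeasure_pair_measure_alt2[OF P])
  also have "\<dots> = (\<integral>\<^sup>+ y. emeasure lborel S1 * indicator S2 y \<partial>lborel)"
  proof (rule nn_integral_cong)
    fix y :: complex
    have "emeasure lborel ((\<lambda>x. c * y + x) -` S1) = emeasure (distr lborel borel ((+) (c * y))) S1"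
      using assms by (subst emeasure_distr) auto
    then have "emeasure lborel ((\<lambda>x. x + c * y) -` S1) = emeasure lborel S1"
      by (simp add: lborel_distr_plus add.commute)
    moreover have "(\<lambda>x. (x, y)) -` ?P = (if y \<in> S2 then (\<lambda>x. x + c * y) -` S1 else {})"
      by auto
    ultimately show "emeasure lborel ((\<lambda>x. (x, y)) -` ?P) = emeasure lborel S1 * indicator S2 y"
      by simp
  qed
  also have "\<dots> = emeasure lborel S1 * emeasure lborel S2"
    using assms by (simp add: nn_integral_cmult_indicator)
  finally show ?thesis .
qed

lemma open_qform_sublevel: "open {v. Re (qform M v) < r}"
  unfolding qform_def by (intro open_Collect_less continuous_intros)

text \<open>
  The ellipsoid contains the set where both terms of
  \<open>q(x, y) = a |x + (cnj c / a) y|\<^sup>2 + ((a b - |c|\<^sup>2) / a) |y|\<^sup>2\<close> are less than \<open>r / 2\<close>.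
\<close>

lemma ellipsoid_volume:
  assumes M: "M $ 1 $ 1 = complex_of_real a" "M $ 2 $ 2 = complex_of_real b"
    "M $ 1 $ 2 = c" "M $ 2 $ 1 = cnj c" and a: "a > 0" and D: "a * b - (cmod c)\<^sup>2 > 0" and r: "r > 0"
  shows "emeasure lborel {v. Re (qform M v) < r} \<ge> ennreal (r\<^sup>2 / (a * b - (cmod c)\<^sup>2))"
proof -
  let ?D = "a * b - (cmod c)\<^sup>2"
  \<comment> \<open>Half-sides of two squares. On a square of half-side x the squared modulus is
    below 2 x^2, and these values make each of the two terms of the form equal to r / 2 at that
    bound.\<close>
  define s t where "s = sqrt (r / (4 * a))" and "t = sqrt (r * a / (4 * ?D))"
  have st: "s > 0" "t > 0" "s\<^sup>2 = r / (4 * a)" "t\<^sup>2 = r * a / (4 * ?D)"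
    using a D r by (simp_all add: s_def t_def)
  define S where "S x = box (Complex (- x) (- x)) (Complex x x)" for x :: real
  have S: "z \<in> S x \<longleftrightarrow> \<bar>Re z\<bar> < x \<and> \<bar>Im z\<bar> < x" for z x
    by (auto simp: S_def box_def Basis_complex_def inner_complex_def)
  have Sm: "(cmod z)\<^sup>2 < 2 * x\<^sup>2" if "z \<in> S x" for z x
  proof -
    have "(Re z)\<^sup>2 < x\<^sup>2" "(Im z)\<^sup>2 < x\<^sup>2"
      using that power_strict_mono[of "\<bar>Re z\<bar>" x 2] power_strict_mono[of "\<bar>Im z\<bar>" x 2]
      unfolding S by simp_all
    then show ?thesis
      by (simp add: cmod_power2)
  qed
  have eS: "emeasure lborel (S x) = ennreal (4 * x\<^sup>2)" if "x > 0" for x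
    using that unfolding S_def
    by (subst emeasure_lborel_box) (auto simp: Basis_complex_def inner_complex_def prod.insert_if complex_eq_iff power2_eq_square)
  let ?E = "{v :: complex ^ 2. v $ 1 + cnj c / a * v $ 2 \<in> S s \<and> v $ 2 \<in> S t}"
  have q: "Re (qform M v) = a * (cmod (v $ 1 + cnj c / a * v $ 2))\<^sup>2 + ?D / a * (cmod (v $ 2))\<^sup>2" for v
  proof -
    have "complex_of_real (a * (cmod (v $ 1 + cnj c / a * v $ 2))\<^sup>2 + ?D / a * (cmod (v $ 2))\<^sup>2) = qform M v"
      using a unfolding of_real_add of_real_mult of_real_diff of_real_divide complex_norm_square qform_def sum_2 M
      by (simp add: field_simps)
    then show ?thesis
      by (metis Re_complex_of_real)
  qed
  have "?E \<subseteq> {v. Re (qform M v) < r}"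
  proof (clarify)
    fix v :: "complex ^ 2"
    assume v: "v $ 1 + cnj c / a * v $ 2 \<in> S s" "v $ 2 \<in> S t"
    have "a * (cmod (v $ 1 + cnj c / a * v $ 2))\<^sup>2 < a * (2 * s\<^sup>2)"
      using Sm[OF v(1)] a by (intro mult_strict_left_mono)
    moreover have "?D / a * (cmod (v $ 2))\<^sup>2 < ?D / a * (2 * t\<^sup>2)"
      using Sm[OF v(2)] a D by (intro mult_strict_left_mono) auto
    moreover have "a * (2 * s\<^sup>2) = r / 2" "?D / a * (2 * t\<^sup>2) = r / 2"
    proof -
      show "a * (2 * s\<^sup>2) = r / 2"
        using a by (simp add: st(3))
      have "D' / a * (2 * (r * a / (4 * D'))) = r / 2" if "D' > 0" for D'
        using that a by simp
      from this[OF D] show "?D / a * (2 * t\<^sup>2) = r / 2"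
        unfolding st(4) .
    qed
    ultimately show "Re (qform M v) < r"
      unfolding q by linarith
  qed
  then have "emeasure lborel ?E \<le> emeasure lborel {v. Re (qform M v) < r}"
    using open_qform_sublevel[of M r] by (intro emeasure_mono) auto
  moreover have "emeasure lborel ?E = ennreal (4 * s\<^sup>2) * ennreal (4 * t\<^sup>2)"
    using emeasure_sheared_box[of "S s" "S t" "cnj c / a"] by (simp add: eS st) (simp add: S_def)
  moreover have "ennreal (4 * s\<^sup>2) * ennreal (4 * t\<^sup>2) = ennreal (r\<^sup>2 / ?D)"
  proof -
    have "4 * (r / (4 * a)) * (4 * (r * a / (4 * D'))) = r\<^sup>2 / D'" if "D' > 0" for D'
      using that a by (simp add: power2_eq_square)
    from this[OF D] have "4 * s\<^sup>2 * (4 * t\<^sup>2) = r\<^sup>2 / ?D"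
      unfolding st(3,4) .
    then show ?thesis
      by (subst ennreal_mult[symmetric]) simp_all
  qed
  ultimately show ?thesis
    by simp
qed

subsection \<open>Sums of squared moduli of holomorphic functions\<close>

definition has_cderiv :: "(complex ^ 2 \<Rightarrow> complex) \<Rightarrow> (2 \<Rightarrow> complex) \<Rightarrow> complex ^ 2 \<Rightarrow> bool" where
  "has_cderiv h g w \<longleftrightarrow> (h has_derivative (\<lambda>v. \<Sum>j\<in>UNIV. g j * v $ j)) (at w)"

lemma
  assumes "has_cderiv h g w"
  shows has_cderiv_dz: "dz j h w = g j"
    and has_cderiv_dzbar: "dzbar j h w = 0"
    and has_cderiv_differentiable: "h differentiable (at w)"
proof -
  have D: "(h has_derivative (\<lambda>v. \<Sum>j\<in>UNIV. g j * v $ j)) (at w)"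
    using assms by (simp add: has_cderiv_def)
  have ax: "(\<Sum>k\<in>UNIV. g k * axis j c $ k) = g j * c" for j c
    by (simp add: axis_def if_distrib[of "\<lambda>x. _ * x"] cong: if_cong)
  show "dz j h w = g j" "dzbar j h w = 0"
    unfolding dz_eq[OF D] dzbar_eq[OF D] ax by (simp_all add: complex_eq_iff)
  show "h differentiable (at w)"
    using D by (auto simp: differentiable_def)
qed

lemma differentiable_cnj: "h differentiable (at w) \<Longrightarrow> (\<lambda>w. cnj (h w)) differentiable (at w)"
  unfolding differentiable_def using bounded_linear.has_derivative[OF bounded_linear_cnj] by blast

text \<open>Each \<open>z c\<close> is holomorphic, so in its squared modulus the operator
  \<open>dz\<close> sees only \<open>z c\<close> and \<open>dzbar\<close> only the
  conjugate.\<close>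

lemma
  fixes z :: "'c \<Rightarrow> complex ^ 2 \<Rightarrow> complex"
  assumes "finite J" and S: "open S" "w \<in> S"
    and z: "\<And>c x. c \<in> J \<Longrightarrow> x \<in> S \<Longrightarrow> has_cderiv (z c) (\<lambda>j. z' c j x) x"
    and z': "\<And>c j. c \<in> J \<Longrightarrow> \<exists>g. has_cderiv (z' c j) g w"
    and R: "\<And>x. x \<in> S \<Longrightarrow> R x = (\<Sum>c\<in>J. z c x * cnj (z c x))"
  shows dz_sum_squares: "dz j R w = (\<Sum>c\<in>J. z' c j w * cnj (z c w))"
    and dzbar_sum_squares: "dzbar j R w = (\<Sum>c\<in>J. z c w * cnj (z' c j w))"
    and hessian_sum_squares: "complex_hessian R w $ j $ k = (\<Sum>c\<in>J. z' c j w * cnj (z' c k w))"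
proof -
  have d: "z c differentiable (at x)" if "c \<in> J" "x \<in> S" for c x
    using has_cderiv_differentiable[OF z[OF that]] .
  have d': "z' c j differentiable (at w)" if "c \<in> J" for c j
    using z'[OF that, of j] has_cderiv_differentiable by blast
  have dm: "(\<lambda>x. z c x * cnj (z c x)) differentiable (at x)" if "c \<in> J" "x \<in> S" for c x
    by (intro differentiable_mult differentiable_cnj d that)
  have dz: "dz j R x = (\<Sum>c\<in>J. z' c j x * cnj (z c x))" if x: "x \<in> S" for j x
  proof -
    have "dz j R x = dz j (\<lambda>x. \<Sum>c\<in>J. z c x * cnj (z c x)) x"
      by (rule dz_cong(1)[OF S(1) x R])
    also have "\<dots> = (\<Sum>c\<in>J. dz j (\<lambda>x. z c x * cnj (z c x)) x)"
      by (rule dz_sum) (rule dm[OF _ x])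
    also have "\<dots> = (\<Sum>c\<in>J. z' c j x * cnj (z c x))"
      using x by (intro sum.cong refl)
        (simp add: dz_mult d differentiable_cnj dz_cnj has_cderiv_dz[OF z] has_cderiv_dzbar[OF z])
    finally show ?thesis .
  qed
  have dzbar: "dzbar j R x = (\<Sum>c\<in>J. z c x * cnj (z' c j x))" if x: "x \<in> S" for j x
  proof -
    have "dzbar j R x = dzbar j (\<lambda>x. \<Sum>c\<in>J. z c x * cnj (z c x)) x"
      by (rule dz_cong(2)[OF S(1) x R])
    also have "\<dots> = (\<Sum>c\<in>J. dzbar j (\<lambda>x. z c x * cnj (z c x)) x)"
      by (rule dzbar_sum) (rule dm[OF _ x])
    also have "\<dots> = (\<Sum>c\<in>J. z c x * cnj (z' c j x))"
      using x by (intro sum.cong refl)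
        (simp add: dzbar_mult d differentiable_cnj dzbar_cnj has_cderiv_dz[OF z] has_cderiv_dzbar[OF z])
    finally show ?thesis .
  qed
  show "dz j R w = (\<Sum>c\<in>J. z' c j w * cnj (z c w))" "dzbar j R w = (\<Sum>c\<in>J. z c w * cnj (z' c j w))"
    using dz dzbar S(2) by blast+
  have "complex_hessian R w $ j $ k = dz j (\<lambda>x. \<Sum>c\<in>J. z c x * cnj (z' c k x)) w"
    unfolding hessian_nth by (rule dz_cong(1)[OF S dzbar])
  also have "\<dots> = (\<Sum>c\<in>J. dz j (\<lambda>x. z c x * cnj (z' c k x)) w)"
    by (rule dz_sum) (intro differentiable_mult differentiable_cnj d d' S)
  also have "\<dots> = (\<Sum>c\<in>J. z' c j w * cnj (z' c k w))"
  proof (intro sum.cong refl)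
    fix c assume c: "c \<in> J"
    obtain g where "has_cderiv (z' c k) g w"
      using z'[OF c] by blast
    then have "dzbar j (z' c k) w = 0"
      by (rule has_cderiv_dzbar)
    then show "dz j (\<lambda>x. z c x * cnj (z' c k x)) w = z' c j w * cnj (z' c k w)"
      using c S(2) by (simp add: dz_mult d d' differentiable_cnj dz_cnj has_cderiv_dz[OF z])
  qed
  finally show "complex_hessian R w $ j $ k = (\<Sum>c\<in>J. z' c j w * cnj (z' c k w))" .
qed

lemma has_cderiv_ratio:
  fixes p q :: "complex ^ 2 \<Rightarrow> complex"
  assumes "poly_fun p" "poly_fun q" "q w \<noteq> 0"
  shows "has_cderiv (\<lambda>w. p w / q w + c) (\<lambda>j. (dz j p w * q w - p w * dz j q w) / (q w * q w)) w"
proof -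
  have "((\<lambda>w. p w / q w + c) has_derivative (\<lambda>v. ((\<Sum>k\<in>UNIV. dz k p w * v $ k) * q w - p w * (\<Sum>k\<in>UNIV. dz k q w * v $ k)) / (q w * q w))) (at w)"
    by (rule has_derivative_add_const[OF has_derivative_divide'[OF poly_fun_derivative[OF assms(1)] poly_fun_derivative[OF assms(2)] assms(3)]])
  moreover have "((\<Sum>k\<in>UNIV. dz k p w * v $ k) * q w - p w * (\<Sum>k\<in>UNIV. dz k q w * v $ k)) / (q w * q w)
      = (\<Sum>k\<in>UNIV. (dz k p w * q w - p w * dz k q w) / (q w * q w) * v $ k)" for v
    by (simp add: sum_2 diff_divide_distrib add_divide_distrib algebra_simps)
  ultimately show ?thesis
    by (simp add: has_cderiv_def)
qed

text \<open>Positivity of the Gram determinant of three vectors.\<close>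

lemma gram_inequality:
  fixes x y z :: "'c \<Rightarrow> complex" and J :: "'c set"
  defines "ip \<equiv> \<lambda>u v. \<Sum>c\<in>J. u c * cnj (v c)"
  assumes M: "M $ 1 $ 1 = ip x x" "M $ 1 $ 2 = ip x y" "M $ 2 $ 1 = ip y x" "M $ 2 $ 2 = ip y y"
    and N: "N $ 1 $ 1 = ip x z * ip z x" "N $ 1 $ 2 = ip x z * ip z y"
      "N $ 2 $ 1 = ip y z * ip z x" "N $ 2 $ 2 = ip y z * ip z y"
    and J: "finite J"
  shows "2 * Re (mixed_disc N M) \<le> Re (ip z z) * Re (mixed_disc M M)"
proof -
  have ip_cnj: "cnj (ip u v) = ip v u" for u v
    by (simp add: ip_def mult.commute)
  have ip_real: "ip u u = of_real (\<Sum>c\<in>J. (cmod (u c))\<^sup>2)" for u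
    by (simp add: ip_def complex_norm_square[symmetric])
  define A B r where "A = (\<Sum>c\<in>J. (cmod (x c))\<^sup>2)" and "B = (\<Sum>c\<in>J. (cmod (y c))\<^sup>2)" and "r = (\<Sum>c\<in>J. (cmod (z c))\<^sup>2)"
  define c p q where "c = ip x y" and "p = ip x z" and "q = ip y z"
  have ips: "ip x x = of_real A" "ip y y = of_real B" "ip z z = of_real r" "ip x y = c" "ip y x = cnj c"
    "ip x z = p" "ip z x = cnj p" "ip y z = q" "ip z y = cnj q"
    using ip_cnj by (simp_all add: ip_real A_def B_def r_def c_def p_def q_def)
  define D where "D = A * B - (cmod c)\<^sup>2"
  have Dc: "complex_of_real D = of_real A * of_real B - c * cnj c"
    unfolding D_def of_real_diff of_real_mult complex_norm_square ..
  define X Y where "X = of_real B * cnj p - cnj c * cnj q" and "Y = of_real A * cnj q - c * cnj p"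
  \<comment> \<open>By Cramer's rule \<open>V\<close> is \<open>D\<close> times the component of
    \<open>z\<close> orthogonal to \<open>x\<close> and \<open>y\<close>. Its squared norm is
    \<open>D * (D * r - W)\<close>, which gives the claim when \<open>D\<close> is positive; when
    \<open>D = 0\<close> this norm is 0, hence \<open>V\<close> and \<open>W\<close> vanish.\<close>
  define V where "V e = of_real D * z e - X * x e - Y * y e" for e
  have Vu: "ip V u = of_real D * ip z u - X * ip x u - Y * ip y u" for u
    by (simp add: ip_def V_def algebra_simps sum_subtractf sum_distrib_left sum.distrib)
  have Vx: "ip V x = 0" and Vy: "ip V y = 0"
    unfolding Vu ips X_def Y_def Dc by (simp_all add: algebra_simps)
  define W where "W = X * p + Y * q"
  have Vz: "ip V z = of_real (D * r) - W"
    unfolding Vu ips W_def by simp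
  have W_eq: "W = mixed_disc N M"
    unfolding W_def X_def Y_def mixed_disc_def M N ips by (simp add: algebra_simps)
  have D2: "mixed_disc M M = of_real (2 * D)"
    unfolding of_real_mult Dc mixed_disc_def M ips by (simp add: algebra_simps)
  have "ip V V = cnj (of_real D) * ip V z - cnj X * ip V x - cnj Y * ip V y"
  proof -
    have "ip V V = cnj (of_real D * ip z V - X * ip x V - Y * ip y V)"
      using Vu[of V] ip_cnj[of V V] by simp
    then show ?thesis
      by (simp add: ip_cnj)
  qed
  then have VV: "ip V V = of_real D * (of_real (D * r) - W)"
    using Vx Vy Vz by simp
  have "D \<ge> 0"
  proof -
    have "(cmod (\<Sum>e\<in>J. x e * cnj (y e)))\<^sup>2 \<le> A * B"
    proof -
      have "cmod (\<Sum>e\<in>J. x e * cnj (y e)) \<le> (\<Sum>e\<in>J. \<bar>cmod (x e)\<bar> * \<bar>cmod (y e)\<bar>)"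
        by (rule order_trans[OF norm_sum]) (simp add: norm_mult)
      also have "\<dots> \<le> L2_set (\<lambda>e. cmod (x e)) J * L2_set (\<lambda>e. cmod (y e)) J"
        by (rule L2_set_mult_ineq)
      also have "\<dots> = sqrt A * sqrt B"
        by (simp add: L2_set_def A_def B_def)
      finally have "cmod (\<Sum>e\<in>J. x e * cnj (y e)) \<le> sqrt (A * B)"
        by (simp add: real_sqrt_mult)
      then have "(cmod (\<Sum>e\<in>J. x e * cnj (y e)))\<^sup>2 \<le> (sqrt (A * B))\<^sup>2"
        by (intro power_mono) auto
      moreover have "A * B \<ge> 0"
        by (simp add: A_def B_def sum_nonneg)
      ultimately show ?thesis
        by simp
    qed
    then show ?thesis
      by (simp add: D_def c_def ip_def)
  qed
  have "Re W \<le> D * r"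
  proof (cases "D = 0")
    case False
    have "Re (ip V V) \<ge> 0"
      by (simp add: ip_real sum_nonneg)
    then have "D * (D * r - Re W) \<ge> 0"
      unfolding VV by simp
    then show ?thesis
      using False \<open>D \<ge> 0\<close> by (simp add: zero_le_mult_iff)
  next
    case True
    then have "(\<Sum>c\<in>J. (cmod (V c))\<^sup>2) = 0"
      using VV unfolding ip_real by (simp only: of_real_0 mult_zero_left of_real_eq_0_iff)
    then have "V c = 0" if "c \<in> J" for c
      using J that by (simp add: sum_nonneg_eq_0_iff)
    then have "ip V z = 0"
      by (simp add: ip_def)
    then show ?thesis
      using Vz True by simp
  qed
  then show ?thesis
    unfolding D2 W_eq[symmetric] ips by (simp add: mult.commute)
qed

subsection \<open>Growth of Monge-Ampere masses\<close>

lemma integrable_dz: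
  assumes h: "C_diff (Suc 0) h" and K: "compact K" "\<And>w. w \<notin> K \<Longrightarrow> h w = 0"
  shows "integrable lborel (dz j h)"
proof (rule integrable_compact_support[OF _ K(1)])
  show "continuous_on UNIV (dz j h)"
  proof -
    have "continuous_on UNIV (\<lambda>w. frechet_derivative h (at w) v)" for v
      using C_diff_SucD(2)[OF h] by simp
    then show ?thesis
      unfolding dz_def[abs_def] divide_inverse by (intro continuous_intros)
  qed
  show "dz j h w = 0" if "w \<notin> K" for w
    using frechet_derivative_outside(1)[of K h w j] K that by simp
qed

lemma C_diff_compose_real_1:
  assumes h: "smooth (\<lambda>w. complex_of_real (h w))"
    and \<kappa>: "\<And>w. (\<kappa> has_real_derivative \<kappa>' (h w)) (at (h w))"
    and cont: "continuous_on UNIV (\<lambda>w. \<kappa>' (h w))"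
  shows "C_diff (Suc 0) (\<lambda>w. complex_of_real (\<kappa> (h w)))"
proof (rule C_diff_SucI)
  let ?D = "\<lambda>w v. frechet_derivative (\<lambda>w. complex_of_real (h w)) (at w) v"
  show "((\<lambda>w. complex_of_real (\<kappa> (h w))) has_derivative
      (\<lambda>v. complex_of_real (\<kappa>' (h w)) * complex_of_real (Re (?D w v)))) (at w)" for w
  proof -
    have "(h has_derivative (\<lambda>v. Re (?D w v))) (at w)"
      using has_derivative_Re[OF smooth_imp_differentiable[OF h, of w]] by simp
    from has_derivative_of_real[OF has_derivative_compose[OF this has_field_derivative_imp_has_derivative[OF \<kappa>[of w]]], where ?'a = complex]
    show ?thesis
      by simp
  qed
  have "continuous_on UNIV (\<lambda>w. ?D w v)" for v
    by (rule smooth_imp_continuous[OF smooth_derivative[OF h]])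
  then show "C_diff 0 (\<lambda>w. complex_of_real (\<kappa>' (h w)) * complex_of_real (Re (?D w v)))" for v
    using cont by (auto intro!: continuous_intros)
qed

text \<open>Stokes' theorem for \<kappa>(\<rho>) times the (0,1)-differential of \<rho> times dd^c
  \<rho>, a compactly supported form of degree 3 with coefficients \<open>X\<close>. The matrix
  \<beta> represents the product of the two first-order differentials of \<rho>; the third
  derivatives of \<rho> cancel because dd^c \<rho> is closed.\<close>

lemma radial_identity:
  fixes \<rho> :: "complex ^ 2 \<Rightarrow> real"
  defines "R \<equiv> \<lambda>w. complex_of_real (\<rho> w)"
  defines "\<alpha> \<equiv> complex_hessian R"
  defines "\<beta> \<equiv> \<lambda>w. \<chi> j k. dz j R w * dzbar k R w"
  assumes R: "smooth R"
    and \<kappa>: "\<And>w. (\<kappa> has_real_derivative \<kappa>' (\<rho> w)) (at (\<rho> w))"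
    and cont: "continuous_on UNIV (\<lambda>w. \<kappa>' (\<rho> w))"
    and B: "compact B" "\<And>w. w \<notin> B \<Longrightarrow> \<kappa> (\<rho> w) = 0"
  shows "integrable lborel (\<lambda>w. of_real (\<kappa> (\<rho> w)) * mixed_disc (\<alpha> w) (\<alpha> w) + of_real (\<kappa>' (\<rho> w)) * mixed_disc (\<beta> w) (\<alpha> w))"
    "(\<integral>w. of_real (\<kappa> (\<rho> w)) * mixed_disc (\<alpha> w) (\<alpha> w) + of_real (\<kappa>' (\<rho> w)) * mixed_disc (\<beta> w) (\<alpha> w) \<partial>lborel) = 0"
proof -
  define K where "K w = complex_of_real (\<kappa> (\<rho> w))" for w
  let ?H = "\<lambda>l m w. complex_hessian R w $ l $ m"
  have sH: "smooth (?H l m)" for l m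
    by (rule smooth_hessian[OF R])
  have K: "C_diff (Suc 0) K"
    unfolding K_def[abs_def] by (rule C_diff_compose_real_1[OF R[unfolded R_def] \<kappa> cont])
  have dK: "dz j K w = of_real (\<kappa>' (\<rho> w)) * dz j R w" "K differentiable (at w)" for j w
    using dz_of_real_compose[OF \<kappa>[of w] smooth_differentiable[OF R[unfolded R_def], of w]]
    by (simp_all add: K_def[abs_def] R_def)
  define X where "X k l m w = K w * (dzbar k R w * ?H l m w)" for k l m w
  have X: "C_diff (Suc 0) (X k l m)" for k l m
    unfolding X_def[abs_def] using smooth_mult[OF smooth_dzbar[OF R] sH]
    by (intro C_diff_mult[OF K]) (simp add: smooth_def)
  have X0: "X k l m w = 0" if "w \<notin> B" for k l m w
    using B(2)[OF that] by (simp add: X_def K_def)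
  have dX: "dz j (X k l m) w = of_real (\<kappa>' (\<rho> w)) * dz j R w * (dzbar k R w * ?H l m w)
      + K w * (?H j k w * ?H l m w + dzbar k R w * dz j (?H l m) w)" for j k l m w
  proof -
    have d: "dzbar k R differentiable (at w)" "?H l m differentiable (at w)"
      by (intro smooth_differentiable smooth_dzbar R sH)+
    show ?thesis
      unfolding X_def[abs_def] using d dK
      by (simp add: dz_mult differentiable_mult hessian_nth)
  qed
  have H: "?H l m = dz l (dzbar m R)" for l m
    by (simp add: fun_eq_iff hessian_nth)
  have comm: "dz j (?H l m) w = dz l (?H j m) w" for j l m w
    unfolding H by (rule dz_commute[OF smooth_dzbar[OF R]])
  have e: "dz 1 (?H 2 2) w = dz 2 (?H 1 2) w" "dz 2 (?H 1 1) w = dz 1 (?H 2 1) w" for w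
    by (rule comm)+
  have sum: "of_real (\<kappa> (\<rho> w)) * mixed_disc (\<alpha> w) (\<alpha> w) + of_real (\<kappa>' (\<rho> w)) * mixed_disc (\<beta> w) (\<alpha> w)
      = dz 1 (X 1 2 2) w + dz 2 (X 2 1 1) w - dz 1 (X 2 2 1) w - dz 2 (X 1 1 2) w" for w
    unfolding dX e mixed_disc_def \<alpha>_def \<beta>_def K_def[symmetric] by (simp add: algebra_simps)
  have i: "integrable lborel (dz j (X k l m))" for j k l m
    by (rule integrable_dz[OF X B(1) X0])
  have z: "(\<integral>w. dz j (X k l m) w \<partial>lborel) = 0" for j k l m
    by (rule integral_dz_zero[OF X B(1) X0])
  show "integrable lborel (\<lambda>w. of_real (\<kappa> (\<rho> w)) * mixed_disc (\<alpha> w) (\<alpha> w) + of_real (\<kappa>' (\<rho> w)) * mixed_disc (\<beta> w) (\<alpha> w))"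
    unfolding sum using i by (intro Bochner_Integration.integrable_add Bochner_Integration.integrable_diff)
  show "(\<integral>w. of_real (\<kappa> (\<rho> w)) * mixed_disc (\<alpha> w) (\<alpha> w) + of_real (\<kappa>' (\<rho> w)) * mixed_disc (\<beta> w) (\<alpha> w) \<partial>lborel) = 0"
    unfolding sum using i z by simp
qed

definition pos_sq :: "real \<Rightarrow> real" where
  "pos_sq x = (max 0 x)\<^sup>2"

lemma pos_sq_has_derivative: "(pos_sq has_real_derivative 2 * max 0 x) (at x)"
proof -
  consider "x > 0" | "x < 0" | "x = 0"
    by linarith
  then show ?thesis
  proof cases
    case 1
    have "((\<lambda>x. x\<^sup>2) has_real_derivative 2 * max 0 x) (at x)"
      using 1 by (auto intro!: derivative_eq_intros)
    then show ?thesis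
      by (rule has_field_derivative_transform_within_open[where S = "{0<..}"]) (auto simp: 1 pos_sq_def)
  next
    case 2
    have "((\<lambda>x. 0) has_real_derivative 2 * max 0 x) (at x)"
      using 2 by (auto intro!: derivative_eq_intros)
    then show ?thesis
      by (rule has_field_derivative_transform_within_open[where S = "{..<0}"]) (auto simp: 2 pos_sq_def)
  next
    case 3
    have "((\<lambda>h. pos_sq h / h) \<longlongrightarrow> 0) (at 0)"
    proof (rule Lim_null_comparison)
      show "\<forall>\<^sub>F h in at 0. norm (pos_sq h / h) \<le> \<bar>h\<bar>"
        by (auto simp: pos_sq_def max_def power2_eq_square)
      show "((\<lambda>h :: real. \<bar>h\<bar>) \<longlongrightarrow> 0) (at 0)"
        by (rule tendsto_rabs_zero) (rule tendsto_ident_at)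
    qed
    then show ?thesis
      using 3 by (simp add: DERIV_def pos_sq_def)
  qed
qed

text \<open>A \<open>C\<^sup>1\<close> cut-off: \<open>1\<close> for \<open>x \<le> t / 2\<close> and \<open>0\<close> for \<open>x \<ge> t\<close>.\<close>

definition cutoff :: "real \<Rightarrow> real \<Rightarrow> real" where
  "cutoff t x = pos_sq (1 - pos_sq (2 * x / t - 1))"

definition cutoff' :: "real \<Rightarrow> real \<Rightarrow> real" where
  "cutoff' t x = - (8 / t) * max 0 (1 - pos_sq (2 * x / t - 1)) * max 0 (2 * x / t - 1)"

lemma pos_sq_nonneg: "pos_sq x \<ge> 0"
  by (simp add: pos_sq_def)

lemma cutoff_has_derivative: "t > 0 \<Longrightarrow> (cutoff t has_real_derivative cutoff' t x) (at x)"
proof -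
  assume "t > 0"
  then have "((\<lambda>x. 2 * x / t - 1) has_real_derivative 2 / t) (at x)"
    by (auto intro!: derivative_eq_intros)
  from DERIV_chain2[OF pos_sq_has_derivative this]
  have "((\<lambda>x. 1 - pos_sq (2 * x / t - 1)) has_real_derivative - (2 * max 0 (2 * x / t - 1) * (2 / t))) (at x)"
    by (auto intro!: derivative_eq_intros)
  from DERIV_chain2[OF pos_sq_has_derivative this] show ?thesis
    by (simp add: cutoff_def[abs_def] cutoff'_def mult_ac)
qed

lemma
  assumes "t > 0"
  shows cutoff_nonneg: "cutoff t x \<ge> 0"
    and cutoff_eq_1: "x \<le> t / 2 \<Longrightarrow> cutoff t x = 1"
    and cutoff_eq_0: "t \<le> x \<Longrightarrow> cutoff t x = 0"
    and cutoff'_eq_0: "x \<le> t / 2 \<Longrightarrow> cutoff' t x = 0"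
    and cutoff'_eq_0': "t \<le> x \<Longrightarrow> cutoff' t x = 0"
    and cutoff'_le: "cutoff' t x \<le> 0"
    and cutoff'_ge: "x \<le> t \<Longrightarrow> cutoff' t x \<ge> - (8 / t)"
proof -
  show "cutoff t x \<ge> 0"
    by (simp add: cutoff_def pos_sq_nonneg)
  have half: "2 * x / t - 1 \<le> 0" if "x \<le> t / 2"
    using that assms by (simp add: field_simps)
  show "x \<le> t / 2 \<Longrightarrow> cutoff t x = 1" "x \<le> t / 2 \<Longrightarrow> cutoff' t x = 0"
    using half by (auto simp: cutoff_def cutoff'_def pos_sq_def max_def)
  have big: "pos_sq (2 * x / t - 1) \<ge> 1" if "t \<le> x"
  proof -
    have "2 * x / t - 1 \<ge> 1"
      using that assms by (simp add: field_simps)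
    then show ?thesis
      by (simp add: pos_sq_def max_def)
  qed
  show "t \<le> x \<Longrightarrow> cutoff t x = 0" "t \<le> x \<Longrightarrow> cutoff' t x = 0"
    using big unfolding cutoff_def cutoff'_def by (simp_all add: pos_sq_def[of "1 - _"] max_def)
  show "cutoff' t x \<le> 0"
    using assms by (simp add: cutoff'_def mult_nonneg_nonneg)
  assume "x \<le> t"
  then have "max 0 (2 * x / t - 1) \<le> 1" "max 0 (1 - pos_sq (2 * x / t - 1)) \<le> 1"
    using assms pos_sq_nonneg[of "2 * x / t - 1"] by (simp_all add: field_simps)
  then have "max 0 (1 - pos_sq (2 * x / t - 1)) * max 0 (2 * x / t - 1) \<le> 1 * 1"
    by (intro mult_mono) auto
  then have "(8 / t) * (max 0 (1 - pos_sq (2 * x / t - 1)) * max 0 (2 * x / t - 1)) \<le> (8 / t) * 1"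
    using assms by (intro mult_left_mono) auto
  then show "cutoff' t x \<ge> - (8 / t)"
    by (simp add: cutoff'_def mult.assoc)
qed

lemma continuous_pos_sq: "continuous_on UNIV pos_sq"
  unfolding pos_sq_def[abs_def] by (intro continuous_intros)

lemma integrable_indicator_mult:
  fixes N :: "complex ^ 2 \<Rightarrow> real"
  assumes N: "continuous_on UNIV N" and K: "compact K" and E: "E \<in> sets borel" "E \<subseteq> K"
  shows "integrable lborel (\<lambda>w. indicator E w * N w)"
proof (rule Bochner_Integration.integrable_bound)
  show "integrable lborel (\<lambda>w. indicator K w *\<^sub>R N w)"
    using N K by (intro borel_integrable_compact) (auto intro: continuous_on_subset)
  show "(\<lambda>w. indicator E w * N w) \<in> borel_measurable lborel"
    using E(1) borel_measurable_continuous_onI[OF N] by (intro borel_measurable_times) auto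
  show "AE w in lborel. norm (indicator E w * N w) \<le> norm (indicator K w *\<^sub>R N w)"
    using E(2) by (auto simp: indicator_def)
qed

text \<open>
  The test function \<open>\<kappa>(\<rho>) = cutoff(\<rho>) / (\<rho> + \<epsilon>)\<^sup>2\<close> in the radial identity compares the
  masses of \<open>(dd^c log (\<rho> + \<epsilon>))\<^sup>2\<close> and \<open>(dd^c \<rho>)\<^sup>2\<close>, which differ only where \<open>cutoff\<close> is not constant.
\<close>

lemma radial_estimate:
  fixes \<rho> :: "complex ^ 2 \<Rightarrow> real"
  defines "R \<equiv> \<lambda>w. complex_of_real (\<rho> w)"
  defines "\<alpha> \<equiv> complex_hessian R"
  defines "\<beta> \<equiv> \<lambda>w. \<chi> j k. dz j R w * dzbar k R w"
  defines "N \<equiv> \<lambda>w. Re (mixed_disc (\<alpha> w) (\<alpha> w))"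
  assumes R: "smooth R" and \<rho>: "\<And>w. \<rho> w \<ge> 0" and t: "t > 0" and \<epsilon>: "\<epsilon> > 0"
    and B: "compact {w. \<rho> w \<le> t}"
    and N: "\<And>w. \<rho> w < t \<Longrightarrow> N w \<ge> 0"
    and \<beta>: "\<And>w. \<rho> w < t \<Longrightarrow> 0 \<le> Re (mixed_disc (\<beta> w) (\<alpha> w))"
    "\<And>w. \<rho> w < t \<Longrightarrow> 2 * Re (mixed_disc (\<beta> w) (\<alpha> w)) \<le> \<rho> w * N w"
  shows "(\<integral>w. indicator {w. \<rho> w < t / 2} w * (\<epsilon> / (\<rho> w + \<epsilon>) ^ 3 * N w) \<partial>lborel)
    \<le> 8 / t\<^sup>2 * (\<integral>w. indicator {w. \<rho> w < t} w * N w \<partial>lborel)"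
proof -
  define \<kappa> where "\<kappa> x = cutoff t x / (x + \<epsilon>)\<^sup>2" for x
  define \<kappa>' where "\<kappa>' x = cutoff' t x / (x + \<epsilon>)\<^sup>2 - 2 * cutoff t x / (x + \<epsilon>) ^ 3" for x
  have pos: "\<rho> w + \<epsilon> > 0" for w
    using \<rho>[of w] \<epsilon> by simp
  have \<kappa>_deriv: "(\<kappa> has_real_derivative \<kappa>' (\<rho> w)) (at (\<rho> w))" for w
  proof -
    have alg: "(c' * r\<^sup>2 - c * (2 * r)) / (r\<^sup>2 * r\<^sup>2) = c' / r\<^sup>2 - 2 * c / r ^ 3" if "r > 0" for r c c' :: real
      using that by (simp add: field_simps power2_eq_square power3_eq_cube)
    have "((\<lambda>x. (x + \<epsilon>)\<^sup>2) has_real_derivative 2 * (\<rho> w + \<epsilon>)) (at (\<rho> w))"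
      by (auto intro!: derivative_eq_intros)
    from DERIV_divide[OF cutoff_has_derivative[OF t] this] show ?thesis
      using pos[of w] alg[OF pos[of w]] by (simp add: \<kappa>_def[abs_def] \<kappa>'_def)
  qed
  have cR: "continuous_on UNIV \<rho>"
    using continuous_on_Re[OF smooth_imp_continuous[OF R]] by (simp add: R_def)
  have ccut: "continuous_on UNIV (cutoff t)" "continuous_on UNIV (cutoff' t)"
  proof -
    show "continuous_on UNIV (cutoff t)"
      using cutoff_has_derivative[OF t] by (auto intro!: continuous_at_imp_continuous_on DERIV_isCont)
    have "continuous_on UNIV (\<lambda>x. pos_sq (2 * x / t - 1))"
      by (rule continuous_on_compose2[OF continuous_pos_sq]) (use t in \<open>auto intro!: continuous_intros\<close>)
    then show "continuous_on UNIV (cutoff' t)"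
      unfolding cutoff'_def[abs_def] using t by (intro continuous_intros) auto
  qed
  have ccR: "continuous_on UNIV (\<lambda>w. cutoff t (\<rho> w))" "continuous_on UNIV (\<lambda>w. cutoff' t (\<rho> w))"
    using continuous_on_compose2[OF ccut(1) cR] continuous_on_compose2[OF ccut(2) cR] by auto
  have c\<kappa>': "continuous_on UNIV (\<lambda>w. \<kappa>' (\<rho> w))"
    unfolding \<kappa>'_def using pos by (intro continuous_intros ccR cR) (auto simp: less_imp_neq[symmetric])
  have \<kappa>0: "\<kappa> (\<rho> w) = 0" if "w \<notin> {w. \<rho> w \<le> t}" for w
    using that cutoff_eq_0[OF t, of "\<rho> w"] by (simp add: \<kappa>_def)
  define I where "I w = of_real (\<kappa> (\<rho> w)) * mixed_disc (\<alpha> w) (\<alpha> w) + of_real (\<kappa>' (\<rho> w)) * mixed_disc (\<beta> w) (\<alpha> w)" for w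
  have I: "integrable lborel I" "(\<integral>w. I w \<partial>lborel) = 0"
    unfolding I_def \<alpha>_def \<beta>_def R_def using radial_identity[OF R[unfolded R_def] \<kappa>_deriv c\<kappa>' B \<kappa>0] by blast+
  have int0: "(\<integral>w. Re (I w) \<partial>lborel) = 0"
    using I by (simp add: integral_Re)
  have cN: "continuous_on UNIV N"
  proof -
    have "continuous_on UNIV (\<lambda>w. \<alpha> w $ l $ m)" for l m
      unfolding \<alpha>_def by (intro smooth_imp_continuous smooth_hessian R)
    then show ?thesis
      unfolding N_def mixed_disc_def
      by (intro continuous_on_Re continuous_on_diff continuous_on_add continuous_on_mult)
  qed
  have E: "{w. \<rho> w < s} \<in> sets borel" for s
    using open_Collect_less[OF cR continuous_on_const] by simp
  have i1: "integrable lborel (\<lambda>w. indicator {w. \<rho> w < t / 2} w * (\<epsilon> / (\<rho> w + \<epsilon>) ^ 3 * N w))"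
    using t pos by (intro integrable_indicator_mult[OF _ B] continuous_intros cN cR E) (auto simp: less_imp_neq[symmetric])
  have i2: "integrable lborel (\<lambda>w. indicator {w. \<rho> w < t} w * N w)"
    by (intro integrable_indicator_mult[OF cN B] E) auto
  have "(\<integral>w. indicator {w. \<rho> w < t / 2} w * (\<epsilon> / (\<rho> w + \<epsilon>) ^ 3 * N w)
      - 8 / t\<^sup>2 * (indicator {w. \<rho> w < t} w * N w) \<partial>lborel) \<le> (\<integral>w. Re (I w) \<partial>lborel)"
  proof (rule integral_mono)
    show "integrable lborel (\<lambda>w. indicator {w. \<rho> w < t / 2} w * (\<epsilon> / (\<rho> w + \<epsilon>) ^ 3 * N w)
      - 8 / t\<^sup>2 * (indicator {w. \<rho> w < t} w * N w))"
      using i1 i2 by (intro Bochner_Integration.integrable_diff integrable_mult_right)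
    show "integrable lborel (\<lambda>w. Re (I w))"
      using I(1) by (rule integrable_Re)
    fix w
    define b where "b = Re (mixed_disc (\<beta> w) (\<alpha> w))"
    have ReI: "Re (I w) = \<kappa> (\<rho> w) * N w + \<kappa>' (\<rho> w) * b"
      by (simp add: I_def N_def b_def)
    define r where "r = \<rho> w + \<epsilon>"
    have r: "r > 0" "r \<ge> \<rho> w"
      using pos[of w] \<epsilon> by (auto simp: r_def)
    show "indicator {w. \<rho> w < t / 2} w * (\<epsilon> / (\<rho> w + \<epsilon>) ^ 3 * N w)
      - 8 / t\<^sup>2 * (indicator {w. \<rho> w < t} w * N w) \<le> Re (I w)"
    proof (cases "\<rho> w < t")
      case False
      then have "\<kappa> (\<rho> w) = 0" "\<kappa>' (\<rho> w) = 0"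
        using cutoff_eq_0[OF t, of "\<rho> w"] cutoff'_eq_0'[OF t, of "\<rho> w"] by (auto simp: \<kappa>_def \<kappa>'_def)
      then show ?thesis
        using False t unfolding ReI by simp
    next
      case True
      note b = \<beta>[OF True, folded b_def] and Nw = N[OF True]
      \<comment> \<open>The part of the integrand where the cut-off is not differentiated. The Gram
        bound \<open>2 * b \<le> \<rho> w * N w\<close> makes N / r^2 - 2 b / r^3 at least (r -
        \<rho>) N / r^3, and r - \<rho> is \<epsilon>.\<close>
      have main: "cutoff t (\<rho> w) * (\<epsilon> / r ^ 3 * N w) \<le> cutoff t (\<rho> w) / r\<^sup>2 * N w - 2 * cutoff t (\<rho> w) / r ^ 3 * b"
      proof -
        have "\<epsilon> / r ^ 3 * N w = N w / r\<^sup>2 - \<rho> w * N w / r ^ 3"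
        proof -
          have alg: "(r - y) / r ^ 3 * x = x / r\<^sup>2 - y * x / r ^ 3" if "r > 0" for r x y :: real
            using that by (simp add: field_simps power2_eq_square power3_eq_cube)
          have "\<epsilon> = r - \<rho> w"
            by (simp add: r_def)
          then show ?thesis
            using alg[OF r(1), of "\<rho> w" "N w"] by simp
        qed
        also have "\<dots> \<le> N w / r\<^sup>2 - 2 * b / r ^ 3"
          using b(2) r by (simp add: divide_right_mono)
        finally have "cutoff t (\<rho> w) * (\<epsilon> / r ^ 3 * N w) \<le> cutoff t (\<rho> w) * (N w / r\<^sup>2 - 2 * b / r ^ 3)"
          by (rule mult_left_mono) (rule cutoff_nonneg[OF t])
        then show ?thesis
          by (simp add: algebra_simps)
      qed
      \<comment> \<open>The cut-off varies only for \<rho> between t / 2 and t. There r^2 is at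
        least \<rho> t / 2 and b is at most \<rho> N / 2, so the factor \<rho> cancels and the bound
        is free of \<epsilon>.\<close>
      have rest: "cutoff' t (\<rho> w) / r\<^sup>2 * b \<ge> - (8 / t\<^sup>2 * N w)"
      proof (cases "\<rho> w \<le> t / 2")
        case True
        then show ?thesis
          using cutoff'_eq_0[OF t True] t Nw by simp
      next
        case False
        have "r\<^sup>2 \<ge> \<rho> w * (t / 2)"
          using r False t unfolding power2_eq_square by (intro mult_mono) auto
        then have "b / r\<^sup>2 \<le> (\<rho> w * N w / 2) / (\<rho> w * (t / 2))"
          using b False t Nw by (intro frac_le) auto
        also have "\<dots> = N w / t"
          using False t by simp
        finally have "(8 / t) * (b / r\<^sup>2) \<le> (8 / t) * (N w / t)"
          using t by (intro mult_left_mono) auto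
        moreover have "cutoff' t (\<rho> w) * (b / r\<^sup>2) \<ge> - (8 / t) * (b / r\<^sup>2)"
          using cutoff'_ge[OF t, of "\<rho> w"] \<open>\<rho> w < t\<close> b(1) by (intro mult_right_mono) auto
        ultimately show ?thesis
          by (simp add: power2_eq_square)
      qed
      have "indicator {w. \<rho> w < t / 2} w * (\<epsilon> / r ^ 3 * N w) \<le> cutoff t (\<rho> w) * (\<epsilon> / r ^ 3 * N w)"
        using cutoff_eq_1[OF t, of "\<rho> w"] cutoff_nonneg[OF t, of "\<rho> w"] \<epsilon> r Nw by (auto simp: indicator_def)
      then show ?thesis
        using main rest True unfolding ReI \<kappa>_def \<kappa>'_def r_def[symmetric] by (simp add: left_diff_distrib)
    qed
  qed
  then show ?thesis
    unfolding int0 using i1 i2 by simp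
qed

text \<open>Write D for the determinant. On the ellipsoid where the form is below \<epsilon> / 2,
  one has \<rho> < \<epsilon> and N at least D, half its central value, so the integrand is at least
  D / (8 \<epsilon>^2). The volume is at least (\<epsilon> / 2)^2 / D, and the product 1/32 depends
  on neither \<epsilon> nor D. It plays the role of the point mass of (dd^c log \<rho>)^2.\<close>

lemma mass_at_point:
  fixes \<rho> N :: "complex ^ 2 \<Rightarrow> real"
  assumes M: "M $ 1 $ 1 = complex_of_real a" "M $ 2 $ 2 = complex_of_real b"
    "M $ 1 $ 2 = c" "M $ 2 $ 1 = cnj c" and a: "a > 0" and D: "a * b - (cmod c)\<^sup>2 > 0"
    and N: "continuous_on UNIV N" "N p = 2 * (a * b - (cmod c)\<^sup>2)" "\<And>w. \<rho> w < t \<Longrightarrow> N w \<ge> 0"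
    and t: "t > 0" and \<rho>: "continuous_on UNIV \<rho>" "\<And>w. \<rho> w \<ge> 0" and B: "compact {w. \<rho> w \<le> t}"
    and m: "m > 0" "\<And>v. m * (norm v)\<^sup>2 \<le> Re (qform M v)"
    and r: "r > 0" "\<And>v. norm v < r \<Longrightarrow> \<rho> (p + v) \<le> 2 * Re (qform M v)"
  shows "\<exists>\<epsilon>>0. 1 / 32 \<le> (\<integral>w. indicator {w. \<rho> w < t / 2} w * (\<epsilon> / (\<rho> w + \<epsilon>) ^ 3 * N w) \<partial>lborel)"
proof -
  let ?D = "a * b - (cmod c)\<^sup>2"
  have "isCont N p"
    using N(1) by (simp add: continuous_on_eq_continuous_at)
  then obtain r1 where r1: "r1 > 0" "\<And>w. dist w p < r1 \<Longrightarrow> dist (N w) (N p) < ?D"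
    using D unfolding continuous_at_eps_delta by metis
  define r2 where "r2 = min r r1"
  define \<epsilon> where "\<epsilon> = min (t / 4) (m * r2\<^sup>2)"
  have \<epsilon>: "\<epsilon> > 0" "\<epsilon> < t / 2" "\<epsilon> \<le> m * r2\<^sup>2"
    using t m r(1) r1(1) by (auto simp: \<epsilon>_def r2_def)
  define E0 where "E0 = {v. Re (qform M v) < \<epsilon> / 2}"
  define E where "E = {w. w - p \<in> E0}"
  have E0_small: "norm v < r2" if "v \<in> E0" for v
  proof -
    have "m * (norm v)\<^sup>2 < m * r2\<^sup>2"
      using that m(2)[of v] \<epsilon> by (auto simp: E0_def)
    then have "(norm v)\<^sup>2 < r2\<^sup>2"
      using m(1) by simp
    then show ?thesis
      using r(1) r1(1) by (intro power2_less_imp_less[of _ r2]) (auto simp: r2_def)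
  qed
  have "open E0"
    unfolding E0_def by (rule open_qform_sublevel)
  have E_eq: "E = (\<lambda>v. p + v) ` E0"
    unfolding E_def by (auto intro!: image_eqI[of _ _ "_ - p"])
  have "open E"
    unfolding E_eq using \<open>open E0\<close> by (rule open_translation)
  have "emeasure lborel E0 = emeasure (distr lborel borel ((+) (- p))) E0"
    by (simp add: lborel_distr_plus)
  also have "\<dots> = emeasure lborel E"
    using \<open>open E0\<close> by (subst emeasure_distr) (auto simp: E_def intro!: arg_cong[where f = "emeasure lborel"])
  finally have eE: "emeasure lborel E \<ge> ennreal ((\<epsilon> / 2)\<^sup>2 / ?D)"
    using ellipsoid_volume[OF M a D, of "\<epsilon> / 2"] \<epsilon>(1) by (simp add: E0_def)
  have "bounded E"
    unfolding bounded_def using E0_small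
    by (intro exI[of _ p] exI[of _ r2]) (auto simp: E_def dist_norm norm_minus_commute less_imp_le)
  then have fin: "emeasure lborel E < \<infinity>"
    using emeasure_bounded_finite by auto
  have onE: "\<rho> w < \<epsilon>" "N w \<ge> ?D" if "w \<in> E" for w
  proof -
    have v: "w - p \<in> E0" "norm (w - p) < r2"
      using that E0_small by (auto simp: E_def)
    have "\<rho> w \<le> 2 * Re (qform M (w - p))"
      using r(2)[of "w - p"] v(2) by (simp add: r2_def)
    also have "\<dots> < \<epsilon>"
      using v(1) by (simp add: E0_def)
    finally show "\<rho> w < \<epsilon>" .
    have "dist (N w) (N p) < ?D"
      using v(2) by (intro r1(2)) (simp add: dist_norm r2_def)
    then show "N w \<ge> ?D"
      using N(2) by (simp add: dist_real_def)
  qed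
  have E': "{w. \<rho> w < s} \<in> sets borel" for s
    using open_Collect_less[OF \<rho>(1) continuous_on_const] by simp
  have pos: "\<rho> w + \<epsilon> > 0" for w
    using \<rho>(2)[of w] \<epsilon>(1) by simp
  have int: "integrable lborel (\<lambda>w. indicator {w. \<rho> w < t / 2} w * (\<epsilon> / (\<rho> w + \<epsilon>) ^ 3 * N w))"
    using t pos by (intro integrable_indicator_mult[OF _ B] continuous_intros N(1) \<rho>(1) E') (auto simp: less_imp_neq[symmetric])
  have "1 / 32 = (\<epsilon> / 2)\<^sup>2 / ?D * (?D / (8 * \<epsilon>\<^sup>2))"
    using \<epsilon>(1) D by (simp add: power_divide)
  also have "\<dots> \<le> measure lborel E * (?D / (8 * \<epsilon>\<^sup>2))"
  proof (rule mult_right_mono)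
    have "ennreal ((\<epsilon> / 2)\<^sup>2 / ?D) \<le> ennreal (measure lborel E)"
      using eE fin by (simp add: emeasure_eq_ennreal_measure)
    then show "(\<epsilon> / 2)\<^sup>2 / ?D \<le> measure lborel E"
      by (simp add: ennreal_le_iff)
  qed (use D in auto)
  also have "\<dots> = (\<integral>w. indicator E w * (?D / (8 * \<epsilon>\<^sup>2)) \<partial>lborel)"
    using \<open>open E\<close> fin by simp
  also have "\<dots> \<le> (\<integral>w. indicator {w. \<rho> w < t / 2} w * (\<epsilon> / (\<rho> w + \<epsilon>) ^ 3 * N w) \<partial>lborel)"
  proof (rule integral_mono[OF _ int])
    show "integrable lborel (\<lambda>w. indicator E w * (?D / (8 * \<epsilon>\<^sup>2)))"
      using \<open>open E\<close> fin by (intro integrable_mult_left integrable_real_indicator) auto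
    fix w
    show "indicator E w * (?D / (8 * \<epsilon>\<^sup>2)) \<le> indicator {w. \<rho> w < t / 2} w * (\<epsilon> / (\<rho> w + \<epsilon>) ^ 3 * N w)"
    proof (cases "w \<in> E")
      case True
      have "(\<rho> w + \<epsilon>) ^ 3 \<le> (2 * \<epsilon>) ^ 3"
        using onE(1)[OF True] pos[of w] by (intro power_mono) auto
      then have "\<epsilon> / (2 * \<epsilon>) ^ 3 \<le> \<epsilon> / (\<rho> w + \<epsilon>) ^ 3"
        using \<epsilon>(1) pos[of w] by (intro divide_left_mono) auto
      then have "\<epsilon> / (2 * \<epsilon>) ^ 3 * ?D \<le> \<epsilon> / (\<rho> w + \<epsilon>) ^ 3 * N w"
        using onE(2)[OF True] D \<epsilon>(1) pos[of w] by (intro mult_mono) auto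
      moreover have "\<epsilon> / (2 * \<epsilon>) ^ 3 * ?D = ?D / (8 * \<epsilon>\<^sup>2)"
        using \<epsilon>(1) by (simp add: power2_eq_square power3_eq_cube)
      moreover have "\<rho> w < t / 2"
        using onE(1)[OF True] \<epsilon>(2) by simp
      ultimately show ?thesis
        using True by simp
    next
      case False
      then show ?thesis
        using N(3)[of w] t \<epsilon>(1) pos[of w] by (auto simp: indicator_def)
    qed
  qed
  finally show ?thesis
    using \<epsilon>(1) by blast
qed

section \<open>Masses of Bowen balls\<close>

text \<open>The squared sine of the angle between the two complex lines. For nonzero vectors it
  depends on the lines only, and it serves as the squared distance in the projective plane.\<close>

definition sin_sq :: "complex ^ 3 \<Rightarrow> complex ^ 3 \<Rightarrow> real" where
  "sin_sq x y = 1 - (cmod (cinner x y))\<^sup>2 / ((norm x)\<^sup>2 * (norm y)\<^sup>2)"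

lemma sin_sq_nonneg: "sin_sq x y \<ge> 0"
proof -
  have "(cmod (cinner x y))\<^sup>2 \<le> (norm x)\<^sup>2 * (norm y)\<^sup>2"
    using power_mono[OF cinner_Cauchy_Schwarz[of x y], of 2] by (simp add: power_mult_distrib)
  then show ?thesis
    by (cases "(norm x)\<^sup>2 * (norm y)\<^sup>2 = 0") (auto simp: sin_sq_def divide_le_eq_1)
qed

lemma sin_sq_le_1: "sin_sq x y \<le> 1"
  by (simp add: sin_sq_def)

lemma sin_sq_self: "x \<noteq> 0 \<Longrightarrow> sin_sq x x = 0"
  unfolding sin_sq_def cinner_self norm_of_real by (simp add: power2_eq_square)

text \<open>
  Agrees with \<open>tan\<^sup>2 = s / (1 - s)\<close> for small \<open>s = sin\<^sup>2\<close>, and is smooth everywhere.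
\<close>

definition tan_sq :: "real \<Rightarrow> real" where
  "tan_sq s = s / (1 - s * smooth_step (1/2) (3/4) s)"

lemma tan_sq_denominator: "s \<ge> 0 \<Longrightarrow> 1 - s * smooth_step (1/2) (3/4) s > 0"
proof (cases "s < 3/4")
  case True
  assume s: "s \<ge> 0"
  have "s * smooth_step (1/2) (3/4) s \<le> s * 1"
    using s by (intro mult_left_mono smooth_step_le_1) auto
  then show ?thesis
    using True by simp
next
  case False
  then show ?thesis
    by (simp add: smooth_step_eq_0)
qed

lemma tan_sq_ge: "s \<ge> 0 \<Longrightarrow> tan_sq s \<ge> s"
proof -
  assume s: "s \<ge> 0"
  have "s * smooth_step (1/2) (3/4) s \<ge> 0"
    using s by (intro mult_nonneg_nonneg smooth_step_nonneg) auto
  then show ?thesis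
    using s tan_sq_denominator[OF s] mult_left_mono[of "1 - s * smooth_step (1/2) (3/4) s" 1 s]
    by (simp add: tan_sq_def le_divide_eq)
qed

lemma tan_sq_eq: "s \<le> 1/2 \<Longrightarrow> tan_sq s = s / (1 - s)"
  by (simp add: tan_sq_def smooth_step_eq_1)

section \<open>Sums of squares and comparison of positive matrices\<close>

lemma qform_sum_squares:
  assumes "\<And>j k. M $ j $ k = (\<Sum>c\<in>J. x c j * cnj (x c k))"
  shows "qform M v = of_real (\<Sum>c\<in>J. (cmod (\<Sum>j\<in>UNIV. x c j * v $ j))\<^sup>2)"
proof -
  have "qform M v = (\<Sum>c\<in>J. (\<Sum>j\<in>UNIV. x c j * v $ j) * cnj (\<Sum>j\<in>UNIV. x c j * v $ j))"
    unfolding qform_def assms sum_2 by (simp add: sum.distrib sum_distrib_left algebra_simps)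
  also have "\<dots> = of_real (\<Sum>c\<in>J. (cmod (\<Sum>j\<in>UNIV. x c j * v $ j))\<^sup>2)"
    unfolding of_real_sum complex_norm_square ..
  finally show ?thesis .
qed

lemma psd_sum_squares:
  assumes "\<And>j k. M $ j $ k = (\<Sum>c\<in>J. x c j * cnj (x c k))"
  shows "psd M"
  unfolding psd_def qform_sum_squares[OF assms] by (simp add: sum_nonneg)

lemma qform_sum: "qform (\<Sum>x\<in>X. M x) v = (\<Sum>x\<in>X. qform (M x) v)"
  by (induction X rule: infinite_finite_induct) (simp_all add: qform_add, simp_all add: qform_def)

lemma qform_diff: "qform (M - N) v = qform M v - qform N v"
  by (simp add: qform_def algebra_simps sum_subtractf)

text \<open>Difference of two squares: \<open>mixed_disc (B - A) (B + A)\<close> is nonnegative,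
  both arguments being positive.\<close>

lemma mixed_disc_mono:
  assumes "psd A" "psd (B - A)"
  shows "Re (mixed_disc A A) \<le> Re (mixed_disc B B)"
proof -
  have "psd (B + A)"
    using psd_add[OF assms(2) psd_add[OF assms(1) assms(1)]] by (simp add: add.commute)
  then have "Re (mixed_disc (B - A) (B + A)) \<ge> 0"
    using mixed_disc_psd(2)[OF assms(2)] by blast
  moreover have "mixed_disc (B - A) (B + A) = mixed_disc B B - mixed_disc A A"
    by (simp add: mixed_disc_def algebra_simps)
  ultimately show ?thesis
    by simp
qed

text \<open>The weights are tuned to \<open>rho_near_a\<close>, where the main term contributes 3/2
  and the error 1/2 of the quadratic form, which makes 2.\<close>

lemma norm_sq_add_le:
  fixes x y :: complex
  shows "(cmod (x + y))\<^sup>2 \<le> 3/2 * (cmod x)\<^sup>2 + 3 * (cmod y)\<^sup>2"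
proof -
  have "(cmod (x + y))\<^sup>2 \<le> (cmod x + cmod y)\<^sup>2"
    by (intro power_mono norm_triangle_ineq) auto
  also have "\<dots> = 3/2 * (cmod x)\<^sup>2 + 3 * (cmod y)\<^sup>2 - (cmod x - 2 * cmod y)\<^sup>2 / 2"
    by (simp add: power2_eq_square field_simps)
  also have "\<dots> \<le> 3/2 * (cmod x)\<^sup>2 + 3 * (cmod y)\<^sup>2"
    by simp
  finally show ?thesis .
qed

text \<open>The vector (b, -c) has value b times the determinant, which is therefore positive;
  \<open>m\<close> is the minimum of the form on the unit sphere.\<close>

lemma positive_qform_bounds:
  assumes M: "psd M" and pos: "\<And>v. v \<noteq> 0 \<Longrightarrow> Re (qform M v) > 0"
  obtains a b c m where "M $ 1 $ 1 = complex_of_real a" "M $ 2 $ 2 = complex_of_real b"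
    "M $ 1 $ 2 = c" "M $ 2 $ 1 = cnj c" "a > 0" "a * b - (cmod c)\<^sup>2 > 0"
    "m > 0" "\<And>v. m * (norm v)\<^sup>2 \<le> Re (qform M v)"
proof -
  obtain a b c where abc: "M $ 1 $ 1 = complex_of_real a" "M $ 2 $ 2 = complex_of_real b"
    "M $ 1 $ 2 = c" "M $ 2 $ 1 = cnj c" "a \<ge> 0" "b \<ge> 0" "(cmod c)\<^sup>2 \<le> a * b"
    using psd_entries[OF M] .
  have q: "Re (qform M (vector [x, y])) = a * (cmod x)\<^sup>2 + 2 * Re (c * x * cnj y) + b * (cmod y)\<^sup>2" for x y
  proof -
    have "qform M (vector [x, y]) = of_real a * (x * cnj x) + (c * x * cnj y + cnj (c * x * cnj y)) + of_real b * (y * cnj y)"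
      unfolding qform_def sum_2 abc(1-4) by (simp add: mult_ac)
    also have "\<dots> = of_real (a * (cmod x)\<^sup>2 + 2 * Re (c * x * cnj y) + b * (cmod y)\<^sup>2)"
      unfolding complex_add_cnj complex_norm_square[symmetric] by simp
    finally show ?thesis
      by simp
  qed
  have nz: "vector [x, y] \<noteq> (0 :: complex ^ 2) \<longleftrightarrow> x \<noteq> 0 \<or> y \<noteq> 0" for x y
    by (auto simp: vec_eq_iff forall_2)
  have a: "a > 0"
    using pos[of "vector [1, 0]"] q[of 1 0] nz[of 1 0] by simp
  have b: "b > 0"
    using pos[of "vector [0, 1]"] q[of 0 1] nz[of 0 1] by simp
  have "c * complex_of_real b * cnj (- c) = - of_real (b * (cmod c)\<^sup>2)"
    unfolding of_real_mult complex_norm_square by simp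
  then have "Re (c * complex_of_real b * cnj (- c)) = - (b * (cmod c)\<^sup>2)"
    by (simp only: uminus_complex.sel Re_complex_of_real)
  then have "Re (qform M (vector [of_real b, - c])) = b * (a * b - (cmod c)\<^sup>2)"
    unfolding q by (simp only: norm_minus_cancel norm_of_real power2_abs) (simp add: algebra_simps power2_eq_square)
  then have D: "a * b - (cmod c)\<^sup>2 > 0"
    using pos[of "vector [of_real b, - c]"] nz[of "of_real b" "- c"] b by (simp add: zero_less_mult_iff)
  let ?S = "sphere 0 1 :: (complex ^ 2) set"
  have "?S \<noteq> {}"
    using norm_sgn[of "axis 1 1 :: complex ^ 2"] by (auto simp: axis_eq_0_iff)
  moreover have "continuous_on ?S (\<lambda>v. Re (qform M v))"
    unfolding qform_def by (intro continuous_intros)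
  ultimately obtain v0 where v0: "v0 \<in> ?S" "\<And>v. v \<in> ?S \<Longrightarrow> Re (qform M v0) \<le> Re (qform M v)"
    using continuous_attains_inf[OF compact_sphere] by blast
  define m where "m = Re (qform M v0)"
  have "v0 \<noteq> 0"
    using v0(1) by auto
  then have "m > 0"
    using pos by (simp add: m_def)
  have "m * (norm v)\<^sup>2 \<le> Re (qform M v)" for v
  proof (cases "v = 0")
    case False
    define u where "u = complex_of_real (1 / norm v) *s v"
    have "u \<in> ?S"
      using False by (simp add: u_def norm_scale_vec norm_divide)
    then have "m \<le> Re (qform M u)"
      unfolding m_def by (rule v0(2))
    moreover have "qform M u = of_real (1 / (norm v)\<^sup>2) * qform M v"
      by (simp add: qform_def u_def sum_2 power2_eq_square algebra_simps add_divide_distrib)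
    ultimately show ?thesis
      using False by (simp add: pos_le_divide_eq)
  qed (simp add: qform_def)
  then show thesis
    using that[of a b c m] abc(1-4) a D \<open>m > 0\<close> by blast
qed

text \<open>A lifted orbit as a sequence of polynomial maps, with the dynamics stripped off;
  \<open>a\<close> is the point whose orbit is the reference. That \<open>P 0\<close> is the chart
  itself makes the Hessian of \<open>rho\<close> definite at \<open>a\<close>.\<close>

locale orbit_family =
  fixes P :: "nat \<Rightarrow> complex ^ 2 \<Rightarrow> complex ^ 3" and n :: nat and i :: 3 and a :: "complex ^ 2"
  assumes poly_P: "poly_fun (\<lambda>w. P k w $ s)"
    and P_nonzero: "P k w \<noteq> 0"
    and P_0: "P 0 w = affine_lift i w"
    and n_pos: "n > 0"
begin

definition Q :: "nat \<Rightarrow> complex ^ 3" where "Q k = P k a"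

definition sn :: "nat \<Rightarrow> complex ^ 2 \<Rightarrow> real" where "sn k w = sin_sq (P k w) (Q k)"

definition q :: "nat \<Rightarrow> complex ^ 2 \<Rightarrow> complex" where "q k w = cinner (P k w) (Q k)"

definition rho :: "complex ^ 2 \<Rightarrow> real" where "rho w = (\<Sum>k<n. tan_sq (sn k w))"

definition H :: "complex ^ 2 \<Rightarrow> complex ^ 2 ^ 2" where
  "H w = (\<Sum>k<n. complex_hessian (log_norm (P k)) w)"

definition J :: "(nat \<times> 3) set" where "J = {..<n} \<times> UNIV"

text \<open>The lift \<open>P k\<close>, rescaled into the affine hyperplane through
  \<open>Q k / |Q k|\<close> orthogonal to \<open>Q k\<close>, minus this base point. The rescaling
  is by 1 / \<open>q k\<close>, so the result is holomorphic where \<open>q k\<close> is nonzero,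
  and the length of the vector \<open>zvec k\<close> is the tangent of the angle between
  \<open>P k\<close> and \<open>Q k\<close>.\<close>

definition zeta :: "nat \<times> 3 \<Rightarrow> complex ^ 2 \<Rightarrow> complex" where
  "zeta c w = (of_real (norm (Q (fst c))) * P (fst c) w $ snd c) / q (fst c) w
     + (- Q (fst c) $ snd c / of_real (norm (Q (fst c))))"

definition zeta' :: "nat \<times> 3 \<Rightarrow> 2 \<Rightarrow> complex ^ 2 \<Rightarrow> complex" where
  "zeta' c j w =
     (dz j (\<lambda>w. of_real (norm (Q (fst c))) * P (fst c) w $ snd c) w * q (fst c) w
       - of_real (norm (Q (fst c))) * P (fst c) w $ snd c * dz j (q (fst c)) w) / (q (fst c) w * q (fst c) w)"

text \<open>On this open set no \<open>q k\<close> with \<open>k < n\<close> vanishes, so the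
  \<open>zeta\<close> are holomorphic, and \<open>tan_sq\<close> is the true squared
  tangent.\<close>

definition S :: "(complex ^ 2) set" where "S = {w. \<forall>k<n. sn k w < 1/2}"

section \<open>The function \<open>rho\<close> and its holomorphic coordinates\<close>

lemma Q_nonzero: "Q k \<noteq> 0"
  by (simp add: Q_def P_nonzero)

lemma poly_q: "poly_fun (q k)"
  unfolding q_def[abs_def] cinner_def by (intro poly_fun_sum poly_fun_mult poly_P poly_fun_const)

lemma poly_numerator: "poly_fun (\<lambda>w. of_real (norm (Q k)) * P k w $ s)"
  by (intro poly_fun_mult poly_P poly_fun_const)

lemma smooth_sn: "smooth (\<lambda>w. complex_of_real (sn k w))"
proof -
  have "complex_of_real (sn k w) = 1 - q k w * cnj (q k w) * inverse (cinner (P k w) (P k w) * cinner (Q k) (Q k))" for w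
    unfolding sn_def sin_sq_def of_real_diff of_real_divide of_real_mult complex_norm_square cinner_self
    by (simp add: q_def divide_inverse)
  moreover have "smooth (\<lambda>w. 1 - q k w * cnj (q k w) * inverse (cinner (P k w) (P k w) * cinner (Q k) (Q k)))"
    using P_nonzero Q_nonzero
    by (intro smooth_intros smooth_inverse poly_fun_smooth poly_q smooth_cinner poly_P) (simp add: cinner_self)
  ultimately show ?thesis
    by simp
qed

lemma sn_bounds: "0 \<le> sn k w" "sn k w \<le> 1" "sn k a = 0"
  by (simp_all add: sn_def sin_sq_nonneg sin_sq_le_1 Q_def sin_sq_self P_nonzero)

lemma smooth_rho: "smooth (\<lambda>w. complex_of_real (rho w))"
proof -
  have "smooth (\<lambda>w. complex_of_real (sn k w) *
      inverse (1 - complex_of_real (sn k w) * complex_of_real (smooth_step (1/2) (3/4) (sn k w))))" for k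
  proof (intro smooth_intros smooth_inverse smooth_sn smooth_smooth_step)
    show "1 - complex_of_real (sn k w) * complex_of_real (smooth_step (1/2) (3/4) (sn k w)) \<noteq> 0" for w
    proof -
      have "complex_of_real (1 - sn k w * smooth_step (1/2) (3/4) (sn k w)) \<noteq> 0"
        using tan_sq_denominator[OF sn_bounds(1)[of k w]] by (simp only: of_real_eq_0_iff)
      then show ?thesis
        by simp
    qed
  qed simp
  moreover have "complex_of_real (tan_sq (sn k w)) = complex_of_real (sn k w) *
      inverse (1 - complex_of_real (sn k w) * complex_of_real (smooth_step (1/2) (3/4) (sn k w)))" for k w
    unfolding tan_sq_def divide_inverse of_real_mult of_real_inverse of_real_diff of_real_1 ..
  ultimately have "smooth (\<lambda>w. complex_of_real (tan_sq (sn k w)))" for k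
    by simp
  then show ?thesis
    unfolding rho_def of_real_sum by (intro smooth_sum)
qed

lemma tan_sq_nonneg: "tan_sq (sn k w) \<ge> 0"
  using tan_sq_ge[OF sn_bounds(1)] sn_bounds(1) order_trans by blast

lemma rho_nonneg: "rho w \<ge> 0"
  unfolding rho_def by (intro sum_nonneg tan_sq_nonneg)

lemma sn_le_rho: "k < n \<Longrightarrow> sn k w \<le> rho w"
proof -
  assume "k < n"
  then have "tan_sq (sn k w) \<le> rho w"
    unfolding rho_def by (intro member_le_sum tan_sq_nonneg) auto
  then show ?thesis
    using tan_sq_ge[OF sn_bounds(1)[of k w]] by simp
qed

lemma continuous_sn: "continuous_on UNIV (sn k)"
  using continuous_on_Re[OF smooth_imp_continuous[OF smooth_sn]] by simp

lemma continuous_rho: "continuous_on UNIV rho"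
  using continuous_on_Re[OF smooth_imp_continuous[OF smooth_rho]] by simp

lemma open_S: "open S"
proof -
  have "S = (\<Inter>k\<in>{..<n}. {w. sn k w < 1/2})"
    by (auto simp: S_def)
  then show ?thesis
    by (simp only:) (intro open_INT ballI open_Collect_less continuous_sn continuous_on_const finite_lessThan)
qed

lemma a_in_S: "a \<in> S"
  by (simp add: S_def sn_bounds)

lemma sublevel_subset_S: "rho w < 1/2 \<Longrightarrow> w \<in> S"
  using sn_le_rho[of _ w] by (force simp: S_def)

lemma q_nonzero: "w \<in> S \<Longrightarrow> k < n \<Longrightarrow> q k w \<noteq> 0"
  by (auto simp: S_def sn_def sin_sq_def q_def)

lemma zeta_cderiv:
  assumes "w \<in> S" "c \<in> J"
  shows "has_cderiv (zeta c) (\<lambda>j. zeta' c j w) w"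
  unfolding zeta_def[abs_def] zeta'_def
  using assms by (intro has_cderiv_ratio poly_numerator poly_q q_nonzero) (auto simp: J_def)

lemma zeta'_cderiv:
  assumes "w \<in> S" "c \<in> J"
  shows "\<exists>g. has_cderiv (zeta' c j) g w"
proof -
  let ?p = "\<lambda>w. of_real (norm (Q (fst c))) * P (fst c) w $ snd c"
  let ?q = "q (fst c)"
  have pq: "poly_fun (\<lambda>w. dz j ?p w * ?q w - ?p w * dz j ?q w)" "poly_fun (\<lambda>w. ?q w * ?q w)"
    by (intro poly_fun_diff poly_fun_mult[of _ ?q] poly_fun_mult[of ?p] poly_fun_mult[of "dz j ?p"]
        poly_fun_mult[of _ "dz j ?q"] poly_fun_dz poly_numerator poly_q)+
  have "?q w * ?q w \<noteq> 0"
    using assms q_nonzero by (auto simp: J_def)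
  from has_cderiv_ratio[OF pq this, of 0] show ?thesis
    unfolding zeta'_def[abs_def] add_0_right by blast
qed

definition zvec :: "nat \<Rightarrow> complex ^ 2 \<Rightarrow> complex ^ 3" where "zvec k w = (\<chi> s. zeta (k, s) w)"

definition zvec' :: "nat \<Rightarrow> 2 \<Rightarrow> complex ^ 2 \<Rightarrow> complex ^ 3" where "zvec' k j w = (\<chi> s. zeta' (k, s) j w)"

lemma zvec_eq: "zvec k w = (of_real (norm (Q k)) / q k w) *s P k w - (1 / of_real (norm (Q k))) *s Q k"
  by (simp add: zvec_def zeta_def vec_eq_iff)

lemma dz_q: "dz j (q k) w = cinner (dvec j (P k) w) (Q k)"
  using dz_cinner[of "P k" "\<lambda>_. Q k" j w, OF poly_P poly_fun_const] by (simp add: q_def[abs_def])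

lemma zvec'_eq:
  "zvec' k j w = (of_real (norm (Q k)) / (q k w * q k w)) *s (q k w *s dvec j (P k) w - cinner (dvec j (P k) w) (Q k) *s P k w)"
proof -
  have "dz j (\<lambda>w. of_real (norm (Q k)) * P k w $ s) w = of_real (norm (Q k)) * dz j (\<lambda>w. P k w $ s) w" for s
    by (simp add: dz_mult poly_fun_differentiable[OF poly_P])
  then show ?thesis
    by (simp add: zvec'_def zeta'_def vec_eq_iff dz_q dvec_def algebra_simps diff_divide_distrib)
qed

lemma norm_zvec:
  assumes "w \<in> S" "k < n"
  shows "(norm (zvec k w))\<^sup>2 = sn k w / (1 - sn k w)"
proof -
  let ?N = "complex_of_real (norm (Q k))"
  have qn: "q k w \<noteq> 0" "cnj (q k w) \<noteq> 0"
    using q_nonzero[OF assms] by auto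
  have PQ: "cinner (P k w) (Q k) = q k w" "cinner (Q k) (P k w) = cnj (q k w)"
    by (simp_all add: q_def cnj_cinner)
  have QQ: "cinner (Q k) (Q k) = ?N\<^sup>2"
    by (simp add: cinner_self)
  have N0: "?N \<noteq> 0"
    using Q_nonzero by simp
  have "cinner (zvec k w) (zvec k w) = ?N\<^sup>2 * cinner (P k w) (P k w) / (q k w * cnj (q k w)) - 1"
    unfolding zvec_eq cinner_diff_left cinner_diff_right cinner_scale_left cinner_scale_right PQ QQ
    using qn N0 by (simp add: field_simps power2_eq_square)
  also have "\<dots> = of_real ((norm (Q k))\<^sup>2 * (norm (P k w))\<^sup>2 / (cmod (q k w))\<^sup>2 - 1)"
    unfolding of_real_diff of_real_divide of_real_mult complex_norm_square cinner_self[of "P k w"] by simp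
  finally have "(norm (zvec k w))\<^sup>2 = (norm (Q k))\<^sup>2 * (norm (P k w))\<^sup>2 / (cmod (q k w))\<^sup>2 - 1"
    unfolding cinner_self by (simp only: of_real_eq_iff)
  also have "\<dots> = sn k w / (1 - sn k w)"
    unfolding sn_def sin_sq_def q_def[symmetric] using qn P_nonzero[of k w] Q_nonzero[of k]
    by (simp add: field_simps)
  finally show ?thesis .
qed

lemma sum_J: "(\<Sum>c\<in>J. h c) = (\<Sum>k<n. \<Sum>s\<in>UNIV. h (k, s))"
  by (simp add: J_def sum.cartesian_product)

lemma rho_eq:
  assumes "w \<in> S"
  shows "complex_of_real (rho w) = (\<Sum>c\<in>J. zeta c w * cnj (zeta c w))"
proof -
  have "(\<Sum>c\<in>J. zeta c w * cnj (zeta c w)) = (\<Sum>k<n. cinner (zvec k w) (zvec k w))"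
    by (simp add: sum_J cinner_def zvec_def)
  also have "\<dots> = (\<Sum>k<n. complex_of_real (tan_sq (sn k w)))"
  proof (intro sum.cong refl)
    fix k assume "k \<in> {..<n}"
    then have "tan_sq (sn k w) = (norm (zvec k w))\<^sup>2"
      using assms norm_zvec[OF assms, of k] by (subst tan_sq_eq) (auto simp: S_def)
    then show "cinner (zvec k w) (zvec k w) = complex_of_real (tan_sq (sn k w))"
      by (simp add: cinner_self)
  qed
  finally show ?thesis
    by (simp add: rho_def)
qed

lemma finite_J: "finite J"
  by (simp add: J_def)

lemma
  assumes "w \<in> S"
  shows dz_rho: "dz j (\<lambda>w. complex_of_real (rho w)) w = (\<Sum>c\<in>J. zeta' c j w * cnj (zeta c w))"
    and dzbar_rho: "dzbar j (\<lambda>w. complex_of_real (rho w)) w = (\<Sum>c\<in>J. zeta c w * cnj (zeta' c j w))"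
    and hessian_rho: "complex_hessian (\<lambda>w. complex_of_real (rho w)) w $ j $ k = (\<Sum>c\<in>J. zeta' c j w * cnj (zeta' c k w))"
  using dz_sum_squares[OF finite_J open_S assms zeta_cderiv zeta'_cderiv[OF assms] rho_eq, of j]
    dzbar_sum_squares[OF finite_J open_S assms zeta_cderiv zeta'_cderiv[OF assms] rho_eq, of j]
    hessian_sum_squares[OF finite_J open_S assms zeta_cderiv zeta'_cderiv[OF assms] rho_eq, of j k]
  by blast+

lemma qform_hessian_rho:
  assumes "w \<in> S"
  shows "qform (complex_hessian (\<lambda>w. complex_of_real (rho w)) w) v =
    of_real (\<Sum>k<n. (norm (\<Sum>j\<in>UNIV. v $ j *s zvec' k j w))\<^sup>2)"
proof -
  have "(\<Sum>s\<in>UNIV. (cmod (\<Sum>j\<in>UNIV. zeta' (k, s) j w * v $ j))\<^sup>2) = (norm (\<Sum>j\<in>UNIV. v $ j *s zvec' k j w))\<^sup>2" for k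
    by (simp add: norm_vec_def L2_set_def sum_nonneg zvec'_def mult.commute)
  then show ?thesis
    unfolding qform_sum_squares[OF hessian_rho[OF assms]] sum_J by simp
qed

text \<open>By the invariances of \<open>levi\<close> the form of log |P k| may be computed at the
  rescaled lift \<open>p\<close>, with derivatives \<open>b\<close> orthogonal to
  \<open>Q k\<close>. Here |p|^2 = 1 + x with x = tan^2 at most 1 on \<open>S\<close>, and the
  product of \<open>b\<close> with \<open>p\<close> is that with \<open>zvec k\<close>, so
  Cauchy-Schwarz loses only the fraction x / (1 + x). What remains is |b|^2 / (2 (1 + x)^2), at
  least |b|^2 / 8.\<close>

lemma hessian_rho_le:
  assumes "w \<in> S"
  shows "psd ((\<chi> j k. 8 * H w $ j $ k) - complex_hessian (\<lambda>w. complex_of_real (rho w)) w)"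
proof -
  have key: "(norm (\<Sum>j\<in>UNIV. v $ j *s zvec' k j w))\<^sup>2 \<le> 8 * Re (qform (complex_hessian (log_norm (P k)) w) v)"
    and im: "Im (qform (complex_hessian (log_norm (P k)) w) v) = 0" if k: "k < n" for k v
  proof -
    define h where "h = complex_of_real (norm (Q k)) / q k w"
    define p where "p = h *s P k w"
    define b where "b = (\<Sum>j\<in>UNIV. v $ j *s zvec' k j w)"
    have qn: "q k w \<noteq> 0"
      by (rule q_nonzero[OF assms k])
    have h: "h \<noteq> 0"
      using qn Q_nonzero by (simp add: h_def)
    have p0: "p \<noteq> 0"
      using h P_nonzero by (simp add: p_def)
    have z': "zvec' k j w = h *s dvec j (P k) w + (- cinner (dvec j (P k) w) (Q k) / q k w) *s p" for j
      unfolding zvec'_eq p_def h_def using qn by (simp add: vec_eq_iff field_simps)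
    have "complex_hessian (log_norm (P k)) w $ j $ l = levi p (zvec' k j w) (zvec' k l w)" for j l
      unfolding z' levi_add_multiple[OF p0] unfolding p_def levi_scale[OF h]
      by (rule hessian_log_norm[OF poly_P P_nonzero])
    then have "complex_hessian (log_norm (P k)) w = (\<chi> j l. levi p (zvec' k j w) (zvec' k l w))"
      by (simp add: vec_eq_iff)
    then have qf: "qform (complex_hessian (log_norm (P k)) w) v = levi p b b"
      unfolding b_def by (simp only: qform_levi)
    show "Im (qform (complex_hessian (log_norm (P k)) w) v) = 0"
      unfolding qf by (rule levi_nonneg)
    have PQ: "cinner (P k w) (Q k) = q k w"
      by (simp add: q_def)
    have "cinner (zvec' k j w) (Q k) = 0" for j
      unfolding zvec'_eq cinner_scale_left cinner_diff_left PQ by simp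
    then have bQ: "cinner b (Q k) = 0"
      by (simp add: b_def cinner_sum_left cinner_scale_left)
    have QQ: "cinner (Q k) (Q k) = (of_real (norm (Q k)))\<^sup>2"
      by (simp add: cinner_self)
    have p_eq: "p = zvec k w + (1 / of_real (norm (Q k))) *s Q k"
      unfolding zvec_eq p_def h_def by simp
    have zQ: "cinner (zvec k w) (Q k) = 0"
      unfolding zvec_eq cinner_diff_left cinner_scale_left PQ QQ using qn Q_nonzero
      by (simp add: power2_eq_square)
    then have Qz: "cinner (Q k) (zvec k w) = 0"
      using cnj_cinner[of "zvec k w" "Q k"] by simp
    define x where "x = (norm (zvec k w))\<^sup>2"
    have "cinner p p = of_real (1 + x)"
      unfolding p_eq cinner_add_left cinner_add_right cinner_scale_left cinner_scale_right zQ Qz QQ x_def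
      using Q_nonzero by (simp add: cinner_self power2_eq_square)
    then have pp: "(norm p)\<^sup>2 = 1 + x"
      unfolding cinner_self by (simp only: of_real_eq_iff)
    have bp: "cinner b p = cinner b (zvec k w)"
      unfolding p_eq cinner_add_right cinner_scale_right bQ by simp
    have "sn k w < 1/2"
      using assms k by (simp add: S_def)
    then have x: "x \<ge> 0" "x \<le> 1"
      using sn_bounds(1)[of k w] by (auto simp: x_def norm_zvec[OF assms k])
    have "cmod (cinner b (zvec k w)) \<le> norm b * norm (zvec k w)"
      by (rule cinner_Cauchy_Schwarz)
    then have cs: "(cmod (cinner b p))\<^sup>2 \<le> (norm b)\<^sup>2 * x"
      unfolding bp x_def power_mult_distrib[symmetric] by (intro power_mono) auto
    have "cinner b p * cinner p b = of_real ((cmod (cinner b p))\<^sup>2)"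
      using complex_norm_square[of "cinner b p"] by (simp add: cnj_cinner)
    then have "levi p b b = of_real (((norm b)\<^sup>2 / (1 + x) - (cmod (cinner b p))\<^sup>2 / (1 + x)\<^sup>2) / 2)"
      by (simp add: levi_def cinner_self pp del: of_real_power of_real_add flip: of_real_power)
    then have "Re (levi p b b) = ((norm b)\<^sup>2 / (1 + x) - (cmod (cinner b p))\<^sup>2 / (1 + x)\<^sup>2) / 2"
      by (simp only: Re_complex_of_real)
    also have "\<dots> \<ge> ((norm b)\<^sup>2 / (1 + x) - (norm b)\<^sup>2 * x / (1 + x)\<^sup>2) / 2"
      using cs by (intro divide_right_mono diff_left_mono) auto
    also have "((norm b)\<^sup>2 / (1 + x) - (norm b)\<^sup>2 * x / (1 + x)\<^sup>2) / 2 = (norm b)\<^sup>2 / (2 * (1 + x)\<^sup>2)"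
    proof -
      have "(N / y - N * (y - 1) / y\<^sup>2) / 2 = N / (2 * y\<^sup>2)" if "y > 0" for N y :: real
        using that by (simp add: field_simps power2_eq_square)
      from this[of "1 + x" "(norm b)\<^sup>2"] show ?thesis
        using x(1) by simp
    qed
    also have "\<dots> \<ge> (norm b)\<^sup>2 / 8"
    proof (rule divide_left_mono)
      have "(1 + x)\<^sup>2 \<le> 2\<^sup>2"
        using x by (intro power_mono) auto
      then show "2 * (1 + x)\<^sup>2 \<le> 8"
        by simp
    qed (use x in auto)
    finally show "(norm (\<Sum>j\<in>UNIV. v $ j *s zvec' k j w))\<^sup>2 \<le> 8 * Re (qform (complex_hessian (log_norm (P k)) w) v)"
      unfolding qf b_def[symmetric] by simp
  qed
  have q: "qform (\<chi> j k. 8 * H w $ j $ k) v = 8 * (\<Sum>k<n. qform (complex_hessian (log_norm (P k)) w) v)" for v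
    unfolding qform_scale H_def qform_sum ..
  show ?thesis
    unfolding psd_def qform_diff q qform_hessian_rho[OF assms]
    using sum_mono[of "{..<n}", OF key] im by (auto simp: sum_distrib_left)
qed

lemma psd_hessian_rho: "w \<in> S \<Longrightarrow> psd (complex_hessian (\<lambda>w. complex_of_real (rho w)) w)"
  by (rule psd_sum_squares[OF hessian_rho])

lemma zeta_at_a: "c \<in> J \<Longrightarrow> zeta c a = 0"
proof -
  have "q k a = of_real (norm (Q k)) * of_real (norm (Q k))" for k
    by (simp add: q_def Q_def cinner_self power2_eq_square)
  then show ?thesis
    using Q_nonzero by (simp add: zeta_def Q_def)
qed

text \<open>Time 0 suffices. If its summand vanished for \<open>v\<close>, the derivative
  \<open>u\<close> of the chart along \<open>v\<close> would be a multiple of the lift; but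
  \<open>u\<close> has coordinate 0 at \<open>i\<close>, where the lift has 1. Hence
  \<open>u = 0\<close>, and \<open>v = 0\<close> because the chart is an immersion.\<close>

lemma qform_at_a_positive:
  assumes "v \<noteq> 0"
  shows "Re (qform (complex_hessian (\<lambda>w. complex_of_real (rho w)) a) v) > 0"
proof (rule ccontr)
  assume "\<not> ?thesis"
  then have "(\<Sum>k<n. (norm (\<Sum>j\<in>UNIV. v $ j *s zvec' k j a))\<^sup>2) \<le> 0"
    by (simp add: qform_hessian_rho[OF a_in_S])
  moreover have "(norm (\<Sum>j\<in>UNIV. v $ j *s zvec' 0 j a))\<^sup>2 \<le> (\<Sum>k<n. (norm (\<Sum>j\<in>UNIV. v $ j *s zvec' k j a))\<^sup>2)"
    using n_pos by (intro member_le_sum) auto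
  ultimately have "(norm (\<Sum>j\<in>UNIV. v $ j *s zvec' 0 j a))\<^sup>2 \<le> 0"
    by linarith
  then have 0: "(\<Sum>j\<in>UNIV. v $ j *s zvec' 0 j a) = 0"
    by simp
  have qn: "q 0 a \<noteq> 0"
    by (rule q_nonzero[OF a_in_S n_pos])
  define u where "u = (\<Sum>j\<in>UNIV. v $ j *s dvec j (P 0) a)"
  have P0: "P 0 = affine_lift i"
    by (rule ext) (rule P_0)
  have dP: "dvec j (P 0) a = axis (affine_index i j) 1" for j
    unfolding P0 by (rule dvec_affine_lift)
  define e where "e = cinner u (Q 0)"
  have "(of_real (norm (Q 0)) / (q 0 a * q 0 a)) *s (q 0 a *s u - e *s P 0 a) = 0"
  proof -
    have "(\<Sum>j\<in>UNIV. v $ j *s zvec' 0 j a) = (of_real (norm (Q 0)) / (q 0 a * q 0 a)) *s (q 0 a *s u - e *s P 0 a)"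
      unfolding zvec'_eq u_def e_def sum_2 by (simp add: vec_eq_iff cinner_add_left cinner_scale_left algebra_simps add_divide_distrib)
    then show ?thesis
      using 0 by simp
  qed
  moreover have "of_real (norm (Q 0)) / (q 0 a * q 0 a) \<noteq> 0"
    using qn Q_nonzero by simp
  ultimately have "q 0 a *s u - e *s P 0 a = 0"
    unfolding vector_mul_eq_0 by blast
  then have eq: "q 0 a *s u = e *s P 0 a"
    by simp
  have "u $ i = 0"
    unfolding u_def dP by (simp add: sum_2 axis_def affine_index_neq affine_index_neq[symmetric])
  then have "e = 0"
    using arg_cong[OF eq, of "\<lambda>x. x $ i"] by (simp add: P_0 affine_lift_index)
  then have "u = 0"
    using eq qn by simp
  have "u $ affine_index i k = v $ k" for k
  proof -
    have "affine_index i j = affine_index i k \<longleftrightarrow> j = k" for j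
      using exhaust_3[of i] exhaust_2[of j] exhaust_2[of k] by (auto simp: affine_index_def)
    then show ?thesis
      unfolding u_def dP by (simp add: axis_def if_distrib[of "\<lambda>x. _ * x"] eq_commute[of "affine_index i k"] cong: if_cong)
  qed
  then have "v = 0"
    using \<open>u = 0\<close> by (simp add: vec_eq_iff)
  then show False
    using assms by simp
qed

text \<open>All the \<open>zeta\<close> vanish at \<open>a\<close>, and the squared moduli of their
  linear parts add up to the quadratic form. The precision \<eta> is such that the total error, 3
  \<open>card J\<close> \<eta>^2 times |v|^2, is at most half the lower bound \<open>m\<close> |v|^2
  of the form.\<close>

lemma rho_near_a:
  obtains r where "r > 0"
    "\<And>v. norm v < r \<Longrightarrow> rho (a + v) \<le> 2 * Re (qform (complex_hessian (\<lambda>w. complex_of_real (rho w)) a) v)"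
proof -
  let ?q = "\<lambda>v. Re (qform (complex_hessian (\<lambda>w. complex_of_real (rho w)) a) v)"
  obtain x y z m where "m > 0" and m: "\<And>v. m * (norm v)\<^sup>2 \<le> ?q v"
    using positive_qform_bounds[OF psd_hessian_rho[OF a_in_S] qform_at_a_positive] by metis
  define \<eta> where "\<eta> = sqrt (m / (6 * (card J + 1)))"
  have \<eta>: "\<eta> > 0" "\<eta>\<^sup>2 = m / (6 * (card J + 1))"
    using \<open>m > 0\<close> by (simp_all add: \<eta>_def)
  have "\<exists>r>0. \<forall>v. norm v < r \<longrightarrow> cmod (zeta c (a + v) - (\<Sum>j\<in>UNIV. zeta' c j a * v $ j)) \<le> \<eta> * norm v"
    if c: "c \<in> J" for c
  proof -
    have "(zeta c has_derivative (\<lambda>v. \<Sum>j\<in>UNIV. zeta' c j a * v $ j)) (at a)"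
      using zeta_cderiv[OF a_in_S c] by (simp add: has_cderiv_def)
    then obtain r where "r > 0" "\<And>w. norm (w - a) < r \<Longrightarrow>
        cmod (zeta c w - zeta c a - (\<Sum>j\<in>UNIV. zeta' c j a * (w - a) $ j)) \<le> \<eta> * norm (w - a)"
      using \<eta>(1) unfolding has_derivative_at_alt by blast
    from this(1) this(2)[of "a + _"] show ?thesis
      by (intro exI[of _ r]) (simp add: zeta_at_a[OF c])
  qed
  then obtain r where r: "\<And>c. c \<in> J \<Longrightarrow> r c > 0"
    "\<And>c v. c \<in> J \<Longrightarrow> norm v < r c \<Longrightarrow> cmod (zeta c (a + v) - (\<Sum>j\<in>UNIV. zeta' c j a * v $ j)) \<le> \<eta> * norm v"
    by metis
  obtain r0 where r0: "r0 > 0" "ball a r0 \<subseteq> S"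
    using open_S a_in_S by (auto elim: openE)
  define r1 where "r1 = Min (insert r0 (r ` J))"
  have r1: "r1 > 0" "r1 \<le> r0" "\<And>c. c \<in> J \<Longrightarrow> r1 \<le> r c"
    using r(1) r0(1) finite_J by (auto simp: r1_def)
  show thesis
  proof (rule that[OF r1(1)])
    fix v :: "complex ^ 2" assume v: "norm v < r1"
    let ?l = "\<lambda>c. \<Sum>j\<in>UNIV. zeta' c j a * v $ j"
    have "a + v \<in> S"
      using v r1(2) r0(2) by (auto simp: dist_norm)
    have "complex_of_real (rho (a + v)) = of_real (\<Sum>c\<in>J. (cmod (zeta c (a + v)))\<^sup>2)"
      unfolding rho_eq[OF \<open>a + v \<in> S\<close>] of_real_sum complex_norm_square ..
    then have "rho (a + v) = (\<Sum>c\<in>J. (cmod (zeta c (a + v)))\<^sup>2)"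
      by (simp only: of_real_eq_iff)
    also have "\<dots> \<le> (\<Sum>c\<in>J. 3/2 * (cmod (?l c))\<^sup>2 + 3 * (\<eta>\<^sup>2 * (norm v)\<^sup>2))"
    proof (rule sum_mono)
      fix c assume c: "c \<in> J"
      have "cmod (zeta c (a + v) - ?l c) \<le> \<eta> * norm v"
        using r(2)[OF c] v r1(3)[OF c] by simp
      then have "(cmod (zeta c (a + v) - ?l c))\<^sup>2 \<le> \<eta>\<^sup>2 * (norm v)\<^sup>2"
        unfolding power_mult_distrib[symmetric] by (intro power_mono) auto
      then show "(cmod (zeta c (a + v)))\<^sup>2 \<le> 3/2 * (cmod (?l c))\<^sup>2 + 3 * (\<eta>\<^sup>2 * (norm v)\<^sup>2)"
        using norm_sq_add_le[of "?l c" "zeta c (a + v) - ?l c"] by simp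
    qed
    also have "\<dots> = 3/2 * ?q v + card J * (3 * (\<eta>\<^sup>2 * (norm v)\<^sup>2))"
      unfolding qform_sum_squares[OF hessian_rho[OF a_in_S]] by (simp add: sum.distrib sum_distrib_left)
    also have "card J * (3 * (\<eta>\<^sup>2 * (norm v)\<^sup>2)) \<le> m * (norm v)\<^sup>2 / 2"
    proof -
      have "real (card J) / (real (card J) + 1) \<le> 1"
        by simp
      then have "real (card J) / (real (card J) + 1) * (m * (norm v)\<^sup>2 / 2) \<le> 1 * (m * (norm v)\<^sup>2 / 2)"
        using \<open>m > 0\<close> by (intro mult_right_mono) auto
      moreover have "card J * (3 * (\<eta>\<^sup>2 * (norm v)\<^sup>2)) = real (card J) / (real (card J) + 1) * (m * (norm v)\<^sup>2 / 2)"
        unfolding \<eta>(2) by (simp add: field_simps)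
      ultimately show ?thesis
        by simp
    qed
    also have "m * (norm v)\<^sup>2 / 2 \<le> ?q v / 2"
      using m[of v] by simp
    finally show "rho (a + v) \<le> 2 * ?q v"
      by simp
  qed
qed

text \<open>Combining 1/32 with the factor 8 / t^2 of the radial estimate gives t^2 / 256 for the
  mass of (dd^c \<open>rho\<close>)^2. The comparison of \<open>rho\<close> with 8 \<open>H\<close>
  costs another 64, and 256 * 64 = 16384. Nothing in the constant depends on \<open>n\<close> or on
  the orbit.\<close>

theorem bowen_ball_mass:
  assumes t: "0 < t" "t \<le> 1/2" and B: "compact {w. rho w \<le> t}"
  shows "t\<^sup>2 / 16384 \<le> (\<integral>w. indicator {w. rho w < t} w * Re (mixed_disc (H w) (H w)) \<partial>lborel)"
proof -
  define R where "R w = complex_of_real (rho w)" for w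
  define N where "N w = Re (mixed_disc (complex_hessian R w) (complex_hessian R w))" for w
  have R: "smooth R"
    unfolding R_def[abs_def] by (rule smooth_rho)
  have inS: "w \<in> S" if "rho w < t" for w
    using that t by (intro sublevel_subset_S) simp
  have psdR: "psd (complex_hessian R w)" if "w \<in> S" for w
    unfolding R_def[abs_def] by (rule psd_hessian_rho[OF that])
  have N_nonneg: "N w \<ge> 0" if "rho w < t" for w
    unfolding N_def by (intro mixed_disc_psd psdR inS that)
  define \<beta> where "\<beta> w = (\<chi> j k. dz j R w * dzbar k R w)" for w
  have \<beta>: "0 \<le> Re (mixed_disc (\<beta> w) (complex_hessian R w))"
    "2 * Re (mixed_disc (\<beta> w) (complex_hessian R w)) \<le> rho w * N w" if w: "rho w < t" for w
  proof -
    note w' = inS[OF w]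
    have d: "dz j R w = (\<Sum>c\<in>J. zeta' c j w * cnj (zeta c w))" "dzbar j R w = (\<Sum>c\<in>J. zeta c w * cnj (zeta' c j w))" for j
      unfolding R_def[abs_def] by (rule dz_rho[OF w'] dzbar_rho[OF w'])+
    have cnjd: "dzbar k R w = cnj (dz k R w)" for k
      unfolding d by (simp add: mult.commute)
    have "psd (\<beta> w)"
      by (rule psd_sum_squares[where J = "{()}" and x = "\<lambda>_ j. dz j R w"]) (simp add: \<beta>_def cnjd)
    then show "0 \<le> Re (mixed_disc (\<beta> w) (complex_hessian R w))"
      by (intro mixed_disc_psd(2) psdR w')
    have h: "complex_hessian R w $ j $ k = (\<Sum>c\<in>J. zeta' c j w * cnj (zeta' c k w))" for j k
      unfolding R_def[abs_def] by (rule hessian_rho[OF w'])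
    have "2 * Re (mixed_disc (\<beta> w) (complex_hessian R w)) \<le>
        Re (\<Sum>c\<in>J. zeta c w * cnj (zeta c w)) * Re (mixed_disc (complex_hessian R w) (complex_hessian R w))"
      by (rule gram_inequality[where x = "\<lambda>c. zeta' c 1 w" and y = "\<lambda>c. zeta' c 2 w"])
        (simp_all add: h \<beta>_def d finite_J)
    then show "2 * Re (mixed_disc (\<beta> w) (complex_hessian R w)) \<le> rho w * N w"
      by (simp add: N_def flip: rho_eq[OF w'])
  qed
  have cont: "continuous_on UNIV (\<lambda>w. complex_hessian h w $ l $ m)" if "smooth h" for h l m
    by (intro smooth_imp_continuous smooth_hessian that)
  have cN: "continuous_on UNIV N"
    unfolding N_def mixed_disc_def
    by (intro continuous_on_Re continuous_on_diff continuous_on_add continuous_on_mult cont R)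
  obtain x y z m where M: "complex_hessian R a $ 1 $ 1 = complex_of_real x" "complex_hessian R a $ 2 $ 2 = complex_of_real y"
    "complex_hessian R a $ 1 $ 2 = z" "complex_hessian R a $ 2 $ 1 = cnj z" "x > 0" "x * y - (cmod z)\<^sup>2 > 0"
    "m > 0" "\<And>v. m * (norm v)\<^sup>2 \<le> Re (qform (complex_hessian R a) v)"
    using positive_qform_bounds[OF psd_hessian_rho[OF a_in_S] qform_at_a_positive] unfolding R_def[abs_def] by metis
  obtain r where r: "r > 0" "\<And>v. norm v < r \<Longrightarrow> rho (a + v) \<le> 2 * Re (qform (complex_hessian R a) v)"
    using rho_near_a unfolding R_def[abs_def] by metis
  have Na: "N a = 2 * (x * y - (cmod z)\<^sup>2)"
  proof -
    have "mixed_disc (complex_hessian R a) (complex_hessian R a) = of_real (2 * (x * y - (cmod z)\<^sup>2))"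
      unfolding mixed_disc_def M(1-4) of_real_mult of_real_diff complex_norm_square by (simp add: algebra_simps)
    then show ?thesis
      unfolding N_def by simp
  qed
  obtain \<epsilon> where \<epsilon>: "\<epsilon> > 0"
    "1 / 32 \<le> (\<integral>w. indicator {w. rho w < t / 2} w * (\<epsilon> / (rho w + \<epsilon>) ^ 3 * N w) \<partial>lborel)"
    using mass_at_point[OF M(1-6) cN Na N_nonneg t(1) continuous_rho rho_nonneg B M(7,8) r] by blast
  have "1 / 32 \<le> 8 / t\<^sup>2 * (\<integral>w. indicator {w. rho w < t} w * N w \<partial>lborel)"
    using \<epsilon>(2) radial_estimate[OF R[unfolded R_def] rho_nonneg t(1) \<epsilon>(1) B]
      N_nonneg \<beta> unfolding N_def \<beta>_def R_def[abs_def] by (meson order_trans)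
  then have 1: "t\<^sup>2 / 256 \<le> (\<integral>w. indicator {w. rho w < t} w * N w \<partial>lborel)"
    using t(1) by (simp add: field_simps)
  have E: "{w. rho w < t} \<in> sets borel"
    using open_Collect_less[OF continuous_rho continuous_on_const] by simp
  have cH: "continuous_on UNIV (\<lambda>w. H w $ l $ m)" for l m
    unfolding H_def sum_component by (intro continuous_intros cont smooth_log_norm poly_P P_nonzero)
  have cHH: "continuous_on UNIV (\<lambda>w. Re (mixed_disc (H w) (H w)))"
    unfolding mixed_disc_def by (intro continuous_on_Re continuous_on_diff continuous_on_add continuous_on_mult cH)
  have "(\<integral>w. indicator {w. rho w < t} w * N w \<partial>lborel) \<le> (\<integral>w. 64 * (indicator {w. rho w < t} w * Re (mixed_disc (H w) (H w))) \<partial>lborel)"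
  proof (rule integral_mono)
    show "integrable lborel (\<lambda>w. indicator {w. rho w < t} w * N w)"
      by (rule integrable_indicator_mult[OF cN B E]) auto
    show "integrable lborel (\<lambda>w. 64 * (indicator {w. rho w < t} w * Re (mixed_disc (H w) (H w))))"
      by (intro integrable_mult_right integrable_indicator_mult[OF cHH B E]) auto
    show "indicator {w. rho w < t} w * N w \<le> 64 * (indicator {w. rho w < t} w * Re (mixed_disc (H w) (H w)))" for w
    proof (cases "rho w < t")
      case True
      have "N w \<le> Re (mixed_disc (\<chi> j k. 8 * H w $ j $ k) (\<chi> j k. 8 * H w $ j $ k))"
        unfolding N_def using hessian_rho_le[OF inS[OF True]] psdR[OF inS[OF True]]
        by (intro mixed_disc_mono) (simp_all add: R_def[abs_def])
      also have "mixed_disc (\<chi> j k. 8 * H w $ j $ k) (\<chi> j k. 8 * H w $ j $ k) = 64 * mixed_disc (H w) (H w)"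
        by (simp add: mixed_disc_def algebra_simps)
      finally show ?thesis
        using True by simp
    qed simp
  qed
  then have "(\<integral>w. indicator {w. rho w < t} w * N w \<partial>lborel) \<le> 64 * (\<integral>w. indicator {w. rho w < t} w * Re (mixed_disc (H w) (H w)) \<partial>lborel)"
    by simp
  then show ?thesis
    using 1 by simp
qed

end

section \<open>Separated sets\<close>

text \<open>Pythagoras: the vector from \<open>c *s y\<close> to \<open>x\<close> splits into a
  component orthogonal to the line of \<open>y\<close> and one along it.\<close>

lemma norm_diff_proj_sq:
  assumes "y \<noteq> 0"
  shows "(norm (x - c *s y))\<^sup>2 = (norm x)\<^sup>2 * sin_sq x y + (cmod (c - cinner x y / cinner y y))\<^sup>2 * (norm y)\<^sup>2"
proof (cases "x = 0")
  case True
  then show ?thesis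
    using assms by (simp add: norm_scale_vec cinner_def power_mult_distrib)
next
  case False
  have yy: "cinner y y \<noteq> 0"
    using assms by (simp add: cinner_self)
  have cyy: "cnj (cinner y y) = cinner y y"
    by (rule cnj_cinner)
  have "complex_of_real ((norm x)\<^sup>2 * sin_sq x y) = cinner x x - cinner x y * cnj (cinner x y) / cinner y y"
    using False assms unfolding sin_sq_def cinner_self complex_norm_square[symmetric]
    by (simp add: right_diff_distrib)
  then have "complex_of_real ((norm x)\<^sup>2 * sin_sq x y + (cmod (c - cinner x y / cinner y y))\<^sup>2 * (norm y)\<^sup>2)
    = cinner x x - cinner x y * cnj (cinner x y) / cinner y y
      + (c - cinner x y / cinner y y) * cnj (c - cinner x y / cinner y y) * cinner y y"
    by (simp only: of_real_add of_real_mult complex_norm_square cinner_self[of y, symmetric])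
  also have "\<dots> = cinner x x - cnj c * cinner x y - c * cnj (cinner x y) + c * cnj c * cinner y y"
    unfolding complex_cnj_diff complex_cnj_divide cyy using yy by (simp add: field_simps)
  also have "\<dots> = cinner (x - c *s y) (x - c *s y)"
    by (simp add: cinner_diff_left cinner_diff_right cinner_scale_left cinner_scale_right cnj_cinner algebra_simps)
  finally show ?thesis
    unfolding cinner_self by (simp only: of_real_eq_iff)
qed

lemma sin_sq_le: "y \<noteq> 0 \<Longrightarrow> (norm x)\<^sup>2 * sin_sq x y \<le> (norm (x - c *s y))\<^sup>2"
  by (simp add: norm_diff_proj_sq)

lemma sin_sq_attained:
  "y \<noteq> 0 \<Longrightarrow> (norm (x - (cinner x y / cinner y y) *s y))\<^sup>2 = (norm x)\<^sup>2 * sin_sq x y"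
  by (simp add: norm_diff_proj_sq)

text \<open>Project \<open>x\<close> to the line of \<open>y\<close> and that point to the line of
  \<open>z\<close>; the distances add up, and the factor 2 comes from squaring a sum of two
  terms.\<close>

lemma sin_sq_triangle:
  assumes "x \<noteq> 0" "y \<noteq> 0" "z \<noteq> 0"
  shows "sin_sq x z \<le> 2 * sin_sq x y + 2 * sin_sq y z"
proof -
  define c where "c = cinner x y / cinner y y"
  define c' where "c' = cinner y z / cinner z z"
  define e1 where "e1 = x - c *s y"
  define e2 where "e2 = y - c' *s z"
  have e1: "(norm e1)\<^sup>2 = (norm x)\<^sup>2 * sin_sq x y" and e2: "(norm e2)\<^sup>2 = (norm y)\<^sup>2 * sin_sq y z"
    unfolding e1_def e2_def c_def c'_def by (intro sin_sq_attained assms)+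
  have "cmod c = cmod (cinner x y) / (norm y)\<^sup>2"
    unfolding c_def norm_divide cinner_self norm_of_real by simp
  also have "\<dots> \<le> norm x * norm y / (norm y)\<^sup>2"
    by (intro divide_right_mono cinner_Cauchy_Schwarz) auto
  finally have c: "cmod c * norm y \<le> norm x"
    using assms by (simp add: power2_eq_square field_simps)
  have "(norm x)\<^sup>2 * sin_sq x z \<le> (norm (x - (c * c') *s z))\<^sup>2"
    by (rule sin_sq_le[OF assms(3)])
  also have "x - (c * c') *s z = e1 + c *s e2"
    by (simp add: e1_def e2_def vec_eq_iff algebra_simps)
  also have "(norm (e1 + c *s e2))\<^sup>2 \<le> (norm e1 + cmod c * norm e2)\<^sup>2"
    using norm_triangle_ineq[of e1 "c *s e2"] by (intro power_mono) (auto simp: norm_scale_vec)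
  also have "\<dots> \<le> 2 * (norm e1)\<^sup>2 + 2 * ((cmod c)\<^sup>2 * (norm e2)\<^sup>2)"
    using sum_squares_bound[of "norm e1" "cmod c * norm e2"] by (simp add: power2_sum power_mult_distrib)
  also have "(cmod c)\<^sup>2 * (norm e2)\<^sup>2 = (cmod c * norm y)\<^sup>2 * sin_sq y z"
    unfolding e2 by (simp add: power_mult_distrib)
  also have "\<dots> \<le> (norm x)\<^sup>2 * sin_sq y z"
    using c by (intro mult_right_mono power_mono sin_sq_nonneg) auto
  finally have "(norm x)\<^sup>2 * sin_sq x z \<le> (norm x)\<^sup>2 * (2 * sin_sq x y + 2 * sin_sq y z)"
    unfolding e1 by (simp add: algebra_simps)
  then show ?thesis
    using assms(1) by simp
qed

lemma sin_sq_commute: "sin_sq x y = sin_sq y x"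
proof -
  have "cmod (cinner x y) = cmod (cinner y x)"
    by (metis cnj_cinner complex_mod_cnj)
  then show ?thesis
    by (simp add: sin_sq_def mult.commute)
qed

text \<open>The numerator of the squared sine is the defect in the Cauchy-Schwarz inequality for the
  two lifts. It exceeds |w - a|^2 by the corresponding defect for \<open>w\<close> and
  \<open>a\<close>.\<close>

lemma sin_sq_affine_lift:
  "sin_sq (affine_lift i w) (affine_lift i a) \<ge> (norm (w - a))\<^sup>2 / ((1 + (norm w)\<^sup>2) * (1 + (norm a)\<^sup>2))"
proof -
  have c: "cinner (affine_lift i w) (affine_lift i a) = 1 + cinner w a"
    using exhaust_3[of i] by (auto simp: affine_lift_def cinner_def sum_2 sum_3)
  have re: "(norm (w - a))\<^sup>2 = (norm w)\<^sup>2 + (norm a)\<^sup>2 - 2 * Re (cinner w a)"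
  proof -
    have "complex_of_real ((norm (w - a))\<^sup>2) = cinner w w + cinner a a - (cinner w a + cnj (cinner w a))"
      unfolding cinner_self[of "w - a", symmetric] cinner_diff_left cinner_diff_right cnj_cinner by simp
    also have "\<dots> = of_real ((norm w)\<^sup>2 + (norm a)\<^sup>2 - 2 * Re (cinner w a))"
      unfolding cinner_self complex_add_cnj by simp
    finally show ?thesis
      by (simp only: of_real_eq_iff)
  qed
  have "(cmod (1 + cinner w a))\<^sup>2 = 1 + 2 * Re (cinner w a) + (cmod (cinner w a))\<^sup>2"
    unfolding cmod_power2 by (simp add: power2_eq_square algebra_simps)
  also have "(cmod (cinner w a))\<^sup>2 \<le> (norm w)\<^sup>2 * (norm a)\<^sup>2"
    using power_mono[OF cinner_Cauchy_Schwarz[of w a], of 2] by (simp add: power_mult_distrib)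
  finally have "(norm (w - a))\<^sup>2 \<le> (1 + (norm w)\<^sup>2) * (1 + (norm a)\<^sup>2) - (cmod (1 + cinner w a))\<^sup>2"
    unfolding re by (simp add: algebra_simps)
  moreover have p: "(1 + (norm w)\<^sup>2) * (1 + (norm a)\<^sup>2) > 0"
    by (simp add: add_pos_nonneg)
  ultimately have "(norm (w - a))\<^sup>2 / ((1 + (norm w)\<^sup>2) * (1 + (norm a)\<^sup>2))
      \<le> ((1 + (norm w)\<^sup>2) * (1 + (norm a)\<^sup>2) - (cmod (1 + cinner w a))\<^sup>2) / ((1 + (norm w)\<^sup>2) * (1 + (norm a)\<^sup>2))"
    by (intro divide_right_mono) auto
  also have "\<dots> = sin_sq (affine_lift i w) (affine_lift i a)"
    unfolding sin_sq_def c norm_affine_lift diff_divide_distrib using p by (simp only: divide_self[OF less_imp_neq[symmetric]])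
  finally show ?thesis .
qed

lemma sin_sq_affine_lift_uniform:
  assumes "s > 0" "R > 0"
  obtains \<tau> where "\<tau> > 0" "\<And>i w a. norm a \<le> R \<Longrightarrow> sin_sq (affine_lift i w) (affine_lift i a) < \<tau> \<Longrightarrow> norm (w - a) < s"
proof -
  \<comment> \<open>With x = |w - a|^2, the squared sine is at least x / ((1 + 2 R^2 + 2 x) (1 +
    R^2)). This increases with x, and \<tau> is its value at x = s^2.\<close>
  define \<tau> where "\<tau> = s\<^sup>2 / ((1 + 2 * R\<^sup>2 + 2 * s\<^sup>2) * (1 + R\<^sup>2))"
  have dpos: "1 + 2 * R\<^sup>2 + 2 * s\<^sup>2 > 0" "1 + R\<^sup>2 > 0"
    by (simp_all add: add_pos_nonneg)
  have "norm (w - a) < s" if a: "norm a \<le> R" and lt: "sin_sq (affine_lift i w) (affine_lift i a) < \<tau>" for i w a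
  proof (rule ccontr)
    assume "\<not> ?thesis"
    then have ge: "s\<^sup>2 \<le> (norm (w - a))\<^sup>2"
      using assms(1) by (intro power_mono) auto
    define x where "x = (norm (w - a))\<^sup>2"
    have aR: "(norm a)\<^sup>2 \<le> R\<^sup>2"
      using a by (intro power_mono) auto
    have "norm w \<le> norm a + norm (w - a)"
      using norm_triangle_ineq[of a "w - a"] by simp
    then have "(norm w)\<^sup>2 \<le> (norm a + norm (w - a))\<^sup>2"
      by (intro power_mono) auto
    also have "\<dots> \<le> 2 * (norm a)\<^sup>2 + 2 * x"
      using sum_squares_bound[of "norm a" "norm (w - a)"] by (simp add: power2_sum x_def)
    finally have w: "1 + (norm w)\<^sup>2 \<le> 1 + 2 * R\<^sup>2 + 2 * x"
      using aR by simp
    have x: "x \<ge> s\<^sup>2" "x > 0"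
      using ge assms(1) by (auto simp: x_def intro: less_le_trans[of _ "s\<^sup>2"])
    have "s\<^sup>2 * (1 + 2 * R\<^sup>2 + 2 * x) \<le> x * (1 + 2 * R\<^sup>2 + 2 * s\<^sup>2)"
      using mult_right_mono[OF x(1), of "1 + 2 * R\<^sup>2"] by (simp add: algebra_simps add_nonneg_nonneg)
    then have "s\<^sup>2 / (1 + 2 * R\<^sup>2 + 2 * s\<^sup>2) \<le> x / (1 + 2 * R\<^sup>2 + 2 * x)"
      using x dpos by (simp add: divide_simps add_pos_nonneg)
    then have "\<tau> \<le> x / (1 + 2 * R\<^sup>2 + 2 * x) / (1 + R\<^sup>2)"
      using dpos unfolding \<tau>_def by (simp add: divide_right_mono flip: divide_divide_eq_left)
    also have "\<dots> \<le> x / (1 + (norm w)\<^sup>2) / (1 + (norm a)\<^sup>2)"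
      using w aR x by (intro frac_le divide_nonneg_nonneg add_pos_nonneg) auto
    also have "\<dots> \<le> sin_sq (affine_lift i w) (affine_lift i a)"
      using sin_sq_affine_lift[of w a i] by (simp add: x_def)
    finally show False
      using lt by simp
  qed
  moreover have "\<tau> > 0"
    using assms dpos by (simp add: \<tau>_def)
  ultimately show thesis
    using that by blast
qed

lemma mixed_disc_sum:
  "mixed_disc (\<Sum>x\<in>X. M x) (\<Sum>y\<in>Y. N y) = (\<Sum>x\<in>X. \<Sum>y\<in>Y. mixed_disc (M x) (N y))"
  by (simp add: mixed_disc_def sum_product sum.distrib sum_subtractf)

context lifted_endomorphism
begin

definition separated :: "3 \<Rightarrow> nat \<Rightarrow> real \<Rightarrow> (complex ^ 2) set \<Rightarrow> bool" where
  "separated i n \<delta> A \<longleftrightarrow>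
     (\<forall>a\<in>A. \<forall>b\<in>A. a \<noteq> b \<longrightarrow> (\<exists>k<n. sin_sq (lift_iter i k a) (lift_iter i k b) \<ge> \<delta>))"

lemma orbit_family_lift_iter: "n > 0 \<Longrightarrow> orbit_family (lift_iter i) n i"
  by unfold_locales (auto simp: poly_fun_lift_iter lift_iter_nonzero, simp add: lift_iter_def)

text \<open>The radius \<open>s\<close> precedes \<delta>, so that one finite cover will later serve
  every \<delta>. The disjoint sublevel sets lie where the bump equals 1; their masses therefore sum
  to at most the integral of the bump against the square of \<open>H\<close>, a double sum over
  times \<open>k, l < n\<close> of the masses of \<open>local_mass_bound\<close>.\<close>

lemma card_separated_le:
  assumes \<mu>: "green_measure f d \<mu>" and x: "chart i a0 \<notin> measure_support \<mu>"
  obtains s where "s > 0" "\<And>\<delta>. \<delta> > 0 \<Longrightarrow> \<exists>K>0. \<forall>n A. n > 0 \<longrightarrow> finite A \<longrightarrow> A \<subseteq> ball a0 s \<longrightarrow>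
    separated i n \<delta> A \<longrightarrow> real (card A) \<le> K * (real n)\<^sup>2 * real d ^ n"
proof -
  obtain r C where rC: "r > 0" "C \<ge> 0" and ex: "\<exists>\<theta>. test_function (\<lambda>w. complex_of_real (\<theta> w)) \<and> (\<forall>w. \<theta> w \<ge> 0) \<and> (\<forall>w\<in>cball a0 r. \<theta> w = 1) \<and>
      (\<forall>m n. cmod (\<integral>w. complex_of_real (\<theta> w) * mixed_disc (complex_hessian (log_norm (lift_iter i m)) w)
          (complex_hessian (log_norm (lift_iter i n)) w) \<partial>lborel) \<le> C * (real d ^ m + real d ^ n))"
    using local_mass_bound[OF assms] .
  then obtain \<theta> where \<theta>: "test_function (\<lambda>w. complex_of_real (\<theta> w))" "\<And>w. \<theta> w \<ge> 0" "\<And>w. w \<in> cball a0 r \<Longrightarrow> \<theta> w = 1"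
    and mass: "\<And>m n. cmod (\<integral>w. complex_of_real (\<theta> w) * mixed_disc (complex_hessian (log_norm (lift_iter i m)) w)
          (complex_hessian (log_norm (lift_iter i n)) w) \<partial>lborel) \<le> C * (real d ^ m + real d ^ n)"
    by blast
  obtain \<tau> where \<tau>: "\<tau> > 0" "\<And>w a. norm a \<le> norm a0 + r \<Longrightarrow> sin_sq (affine_lift i w) (affine_lift i a) < \<tau> \<Longrightarrow> norm (w - a) < r / 2"
    using sin_sq_affine_lift_uniform[of "r / 2" "norm a0 + r"] rC(1) by (metis add_nonneg_pos half_gt_zero norm_ge_zero)
  show thesis
  proof (rule that[of "r / 2"])
    fix \<delta> :: real assume "\<delta> > 0"
    \<comment> \<open>The bound 1/2 keeps the sublevel sets inside the domain of the coordinates,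
      \<tau> / 2 keeps them in the ball where the bump is 1, and \<delta> / 5 makes them disjoint: a
      common point would give separation at most 4 t < \<delta>.\<close>
    define t where "t = min (1/2) (min (\<tau> / 2) (\<delta> / 5))"
    have t: "0 < t" "t \<le> 1/2" "t < \<tau>" "4 * t < \<delta>"
      using \<tau>(1) \<open>\<delta> > 0\<close> by (auto simp: t_def)
    \<comment> \<open>Twice 16384, since both powers of \<open>d\<close> in the mass bound are
      replaced by d^n; \<open>C + 1\<close> keeps the constant positive even for
      \<open>C = 0\<close>.\<close>
    define K where "K = 32768 * (C + 1) / t\<^sup>2"
    have "K > 0"
      using t rC(2) by (simp add: K_def)
    have "real (card A) \<le> K * (real n)\<^sup>2 * real d ^ n"
      if n: "n > 0" and A: "finite A" "A \<subseteq> ball a0 (r / 2)" and sep: "separated i n \<delta> A" for n A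
    proof -
      define H where "H w = (\<Sum>k<n. complex_hessian (log_norm (lift_iter i k)) w)" for w
      define rho where "rho = orbit_family.rho (lift_iter i) n"
      have of: "orbit_family (lift_iter i) n i"
        by (rule orbit_family_lift_iter[OF n])
      have rho_cont: "continuous_on UNIV (rho a)" for a
        unfolding rho_def by (rule orbit_family.continuous_rho[OF of])
      have sn: "sin_sq (lift_iter i k w) (lift_iter i k a) \<le> rho a w" if "k < n" for k w a
        using orbit_family.sn_le_rho[OF of that, of a w]
        by (simp add: rho_def orbit_family.sn_def[OF of] orbit_family.Q_def[OF of])
      have inball: "w \<in> cball a0 r" if "a \<in> A" "rho a w \<le> t" for a w
      proof -
        have da: "dist a0 a < r / 2"
          using that A by auto
        have "norm a \<le> norm a0 + r"
          using da norm_triangle_ineq[of a0 "a - a0"] rC(1) norm_minus_commute[of a a0] unfolding dist_norm by simp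
        moreover have "sin_sq (affine_lift i w) (affine_lift i a) < \<tau>"
          using sn[OF n, of w a] that(2) t by (simp add: lift_iter_def)
        ultimately have "norm (w - a) < r / 2"
          by (rule \<tau>(2))
        then show ?thesis
          using da dist_triangle[of a0 w a] by (simp add: dist_norm norm_minus_commute)
      qed
      have comp: "compact {w. rho a w \<le> t}" if "a \<in> A" for a
      proof -
        have "closed {w. rho a w \<le> t}"
          by (rule closed_Collect_le[OF rho_cont continuous_on_const])
        moreover have "{w. rho a w \<le> t} = {w. rho a w \<le> t} \<inter> cball a0 r"
          using inball[OF that] by blast
        ultimately show ?thesis
          using closed_Int_compact[OF _ compact_cball] by metis
      qed
      have Bow: "t\<^sup>2 / 16384 \<le> (\<integral>w. indicator {w. rho a w < t} w * Re (mixed_disc (H w) (H w)) \<partial>lborel)" if "a \<in> A" for a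
        using orbit_family.bowen_ball_mass[OF of t(1,2), of a] comp[OF that]
        by (simp add: rho_def H_def orbit_family.H_def[OF of])
      have disj: "a = b" if "a \<in> A" "b \<in> A" "rho a w < t" "rho b w < t" for a b w
      proof (rule ccontr)
        note ab = that
        assume "a \<noteq> b"
        then obtain k where k: "k < n" "sin_sq (lift_iter i k a) (lift_iter i k b) \<ge> \<delta>"
          using sep ab(1,2) unfolding separated_def by blast
        have "sin_sq (lift_iter i k a) (lift_iter i k b) \<le>
            2 * sin_sq (lift_iter i k a) (lift_iter i k w) + 2 * sin_sq (lift_iter i k w) (lift_iter i k b)"
          by (intro sin_sq_triangle lift_iter_nonzero)
        also have "\<dots> \<le> 2 * t + 2 * t"
          using sn[OF k(1), of w a] sn[OF k(1), of w b] ab(3,4)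
          by (simp add: sin_sq_commute[of "lift_iter i k a"])
        finally show False
          using k(2) t(4) by simp
      qed
      have psdL: "psd (complex_hessian (log_norm (lift_iter i k)) w)" for k w
        by (rule psd_hessian_log_norm[OF poly_fun_lift_iter lift_iter_nonzero])
      have psdH: "psd (H w)" for w
        unfolding psd_def H_def qform_sum using psdL by (auto simp: psd_def sum_nonneg)
      have MH: "Re (mixed_disc (H w) (H w)) \<ge> 0" "Im (mixed_disc (H w) (H w)) = 0" for w
        by (rule mixed_disc_psd[OF psdH psdH])+
      have cL: "continuous_on UNIV (\<lambda>w. complex_hessian (log_norm (lift_iter i k)) w $ l $ m)" for k l m
        by (intro smooth_imp_continuous smooth_hessian smooth_log_norm_lift)
      have cH: "continuous_on UNIV (\<lambda>w. H w $ l $ m)" for l m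
        unfolding H_def sum_component by (intro continuous_on_sum cL)
      have cHH: "continuous_on UNIV (\<lambda>w. mixed_disc (H w) (H w))"
        unfolding mixed_disc_def by (intro continuous_on_diff continuous_on_add continuous_on_mult cH)
      have cHHr: "continuous_on UNIV (\<lambda>w. Re (mixed_disc (H w) (H w)))"
        by (intro continuous_on_Re cHH)
      have E: "{w. rho a w < t} \<in> sets borel" for a
        using open_Collect_less[OF rho_cont continuous_on_const] by simp
      have i1: "integrable lborel (\<lambda>w. indicator {w. rho a w < t} w * Re (mixed_disc (H w) (H w)))" if "a \<in> A" for a
        by (rule integrable_indicator_mult[OF cHHr comp[OF that] E]) auto
      have i2: "integrable lborel (\<lambda>w. complex_of_real (\<theta> w) * mixed_disc (H w) (H w))"
        by (rule integrable_continuous_test(2)[OF cHH \<theta>(1)])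
      have "real (card A) * (t\<^sup>2 / 16384) \<le> (\<Sum>a\<in>A. \<integral>w. indicator {w. rho a w < t} w * Re (mixed_disc (H w) (H w)) \<partial>lborel)"
        using sum_mono[OF Bow, of A] by simp
      also have "\<dots> = (\<integral>w. (\<Sum>a\<in>A. indicator {w. rho a w < t} w * Re (mixed_disc (H w) (H w))) \<partial>lborel)"
        using i1 by (intro Bochner_Integration.integral_sum[symmetric])
      also have "\<dots> \<le> (\<integral>w. Re (complex_of_real (\<theta> w) * mixed_disc (H w) (H w)) \<partial>lborel)"
      proof (rule integral_mono)
        show "integrable lborel (\<lambda>w. \<Sum>a\<in>A. indicator {w. rho a w < t} w * Re (mixed_disc (H w) (H w)))"
          using i1 by (intro Bochner_Integration.integrable_sum)
        show "integrable lborel (\<lambda>w. Re (complex_of_real (\<theta> w) * mixed_disc (H w) (H w)))"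
          by (rule integrable_Re[OF i2])
        fix w
        have "(\<Sum>a\<in>A. indicator {w. rho a w < t} w) \<le> \<theta> w"
        proof (cases "\<exists>a\<in>A. rho a w < t")
          case True
          then obtain a where a: "a \<in> A" "rho a w < t"
            by blast
          then have "indicator {w. rho b w < t} w = (if b = a then 1 else 0 :: real)" if "b \<in> A" for b
            using disj[OF that a(1)] by (auto simp: indicator_def)
          then have "(\<Sum>a\<in>A. indicator {w. rho a w < t} w) = (1 :: real)"
            using a(1) A(1) by simp
          moreover have "\<theta> w = 1"
            using \<theta>(3) inball[OF a(1)] a(2) by simp
          ultimately show ?thesis
            by simp
        next
          case False
          then show ?thesis
            using \<theta>(2)[of w] by simp
        qed
        then show "(\<Sum>a\<in>A. indicator {w. rho a w < t} w * Re (mixed_disc (H w) (H w))) \<le> Re (complex_of_real (\<theta> w) * mixed_disc (H w) (H w))"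
          using MH[of w] by (simp add: mult_right_mono flip: sum_distrib_right)
      qed
      also have "\<dots> = Re (\<integral>w. complex_of_real (\<theta> w) * mixed_disc (H w) (H w) \<partial>lborel)"
        using i2 by (rule integral_Re)
      also have "\<dots> \<le> cmod (\<integral>w. complex_of_real (\<theta> w) * mixed_disc (H w) (H w) \<partial>lborel)"
        by (rule complex_Re_le_cmod)
      also have "(\<integral>w. complex_of_real (\<theta> w) * mixed_disc (H w) (H w) \<partial>lborel) =
        (\<Sum>k<n. \<Sum>l<n. \<integral>w. complex_of_real (\<theta> w) * mixed_disc (complex_hessian (log_norm (lift_iter i k)) w)
          (complex_hessian (log_norm (lift_iter i l)) w) \<partial>lborel)"
      proof -
        have i3: "integrable lborel (\<lambda>w. complex_of_real (\<theta> w) * mixed_disc (complex_hessian (log_norm (lift_iter i k)) w)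
          (complex_hessian (log_norm (lift_iter i l)) w))" for k l
          unfolding mixed_disc_def
          by (intro integrable_continuous_test(2)[OF _ \<theta>(1)] continuous_on_diff continuous_on_add continuous_on_mult cL)
        show ?thesis
          unfolding H_def mixed_disc_sum sum_distrib_left using i3
          by (simp add: Bochner_Integration.integral_sum Bochner_Integration.integrable_sum)
      qed
      also have "cmod \<dots> \<le> (\<Sum>k<n. \<Sum>l<n. C * (real d ^ k + real d ^ l))"
        by (intro order_trans[OF norm_sum] sum_mono mass)
      also have "\<dots> \<le> (\<Sum>k<n. \<Sum>l<n. (C + 1) * (2 * real d ^ n))"
      proof (intro sum_mono mult_mono)
        fix k l assume "k \<in> {..<n}" "l \<in> {..<n}"
        then have "real d ^ k \<le> real d ^ n" "real d ^ l \<le> real d ^ n"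
          using d_pos by (auto intro!: power_increasing)
        then show "real d ^ k + real d ^ l \<le> 2 * real d ^ n"
          by simp
      qed (use rC in auto)
      also have "\<dots> = (C + 1) * 2 * (real n)\<^sup>2 * real d ^ n"
        by (simp add: power2_eq_square)
      finally have "real (card A) * (t\<^sup>2 / 16384) \<le> (C + 1) * 2 * (real n)\<^sup>2 * real d ^ n" .
      then have "real (card A) \<le> (C + 1) * 2 * (real n)\<^sup>2 * real d ^ n * 16384 / t\<^sup>2"
        using t(1) by (simp add: field_simps)
      then show ?thesis
        by (simp add: K_def field_simps)
    qed
    then show "\<exists>K>0. \<forall>n A. n > 0 \<longrightarrow> finite A \<longrightarrow> A \<subseteq> ball a0 (r / 2) \<longrightarrow>
      separated i n \<delta> A \<longrightarrow> real (card A) \<le> K * (real n)\<^sup>2 * real d ^ n"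
      using \<open>K > 0\<close> by blast
  qed (use rC in auto)
qed

end

section \<open>Visits to the critical set\<close>

lemma has_derivative_vecI:
  fixes h :: "complex ^ 'm \<Rightarrow> complex ^ 'n"
  assumes "\<And>s. ((\<lambda>z. h z $ s) has_derivative (\<lambda>v. D v $ s)) (at z)"
  shows "(h has_derivative D) (at z)"
proof -
  have lin: "bounded_linear (\<lambda>x. x *s axis s 1 :: complex ^ 'n)" for s
  proof (rule linear_conv_bounded_linear[THEN iffD1])
    show "linear (\<lambda>x. x *s axis s 1 :: complex ^ 'n)"
      by (rule linearI) (simp_all add: vec_eq_iff algebra_simps)
  qed
  have "((\<lambda>z. \<Sum>s\<in>UNIV. h z $ s *s axis s 1) has_derivative (\<lambda>v. \<Sum>s\<in>UNIV. D v $ s *s axis s 1)) (at z)"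
    by (intro has_derivative_sum bounded_linear.has_derivative[OF lin] assms)
  then show ?thesis
    by (simp add: basis_expansion)
qed

lemma norm_vec_le_sum: "norm (x :: complex ^ 'n) \<le> (\<Sum>s\<in>UNIV. cmod (x $ s))"
  unfolding norm_vec_def by (rule L2_set_le_sum) simp

text \<open>Equality of projective points as polynomial equations between lifts, hence a visibly
  closed condition for compactness arguments.\<close>

definition proportional :: "complex ^ 3 \<Rightarrow> complex ^ 3 \<Rightarrow> bool" where
  "proportional x y \<longleftrightarrow> (\<forall>p q. x $ p * y $ q = x $ q * y $ p)"

lemma proportional_iff:
  assumes "x \<noteq> 0" "y \<noteq> 0"
  shows "proportional x y \<longleftrightarrow> proj x = proj y"
proof
  assume pr: "proportional x y"
  obtain p where p: "x $ p \<noteq> 0"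
    using assms(1) by (auto simp: vec_eq_iff)
  have y: "y = (y $ p / x $ p) *s x"
    using pr p by (simp add: proportional_def vec_eq_iff field_simps)
  then have "y $ p / x $ p \<noteq> 0"
    using assms(2) by (metis vector_mul_eq_0)
  then show "proj x = proj y"
    using y proj_eq_iff[OF assms] by blast
next
  assume "proj x = proj y"
  then obtain c where "y = c *s x"
    using proj_eq_iff[OF assms] by blast
  then show "proportional x y"
    by (simp add: proportional_def)
qed

lemma proj_scale: "c \<noteq> 0 \<Longrightarrow> z \<noteq> 0 \<Longrightarrow> proj (c *s z) = proj z"
  using proj_eq_iff[of z "c *s z"] by (auto simp: vector_mul_eq_0)

lemma unit_lift: "\<exists>z. norm z = 1 \<and> proj z = x"
proof -
  obtain z where z: "z \<noteq> 0" "proj z = x"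
    using proj_surj by blast
  then have "norm (complex_of_real (1 / norm z) *s z) = 1"
    by (simp add: norm_scale_vec norm_divide)
  moreover have "proj (complex_of_real (1 / norm z) *s z) = x"
    using proj_scale[of "complex_of_real (1 / norm z)" z] z by simp
  ultimately show ?thesis
    by blast
qed

lemma sin_sq_scale:
  assumes "c \<noteq> 0"
  shows "sin_sq (c *s x) y = sin_sq x y"
  using assms by (simp add: sin_sq_def cinner_scale_left norm_mult norm_scale_vec power_mult_distrib)

lemma sin_sq_proj_cong:
  assumes "x \<noteq> 0" "y \<noteq> 0" "x' \<noteq> 0" "y' \<noteq> 0" "proj x = proj x'" "proj y = proj y'"
  shows "sin_sq x y = sin_sq x' y'"
proof -
  obtain c c' where c: "c \<noteq> 0" "x' = c *s x" "c' \<noteq> 0" "y' = c' *s y"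
    using proj_eq_iff assms by metis
  then show ?thesis
    by (metis sin_sq_scale sin_sq_commute)
qed

text \<open>Choose the phase that makes the Hermitian product real and nonnegative, with value g.
  The squared distance is then 2 - 2 g, at most 2 - 2 g^2 since g is at most 1.\<close>

lemma unit_phase:
  assumes "norm x = 1" "norm y = 1"
  shows "\<exists>c. cmod c = 1 \<and> (norm (x - c *s y))\<^sup>2 \<le> 2 * sin_sq x y"
proof -
  let ?g = "cinner x y"
  define c where "c = (if ?g = 0 then 1 else ?g / of_real (cmod ?g))"
  have c: "cmod c = 1" "cnj c * ?g = of_real (cmod ?g)"
  proof -
    show "cmod c = 1"
      by (auto simp: c_def norm_divide)
    show "cnj c * ?g = of_real (cmod ?g)"
    proof (cases "?g = 0")
      case False
      then have "cnj c * ?g = complex_of_real ((cmod ?g)\<^sup>2) / of_real (cmod ?g)"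
        unfolding complex_norm_square by (simp add: c_def mult.commute)
      also have "\<dots> = of_real (cmod ?g)"
        using False by (simp add: power2_eq_square)
      finally show ?thesis .
    qed simp
  qed
  have "complex_of_real ((norm (x - c *s y))\<^sup>2) = 1 - (cnj c * ?g + cnj (cnj c * ?g)) + c * cnj c"
    unfolding cinner_self[symmetric] cinner_diff_left cinner_diff_right cinner_scale_left cinner_scale_right
    using assms by (simp add: cinner_self cnj_cinner algebra_simps)
  also have "\<dots> = of_real (2 - 2 * cmod ?g)"
    unfolding c(2) complex_norm_square[symmetric] using c(1) by simp
  finally have "(norm (x - c *s y))\<^sup>2 = 2 - 2 * cmod ?g"
    by (simp only: of_real_eq_iff)
  moreover have "cmod ?g \<le> 1"
    using cinner_Cauchy_Schwarz[of x y] assms by simp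
  then have "(cmod ?g)\<^sup>2 \<le> cmod ?g"
    using mult_left_mono[of "cmod ?g" 1 "cmod ?g"] by (simp add: power2_eq_square)
  ultimately show ?thesis
    using c(1) assms by (intro exI[of _ c]) (simp add: sin_sq_def)
qed

context lifted_endomorphism
begin

section \<open>The differential of the lift and the critical set\<close>

definition partials :: "3 \<Rightarrow> 3 \<Rightarrow> complex ^ 3 \<Rightarrow> complex" where
  "partials s = (SOME p'. (\<forall>k. poly_fun (p' k)) \<and>
     (\<forall>z. ((\<lambda>z. F z $ s) has_derivative (\<lambda>v. \<Sum>k\<in>UNIV. p' k z * v $ k)) (at z)))"

definition DF :: "complex ^ 3 \<Rightarrow> complex ^ 3 \<Rightarrow> complex ^ 3" where
  "DF z v = (\<chi> s. \<Sum>k\<in>UNIV. partials s k z * v $ k)"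

lemma
  shows poly_fun_partials: "poly_fun (partials s k)"
    and DF_component: "((\<lambda>z. F z $ s) has_derivative (\<lambda>v. DF z v $ s)) (at z)"
  using someI_ex[OF poly_fun_has_derivative[OF homogeneous_imp_poly_fun[OF homogeneous_F]]]
  unfolding DF_def partials_def by auto

lemma DF: "(F has_derivative DF z) (at z)"
  by (intro has_derivative_vecI DF_component)

lemma linear_DF: "linear (DF z)"
  using has_derivative_linear[OF DF] .

lemma DF_scale: "DF z (c *s v) = c *s DF z v"
  by (simp add: DF_def vec_eq_iff sum_distrib_left mult_ac)

lemma DF_add: "DF z (v + w) = DF z v + DF z w"
  by (simp add: DF_def vec_eq_iff sum.distrib algebra_simps)

lemma continuous_DF: "continuous_on S (\<lambda>x. DF (fst x) (snd x))"
proof (rule continuous_on_vecI)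
  fix s
  have "continuous_on S (\<lambda>x. partials s k (fst x))" for k
    by (rule continuous_on_compose2[OF poly_fun_continuous[OF poly_fun_partials, of UNIV]])
      (auto intro: continuous_intros)
  then show "continuous_on S (\<lambda>x. DF (fst x) (snd x) $ s)"
    unfolding DF_def by (simp only: vec_lambda_beta) (intro continuous_intros)
qed

lemma euler_identity: "DF z z = of_nat d *s F z"
proof -
  have 1: "((\<lambda>t :: real. F (of_real t *s z)) has_derivative (\<lambda>t. DF z (of_real t *s z))) (at 1)"
  proof -
    have "((\<lambda>t :: real. of_real t *s z) has_derivative (\<lambda>t. of_real t *s z)) (at 1)"
    proof (intro bounded_linear_imp_has_derivative linear_conv_bounded_linear[THEN iffD1])
      show "linear (\<lambda>t :: real. complex_of_real t *s z)"
        by (rule linearI) (simp_all add: vec_eq_iff algebra_simps scaleR_conv_of_real[where 'a = complex])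
    qed
    from has_derivative_compose[OF this, of F "DF (of_real 1 *s z)"] show ?thesis
      using DF by simp
  qed
  have 2: "((\<lambda>t :: real. F (of_real t *s z) $ s) has_derivative (\<lambda>t. of_nat d * F z $ s * of_real t)) (at 1)" for s
  proof -
    have "((\<lambda>t :: real. complex_of_real (t ^ d) * F z $ s) has_derivative (\<lambda>t. of_nat d * F z $ s * of_real t)) (at 1)"
    proof -
      have "((\<lambda>t :: real. t ^ d) has_derivative (\<lambda>t. real d * t)) (at 1)"
        by (auto intro!: derivative_eq_intros)
      from has_derivative_mult_left[OF has_derivative_of_real[OF this, where ?'a = complex], of "F z $ s"] show ?thesis
        by (simp add: mult_ac)
    qed
    then show ?thesis
      by (simp add: F_scale)
  qed
  have "DF z (of_real 1 *s z) $ s = of_nat d * F z $ s * of_real 1" for s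
    using has_derivative_unique[OF bounded_linear.has_derivative[OF bounded_linear_vec_nth 1] 2[of s]] by meson
  then show ?thesis
    by (simp add: vec_eq_iff)
qed

text \<open>Homogeneity of degree d - 1, multiplied by \<open>c\<close> so that no exponent is
  subtracted.\<close>

lemma DF_homogeneous: "c *s DF (c *s z) v = c ^ d *s DF z v"
proof -
  have lin: "bounded_linear (\<lambda>v. c *s v :: complex ^ 3)" for c
  proof (rule linear_conv_bounded_linear[THEN iffD1])
    show "linear (\<lambda>v. c *s v :: complex ^ 3)"
      by (rule linearI) (simp_all add: vec_eq_iff algebra_simps)
  qed
  have "((\<lambda>z. F (c *s z)) has_derivative (\<lambda>v. DF (c *s z) (c *s v))) (at z)"
    by (rule has_derivative_compose[OF bounded_linear_imp_has_derivative[OF lin] DF])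
  moreover have "((\<lambda>z. F (c *s z)) has_derivative (\<lambda>v. c ^ d *s DF z v)) (at z)"
    unfolding F_scale by (rule bounded_linear.has_derivative[OF lin DF])
  ultimately have "DF (c *s z) (c *s v) = c ^ d *s DF z v"
    using has_derivative_unique by metis
  then show ?thesis
    by (simp add: DF_scale)
qed

text \<open>Rescale the lift to the affine one, \<open>p\<close>, and subtract from \<open>v\<close>
  the multiple of \<open>p\<close> that brings it into the tangent space of the chart. By Euler's
  identity \<open>DF p\<close> sends the resulting \<open>y\<close> to a multiple of
  \<open>F p\<close>, which the quotients defining the target coordinates annihilate. Nor can
  \<open>y\<close> be zero: \<open>v\<close> would be a multiple of \<open>p\<close>, whose image
  under \<open>DF p\<close> is a nonzero multiple of \<open>F p\<close>.\<close>

lemma critical_if_DF_degenerate: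
  assumes z: "z \<noteq> 0" and v: "v \<noteq> 0" "DF z v = 0"
  shows "proj z \<in> critical_set f"
proof -
  obtain i where "proj z \<in> range (chart i)"
    using charts_cover by blast
  then obtain w where iw: "proj z = chart i w"
    by blast
  define p where "p = affine_lift i w"
  obtain c where c: "c \<noteq> 0" "p = c *s z"
    using iw proj_eq_iff[OF z affine_lift_nonzero, of i w] unfolding chart_def p_def by auto
  have "DF p v = 0"
    using DF_homogeneous[of c z v] c v(2) by simp
  define s0 where "s0 = v $ i"
  define u :: "complex ^ 2" where "u = (\<chi> k. (v - s0 *s p) $ affine_index i k)"
  define y where "y = (\<Sum>k\<in>UNIV. u $ k *s axis (affine_index i k) 1 :: complex ^ 3)"
  have pi: "p $ i = 1"
    by (simp add: p_def affine_lift_index)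
  have y_eq: "y = v - s0 *s p"
  proof -
    have "y $ s = (v - s0 *s p) $ s" for s
      using affine_index_cases[of s i] exhaust_3[of i] pi
      by (auto simp: y_def sum_2 u_def s0_def axis_def affine_index_def)
    then show ?thesis
      by (simp add: vec_eq_iff)
  qed
  have DFp: "DF p y = (- s0 * of_nat d) *s F p"
  proof -
    have "DF p y = DF p v + DF p ((- s0) *s p)"
      unfolding y_eq DF_add[symmetric] by (simp add: vec_eq_iff)
    then show ?thesis
      using \<open>DF p v = 0\<close> by (simp only: DF_scale euler_identity) (simp add: vec_eq_iff)
  qed
  have Fp: "F p \<noteq> 0"
    using F_eq_0[of p] affine_lift_nonzero[of i w] by (auto simp: p_def)
  have "u \<noteq> 0"
  proof
    assume "u = 0"
    then have "y = 0"
      by (simp add: y_def)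
    then have v_eq: "v = s0 *s p"
      using y_eq by simp
    then have "s0 \<noteq> 0"
      using v(1) by auto
    have "DF p 0 = 0"
      by (simp add: DF_def vec_eq_iff)
    then have "(- s0 * of_nat d) *s F p = 0"
      using DFp \<open>y = 0\<close> by simp
    then show False
      using Fp \<open>s0 \<noteq> 0\<close> d_pos by (simp add: vector_mul_eq_0)
  qed
  obtain j where j: "F p $ j \<noteq> 0"
    using Fp by (auto simp: vec_eq_iff)
  define P where "P w = F (affine_lift i w)" for w
  have P: "poly_fun (\<lambda>w. P w $ s)" for s
    unfolding P_def by (rule poly_fun_compose[OF homogeneous_imp_poly_fun[OF homogeneous_F] poly_fun_affine_lift])
  have Pnz: "P x \<noteq> 0" for x
    unfolding P_def using F_eq_0 affine_lift_nonzero by blast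
  have gP: "f (chart i x) = proj (P x)" for x
    unfolding chart_def P_def by (rule f_proj[OF affine_lift_nonzero])
  have Pw: "P w = F p"
    by (simp add: P_def p_def)
  have dP: "(\<Sum>k\<in>UNIV. dz k (\<lambda>w. P w $ s) w * u $ k) = DF p y $ s" for s
  proof -
    have lift: "(affine_lift i has_derivative (\<lambda>v. \<Sum>k\<in>UNIV. v $ k *s axis (affine_index i k) 1)) (at w)"
    proof (rule has_derivative_vecI)
      fix s
      show "((\<lambda>w. affine_lift i w $ s) has_derivative (\<lambda>v. (\<Sum>k\<in>UNIV. v $ k *s axis (affine_index i k) 1 :: complex ^ 3) $ s)) (at w)"
        using poly_fun_derivative[OF poly_fun_affine_lift, of i s w] dvec_affine_lift[of _ i w]
        by (simp add: dvec_def vec_eq_iff mult.commute)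
    qed
    have "((\<lambda>w. P w $ s) has_derivative (\<lambda>v. DF p (\<Sum>k\<in>UNIV. v $ k *s axis (affine_index i k) 1) $ s)) (at w)"
      unfolding P_def p_def by (rule has_derivative_compose[OF lift DF_component])
    from fun_cong[OF has_derivative_unique[OF poly_fun_derivative[OF P, of s w] this], of u]
    show ?thesis
      unfolding y_def .
  qed
  define S where "S = {x. P x $ j \<noteq> 0}"
  have S: "open S" "w \<in> S"
    using open_Collect_neq[OF poly_fun_continuous[OF P] continuous_on_const] j by (auto simp: S_def Pw)
  define L where "L v = (\<chi> k. ((\<Sum>m\<in>UNIV. dz m (\<lambda>x. P x $ affine_index j k) w * v $ m) * P w $ j
          - P w $ affine_index j k * (\<Sum>m\<in>UNIV. dz m (\<lambda>x. P x $ j) w * v $ m)) / (P w $ j * P w $ j))" for v :: "complex ^ 2"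
  have rep: "local_rep f i j x $ k = P x $ affine_index j k / P x $ j" if "x \<in> S" for x k
    using local_rep_eq[of f i x P j, OF gP Pnz] that by (simp add: S_def)
  have "(local_rep f i j has_derivative L) (at w)"
  proof (rule has_derivative_vecI)
    fix k
    have "((\<lambda>x. P x $ affine_index j k / P x $ j) has_derivative (\<lambda>v. L v $ k)) (at w)"
      unfolding L_def vec_lambda_beta
      by (rule has_derivative_divide'[OF poly_fun_derivative[OF P] poly_fun_derivative[OF P]]) (simp add: Pw j)
    then show "((\<lambda>x. local_rep f i j x $ k) has_derivative (\<lambda>v. L v $ k)) (at w)"
      by (rule has_derivative_transform_within_open[OF _ S])
        (simp add: rep)
  qed
  then have fd: "frechet_derivative (local_rep f i j) (at w) = L"
    by (rule frechet_derivative_at[symmetric])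
  have "L u = 0"
    unfolding L_def dP DFp Pw by (simp add: vec_eq_iff)
  moreover have "L 0 = 0"
    by (simp add: L_def vec_eq_iff)
  ultimately have "\<not> bij L"
    using \<open>u \<noteq> 0\<close> by (metis bij_is_inj injD)
  moreover have "f (proj z) \<in> range (chart j)"
    unfolding iw by (rule image_in_chart[of f i w P j, OF gP Pnz]) (simp add: Pw j)
  ultimately show ?thesis
    unfolding critical_set_def using iw fd by (intro CollectI exI[of _ i] exI[of _ j] exI[of _ w]) simp
qed

text \<open>A neighbourhood of the critical set measured by the differential: \<open>DF\<close>
  nearly kills a unit vector at some unit lift. Its negation is a lower bound for \<open>DF\<close>
  on all unit vectors at all unit lifts, the form in which it is used.\<close>

definition visits :: "real \<Rightarrow> cp2 \<Rightarrow> bool" where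
  "visits \<delta> y \<longleftrightarrow> (\<exists>z v. norm z = 1 \<and> norm v = 1 \<and> proj z = y \<and> norm (DF z v) < \<delta>)"

lemma visits_mono: "visits \<delta> y \<Longrightarrow> \<delta> \<le> \<delta>' \<Longrightarrow> visits \<delta>' y"
  unfolding visits_def by fastforce

text \<open>Compactness of the set \<open>X\<close> of unit lifts of an orbit point together with a
  unit lift and a unit vector at each of the three times. Where the sum \<open>h\<close> of the
  three norms vanishes, the orbit meets the critical set at times \<open>a\<close>, \<open>b\<close>
  and \<open>c\<close>; seen from time \<open>c\<close> this violates genericity with the distinct
  exponents \<open>c - a\<close> and \<open>c - b\<close>. So \<open>h\<close> has a positive
  minimum on \<open>X\<close>, the same for all orbits.\<close>

lemma no_three_visits_fixed_times:
  assumes generic: "\<And>i j :: nat. i \<ge> 1 \<Longrightarrow> j \<ge> 1 \<Longrightarrow> i \<noteq> j \<Longrightarrow>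
           critical_set f \<inter> (f ^^ i) ` critical_set f \<inter> (f ^^ j) ` critical_set f = {}"
    and abc: "a < b" "b < c"
  shows "\<exists>\<delta>>0. \<forall>y. \<not> (visits \<delta> ((f ^^ a) y) \<and> visits \<delta> ((f ^^ b) y) \<and> visits \<delta> ((f ^^ c) y))"
proof -
  let ?S = "sphere 0 1 :: (complex ^ 3) set"
  let ?K = "?S \<times> (?S \<times> ?S) \<times> (?S \<times> ?S) \<times> (?S \<times> ?S)"
  define X where "X = {(w, x1, x2, x3). (w, x1, x2, x3) \<in> ?K \<and> proportional ((F ^^ a) w) (fst x1)
      \<and> proportional ((F ^^ b) w) (fst x2) \<and> proportional ((F ^^ c) w) (fst x3)}"
  define h where "h = (\<lambda>(w :: complex ^ 3, x1, x2, x3). norm (DF (fst x1) (snd x1)) + norm (DF (fst x2) (snd x2)) + norm (DF (fst x3) (snd x3)))"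
  have "compact ?K"
    by (intro compact_Times compact_sphere)
  have cF: "continuous_on UNIV (\<lambda>x. (F ^^ k) (g x) $ s)" if "continuous_on UNIV g" for k s and g :: "'x :: topological_space \<Rightarrow> complex ^ 3"
    using continuous_on_compose2[OF poly_fun_continuous[OF poly_fun_iter, of UNIV k s] that] by simp
  have closed_prop: "closed {x. proportional ((F ^^ k) (g x)) (g' x)}"
    if "continuous_on UNIV g" "continuous_on UNIV g'" for k and g g' :: "'x :: topological_space \<Rightarrow> complex ^ 3"
    unfolding proportional_def
    by (intro closed_Collect_all closed_Collect_eq continuous_on_mult cF that continuous_on_component)
  have X_eq: "X = ?K \<inter> {x. proportional ((F ^^ a) (fst x)) (fst (fst (snd x)))}
      \<inter> {x. proportional ((F ^^ b) (fst x)) (fst (fst (snd (snd x))))}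
      \<inter> {x. proportional ((F ^^ c) (fst x)) (fst (snd (snd (snd x))))}"
    by (auto simp: X_def)
  have "compact X"
    unfolding X_eq by (intro compact_Int_closed \<open>compact ?K\<close> closed_prop continuous_intros)
  have cont_h: "continuous_on X h"
    unfolding h_def case_prod_beta
    by (intro continuous_on_add continuous_on_norm
        continuous_on_compose2[OF continuous_DF[of UNIV], of X "\<lambda>x. fst (snd x)"]
        continuous_on_compose2[OF continuous_DF[of UNIV], of X "\<lambda>x. fst (snd (snd x))"]
        continuous_on_compose2[OF continuous_DF[of UNIV], of X "\<lambda>x. snd (snd (snd x))"] continuous_intros) auto
  have h_pos: "h x > 0" if "x \<in> X" for x
  proof (rule ccontr)
    assume "\<not> h x > 0"
    obtain w x1 x2 x3 where x': "x = (w, x1, x2, x3)"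
      by (cases x rule: prod_cases4)
    obtain z1 v1 z2 v2 z3 v3 where x'': "x1 = (z1, v1)" "x2 = (z2, v2)" "x3 = (z3, v3)"
      by (cases x1, cases x2, cases x3)
    note x = x'[unfolded x'']
    have "DF z1 v1 = 0" "DF z2 v2 = 0" "DF z3 v3 = 0"
    proof -
      have "norm (DF z1 v1) + norm (DF z2 v2) + norm (DF z3 v3) \<le> 0"
        using \<open>\<not> h x > 0\<close> unfolding h_def x by simp
      then have "norm (DF z1 v1) = 0 \<and> norm (DF z2 v2) = 0 \<and> norm (DF z3 v3) = 0"
        using norm_ge_zero[of "DF z1 v1"] norm_ge_zero[of "DF z2 v2"] norm_ge_zero[of "DF z3 v3"] by linarith
      then show "DF z1 v1 = 0" "DF z2 v2 = 0" "DF z3 v3 = 0"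
        by simp_all
    qed
    moreover have nz: "w \<noteq> 0" "z1 \<noteq> 0" "z2 \<noteq> 0" "z3 \<noteq> 0" "v1 \<noteq> 0" "v2 \<noteq> 0" "v3 \<noteq> 0"
      using that unfolding X_def x by auto
    ultimately have crit: "proj z1 \<in> critical_set f" "proj z2 \<in> critical_set f" "proj z3 \<in> critical_set f"
      by (auto intro: critical_if_DF_degenerate)
    have "proj z1 = (f ^^ a) (proj w)" "proj z2 = (f ^^ b) (proj w)" "proj z3 = (f ^^ c) (proj w)"
    proof -
      have "proportional ((F ^^ a) w) z1" "proportional ((F ^^ b) w) z2" "proportional ((F ^^ c) w) z3"
        using that unfolding X_def x by simp_all
      then show "proj z1 = (f ^^ a) (proj w)" "proj z2 = (f ^^ b) (proj w)" "proj z3 = (f ^^ c) (proj w)"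
        unfolding proportional_iff[OF iter_nonzero[OF nz(1)] nz(2)] proportional_iff[OF iter_nonzero[OF nz(1)] nz(3)]
          proportional_iff[OF iter_nonzero[OF nz(1)] nz(4)] by (simp_all only: iter_proj[OF nz(1)])
    qed
    moreover have "(f ^^ c) (proj w) = (f ^^ (c - a)) ((f ^^ a) (proj w))" "(f ^^ c) (proj w) = (f ^^ (c - b)) ((f ^^ b) (proj w))"
      using abc fun_cong[OF funpow_add[of "c - a" a f], of "proj w"] fun_cong[OF funpow_add[of "c - b" b f], of "proj w"]
      by simp_all
    ultimately have "proj z3 = (f ^^ (c - a)) (proj z1)" "proj z3 = (f ^^ (c - b)) (proj z2)"
      by simp_all
    then have "proj z3 \<in> critical_set f \<inter> (f ^^ (c - a)) ` critical_set f \<inter> (f ^^ (c - b)) ` critical_set f"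
      using crit by blast
    then show False
      using generic[of "c - a" "c - b"] abc by auto
  qed
  obtain h0 where h0: "h0 > 0" "\<And>x. x \<in> X \<Longrightarrow> h0 \<le> h x"
  proof (cases "X = {}")
    case True
    then show ?thesis
      using that[of 1] by simp
  next
    case False
    obtain x0 where "x0 \<in> X" "\<And>x. x \<in> X \<Longrightarrow> h x0 \<le> h x"
      using continuous_attains_inf[OF \<open>compact X\<close> False cont_h] by blast
    then show ?thesis
      using that[of "h x0"] h_pos by blast
  qed
  show ?thesis
  proof (intro exI conjI allI notI)
    show "h0 / 3 > 0"
      using h0 by simp
    fix y
    assume "visits (h0 / 3) ((f ^^ a) y) \<and> visits (h0 / 3) ((f ^^ b) y) \<and> visits (h0 / 3) ((f ^^ c) y)"
    then obtain z1 v1 z2 v2 z3 v3 where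
      n: "norm z1 = 1" "norm v1 = 1" "norm z2 = 1" "norm v2 = 1" "norm z3 = 1" "norm v3 = 1"
      and pr: "proj z1 = (f ^^ a) y" "proj z2 = (f ^^ b) y" "proj z3 = (f ^^ c) y"
      and small: "norm (DF z1 v1) < h0 / 3" "norm (DF z2 v2) < h0 / 3" "norm (DF z3 v3) < h0 / 3"
      unfolding visits_def by blast
    obtain w where w: "norm w = 1" "proj w = y"
      using unit_lift by blast
    have nz: "w \<noteq> 0" "z1 \<noteq> 0" "z2 \<noteq> 0" "z3 \<noteq> 0"
      using n w by auto
    have "(w, (z1, v1), (z2, v2), (z3, v3)) \<in> X"
    proof -
      have "proportional ((F ^^ a) w) z1" "proportional ((F ^^ b) w) z2" "proportional ((F ^^ c) w) z3"
        unfolding proportional_iff[OF iter_nonzero[OF nz(1)] nz(2)] proportional_iff[OF iter_nonzero[OF nz(1)] nz(3)]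
          proportional_iff[OF iter_nonzero[OF nz(1)] nz(4)] by (simp_all only: iter_proj[OF nz(1), symmetric] w(2) pr)
      then show ?thesis
        unfolding X_def using n w(1) by simp
    qed
    then have "h0 \<le> h (w, (z1, v1), (z2, v2), (z3, v3))"
      by (rule h0(2))
    then show False
      using small by (simp add: h_def)
  qed
qed

lemma no_three_visits:
  assumes generic: "\<And>i j :: nat. i \<ge> 1 \<Longrightarrow> j \<ge> 1 \<Longrightarrow> i \<noteq> j \<Longrightarrow>
           critical_set f \<inter> (f ^^ i) ` critical_set f \<inter> (f ^^ j) ` critical_set f = {}"
  shows "\<exists>\<delta>>0. \<forall>y a b c. a < b \<longrightarrow> b < c \<longrightarrow> c < N \<longrightarrow>
    \<not> (visits \<delta> ((f ^^ a) y) \<and> visits \<delta> ((f ^^ b) y) \<and> visits \<delta> ((f ^^ c) y))"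
proof -
  let ?T = "{(a, b, c). a < b \<and> b < c \<and> c < N}"
  have "finite ?T"
    by (rule finite_subset[of _ "{..<N} \<times> {..<N} \<times> {..<N}"]) auto
  have "\<forall>t\<in>?T. \<exists>\<delta>>0. \<forall>y. \<not> (visits \<delta> ((f ^^ fst t) y) \<and> visits \<delta> ((f ^^ fst (snd t)) y) \<and> visits \<delta> ((f ^^ snd (snd t)) y))"
  proof
    fix t assume "t \<in> ?T"
    then have t: "fst t < fst (snd t)" "fst (snd t) < snd (snd t)"
      by auto
    show "\<exists>\<delta>>0. \<forall>y. \<not> (visits \<delta> ((f ^^ fst t) y) \<and> visits \<delta> ((f ^^ fst (snd t)) y) \<and> visits \<delta> ((f ^^ snd (snd t)) y))"
      by (rule no_three_visits_fixed_times[OF generic t])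
  qed
  from bchoice[OF this] obtain \<delta> where \<delta>': "\<forall>t\<in>?T. \<delta> t > 0 \<and>
    (\<forall>y. \<not> (visits (\<delta> t) ((f ^^ fst t) y) \<and> visits (\<delta> t) ((f ^^ fst (snd t)) y) \<and> visits (\<delta> t) ((f ^^ snd (snd t)) y)))" ..
  then have \<delta>: "\<And>t. t \<in> ?T \<Longrightarrow> \<delta> t > 0"
    "\<And>t y. t \<in> ?T \<Longrightarrow> \<not> (visits (\<delta> t) ((f ^^ fst t) y) \<and> visits (\<delta> t) ((f ^^ fst (snd t)) y) \<and> visits (\<delta> t) ((f ^^ snd (snd t)) y))"
    by blast+
  define \<delta>0 where "\<delta>0 = Min (insert 1 (\<delta> ` ?T))"
  have "\<delta>0 > 0"
    unfolding \<delta>0_def using \<open>finite ?T\<close> \<delta>(1) by (subst Min_gr_iff) auto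
  moreover have "\<delta>0 \<le> \<delta> t" if "t \<in> ?T" for t
    unfolding \<delta>0_def using \<open>finite ?T\<close> that by (intro Min_le) auto
  moreover have "\<not> (visits \<delta>0 ((f ^^ a) y) \<and> visits \<delta>0 ((f ^^ b) y) \<and> visits \<delta>0 ((f ^^ c) y))"
    if "a < b" "b < c" "c < N" for y a b c
    using \<delta>(2)[of "(a, b, c)" y] calculation(2)[of "(a, b, c)"] that by (auto dest: visits_mono)
  ultimately show ?thesis
    by blast
qed

section \<open>Uniform separation inside the fibres away from the critical region\<close>

lemma locally_injective_if_nondegenerate:
  assumes "\<delta> > 0" "\<And>v. norm v = 1 \<Longrightarrow> norm (DF z v) \<ge> \<delta>"
  obtains r where "r > 0" "inj_on F (ball z r)"
proof -
  have "inj (DF z)"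
  proof (rule linear_injective_0[OF linear_DF, THEN iffD2], intro allI impI)
    fix v assume v: "DF z v = 0"
    show "v = 0"
    proof (rule ccontr)
      assume "v \<noteq> 0"
      then have "norm (complex_of_real (1 / norm v) *s v) = 1"
        by (simp add: norm_scale_vec norm_divide)
      then have "\<delta> \<le> norm (DF z (complex_of_real (1 / norm v) *s v))"
        by (rule assms(2))
      then show False
        using v assms(1) by (simp add: DF_scale)
    qed
  qed
  then obtain g' where g': "linear g'" "g' \<circ> DF z = id"
    using linear_injective_left_inverse[OF linear_DF] by blast
  have on: "onorm (\<lambda>v. DF x v - DF z v) \<le> (\<Sum>s\<in>UNIV. \<Sum>k\<in>UNIV. cmod (partials s k x - partials s k z))" for x
  proof (rule onorm_le)
    fix v
    have "norm (DF x v - DF z v) \<le> (\<Sum>s\<in>UNIV. cmod ((DF x v - DF z v) $ s))"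
      by (rule norm_vec_le_sum)
    also have "\<dots> \<le> (\<Sum>s\<in>UNIV. \<Sum>k\<in>UNIV. cmod (partials s k x - partials s k z) * norm v)"
    proof (rule sum_mono)
      fix s
      have "(DF x v - DF z v) $ s = (\<Sum>k\<in>UNIV. (partials s k x - partials s k z) * v $ k)"
        by (simp add: DF_def sum_subtractf left_diff_distrib)
      also have "cmod \<dots> \<le> (\<Sum>k\<in>UNIV. cmod (partials s k x - partials s k z) * norm v)"
        by (intro order_trans[OF norm_sum] sum_mono) (auto simp: norm_mult intro!: mult_left_mono Finite_Cartesian_Product.norm_nth_le)
      finally show "cmod ((DF x v - DF z v) $ s) \<le> (\<Sum>k\<in>UNIV. cmod (partials s k x - partials s k z) * norm v)" .
    qed
    finally show "norm (DF x v - DF z v) \<le> (\<Sum>s\<in>UNIV. \<Sum>k\<in>UNIV. cmod (partials s k x - partials s k z)) * norm v"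
      by (simp add: sum_distrib_right)
  qed
  have "isCont (\<lambda>x. \<Sum>s\<in>UNIV. \<Sum>k\<in>UNIV. cmod (partials s k x - partials s k z)) z"
  proof -
    have "continuous_on UNIV (\<lambda>x. \<Sum>s\<in>UNIV. \<Sum>k\<in>UNIV. cmod (partials s k x - partials s k z))"
      by (intro continuous_intros poly_fun_continuous poly_fun_partials)
    then show ?thesis
      by (simp add: continuous_on_eq_continuous_at)
  qed
  then have cont: "\<exists>r>0. \<forall>x. dist z x < r \<longrightarrow> (\<Sum>s\<in>UNIV. \<Sum>k\<in>UNIV. cmod (partials s k x - partials s k z)) < e" if "e > 0" for e
    using that unfolding continuous_at_eps_delta by (fastforce simp: dist_commute dist_real_def)
  have small: "\<exists>r>0. \<forall>x. dist z x < r \<longrightarrow> onorm (\<lambda>v. DF x v - DF z v) < e" if e: "e > 0" for e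
  proof -
    obtain r where "r > 0" "\<And>x. dist z x < r \<Longrightarrow> (\<Sum>s\<in>UNIV. \<Sum>k\<in>UNIV. cmod (partials s k x - partials s k z)) < e"
      using cont[OF e] by blast
    then show ?thesis
      using le_less_trans[OF on] by blast
  qed
  obtain r where "r > 0" "ball z r \<subseteq> UNIV" "inj_on F (ball z r)"
  proof (rule has_derivative_locally_injective[of z UNIV g' DF F])
    show "bounded_linear g'"
      using g'(1) linear_conv_bounded_linear by blast
    show "\<And>x. x \<in> UNIV \<Longrightarrow> (F has_derivative DF x) (at x)"
      by (rule DF)
    show "\<And>e. e > 0 \<Longrightarrow> \<exists>r>0. \<forall>x. dist z x < r \<longrightarrow> onorm (\<lambda>v. DF x v - DF z v) < e"
      by (rule small)
  qed (use g'(2) in auto)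
  then show thesis
    by (intro that)
qed

text \<open>Otherwise pairs of distinct points in common fibres would merge at a point
  \<open>z\<close> where \<open>DF\<close> is nondegenerate. With phases adjusted, the unit lifts
  \<open>X m\<close> and \<open>Y m\<close> both tend to \<open>z\<close>. Equality of the images
  gives only \<open>F (X m) = c m *s F (Y m)\<close>, but \<open>c\<close> tends to 1, and so does
  its principal \<open>d\<close>-th root \<open>e\<close>. Then \<open>F\<close> agrees at
  \<open>X m\<close> and at \<open>e m *s Y m\<close>, which contradicts local injectivity at
  \<open>z\<close>.\<close>

lemma fibres_separated:
  assumes "\<delta> > 0"
  shows "\<exists>\<epsilon>>0. \<forall>x y. norm x = 1 \<longrightarrow> norm y = 1 \<longrightarrow> proj x \<noteq> proj y \<longrightarrow> f (proj x) = f (proj y) \<longrightarrow>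
    \<not> visits \<delta> (proj x) \<longrightarrow> sin_sq x y \<ge> \<epsilon>"
proof (rule ccontr)
  assume "\<not> ?thesis"
  then have bad: "\<And>\<epsilon>. \<epsilon> > 0 \<Longrightarrow> \<exists>x y. norm x = 1 \<and> norm y = 1 \<and> proj x \<noteq> proj y \<and> f (proj x) = f (proj y) \<and>
    \<not> visits \<delta> (proj x) \<and> sin_sq x y < \<epsilon>"
    by (meson not_le)
  have "\<exists>x y. norm x = 1 \<and> norm y = 1 \<and> proj x \<noteq> proj y \<and> f (proj x) = f (proj y) \<and>
    \<not> visits \<delta> (proj x) \<and> (norm (x - y))\<^sup>2 \<le> 2 / real (Suc m)" for m :: nat
  proof -
    obtain x y where xy: "norm x = 1" "norm y = 1" "proj x \<noteq> proj y" "f (proj x) = f (proj y)"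
      "\<not> visits \<delta> (proj x)" "sin_sq x y < 1 / real (Suc m)"
      using bad[of "1 / real (Suc m)"] by auto
    obtain c where c: "cmod c = 1" "(norm (x - c *s y))\<^sup>2 \<le> 2 * sin_sq x y"
      using unit_phase[OF xy(1,2)] by blast
    have "y \<noteq> 0" "c \<noteq> 0"
      using xy(2) c(1) by auto
    then have "proj (c *s y) = proj y"
      by (intro proj_scale)
    then show ?thesis
      using xy c by (intro exI[of _ x] exI[of _ "c *s y"]) (auto simp: norm_scale_vec intro: order_trans)
  qed
  then obtain x y where xy: "\<And>m. norm (x m) = 1" "\<And>m. norm (y m) = 1" "\<And>m. proj (x m) \<noteq> proj (y m)"
    "\<And>m. f (proj (x m)) = f (proj (y m))" "\<And>m. \<not> visits \<delta> (proj (x m))" "\<And>m. (norm (x m - y m))\<^sup>2 \<le> 2 / real (Suc m)"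
    by metis
  have "\<forall>m. x m \<in> sphere 0 1"
    using xy(1) by simp
  then obtain z r where z: "z \<in> sphere 0 1" "strict_mono r" "(x \<circ> r) \<longlonglongrightarrow> z"
    using compact_sphere unfolding compact_def by metis
  define X where "X = x \<circ> r"
  define Y where "Y = y \<circ> r"
  have "(\<lambda>m. 2 / real (Suc m)) \<longlonglongrightarrow> 0"
    using tendsto_mult[OF tendsto_const[of 2] LIMSEQ_inverse_real_of_nat] by (simp add: divide_inverse)
  then have "(\<lambda>m. (norm (x m - y m))\<^sup>2) \<longlonglongrightarrow> 0"
    by (rule Lim_null_comparison[rotated]) (use xy(6) in \<open>auto intro!: always_eventually\<close>)
  then have "(\<lambda>m. sqrt ((norm (x m - y m))\<^sup>2)) \<longlonglongrightarrow> sqrt 0"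
    by (intro tendsto_real_sqrt)
  then have "(\<lambda>m. x m - y m) \<longlonglongrightarrow> 0"
    by (simp add: tendsto_norm_zero_iff)
  then have "(\<lambda>m. X m - Y m) \<longlonglongrightarrow> 0"
    using LIMSEQ_subseq_LIMSEQ[OF _ z(2)] by (fastforce simp: X_def Y_def o_def)
  from tendsto_diff[OF z(3)[folded X_def] this] have Y: "Y \<longlonglongrightarrow> z"
    by simp
  have X: "X \<longlonglongrightarrow> z"
    using z(3) by (simp add: X_def)
  have "z \<noteq> 0"
    using z(1) by auto
  have cFz: "isCont F z"
    using continuous_on_F[of UNIV] by (simp add: continuous_on_eq_continuous_at)
  have FX: "(\<lambda>m. F (X m)) \<longlonglongrightarrow> F z" and FY: "(\<lambda>m. F (Y m)) \<longlonglongrightarrow> F z"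
    using isCont_tendsto_compose[OF cFz X] isCont_tendsto_compose[OF cFz Y] by auto
  have XY: "X m \<noteq> 0" "Y m \<noteq> 0" for m
    using xy(1,2)[of "r m"] by (auto simp: X_def Y_def)
  have nz: "X m \<noteq> 0" "Y m \<noteq> 0" "F (X m) \<noteq> 0" "F (Y m) \<noteq> 0" for m
    using XY F_eq_0[of "X m"] F_eq_0[of "Y m"] by auto
  have "\<exists>c. c \<noteq> 0 \<and> F (X m) = c *s F (Y m)" for m
    using xy(4)[of "r m", symmetric] nz[of m] proj_eq_iff[OF nz(4)[of m] nz(3)[of m]] by (simp add: f_proj X_def Y_def)
  then obtain c where c: "\<And>m. c m \<noteq> 0" "\<And>m. F (X m) = c m *s F (Y m)"
    by metis
  have "(\<lambda>m. cinner (F (X m)) (F (Y m)) / cinner (F (Y m)) (F (Y m))) \<longlonglongrightarrow> cinner (F z) (F z) / cinner (F z) (F z)"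
    unfolding cinner_def using F_eq_0[of z] \<open>z \<noteq> 0\<close> cinner_self[of "F z"]
    by (intro tendsto_divide tendsto_sum tendsto_mult tendsto_cnj tendsto_vec_nth FX FY) (auto simp: cinner_def)
  moreover have "cinner (F (X m)) (F (Y m)) / cinner (F (Y m)) (F (Y m)) = c m" for m
    using nz[of m] by (simp add: c(2) cinner_scale_left cinner_self)
  moreover have "cinner (F z) (F z) / cinner (F z) (F z) = 1"
    using F_eq_0[of z] \<open>z \<noteq> 0\<close> by (auto simp: cinner_self)
  ultimately have c1: "c \<longlonglongrightarrow> 1"
    by simp
  define e where "e m = exp (Ln (c m) / of_nat d)" for m
  have "(\<lambda>m. exp (Ln (c m) / of_nat d)) \<longlonglongrightarrow> exp (Ln 1 / of_nat d)"
    using d_pos by (intro tendsto_intros tendsto_Ln c1) auto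
  then have e1: "e \<longlonglongrightarrow> 1"
    by (simp add: e_def[abs_def])
  have ed: "e m ^ d = c m" for m
    using c(1)[of m] d_pos by (simp add: e_def flip: exp_of_nat_mult)
  have "(\<lambda>m. e m *s Y m) \<longlonglongrightarrow> 1 *s z"
    by (rule vec_tendstoI) (simp, intro tendsto_mult[OF e1, of _ "z $ _", simplified] tendsto_vec_nth Y)
  then have eY: "(\<lambda>m. e m *s Y m) \<longlonglongrightarrow> z"
    by simp
  have "norm (DF z v) \<ge> \<delta>" if v: "norm v = 1" for v
  proof -
    have "(\<lambda>m. norm (DF (X m) v)) \<longlonglongrightarrow> norm (DF z v)"
    proof -
      have "continuous_on UNIV (\<lambda>z. DF z v)"
      proof -
        have "continuous_on UNIV (\<lambda>z. (z, v))"
          by (intro continuous_intros)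
        then show ?thesis
          using continuous_on_compose2[OF continuous_DF[of UNIV], of UNIV "\<lambda>z. (z, v)"] by simp
      qed
      then have "isCont (\<lambda>z. DF z v) z"
        by (simp add: continuous_on_eq_continuous_at)
      then show ?thesis
        by (intro tendsto_norm isCont_tendsto_compose[OF _ X])
    qed
    moreover have "\<delta> \<le> norm (DF (X m) v)" for m
      using xy(1)[of "r m"] xy(5)[of "r m"] v not_le by (auto simp: visits_def X_def)
    ultimately show ?thesis
      by (intro LIMSEQ_le_const) auto
  qed
  then obtain \<rho> where \<rho>: "\<rho> > 0" "inj_on F (ball z \<rho>)"
    using locally_injective_if_nondegenerate[OF assms] by blast
  have "eventually (\<lambda>m. X m \<in> ball z \<rho>) sequentially" "eventually (\<lambda>m. e m *s Y m \<in> ball z \<rho>) sequentially"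
    using topological_tendstoD[OF X, of "ball z \<rho>"] topological_tendstoD[OF eY, of "ball z \<rho>"] \<rho>(1) by auto
  then have "eventually (\<lambda>m. X m \<in> ball z \<rho> \<and> e m *s Y m \<in> ball z \<rho>) sequentially"
    by (rule eventually_conj)
  then obtain m where m: "X m \<in> ball z \<rho>" "e m *s Y m \<in> ball z \<rho>"
    by (auto simp: eventually_sequentially)
  have "F (e m *s Y m) = F (X m)"
    by (simp add: F_scale ed c(2))
  then have "e m *s Y m = X m"
    using inj_onD[OF \<rho>(2)] m by blast
  moreover have "e m \<noteq> 0"
    by (simp add: e_def)
  ultimately have "proj (X m) = proj (Y m)"
    using proj_scale[of "e m" "Y m"] nz(2)[of m] by simp
  then show False
    using xy(3)[of "r m"] by (simp add: X_def Y_def)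
qed

end

section \<open>Counting preimages\<close>

text \<open>The cone over the image of \<open>ball a s\<close> in chart \<open>i\<close>, with the
  denominator \<open>z $ i\<close> cleared. In this form it is visibly open, and points with
  \<open>z $ i = 0\<close> are excluded automatically.\<close>

definition chart_ball :: "3 \<Rightarrow> complex ^ 2 \<Rightarrow> real \<Rightarrow> (complex ^ 3) set" where
  "chart_ball i a s = {z. norm (z $ i *s a - (\<chi> k. z $ affine_index i k)) < s * cmod (z $ i)}"

lemma open_chart_ball: "open (chart_ball i a s)"
proof -
  have "continuous_on UNIV (\<lambda>z :: complex ^ 3. z $ i *s a - (\<chi> k. z $ affine_index i k))"
    by (rule continuous_on_vecI) (simp, intro continuous_intros)
  then have "continuous_on UNIV (\<lambda>z :: complex ^ 3. norm (z $ i *s a - (\<chi> k. z $ affine_index i k)))"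
    by (rule continuous_on_norm)
  then show ?thesis
    unfolding chart_ball_def by (rule open_Collect_less) (intro continuous_intros)
qed

lemma proj_eq_chart:
  assumes "z $ i \<noteq> 0"
  shows "proj z = chart i (\<chi> k. z $ affine_index i k / z $ i)"
proof -
  have "affine_lift i (\<chi> k. ((1 / z $ i) *s z) $ affine_index i k) = (1 / z $ i) *s z"
    using assms by (intro affine_lift_eqI) simp
  moreover have "proj ((1 / z $ i) *s z) = proj z"
    using assms by (intro proj_scale) auto
  ultimately show ?thesis
    by (simp add: chart_def)
qed

lemma proj_chart_ball:
  assumes "z \<in> chart_ball i a s"
  shows "proj z \<in> chart i ` ball a s"
proof -
  have less: "norm (z $ i *s a - (\<chi> k. z $ affine_index i k)) < s * cmod (z $ i)"
    using assms by (simp add: chart_ball_def)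
  have nz: "z $ i \<noteq> 0"
    using less norm_ge_zero[of "z $ i *s a - (\<chi> k. z $ affine_index i k)"] by fastforce
  have "a - (\<chi> k. z $ affine_index i k / z $ i) = (1 / z $ i) *s (z $ i *s a - (\<chi> k. z $ affine_index i k))"
    using nz by (simp add: vec_eq_iff field_simps)
  then have "dist a (\<chi> k. z $ affine_index i k / z $ i) = norm (z $ i *s a - (\<chi> k. z $ affine_index i k)) / cmod (z $ i)"
    unfolding dist_norm by (simp only: norm_scale_vec) (simp add: norm_divide)
  then have "(\<chi> k. z $ affine_index i k / z $ i) \<in> ball a s"
    using less nz by (simp add: divide_less_eq)
  then show ?thesis
    using proj_eq_chart[OF nz] by blast
qed

lemma mem_chart_ball:
  assumes "z $ i \<noteq> 0" "s > 0"
  shows "z \<in> chart_ball i (\<chi> k. z $ affine_index i k / z $ i) s"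
proof -
  have "z $ i *s (\<chi> k. z $ affine_index i k / z $ i) - (\<chi> k. z $ affine_index i k) = 0"
    using assms by (simp add: vec_eq_iff)
  then show ?thesis
    using assms by (simp add: chart_ball_def)
qed

text \<open>Separation of projective points, phrased through all the unit lifts;
  \<open>sin_sq\<close> gives the same value on each choice.\<close>

definition apart :: "real \<Rightarrow> cp2 \<Rightarrow> cp2 \<Rightarrow> bool" where
  "apart \<delta> x y \<longleftrightarrow> (\<forall>z z'. norm z = 1 \<and> norm z' = 1 \<and> proj z = x \<and> proj z' = y \<longrightarrow> sin_sq z z' \<ge> \<delta>)"

lemma apart_projD:
  assumes "apart \<delta> (proj z) (proj z')" "z \<noteq> 0" "z' \<noteq> 0"
  shows "sin_sq z z' \<ge> \<delta>"
proof -
  obtain x where x: "norm x = 1" "proj x = proj z"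
    using unit_lift by blast
  obtain x' where x': "norm x' = 1" "proj x' = proj z'"
    using unit_lift by blast
  have "sin_sq x x' \<ge> \<delta>"
    using assms(1) x x' unfolding apart_def by blast
  moreover have "x \<noteq> 0" "x' \<noteq> 0"
    using x(1) x'(1) by auto
  then have "sin_sq x x' = sin_sq z z'"
    by (intro sin_sq_proj_cong assms x(2) x'(2))
  ultimately show ?thesis
    by simp
qed

section \<open>Combinatorics of the codes\<close>

lemma card_le_codes:
  assumes "finite A" "finite C" "g ` A \<subseteq> C"
    and fibre: "\<And>c. c \<in> C \<Longrightarrow> real (card {y \<in> A. g y = c}) \<le> B"
  shows "real (card A) \<le> real (card C) * B"
proof -
  have "A = (\<Union>c\<in>C. {y \<in> A. g y = c})"
    using assms(3) by auto
  then have "card A \<le> (\<Sum>c\<in>C. card {y \<in> A. g y = c})"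
    using card_UN_le[OF assms(2), of "\<lambda>c. {y \<in> A. g y = c}"] by simp
  then have "real (card A) \<le> (\<Sum>c\<in>C. real (card {y \<in> A. g y = c}))"
    by (simp flip: of_nat_sum)
  also have "\<dots> \<le> (\<Sum>c\<in>C. B)"
    by (intro sum_mono fibre)
  finally show ?thesis
    by simp
qed

lemma card_small_subsets_le:
  assumes "finite T"
  shows "finite {S. S \<subseteq> T \<and> card S \<le> 2}" "card {S. S \<subseteq> T \<and> card S \<le> 2} \<le> 1 + (card T)\<^sup>2"
proof -
  have "S \<in> insert {} ((\<lambda>(p, q). {p, q}) ` (T \<times> T))" if S: "S \<subseteq> T" "card S \<le> 2" for S
  proof -
    have "finite S"
      using S(1) assms by (rule finite_subset)
    consider "card S = 0" | "card S = 1" | "card S = 2"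
      using S(2) by linarith
    then show ?thesis
    proof cases
      case 1
      then show ?thesis
        using \<open>finite S\<close> by simp
    next
      case 2
      then obtain p where "S = {p}"
        by (auto simp: card_1_singleton_iff)
      then have "S = (\<lambda>(p, q). {p, q}) (p, p)" "(p, p) \<in> T \<times> T"
        using S(1) by auto
      then show ?thesis
        by blast
    next
      case 3
      then obtain p q where "S = {p, q}"
        by (auto simp: card_2_iff)
      then have "S = (\<lambda>(p, q). {p, q}) (p, q)" "(p, q) \<in> T \<times> T"
        using S(1) by auto
      then show ?thesis
        by blast
    qed
  qed
  then have sub: "{S. S \<subseteq> T \<and> card S \<le> 2} \<subseteq> insert {} ((\<lambda>(p, q). {p, q}) ` (T \<times> T))"
    by blast
  have fin: "finite (insert {} ((\<lambda>(p, q). {p, q}) ` (T \<times> T)))"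
    using assms by simp
  show "finite {S. S \<subseteq> T \<and> card S \<le> 2}"
    by (rule finite_subset[OF sub fin])
  have "card {S. S \<subseteq> T \<and> card S \<le> 2} \<le> card (insert {} ((\<lambda>(p, q). {p, q}) ` (T \<times> T)))"
    by (rule card_mono[OF fin sub])
  also have "\<dots> \<le> 1 + card ((\<lambda>(p, q). {p, q}) ` (T \<times> T))"
    using card_insert_le_m1[of "1 + card ((\<lambda>(p, q). {p, q}) ` (T \<times> T))" "(\<lambda>(p, q). {p, q}) ` (T \<times> T)" "{}"] by simp
  also have "\<dots> \<le> 1 + card (T \<times> T)"
    using card_image_le[of "T \<times> T" "\<lambda>(p, q). {p, q}"] assms by simp
  finally show "card {S. S \<subseteq> T \<and> card S \<le> 2} \<le> 1 + (card T)\<^sup>2"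
    by (simp add: card_cartesian_product power2_eq_square)
qed

lemma card_le_2_if_no_three:
  fixes R :: "nat set"
  assumes "finite R" and no: "\<And>a b c. a < b \<Longrightarrow> b < c \<Longrightarrow> a \<in> R \<Longrightarrow> b \<in> R \<Longrightarrow> c \<in> R \<Longrightarrow> False"
  shows "card R \<le> 2"
proof (rule ccontr)
  assume "\<not> card R \<le> 2"
  then have "3 \<le> card R"
    by simp
  then obtain T where "T \<subseteq> R" "card T = 3"
    by (meson obtain_subset_with_card_n)
  then obtain a b c where "a \<in> R" "b \<in> R" "c \<in> R" "a \<noteq> b" "b \<noteq> c" "a \<noteq> c"
    unfolding card_3_iff by blast
  then show False
    using no[of a b c] no[of a c b] no[of b a c] no[of b c a] no[of c a b] no[of c b a] by linarith
qed

context lifted_endomorphism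
begin

lemma finite_fibre_iter: "finite ((f ^^ n) -` {x})"
proof (induction n arbitrary: x)
  case (Suc n)
  have "(f ^^ Suc n) -` {x} = (\<Union>y\<in>f -` {x}. (f ^^ n) -` {y})"
    by auto
  moreover have "finite (f -` {x})"
    using card_fibre_le[of d F f, OF homogeneous_F F_eq_0 d_pos(1) f_proj] by blast
  ultimately show ?case
    using Suc by (simp only: finite_UN_I)
qed simp

text \<open>Every fibre is numbered separately, below the uniform bound. A label identifies a point
  only among those with the same image.\<close>

lemma fibre_labels:
  "\<exists>(M :: nat) lab. (\<forall>y. lab y < M) \<and> (\<forall>y y'. f y = f y' \<longrightarrow> lab y = lab y' \<longrightarrow> y = y')"
proof -
  obtain M where M: "\<And>x. finite (f -` {x})" "\<And>x. card (f -` {x}) \<le> M"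
    using card_fibre_le[of d F f, OF homogeneous_F F_eq_0 d_pos(1) f_proj] by blast
  define h where "h x = (SOME h. bij_betw h (f -` {x}) {0..<card (f -` {x})})" for x
  have h: "bij_betw (h x) (f -` {x}) {0..<card (f -` {x})}" for x
    unfolding h_def using ex_bij_betw_finite_nat[OF M(1)[of x]] by (rule someI_ex)
  show ?thesis
  proof (intro exI[of _ "\<lambda>y. h (f y) y"] exI[of _ M] conjI allI impI)
    fix y
    have "h (f y) y \<in> {0..<card (f -` {f y})}"
      using bij_betwE[OF h[of "f y"]] by blast
    then show "h (f y) y < M"
      using M(2)[of "f y"] by simp
  next
    fix y y'
    assume "f y = f y'" "h (f y) y = h (f y') y'"
    then show "y = y'"
      using inj_onD[OF bij_betw_imp_inj_on[OF h[of "f y"]], of y y'] by simp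
  qed
qed

definition volume_bound :: "3 \<Rightarrow> complex ^ 2 \<Rightarrow> real \<Rightarrow> bool" where
  "volume_bound i a s \<longleftrightarrow> (\<forall>\<delta>>0. \<exists>K>0. \<forall>n A. n > 0 \<longrightarrow> finite A \<longrightarrow> A \<subseteq> ball a s \<longrightarrow>
    separated i n \<delta> A \<longrightarrow> real (card A) \<le> K * (real n)\<^sup>2 * real d ^ n)"

text \<open>Compactness is used on the unit sphere of the lifts: removing the open cone over
  \<open>interior U\<close> leaves a compact set, covered by the open cones
  \<open>chart_ball\<close>.\<close>

lemma finite_cover_off_support:
  assumes \<mu>: "green_measure f d \<mu>" and U: "measure_support \<mu> \<subseteq> interior U"
  obtains C where "finite C" "\<And>i a s. (i, a, s) \<in> C \<Longrightarrow> volume_bound i a s"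
    "\<And>x. x \<notin> interior U \<Longrightarrow> \<exists>i a s. (i, a, s) \<in> C \<and> x \<in> chart i ` ball a s"
proof -
  let ?X = "sphere 0 1 - {z. z \<noteq> 0 \<and> proj z \<in> interior U}"
  let ?I = "{(i, a, s). volume_bound i a s}"
  let ?O = "\<lambda>(i, a, s). chart_ball i a s"
  have "open {z. z \<noteq> 0 \<and> proj z \<in> interior U}"
    using open_interior[of U] unfolding open_cp2_def .
  then have "compact ?X"
    by (intro compact_diff compact_sphere)
  moreover have "open (?O t)" if "t \<in> ?I" for t
    using open_chart_ball by (cases t) auto
  moreover have "?X \<subseteq> (\<Union>t\<in>?I. ?O t)"
  proof
    fix z assume z: "z \<in> ?X"
    then have "z \<noteq> 0"
      by auto
    then obtain i where i: "z $ i \<noteq> 0"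
      by (auto simp: vec_eq_iff)
    define a where "a = (\<chi> k. z $ affine_index i k / z $ i)"
    have "proj z \<notin> interior U"
      using z \<open>z \<noteq> 0\<close> by auto
    then have "chart i a \<notin> measure_support \<mu>"
      using U proj_eq_chart[OF i] unfolding a_def by auto
    then obtain s where s: "s > 0" "volume_bound i a s"
      using card_separated_le[OF \<mu>] unfolding volume_bound_def by metis
    then have "z \<in> ?O (i, a, s)"
      using mem_chart_ball[OF i s(1)] by (simp add: a_def)
    then show "z \<in> (\<Union>t\<in>?I. ?O t)"
      using s(2) by blast
  qed
  ultimately obtain C where C: "C \<subseteq> ?I" "finite C" "?X \<subseteq> (\<Union>t\<in>C. ?O t)"
    by (rule compactE_image)
  show thesis
  proof (rule that[OF C(2)])
    show "volume_bound i a s" if "(i, a, s) \<in> C" for i a s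
      using C(1) that by auto
    fix x assume x: "x \<notin> interior U"
    obtain z where z: "norm z = 1" "proj z = x"
      using unit_lift by blast
    then have "z \<in> ?X"
      using x by simp
    then obtain t where t: "t \<in> C" "z \<in> ?O t"
      using C(3) by blast
    obtain i a s where "t = (i, a, s)"
      by (rule prod_cases3)
    then show "\<exists>i a s. (i, a, s) \<in> C \<and> x \<in> chart i ` ball a s"
      using t proj_chart_ball[of z i a s] z(2) by auto
  qed
qed

lemma card_apart_le:
  assumes \<mu>: "green_measure f d \<mu>" and U: "measure_support \<mu> \<subseteq> interior U" and "\<delta> > 0"
  shows "\<exists>K>0. \<forall>n A. n > 0 \<longrightarrow> finite A \<longrightarrow> A \<inter> interior U = {} \<longrightarrow>
    (\<forall>x\<in>A. \<forall>y\<in>A. x \<noteq> y \<longrightarrow> (\<exists>k<n. apart \<delta> ((f ^^ k) x) ((f ^^ k) y))) \<longrightarrow>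
    real (card A) \<le> K * ((real n)\<^sup>2 * real d ^ n)"
proof -
  obtain C where C: "finite C" "\<And>i a s. (i, a, s) \<in> C \<Longrightarrow> volume_bound i a s"
    "\<And>x. x \<notin> interior U \<Longrightarrow> \<exists>i a s. (i, a, s) \<in> C \<and> x \<in> chart i ` ball a s"
    by (rule finite_cover_off_support[OF \<mu> U]) (rule that)
  have "\<forall>t\<in>C. \<exists>K>0. \<forall>n A. n > 0 \<longrightarrow> finite A \<longrightarrow> A \<subseteq> ball (fst (snd t)) (snd (snd t)) \<longrightarrow>
    separated (fst t) n \<delta> A \<longrightarrow> real (card A) \<le> K * (real n)\<^sup>2 * real d ^ n"
  proof
    fix t assume "t \<in> C"
    then have "volume_bound (fst t) (fst (snd t)) (snd (snd t))"
      using C(2) by simp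
    then show "\<exists>K>0. \<forall>n A. n > 0 \<longrightarrow> finite A \<longrightarrow> A \<subseteq> ball (fst (snd t)) (snd (snd t)) \<longrightarrow>
        separated (fst t) n \<delta> A \<longrightarrow> real (card A) \<le> K * (real n)\<^sup>2 * real d ^ n"
      unfolding volume_bound_def using \<open>\<delta> > 0\<close> by blast
  qed
  from bchoice[OF this] obtain K where K': "\<forall>t\<in>C. K t > 0 \<and> (\<forall>n A. n > 0 \<longrightarrow> finite A \<longrightarrow>
    A \<subseteq> ball (fst (snd t)) (snd (snd t)) \<longrightarrow> separated (fst t) n \<delta> A \<longrightarrow> real (card A) \<le> K t * (real n)\<^sup>2 * real d ^ n)" ..
  have K_pos: "K t > 0" if "t \<in> C" for t
    using K' that by blast
  have K: "real (card A) \<le> K (i, a, s) * (real n)\<^sup>2 * real d ^ n"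
    if "(i, a, s) \<in> C" "n > 0" "finite A" "A \<subseteq> ball a s" "separated i n \<delta> A" for i a s n A
    using bspec[OF K' that(1)] that(2-) by simp
  show ?thesis
  \<comment> \<open>The summand 1 keeps the constant positive when the cover is empty.\<close>
  proof (intro exI[of _ "1 + sum K C"] conjI allI impI)
    show "1 + sum K C > 0"
      using sum_nonneg[of C K] K_pos by (smt (verit))
    fix n :: nat and A :: "cp2 set"
    assume n: "n > 0" and A: "finite A" "A \<inter> interior U = {}"
      and sep: "\<forall>x\<in>A. \<forall>y\<in>A. x \<noteq> y \<longrightarrow> (\<exists>k<n. apart \<delta> ((f ^^ k) x) ((f ^^ k) y))"
    let ?A = "\<lambda>(i, a, s). A \<inter> chart i ` ball a s"
    have A_eq: "A = (\<Union>t\<in>C. ?A t)"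
      using C(3) A(2) by fastforce
    have part: "real (card (?A t)) \<le> K t * ((real n)\<^sup>2 * real d ^ n)" if "t \<in> C" for t
    proof -
      obtain i a s where t: "t = (i, a, s)"
        by (rule prod_cases3)
      let ?B = "chart i -` A \<inter> ball a s"
      have img: "?A t = chart i ` ?B"
        unfolding t by auto
      have fin: "finite ?B"
        using finite_vimageI[OF A(1) inj_chart] by blast
      have "separated i n \<delta> ?B"
        unfolding separated_def
      proof (intro ballI impI)
        fix u v assume uv: "u \<in> ?B" "v \<in> ?B" "u \<noteq> v"
        then obtain k where k: "k < n" "apart \<delta> ((f ^^ k) (chart i u)) ((f ^^ k) (chart i v))"
          using sep[rule_format, of "chart i u" "chart i v"] injD[OF inj_chart, of i u v] by auto
        then have "sin_sq (lift_iter i k u) (lift_iter i k v) \<ge> \<delta>"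
          by (intro apart_projD lift_iter_nonzero) (simp add: proj_lift_iter)
        then show "\<exists>k<n. \<delta> \<le> sin_sq (lift_iter i k u) (lift_iter i k v)"
          using k(1) by blast
      qed
      then have "real (card ?B) \<le> K t * (real n)\<^sup>2 * real d ^ n"
        unfolding t using that[unfolded t] n fin by (intro K) auto
      then show ?thesis
        unfolding img using card_image[OF inj_on_subset[OF inj_chart, of _ i]] by (simp add: mult.assoc)
    qed
    have "card A \<le> (\<Sum>t\<in>C. card (?A t))"
      using card_UN_le[OF C(1), of ?A] A_eq by simp
    then have "real (card A) \<le> (\<Sum>t\<in>C. real (card (?A t)))"
      by (simp flip: of_nat_sum)
    also have "\<dots> \<le> (\<Sum>t\<in>C. K t * ((real n)\<^sup>2 * real d ^ n))"
      by (intro sum_mono part)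
    also have "\<dots> = sum K C * ((real n)\<^sup>2 * real d ^ n)"
      by (simp add: sum_distrib_right)
    also have "\<dots> \<le> (1 + sum K C) * ((real n)\<^sup>2 * real d ^ n)"
      by (intro mult_right_mono) auto
    finally show "real (card A) \<le> (1 + sum K C) * ((real n)\<^sup>2 * real d ^ n)" .
  qed
qed

text \<open>
  The orbit of a point is coded, on each block of \<open>N\<close> consecutive times, by the times at which it
  visits the critical region and the labels of its points at these times. The last time
  at which two points of the same fibre with the same code differ is not a visit, so that they are
  then a definite distance apart.
\<close>

lemma card_fibre_iter_le:
  assumes generic: "\<And>i j :: nat. i \<ge> 1 \<Longrightarrow> j \<ge> 1 \<Longrightarrow> i \<noteq> j \<Longrightarrow>
           critical_set f \<inter> (f ^^ i) ` critical_set f \<inter> (f ^^ j) ` critical_set f = {}"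
    and \<mu>: "green_measure f d \<mu>" and U: "measure_support \<mu> \<subseteq> interior U"
    and lab: "\<And>y. lab y < M" "\<And>y y'. f y = f y' \<Longrightarrow> lab y = lab y' \<Longrightarrow> y = y'"
    and "N > 0"
  shows "\<exists>K>0. \<forall>n x. n > 0 \<longrightarrow> real (card ((f ^^ n) -` {x} - U)) \<le>
    real (1 + (N * M)\<^sup>2) ^ (n div N + 1) * (K * ((real n)\<^sup>2 * real d ^ n))"
proof -
  obtain \<delta> where \<delta>: "\<delta> > 0" and no_three: "\<And>y a b c. a < b \<Longrightarrow> b < c \<Longrightarrow> c < N \<Longrightarrow>
      \<not> (visits \<delta> ((f ^^ a) y) \<and> visits \<delta> ((f ^^ b) y) \<and> visits \<delta> ((f ^^ c) y))"
    using no_three_visits[OF generic, of N] by blast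
  obtain \<epsilon> where \<epsilon>: "\<epsilon> > 0" and sep: "\<forall>x y. norm x = 1 \<longrightarrow> norm y = 1 \<longrightarrow> proj x \<noteq> proj y \<longrightarrow>
      f (proj x) = f (proj y) \<longrightarrow> \<not> visits \<delta> (proj x) \<longrightarrow> sin_sq x y \<ge> \<epsilon>"
    using fibres_separated[OF \<delta>] by blast
  obtain K where K: "K > 0" "\<forall>n A. n > 0 \<longrightarrow> finite A \<longrightarrow> A \<inter> interior U = {} \<longrightarrow>
    (\<forall>x\<in>A. \<forall>y\<in>A. x \<noteq> y \<longrightarrow> (\<exists>k<n. apart \<epsilon> ((f ^^ k) x) ((f ^^ k) y))) \<longrightarrow>
    real (card A) \<le> K * ((real n)\<^sup>2 * real d ^ n)"
    using card_apart_le[OF \<mu> U \<epsilon>] by blast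
  let ?T = "{..<N} \<times> {..<M}"
  let ?S = "{S. S \<subseteq> ?T \<and> card S \<le> 2}"
  have S: "finite ?S" "card ?S \<le> 1 + (N * M)\<^sup>2"
    using card_small_subsets_le[of ?T] by (simp_all add: card_cartesian_product)
  show ?thesis
  proof (intro exI[of _ K] conjI allI impI)
    show "K > 0"
      by (rule K(1))
    fix n :: nat and x
    assume n: "n > 0"
    let ?A = "(f ^^ n) -` {x} - U"
    define R where "R y b = {r. r < N \<and> b * N + r < n \<and> visits \<delta> ((f ^^ (b * N + r)) y)}" for y b
    \<comment> \<open>There are \<open>n div N + 1\<close> blocks; the last one may be incomplete,
      and \<open>R\<close> discards its times from \<open>n\<close> on. Each block contributes at
      most two pairs of a time and a label, that is, one of at most \<open>1 + (N * M)^2\<close>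
      sets.\<close>
    define code where "code y = (\<lambda>b\<in>{..n div N}. (\<lambda>r. (r, lab ((f ^^ (b * N + r)) y))) ` R y b)" for y
    have finR: "finite (R y b)" for y b
      by (rule finite_subset[of _ "{..<N}"]) (auto simp: R_def)
    have "card (R y b) \<le> 2" for y b
    proof (rule card_le_2_if_no_three[OF finR])
      fix r s t
      assume *: "r < s" "s < t" "r \<in> R y b" "s \<in> R y b" "t \<in> R y b"
      have "(f ^^ (b * N + k)) y = (f ^^ k) ((f ^^ (b * N)) y)" for k
        using fun_cong[OF funpow_add[of k "b * N" f], of y] by (simp add: add.commute)
      then show False
        using no_three[OF *(1,2), of "(f ^^ (b * N)) y"] *(3-) by (simp add: R_def)
    qed
    then have small: "card ((\<lambda>r. (r, lab ((f ^^ (b * N + r)) y))) ` R y b) \<le> 2" for y b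
      using card_image_le[OF finR, of "\<lambda>r. (r, lab ((f ^^ (b * N + r)) y))" y b] order_trans by blast
    have sub: "(\<lambda>r. (r, lab ((f ^^ (b * N + r)) y))) ` R y b \<subseteq> ?T" for y b
      using lab(1) by (auto simp: R_def)
    have "code y \<in> PiE {..n div N} (\<lambda>_. ?S)" for y
      unfolding code_def restrict_PiE_iff by (intro ballI CollectI conjI small sub)
    then have code: "code ` ?A \<subseteq> PiE {..n div N} (\<lambda>_. ?S)"
      by blast
    have fin: "finite ?A"
      using finite_fibre_iter by blast
    have "real (card ?A) \<le> real (card (PiE {..n div N} (\<lambda>_. ?S))) * (K * ((real n)\<^sup>2 * real d ^ n))"
    proof (rule card_le_codes[OF fin finite_PiE code])
      fix c
      show "real (card {y \<in> ?A. code y = c}) \<le> K * ((real n)\<^sup>2 * real d ^ n)"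
      proof (rule K(2)[rule_format, OF n])
        show "finite {y \<in> ?A. code y = c}"
          by (rule finite_subset[OF _ fin]) blast
        show "{y \<in> ?A. code y = c} \<inter> interior U = {}"
          using interior_subset[of U] by auto
        fix y y'
        assume y: "y \<in> {y \<in> ?A. code y = c}" "y' \<in> {y \<in> ?A. code y = c}" "y \<noteq> y'"
        \<comment> \<open>The time at which the two orbits merge. They coincide from then on, so
          \<open>k = j - 1\<close> is the last time at which they differ, while the images under
          \<open>f\<close> already agree.\<close>
        define j where "j = (LEAST j. (f ^^ j) y = (f ^^ j) y')"
        have "(f ^^ n) y = (f ^^ n) y'"
          using y by simp
        then have j: "(f ^^ j) y = (f ^^ j) y'" "j \<le> n"
          unfolding j_def by (rule LeastI) (rule Least_le, fact)
        then obtain k where k: "j = Suc k"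
          using y(3) by (cases j) auto
        have neq: "(f ^^ k) y \<noteq> (f ^^ k) y'"
          using not_less_Least[of k "\<lambda>j. (f ^^ j) y = (f ^^ j) y'"] k by (simp add: j_def)
        have eq: "f ((f ^^ k) y) = f ((f ^^ k) y')"
          using j(1) k by simp
        have kn: "k < n"
          using j(2) k by simp
        \<comment> \<open>A visit would be recorded with its label. Equal codes then give the other
          orbit the same label at time \<open>k\<close>, and labels are injective on a
          fibre.\<close>
        have nv: "\<not> visits \<delta> ((f ^^ k) y)"
        proof
          assume v: "visits \<delta> ((f ^^ k) y)"
          let ?b = "k div N" and ?r = "k mod N"
          have kb: "?b * N + ?r = k"
            by simp
          have b: "?b \<in> {..n div N}"
            using kn by (simp add: div_le_mono)
          have "?r \<in> R y ?b"
            unfolding R_def kb using v kn \<open>N > 0\<close> by simp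
          then have "(?r, lab ((f ^^ (?b * N + ?r)) y)) \<in> code y ?b"
            unfolding code_def restrict_apply'[OF b] by blast
          also have "code y ?b = code y' ?b"
            using y by simp
          finally have "lab ((f ^^ k) y) = lab ((f ^^ k) y')"
            unfolding code_def restrict_apply'[OF b] by auto
          then show False
            using lab(2)[OF eq] neq by blast
        qed
        have "apart \<epsilon> ((f ^^ k) y) ((f ^^ k) y')"
          unfolding apart_def
        proof (intro allI impI, elim conjE)
          fix z z'
          assume *: "norm z = 1" "norm z' = 1" "proj z = (f ^^ k) y" "proj z' = (f ^^ k) y'"
          show "\<epsilon> \<le> sin_sq z z'"
            by (rule sep[rule_format, OF *(1,2)]) (simp_all only: * neq eq nv not_False_eq_True)
        qed
        then show "\<exists>k<n. apart \<epsilon> ((f ^^ k) y) ((f ^^ k) y')"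
          using kn by blast
      qed
    qed (use S(1) in auto)
    also have "card (PiE {..n div N} (\<lambda>_. ?S)) = card ?S ^ (n div N + 1)"
      by (subst card_PiE) simp_all
    also have "real (card ?S ^ (n div N + 1)) * (K * ((real n)\<^sup>2 * real d ^ n)) \<le>
        real (1 + (N * M)\<^sup>2) ^ (n div N + 1) * (K * ((real n)\<^sup>2 * real d ^ n))"
      unfolding of_nat_power[of "card ?S"] using S(2) K(1) by (intro mult_right_mono power_mono) (auto simp del: of_nat_add of_nat_power)
    finally show "real (card ?A) \<le> real (1 + (N * M)\<^sup>2) ^ (n div N + 1) * (K * ((real n)\<^sup>2 * real d ^ n))" .
  qed
qed

end

section \<open>The exponential growth rate\<close>

lemma limsup_log_card_le:
  fixes a :: "nat \<Rightarrow> nat"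
  assumes "K > 0" "q \<ge> 1" "N > 0" "d > 0"
    and le: "\<And>n. n > 0 \<Longrightarrow> real (a n) \<le> q ^ (n div N + 1) * (K * ((real n)\<^sup>2 * real d ^ n))"
  shows "limsup (\<lambda>n. ereal (1 / real n) * log_card (a n)) \<le> ereal (ln (real d) + ln q / real N)"
proof -
  define g where "g n = (ln q + ln K) / real n + 2 * (ln (real n) / real n) + (ln (real d) + ln q / real N)" for n :: nat
  have "g \<longlonglongrightarrow> 0 + 2 * 0 + (ln (real d) + ln q / real N)"
    unfolding g_def by (intro tendsto_intros lim_const_over_n lim_ln_over_n)
  then have "(\<lambda>n. ereal (g n)) \<longlonglongrightarrow> ereal (ln (real d) + ln q / real N)"
    by (simp add: tendsto_ereal)
  then have lim: "limsup (\<lambda>n. ereal (g n)) = ereal (ln (real d) + ln q / real N)"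
    by (rule lim_imp_Limsup[OF sequentially_bot])
  have "ereal (1 / real n) * log_card (a n) \<le> ereal (g n)" if n: "n > 0" for n
  proof (cases "a n = 0")
    case True
    then show ?thesis
      using n by (simp add: log_card_def)
  next
    case False
    have "ln (real (a n)) \<le> ln (q ^ (n div N + 1) * (K * ((real n)\<^sup>2 * real d ^ n)))"
      using le[OF n] False by (intro ln_mono) auto
    also have "\<dots> = real (n div N + 1) * ln q + (ln K + (2 * ln (real n) + real n * ln (real d)))"
      using assms n by (simp add: ln_mult ln_realpow del: power_Suc)
    also have "\<dots> \<le> (real n / real N + 1) * ln q + (ln K + (2 * ln (real n) + real n * ln (real d)))"
      using of_nat_div_le_of_nat[of n N] \<open>q \<ge> 1\<close> by (intro add_right_mono mult_right_mono) auto
    finally have "ln (real (a n)) / real n \<le>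
        ((real n / real N + 1) * ln q + (ln K + (2 * ln (real n) + real n * ln (real d)))) / real n"
      by (intro divide_right_mono) auto
    also have "\<dots> = g n"
      using n by (simp add: g_def field_simps)
    finally show ?thesis
      using False by (simp add: log_card_def)
  qed
  then have "eventually (\<lambda>n. ereal (1 / real n) * log_card (a n) \<le> ereal (g n)) sequentially"
    by (auto intro: eventually_mono[OF eventually_gt_at_top[of 0]])
  from Limsup_mono[OF this] show ?thesis
    unfolding lim .
qed

theorem proposition3:
  fixes f :: "cp2 \<Rightarrow> cp2" and d :: nat and \<mu> :: "cp2 measure" and U :: "cp2 set"
  assumes "d \<ge> 2"
    and "endomorphism_of_degree f d"
    and "\<And>i j :: nat. i \<ge> 1 \<Longrightarrow> j \<ge> 1 \<Longrightarrow> i \<noteq> j \<Longrightarrow>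
           critical_set f \<inter> (f ^^ i) ` critical_set f \<inter> (f ^^ j) ` critical_set f = {}"
    and "green_measure f d \<mu>"
    and "measure_support \<mu> \<subseteq> interior U"
  shows "limsup (\<lambda>n. ereal (1 / real n) *
           log_card (Max (range (\<lambda>x. card ((f ^^ n) -` {x} - U))))) \<le> ereal (ln (real d))"
proof -
  obtain F where "\<And>i. homogeneous_poly d (\<lambda>z. F z $ i)" "\<And>z. F z = 0 \<Longrightarrow> z = 0"
    "\<And>z. z \<noteq> 0 \<Longrightarrow> f (proj z) = proj (F z)"
    using assms(2) unfolding endomorphism_of_degree_def by auto
  then interpret lifted_endomorphism f d F
    using assms(1) by unfold_locales
  obtain M :: nat and lab where lab': "(\<forall>y. lab y < M) \<and> (\<forall>y y'. f y = f y' \<longrightarrow> lab y = lab y' \<longrightarrow> y = y')"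
    using fibre_labels by (elim exE)
  then have lab: "\<And>y. lab y < M" "\<And>y y'. f y = f y' \<Longrightarrow> lab y = lab y' \<Longrightarrow> y = y'"
    by auto
  define a where "a n = Max (range (\<lambda>x. card ((f ^^ n) -` {x} - U)))" for n
  \<comment> \<open>A product that dominates \<open>1 + (N * M)^2\<close> for positive
    \<open>N\<close>. Its logarithm splits, so that ln (q N) / N visibly tends to 0.\<close>
  define q where "q N = (real N)\<^sup>2 * (1 + (real M)\<^sup>2)" for N :: nat
  have "limsup (\<lambda>n. ereal (1 / real n) * log_card (a n)) \<le> ereal (ln (real d) + ln (q N) / real N)"
    if N: "N > 0" for N
  proof -
    have "\<exists>K>0. \<forall>n x. n > 0 \<longrightarrow> real (card ((f ^^ n) -` {x} - U)) \<le>
        real (1 + (N * M)\<^sup>2) ^ (n div N + 1) * (K * ((real n)\<^sup>2 * real d ^ n))"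
      by (rule card_fibre_iter_le) (fact assms(3) assms(4) assms(5) lab N)+
    then obtain K where K: "K > 0" "\<And>n x. n > 0 \<Longrightarrow> real (card ((f ^^ n) -` {x} - U)) \<le>
        real (1 + (N * M)\<^sup>2) ^ (n div N + 1) * (K * ((real n)\<^sup>2 * real d ^ n))"
      by blast
    have N1: "1 \<le> (real N)\<^sup>2"
      using N by simp
    have q: "q N \<ge> 1" "real (1 + (N * M)\<^sup>2) \<le> q N"
      using N1 mult_mono[OF N1, of 1 "1 + (real M)\<^sup>2"] by (auto simp: q_def power_mult_distrib distrib_left)
    show ?thesis
    proof (rule limsup_log_card_le[OF K(1) q(1) N d_pos(1)])
      fix n :: nat
      assume n: "n > 0"
      have bound: "real (card ((f ^^ n) -` {x} - U)) \<le> q N ^ (n div N + 1) * (K * ((real n)\<^sup>2 * real d ^ n))" for x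
        by (rule order_trans[OF K(2)[OF n]]) (intro mult_right_mono power_mono q, use K(1) in auto)
      \<comment> \<open>\<open>Max\<close> says something only about a finite set; the bound,
        uniform in \<open>x\<close>, makes the set of cardinalities finite, so that its maximum is
        attained at some point.\<close>
      have "range (\<lambda>x. card ((f ^^ n) -` {x} - U)) \<subseteq> {..nat \<lfloor>q N ^ (n div N + 1) * (K * ((real n)\<^sup>2 * real d ^ n))\<rfloor>}"
        using bound by (auto simp: le_nat_floor)
      then have "finite (range (\<lambda>x. card ((f ^^ n) -` {x} - U)))"
        by (rule finite_subset) simp
      then have "a n \<in> range (\<lambda>x. card ((f ^^ n) -` {x} - U))"
        unfolding a_def by (rule Max_in) simp
      then show "real (a n) \<le> q N ^ (n div N + 1) * (K * ((real n)\<^sup>2 * real d ^ n))"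
        using bound by auto
    qed
  qed
  moreover have "(\<lambda>N. ereal (ln (real d) + ln (q N) / real N)) \<longlonglongrightarrow> ereal (ln (real d))"
  proof -
    have "(\<lambda>N. ln (real d) + (2 * (ln (real N) / real N) + ln (1 + (real M)\<^sup>2) / real N)) \<longlonglongrightarrow> ln (real d) + (2 * 0 + 0)"
      by (intro tendsto_intros lim_const_over_n lim_ln_over_n)
    moreover have "eventually (\<lambda>N. ln (real d) + (2 * (ln (real N) / real N) + ln (1 + (real M)\<^sup>2) / real N) =
        ln (real d) + ln (q N) / real N) sequentially"
      using eventually_gt_at_top[of 0]
    proof eventually_elim
      case (elim N)
      have "1 + (real M)\<^sup>2 > 0"
        by (intro add_pos_nonneg) auto
      then show ?case
        using elim by (simp add: q_def ln_mult ln_realpow add_divide_distrib)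
    qed
    ultimately have "(\<lambda>N. ln (real d) + ln (q N) / real N) \<longlonglongrightarrow> ln (real d) + (2 * 0 + 0)"
      by (rule Lim_transform_eventually)
    then have "(\<lambda>N. ln (real d) + ln (q N) / real N) \<longlonglongrightarrow> ln (real d)"
      by simp
    then show ?thesis
      by (rule tendsto_ereal)
  qed
  ultimately have "limsup (\<lambda>n. ereal (1 / real n) * log_card (a n)) \<le> ereal (ln (real d))"
    by (intro tendsto_lowerbound[of "\<lambda>N. ereal (ln (real d) + ln (q N) / real N)" _ sequentially])
      (auto intro: eventually_mono[OF eventually_gt_at_top[of 0]])
  then show ?thesis
    unfolding a_def .
qed

end
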